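(* Let $r,n,p$ be positive integers with $p\mid r$ and $\gcd(p,n)=2$, put $r'=r/2$, $n'=n/2$, $p'=p/2$. Let $[\tau]$ be an orbit of types of antisymmetric elements, with representative $\tau=(t_0,\dots,t_{r'-1})$, and let $c^1_{[\tau]}$ be the $S_n$-conjugacy class of antisymmetric absolute involutions of $G(r,n)/C_p$ of type $[\tau]$. Then, as $G(r,p,n)$-modules, $$M(c^1_{[\tau]})\cong\bigoplus_{[\mu]}\rho^1_{[\mu,\mu]},$$ where the sum runs over the orbits $[\mu]$ of $\mathrm{Fer}(r',n')$ under the shift $\mu\mapsto(\mu^{(r'-r/p)},\dots,\mu^{(r'-1)},\mu^{(0)},\dots,\mu^{(r'-1-r/p)})$ (indices mod $r'$) which contain an element $\mu=(\mu^{(0)},\dots,\mu^{(r'-1)})$ with $|\mu^{(i)}|=t_i$ for all $i\in[0,r'-1]$.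
   Context: Notation. $\zeta_k=e^{2\pi i/k}$. $G(r,n)$ is the group of $n\times n$ monomial complex matrices whose nonzero entries are $r$-th roots of unity. For $g\in G(r,n)$ write $g=[\sigma_1^{z_1},\dots,\sigma_n^{z_n}]$ if the nonzero entry of row $j$ lies in column $\sigma_j$ and equals $\zeta_r^{z_j}$; put $z_j(g)=z_j\in\mathbb{Z}_r$, $z(g)=\sum_j z_j(g)$, $|g|=[\sigma_1,\dots,\sigma_n]\in S_n$. A cycle of $g$ is $(a_1^{z_{a_1}},\dots,a_k^{z_{a_k}})$ where $(a_1,\dots,a_k)$ is a cycle of $|g|$ and $z_{a_i}=z_{a_i}(g)$. $G(r,p,n)=\{g: z(g)\equiv0\bmod p\}$; $C_p=\langle\zeta_pI\rangle$. An element of $G(r,n)/C_p$ is an absolute involution if $v\bar v=1$; it is antisymmetric (resp. symmetric) if all its lifts $\tilde v$ satisfy $\tilde v^T=-\tilde v$ (resp. $\tilde v^T=\tilde v$). Two elements are $S_n$-conjugate if they are conjugate by a permutation matrix. Types. An antisymmetric $\tilde v\in G(r,n)$ has all cycles of the form $(a^{z},b^{z+r'})$; the type of such a cycle is $z\bmod r'$, and $\tau(\tilde v)=(t_0,\dots,t_{r'-1})$ where $t_i$ is the number of cycles of type $i$. The type of an antisymmetric $v\in G(r,n)/C_p$ is the orbit $[\tau(\tilde v)]$ under $(t_0,\dots,t_{r'-1})\mapsto(t_{r/p},t_{1+r/p},\dots,t_{r'-1+r/p})$ (indices mod $r'$), independent of the lift. Gelfand model. $M=\bigoplus_v\mathbb{C}C_v$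 over absolute involutions $v$ of $G(r,n)/C_p$; for $g\in G(r,p,n)$, lift $\tilde v$: $\langle g,v\rangle=\sum_i z_i(g)z_i(\tilde v)$, $a(g,v)=z_1(\tilde v)-z_{|g|^{-1}(1)}(\tilde v)$, $\mathrm{inv}_v(g)=\#\{\{i,j\}:|\tilde v|(i)=j\ne i,(j-i)(|g|(j)-|g|(i))<0\}$; $\varrho(g)C_v=\zeta_r^{\langle g,v\rangle}(-1)^{\mathrm{inv}_v(g)}C_{|g|v|g|^{-1}}$ for symmetric $v$, $\varrho(g)C_v=\zeta_r^{\langle g,v\rangle}\zeta_r^{a(g,v)}C_{|g|v|g|^{-1}}$ for antisymmetric $v$. For an $S_n$-conjugacy class $c$, $M(c)=\mathrm{span}\{C_v:v\in c\}$ is a $G(r,p,n)$-submodule. Representations. $\mathrm{Fer}(r,n)$: $r$-tuples of partitions of total size $n$; for $\lambda$ with $n_i=|\lambda^{(i)}|$, $\rho_\lambda=\mathrm{Ind}^{G(r,n)}_{G(r,n_0)\times\cdots\times G(r,n_{r-1})}\bigodot_i(\gamma_{n_i}^{\otimes i}\otimes\tilde\rho_{\lambda^{(i)}})$, with $\gamma_m(g)=\zeta_r^{z(g)}$ and $\tilde\rho_{\lambda^{(i)}}(g)=\rho_{\lambda^{(i)}}(|g|)$ (Specht module). For $\mu\in\mathrm{Fer}(r',n')$, $(\mu,\mu)=(\mu^{(0)},\dots,\mu^{(r'-1)},\mu^{(0)},\dots,\mu^{(r'-1)})$; $\rho_{(\mu,\mu)}$ restricted to $G(r,p,n)$ is the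 sum of two non-isomorphic irreducibles $\rho^0_{[\mu,\mu]},\rho^1_{[\mu,\mu]}$ (depending only on the shift-orbit of $\mu$), labelled thus: $\delta(g)=(-1)^{z(g)}$; $(V,\rho_\mu)$ realizes $\rho_{(\mu^{(0)},\dots,\mu^{(r'-1)},\emptyset,\dots,\emptyset)}$ of $G(r,n')$; $\Theta$ = permutations $t=[t_1,\dots,t_n]$ with $t_1<\dots<t_{n'}$, $t_{n'+1}<\dots<t_n$, $\hat t=[t_{n'+1},\dots,t_n,t_1,\dots,t_{n'}]$; for $x\in G(r,n)$, $xt=t'\,\mathrm{diag}(x_1,x_2)$ uniquely with $t'\in\Theta$, $x_i\in G(r,n')$; $\rho_{(\mu,\mu)}$ acts on $T\otimes V\otimes V$ ($T$ with basis $\Theta$) by $x(t\otimes v_1\otimes v_2)=\delta(x_2)t'\otimes\rho_\mu(x_1)v_1\otimes\rho_\mu(x_2)v_2$; $S(t\otimes v_1\otimes v_2)=\hat t\otimes v_2\otimes v_1$ commutes with $G(r,p,n)$ and $\rho^0$, $\rho^1$ are the $G(r,p,n)$-representations on its $+1$, $-1$ eigenspaces.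
   Formalization: The entries σ_j, z_j of g are read from column j instead of row j: with rows and the ordinary matrix product, ϱ is not a homomorphism (e.g. r=p=2, n=4) and Θ is not a transversal; the two readings correspond under transposition. *)

theory Defs
  imports
    "Jordan_Normal_Form.Matrix"
    "HOL-Algebra.Coset"
    "HOL-Combinatorics.Permutations"
    "HOL-Library.Function_Algebras"
begin

section \<open>Complex representations on spaces of functions\<close>

text \<open>Vectors are functions \<open>'x \<Rightarrow> complex\<close> with pointwise operations. A representation consists of a
  subspace and an action; only the restriction of the action to the subspace is meaningful.\<close>

definition cscale :: "complex \<Rightarrow> ('x \<Rightarrow> complex) \<Rightarrow> 'x \<Rightarrow> complex" where
  "cscale c f = (\<lambda>x. c * f x)"

abbreviation clinear :: "(('x \<Rightarrow> complex) \<Rightarrow> ('y \<Rightarrow> complex)) \<Rightarrow> bool" where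
  "clinear \<equiv> Vector_Spaces.linear cscale cscale"

abbreviation cspan :: "('x \<Rightarrow> complex) set \<Rightarrow> ('x \<Rightarrow> complex) set" where
  "cspan \<equiv> Modules.module.span cscale"

record ('g, 'x) rep =
  rspace :: "('x \<Rightarrow> complex) set"
  ract :: "'g \<Rightarrow> ('x \<Rightarrow> complex) \<Rightarrow> ('x \<Rightarrow> complex)"

text \<open>Linear maps between subspaces extend to the ambient spaces, so it is no restriction that the
  intertwining map is given as a linear map between the ambient spaces.\<close>

definition rep_iso :: "'g set \<Rightarrow> ('g, 'x) rep \<Rightarrow> ('g, 'y) rep \<Rightarrow> bool" where
  "rep_iso G R S \<longleftrightarrow> (\<exists>\<phi>. clinear \<phi> \<and> bij_betw \<phi> (rspace R) (rspace S) \<and>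
     (\<forall>g\<in>G. \<forall>f\<in>rspace R. \<phi> (ract R g f) = ract S g (\<phi> f)))"

text \<open>The linear operator sending \<open>b i\<close> to \<open>d i\<close> for \<open>i \<in> I\<close>. It is determined on the span of the
  family \<open>b\<close>, and is only ever applied there.\<close>

definition lin_op :: "'i set \<Rightarrow> ('i \<Rightarrow> 'x \<Rightarrow> complex) \<Rightarrow> ('i \<Rightarrow> 'x \<Rightarrow> complex)
    \<Rightarrow> ('x \<Rightarrow> complex) \<Rightarrow> ('x \<Rightarrow> complex)" where
  "lin_op I b d = (SOME L. clinear L \<and> (\<forall>i\<in>I. L (b i) = d i))"

text \<open>Direct sum over a finite index set \<open>J\<close>.\<close>

definition dsum_rep :: "'o set \<Rightarrow> ('o \<Rightarrow> ('g, 'x) rep) \<Rightarrow> ('g, 'o \<times> 'x) rep" where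
  "dsum_rep J R = \<lparr>
     rspace = {F. (\<forall>j\<in>J. (\<lambda>x. F (j, x)) \<in> rspace (R j)) \<and> (\<forall>j x. j \<notin> J \<longrightarrow> F (j, x) = 0)},
     ract = (\<lambda>g F. \<lambda>(j, x). if j \<in> J then ract (R j) g (\<lambda>y. F (j, y)) x else 0)\<rparr>"

definition pure_tensor :: "('x \<Rightarrow> complex) list \<Rightarrow> 'x list \<Rightarrow> complex" where
  "pure_tensor fs = (\<lambda>xs. if length xs = length fs then \<Prod>i<length fs. (fs ! i) (xs ! i) else 0)"

text \<open>Outer tensor product, a representation of the direct product of the groups; elements of the
  latter are lists.\<close>

definition outer_tensor_rep :: "('g, 'x) rep list \<Rightarrow> ('g list, 'x list) rep" where
  "outer_tensor_rep Rs = \<lparr>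
     rspace = cspan (pure_tensor ` listset (map rspace Rs)),
     ract = (\<lambda>gs. lin_op (listset (map rspace Rs)) pure_tensor
       (\<lambda>fs. pure_tensor (map (\<lambda>i. ract (Rs ! i) (gs ! i) (fs ! i)) [0..<length Rs])))\<rparr>"

text \<open>Induction to the matrix group \<open>G\<close> of a representation \<open>W\<close> of \<open>H\<close>, which is embedded in \<open>G\<close> by
  \<open>\<iota>\<close>: functions \<open>F\<close> from \<open>G\<close> to \<open>W\<close> with \<open>F (\<iota> h * x) = h \<cdot> F x\<close>, acted on by right translation.\<close>

definition ind_rep :: "complex mat set \<Rightarrow> 'h set \<Rightarrow> ('h \<Rightarrow> complex mat) \<Rightarrow> ('h, 'x) rep
    \<Rightarrow> (complex mat, complex mat \<times> 'x) rep" where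
  "ind_rep G H \<iota> W = \<lparr>
     rspace = {F. (\<forall>x\<in>G. (\<lambda>y. F (x, y)) \<in> rspace W) \<and> (\<forall>x y. x \<notin> G \<longrightarrow> F (x, y) = 0) \<and>
       (\<forall>h\<in>H. \<forall>x\<in>G. (\<lambda>y. F (\<iota> h * x, y)) = ract W h (\<lambda>y. F (x, y)))},
     ract = (\<lambda>g F. \<lambda>(x, y). if x \<in> G then F (x * g, y) else 0)\<rparr>"


section \<open>The groups $G(r,n)$ and $G(r,p,n)$\<close>

text \<open>Indices run over \<open>{0..<n}\<close> instead of $\{1,\dots,n\}$.\<close>

definition zeta :: "nat \<Rightarrow> complex" where
  "zeta k = exp (2 * of_real pi * \<i> / of_nat k)"

definition Grn :: "nat \<Rightarrow> nat \<Rightarrow> complex mat monoid" where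
  "Grn r n = \<lparr>carrier = {g \<in> carrier_mat n n.
       (\<forall>i<n. \<exists>!j. j < n \<and> g $$ (i, j) \<noteq> 0) \<and> (\<forall>j<n. \<exists>!i. i < n \<and> g $$ (i, j) \<noteq> 0) \<and>
       (\<forall>i<n. \<forall>j<n. g $$ (i, j) \<noteq> 0 \<longrightarrow> (g $$ (i, j)) ^ r = 1)},
     mult = (*), one = 1\<^sub>m n\<rparr>"

text \<open>In $g = [\sigma_1^{z_1},\dots,\sigma_n^{z_n}]$ the nonzero entry of \<^emph>\<open>column\<close> $j$ lies in row
  $\sigma_j$ and equals $\zeta_r^{z_j}$, so that $|gh| = |g| \circ |h|$ for the matrix product $gh$.
  Reading the entries by rows instead amounts to transposing all matrices and hence to reversing all
  products; with the matrix product the operators of the Gelfand model would then not form a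
  representation, and the set \<open>Theta\<close> below would not be a transversal.\<close>

definition perm_of :: "complex mat \<Rightarrow> nat \<Rightarrow> nat" where
  "perm_of g j = (if j < dim_col g then (THE i. i < dim_row g \<and> g $$ (i, j) \<noteq> 0) else j)"

definition zexp :: "nat \<Rightarrow> complex mat \<Rightarrow> nat \<Rightarrow> nat" where
  "zexp r g j = (THE z. z < r \<and> g $$ (perm_of g j, j) = zeta r ^ z)"

definition ztotal :: "nat \<Rightarrow> complex mat \<Rightarrow> nat" where
  "ztotal r g = (\<Sum>j<dim_col g. zexp r g j)"

definition Grpn :: "nat \<Rightarrow> nat \<Rightarrow> nat \<Rightarrow> complex mat set" where
  "Grpn r p n = {g \<in> carrier (Grn r n). p dvd ztotal r g}"

definition perm_mat :: "nat \<Rightarrow> (nat \<Rightarrow> nat) \<Rightarrow> complex mat" where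
  "perm_mat n \<sigma> = mat n n (\<lambda>(i, j). if i = \<sigma> j then 1 else 0)"

definition Cp :: "nat \<Rightarrow> nat \<Rightarrow> complex mat set" where
  "Cp p n = {zeta p ^ k \<cdot>\<^sub>m 1\<^sub>m n | k. True}"

text \<open>Elements \<open>v\<close> of $G(r,n)/C_p$ are cosets, so that \<open>A \<in> v\<close> means that \<open>A\<close> is a lift of \<open>v\<close>.\<close>

definition abs_involutions :: "nat \<Rightarrow> nat \<Rightarrow> nat \<Rightarrow> complex mat set set" where
  "abs_involutions r p n = {v \<in> carrier (Grn r n Mod Cp p n).
     v \<otimes>\<^bsub>Grn r n Mod Cp p n\<^esub> (map_mat cnj ` v) = \<one>\<^bsub>Grn r n Mod Cp p n\<^esub>}"

definition symmetric_elt :: "complex mat set \<Rightarrow> bool" where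
  "symmetric_elt v \<longleftrightarrow> (\<forall>A\<in>v. transpose_mat A = A)"

definition antisymmetric_elt :: "complex mat set \<Rightarrow> bool" where
  "antisymmetric_elt v \<longleftrightarrow> (\<forall>A\<in>v. transpose_mat A = - A)"

definition perm_conj :: "nat \<Rightarrow> (nat \<Rightarrow> nat) \<Rightarrow> complex mat set \<Rightarrow> complex mat set" where
  "perm_conj n \<sigma> v = (\<lambda>A. perm_mat n \<sigma> * A * perm_mat n (inv_into UNIV \<sigma>)) ` v"

definition Sn_classes :: "nat \<Rightarrow> nat \<Rightarrow> nat \<Rightarrow> complex mat set set set" where
  "Sn_classes r p n = (\<lambda>v. {perm_conj n \<sigma> v | \<sigma>. \<sigma> permutes {..<n}}) ` abs_involutions r p n"


section \<open>Types of antisymmetric elements\<close>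

text \<open>The \<open>i\<close>-th entry counts the cycles $(a^z, b^{z+r'})$ with $z \equiv i$ modulo $r' = r/2$.\<close>

definition antisym_type :: "nat \<Rightarrow> complex mat \<Rightarrow> nat list" where
  "antisym_type r A = map (\<lambda>i. card {{a, perm_of A a} | a. a < dim_col A \<and> zexp r A a mod (r div 2) = i})
     [0..<r div 2]"

definition type_orbit :: "nat \<Rightarrow> nat \<Rightarrow> nat list \<Rightarrow> nat list set" where
  "type_orbit r p \<tau> = {(rotate (r div p) ^^ k) \<tau> | k. True}"

definition has_type :: "nat \<Rightarrow> nat \<Rightarrow> complex mat set \<Rightarrow> nat list set \<Rightarrow> bool" where
  "has_type r p v T \<longleftrightarrow> (\<forall>A\<in>v. type_orbit r p (antisym_type r A) = T)"


section \<open>The Gelfand model\<close>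

definition lift :: "complex mat set \<Rightarrow> complex mat" where
  "lift v = (SOME A. A \<in> v)"

definition pairing :: "nat \<Rightarrow> complex mat \<Rightarrow> complex mat set \<Rightarrow> nat" where
  "pairing r g v = (\<Sum>i<dim_col g. zexp r g i * zexp r (lift v) i)"

definition a_exp :: "nat \<Rightarrow> complex mat \<Rightarrow> complex mat set \<Rightarrow> int" where
  "a_exp r g v = int (zexp r (lift v) 0) - int (zexp r (lift v) (inv_into UNIV (perm_of g) 0))"

definition inv_count :: "complex mat set \<Rightarrow> complex mat \<Rightarrow> nat" where
  "inv_count v g = card {{i, j} | i j. i < dim_col g \<and> j < dim_col g \<and> perm_of (lift v) i = j \<and> j \<noteq> i \<and>
     (int j - int i) * (int (perm_of g j) - int (perm_of g i)) < 0}"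

definition C_basis :: "complex mat set \<Rightarrow> complex mat set \<Rightarrow> complex" where
  "C_basis v = (\<lambda>w. if w = v then 1 else 0)"

definition gelfand_coeff :: "nat \<Rightarrow> complex mat \<Rightarrow> complex mat set \<Rightarrow> complex" where
  "gelfand_coeff r g v = zeta r ^ pairing r g v *
     (if symmetric_elt v then (-1) ^ inv_count v g else zeta r powi a_exp r g v)"

definition gelfand_act :: "nat \<Rightarrow> nat \<Rightarrow> nat \<Rightarrow> complex mat
    \<Rightarrow> (complex mat set \<Rightarrow> complex) \<Rightarrow> (complex mat set \<Rightarrow> complex)" where
  "gelfand_act r p n g = lin_op (abs_involutions r p n) C_basis
     (\<lambda>v. cscale (gelfand_coeff r g v) (C_basis (perm_conj n (perm_of g) v)))"

definition gelfand_sub :: "nat \<Rightarrow> nat \<Rightarrow> nat \<Rightarrow> complex mat set set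
    \<Rightarrow> (complex mat, complex mat set) rep" where
  "gelfand_sub r p n c = \<lparr>rspace = cspan (C_basis ` c), ract = gelfand_act r p n\<rparr>"


section \<open>Specht modules\<close>

text \<open>A partition is the weakly decreasing list of its nonzero parts.\<close>

definition partition_list :: "nat list \<Rightarrow> bool" where
  "partition_list l \<longleftrightarrow> sorted_wrt (\<ge>) l \<and> 0 \<notin> set l"

definition Fer :: "nat \<Rightarrow> nat \<Rightarrow> nat list list set" where
  "Fer r n = {L. length L = r \<and> (\<forall>l\<in>set L. partition_list l) \<and> sum_list (map sum_list L) = n}"

definition cells :: "nat list \<Rightarrow> (nat \<times> nat) set" where
  "cells l = {(i, j). i < length l \<and> j < l ! i}"

definition tableaux :: "nat list \<Rightarrow> (nat \<times> nat \<Rightarrow> nat) set" where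
  "tableaux l = {t. bij_betw t (cells l) {..<sum_list l}}"

text \<open>The tabloid of a tableau is the list of its rows, each row being an unordered set.\<close>

definition tabloid :: "nat list \<Rightarrow> (nat \<times> nat \<Rightarrow> nat) \<Rightarrow> nat set list" where
  "tabloid l t = map (\<lambda>i. {t (i, j) | j. j < l ! i}) [0..<length l]"

definition column_stabilizer :: "nat list \<Rightarrow> (nat \<times> nat \<Rightarrow> nat) \<Rightarrow> (nat \<Rightarrow> nat) set" where
  "column_stabilizer l t = {\<pi>. \<pi> permutes {..<sum_list l} \<and>
     (\<forall>i j. (i, j) \<in> cells l \<longrightarrow> (\<exists>i'. (i', j) \<in> cells l \<and> \<pi> (t (i, j)) = t (i', j)))}"

definition polytabloid :: "nat list \<Rightarrow> (nat \<times> nat \<Rightarrow> nat) \<Rightarrow> nat set list \<Rightarrow> complex" where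
  "polytabloid l t = (\<lambda>T. \<Sum>\<pi>\<in>column_stabilizer l t.
     of_int (sign \<pi>) * (if tabloid l (\<pi> \<circ> t) = T then 1 else 0))"

definition specht :: "nat list \<Rightarrow> (nat set list \<Rightarrow> complex) set" where
  "specht l = cspan (polytabloid l ` tableaux l)"

definition specht_act :: "(nat \<Rightarrow> nat) \<Rightarrow> (nat set list \<Rightarrow> complex) \<Rightarrow> (nat set list \<Rightarrow> complex)" where
  "specht_act \<sigma> f = (\<lambda>T. f (map ((`) (inv_into UNIV \<sigma>)) T))"


section \<open>Irreducible representations\<close>

text \<open>$\gamma_m^{\otimes i} \otimes \tilde\rho_l$ for a partition $l$ of $m$.\<close>

definition twisted_specht_rep :: "nat \<Rightarrow> nat \<Rightarrow> nat list \<Rightarrow> (complex mat, nat set list) rep" where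
  "twisted_specht_rep r i l = \<lparr>rspace = specht l,
     ract = (\<lambda>g f. cscale ((zeta r ^ ztotal r g) ^ i) (specht_act (perm_of g) f))\<rparr>"

definition rho :: "nat \<Rightarrow> nat \<Rightarrow> nat list list \<Rightarrow> (complex mat, complex mat \<times> nat set list list) rep" where
  "rho r n L = ind_rep (carrier (Grn r n))
     (listset (map (\<lambda>l. carrier (Grn r (sum_list l))) L)) diag_block_mat
     (outer_tensor_rep (map (\<lambda>i. twisted_specht_rep r i (L ! i)) [0..<r]))"

definition delta :: "nat \<Rightarrow> complex mat \<Rightarrow> complex" where
  "delta r g = (-1) ^ ztotal r g"

definition Theta :: "nat \<Rightarrow> (nat \<Rightarrow> nat) set" where
  "Theta n = {t. t permutes {..<n} \<and> strict_mono_on {..<n div 2} t \<and> strict_mono_on {n div 2..<n} t}"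

definition hat :: "nat \<Rightarrow> (nat \<Rightarrow> nat) \<Rightarrow> nat \<Rightarrow> nat" where
  "hat n t = (\<lambda>i. if i < n div 2 then t (i + n div 2) else if i < n then t (i - n div 2) else i)"

text \<open>The unique $(t', x_1, x_2)$ with $x t = t'\,\mathrm{diag}(x_1, x_2)$.\<close>

definition coset_decomp :: "nat \<Rightarrow> nat \<Rightarrow> complex mat \<Rightarrow> (nat \<Rightarrow> nat)
    \<Rightarrow> (nat \<Rightarrow> nat) \<times> complex mat \<times> complex mat" where
  "coset_decomp r n x t = (THE (t', x1, x2). t' \<in> Theta n \<and>
     x1 \<in> carrier (Grn r (n div 2)) \<and> x2 \<in> carrier (Grn r (n div 2)) \<and>
     x * perm_mat n t = perm_mat n t' * diag_block_mat [x1, x2])"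

text \<open>The vector $t \otimes v_1 \otimes v_2$ of $T \otimes V \otimes V$.\<close>

definition ptensor :: "(nat \<Rightarrow> nat) \<times> ('x \<Rightarrow> complex) \<times> ('x \<Rightarrow> complex)
    \<Rightarrow> (nat \<Rightarrow> nat) \<times> 'x \<times> 'x \<Rightarrow> complex" where
  "ptensor = (\<lambda>(t, v1, v2). \<lambda>(s, x, y). (if s = t then 1 else 0) * v1 x * v2 y)"

text \<open>$(V, \rho_\mu)$ for $\mu \in \mathrm{Fer}(r/2, n/2)$.\<close>

definition rho_mu :: "nat \<Rightarrow> nat \<Rightarrow> nat list list \<Rightarrow> (complex mat, complex mat \<times> nat set list list) rep" where
  "rho_mu r n \<mu> = rho r (n div 2) (\<mu> @ replicate (r div 2) [])"

definition TVV_gens :: "nat \<Rightarrow> nat \<Rightarrow> nat list list \<Rightarrow> ((nat \<Rightarrow> nat) \<times>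
    (complex mat \<times> nat set list list \<Rightarrow> complex) \<times> (complex mat \<times> nat set list list \<Rightarrow> complex)) set" where
  "TVV_gens r n \<mu> = Theta n \<times> rspace (rho_mu r n \<mu>) \<times> rspace (rho_mu r n \<mu>)"

text \<open>The realization of $\rho_{(\mu,\mu)}$ on $T \otimes V \otimes V$.\<close>

definition TVV_rep :: "nat \<Rightarrow> nat \<Rightarrow> nat list list \<Rightarrow> (complex mat,
    (nat \<Rightarrow> nat) \<times> (complex mat \<times> nat set list list) \<times> (complex mat \<times> nat set list list)) rep" where
  "TVV_rep r n \<mu> = \<lparr>
     rspace = cspan (ptensor ` TVV_gens r n \<mu>),
     ract = (\<lambda>x. lin_op (TVV_gens r n \<mu>) ptensor (\<lambda>(t, v1, v2).
       case coset_decomp r n x t of (t', x1, x2) \<Rightarrow>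
         cscale (delta r x2) (ptensor (t', ract (rho_mu r n \<mu>) x1 v1, ract (rho_mu r n \<mu>) x2 v2))))\<rparr>"

definition S_op :: "nat \<Rightarrow> nat \<Rightarrow> nat list list
    \<Rightarrow> ((nat \<Rightarrow> nat) \<times> (complex mat \<times> nat set list list) \<times> (complex mat \<times> nat set list list) \<Rightarrow> complex)
    \<Rightarrow> ((nat \<Rightarrow> nat) \<times> (complex mat \<times> nat set list list) \<times> (complex mat \<times> nat set list list) \<Rightarrow> complex)" where
  "S_op r n \<mu> = lin_op (TVV_gens r n \<mu>) ptensor (\<lambda>(t, v1, v2). ptensor (hat n t, v2, v1))"

text \<open>$\rho^\epsilon_{[\mu,\mu]}$ for $\epsilon \in \{0, 1\}$, computed from the representative $\mu$.\<close>

definition rho_split :: "nat \<Rightarrow> nat \<Rightarrow> nat \<Rightarrow> nat list list \<Rightarrow> (complex mat,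
    (nat \<Rightarrow> nat) \<times> (complex mat \<times> nat set list list) \<times> (complex mat \<times> nat set list list)) rep" where
  "rho_split r n \<epsilon> \<mu> = \<lparr>
     rspace = {F \<in> rspace (TVV_rep r n \<mu>). S_op r n \<mu> F = cscale ((-1) ^ \<epsilon>) F},
     ract = ract (TVV_rep r n \<mu>)\<rparr>"

text \<open>\<open>rotate (r div 2 - r div p)\<close> shifts $\mu$ to the right by $r/p$ places.\<close>

definition fer_orbit :: "nat \<Rightarrow> nat \<Rightarrow> nat list list \<Rightarrow> nat list list set" where
  "fer_orbit r p \<mu> = {(rotate (r div 2 - r div p) ^^ k) \<mu> | k. True}"

definition fer_orbits_of_type :: "nat \<Rightarrow> nat \<Rightarrow> nat \<Rightarrow> nat list \<Rightarrow> nat list list set set" where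
  "fer_orbits_of_type r p n \<tau> = {X \<in> fer_orbit r p ` Fer (r div 2) (n div 2).
     \<exists>\<mu>\<in>X. \<forall>i<r div 2. sum_list (\<mu> ! i) = \<tau> ! i}"

end

(*
Every antisymmetric matrix of type tau is A(w) for some permutation w, where A(id) exchanges the two
halves of {0,...,n-1} with exponents constant on the blocks of sizes tau, and w acts by conjugation. As
gcd(p,n) = 2, comparing sums of exponents shows that among the multiples of A(w) by powers of zeta_p only
A(w) and -A(w) = A(w s) are S_n-conjugate to A(w), where s exchanges the halves. Hence M(c) becomes the
space of the functions f on S_n that are invariant under the diagonal Young subgroup of shape tau in
S_{n/2} x S_{n/2} and satisfy f(w s) = -f(w); the sign comes from normalizing f by the first nonzero
entry of a lift, which absorbs the factor zeta_r^{a(g,v)}.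

Such an f is decomposed by Fourier analysis on one factor of the Young subgroup, against the projection
kernels of the Specht modules. The coefficient at mu is a vector of the representation induced from
V_mu x V_mu, and the sign change of f says that it lies in the -1 eigenspace of the operator S. Schur
orthogonality and the completeness of the Specht characters show that f is determined by its
coefficients at all mu with block sizes tau, and that these can be prescribed. Rotating tau amounts to
multiplying A by a power of zeta_r, so that the coefficients for the members of an orbit of mu vanish
together, and one representative of each orbit suffices.
*)
theory Submission
  imports Defs "HOL-Combinatorics.Cycles" "Jordan_Normal_Form.Determinant"
begin

text \<open>Signs and lifts shape the argument. Multiplying a lift by \<open>zeta p\<close> shifts
  its type by \<open>r div p\<close>, and \<open>p div 2\<close> such shifts amount to
  \<open>r div 2\<close>: the type returns, but the matrix has become its negative and the halves of
  the parametrization are exchanged. The twist \<open>delta\<close> on the other side has the same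
  origin: in \<open>\<tau> @ \<tau>\<close> the blocks of the second half are numbered from
  \<open>r div 2\<close> on, and \<open>zeta r\<close> to that power is -1. Specht modules enter
  through explicit projection kernels on tabloids, built from integer vectors, so that nonvanishing
  reduces to sums of squares of integers. Every module then becomes a space of functions cut out by
  linear equations with such kernels, and every operator that is specified on generators is replaced
  by a formula on functions. The chosen member of an orbit may have a rotation of \<tau> as its
  block sizes. Each summand therefore lifts the functions on the class along its own rotation, and
  the comparison between rotations is carried out on vanishing of coefficients.\<close>

unbundle no m_inv_syntax

section \<open>Tableaux, tabloids and polytabloids\<close>

abbreviation Sym :: "nat \<Rightarrow> (nat \<Rightarrow> nat) set" where
  "Sym k \<equiv> {\<pi>. \<pi> permutes {..<k}}"

definition tabs :: "nat list \<Rightarrow> nat set list set" where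
  "tabs l = tabloid l ` tableaux l"

definition pact :: "(nat \<Rightarrow> nat) \<Rightarrow> nat set list \<Rightarrow> nat set list" where
  "pact w T = map ((`) w) T"

definition row_idx :: "nat list \<Rightarrow> (nat \<times> nat \<Rightarrow> nat) \<Rightarrow> nat \<Rightarrow> nat" where
  "row_idx l t a = fst (inv_into (cells l) t a)"

definition col_idx :: "nat list \<Rightarrow> (nat \<times> nat \<Rightarrow> nat) \<Rightarrow> nat \<Rightarrow> nat" where
  "col_idx l t a = snd (inv_into (cells l) t a)"

lemma pact_comp: "pact (u \<circ> v) T = pact u (pact v T)"
  by (simp add: pact_def image_comp)

lemma pact_id [simp]: "pact id T = T" "pact (\<lambda>x. x) T = T"
  by (simp_all add: pact_def map_idI)

lemma pact_inv [simp]: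
  assumes "w permutes S"
  shows "pact (inv w) (pact w T) = T" "pact w (pact (inv w) T) = T"
  using assms by (simp_all flip: pact_comp add: permutes_inv_o)

lemma pact_eq_iff:
  assumes "w permutes S"
  shows "pact w x = y \<longleftrightarrow> x = pact (inv w) y"
  using assms by auto

lemma finite_Sym [simp]: "finite (Sym k)"
  by (simp add: finite_permutations)

lemma tabloid_comp: "tabloid l (w \<circ> t) = pact w (tabloid l t)"
  by (auto simp: tabloid_def pact_def)

lemma cells_Sigma: "cells l = Sigma {..<length l} (\<lambda>i. {..<l ! i})"
  by (auto simp: cells_def)

lemma finite_cells [simp]: "finite (cells l)"
  by (simp add: cells_Sigma)

lemma card_cells: "card (cells l) = sum_list l"
  by (simp add: cells_Sigma sum_list_sum_nth atLeast0LessThan)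

lemma tableaux_nonempty: "\<exists>t. t \<in> tableaux l"
  using finite_same_card_bij[of "cells l" "{..<sum_list l}"]
  by (auto simp: tableaux_def card_cells)

lemma tableaux_comp:
  assumes "t \<in> tableaux l" "w permutes {..<sum_list l}"
  shows "w \<circ> t \<in> tableaux l"
  using assms unfolding tableaux_def by (auto intro: bij_betw_trans permutes_imp_bij)

lemma tableaux_row_idx_col_idx:
  assumes "t \<in> tableaux l" "a < sum_list l"
  shows "(row_idx l t a, col_idx l t a) \<in> cells l" "t (row_idx l t a, col_idx l t a) = a"
proof -
  have "a \<in> t ` cells l" using assms by (auto simp: tableaux_def bij_betw_def)
  then show "(row_idx l t a, col_idx l t a) \<in> cells l" "t (row_idx l t a, col_idx l t a) = a"
    by (auto simp: row_idx_def col_idx_def inv_into_into f_inv_into_f)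
qed

lemma row_idx_col_idx_tableau [simp]:
  assumes "t \<in> tableaux l" "(i, j) \<in> cells l"
  shows "row_idx l t (t (i, j)) = i" "col_idx l t (t (i, j)) = j" "t (i, j) < sum_list l"
  using assms by (auto simp: row_idx_def col_idx_def tableaux_def bij_betw_def)

lemma row_idx_col_idx_inj:
  assumes "t \<in> tableaux l" "a < sum_list l" "b < sum_list l" "row_idx l t a = row_idx l t b" "col_idx l t a
    = col_idx l t b"
  shows "a = b"
  using tableaux_row_idx_col_idx[OF assms(1,2)] tableaux_row_idx_col_idx[OF assms(1,3)] assms(4,5) by metis

lemma length_tabloid [simp]: "length (tabloid l t) = length l"
  by (simp add: tabloid_def)

lemma tabloid_nth:
  assumes "t \<in> tableaux l" "i < length l"
  shows "tabloid l t ! i = {a. a < sum_list l \<and> row_idx l t a = i}"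
proof -
  have "\<exists>j. a = t (row_idx l t a, j) \<and> j < l ! row_idx l t a" if "a < sum_list l" for a
    using tableaux_row_idx_col_idx[OF assms(1) that] by (intro exI[of _ "col_idx l t a"]) (auto simp: cells_def)
  then show ?thesis using assms
    by (auto simp: tabloid_def cells_def)
qed

text \<open>A tableau is a total function of which only the values on \<open>cells l\<close> matter.
  Two tableaux of one shape are related by a permutation on the cells only, so tabloids and
  polytabloids must ignore the other values.\<close>

lemma tabloid_cong:
  assumes "\<And>c. c \<in> cells l \<Longrightarrow> t c = t' c"
  shows "tabloid l t = tabloid l t'"
proof -
  have "{t (i, j) |j. j < l ! i} = {t' (i, j) |j. j < l ! i}" if "i < length l" for i
    using assms[of "(i, _)"] that unfolding cells_def by (metis (mono_tags, lifting) case_prodI mem_Collect_eq)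
  then show ?thesis unfolding tabloid_def by (intro map_cong) auto
qed

text \<open>Moving inside the columns is invariance of \<open>col_idx\<close>; in this form closure
  under composition and inverses is immediate.\<close>

lemma column_stabilizer_iff:
  assumes "t \<in> tableaux l"
  shows "\<pi> \<in> column_stabilizer l t \<longleftrightarrow>
    \<pi> permutes {..<sum_list l} \<and> (\<forall>a<sum_list l. col_idx l t (\<pi> a) = col_idx l t a)"
proof -
  have "(\<forall>i j. (i, j) \<in> cells l \<longrightarrow> (\<exists>i'. (i', j) \<in> cells l \<and> \<pi> (t (i, j)) = t (i', j))) \<longleftrightarrow>
     (\<forall>a<sum_list l. col_idx l t (\<pi> a) = col_idx l t a)" if p: "\<pi> permutes {..<sum_list l}"
  proof (intro iffI allI impI)
    fix a assume *: "\<forall>i j. (i, j) \<in> cells l \<longrightarrow> (\<exists>i'. (i', j) \<in> cells l \<and> \<pi> (t (i, j)) = t (i', j))"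
      and a: "a < sum_list l"
    then show "col_idx l t (\<pi> a) = col_idx l t a"
      using tableaux_row_idx_col_idx[OF assms a] row_idx_col_idx_tableau(2)[OF assms] by metis
  next
    fix i j assume *: "\<forall>a<sum_list l. col_idx l t (\<pi> a) = col_idx l t a" and ij: "(i, j) \<in> cells l"
    have 1: "\<pi> (t (i, j)) < sum_list l" using p row_idx_col_idx_tableau(3)[OF assms ij] permutes_in_image by fastforce
    have "col_idx l t (\<pi> (t (i, j))) = j" using * ij assms by simp
    then show "\<exists>i'. (i', j) \<in> cells l \<and> \<pi> (t (i, j)) = t (i', j)"
      using tableaux_row_idx_col_idx[OF assms 1] by metis
  qed
  then show ?thesis unfolding column_stabilizer_def by blast
qed

lemma permutes_less: "\<pi> permutes {..<k} \<Longrightarrow> (a::nat) < k \<Longrightarrow> \<pi> a < k"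
  using permutes_in_image by fastforce

lemma column_stabilizer_group:
  assumes "t \<in> tableaux l"
  shows "id \<in> column_stabilizer l t"
    "\<pi> \<in> column_stabilizer l t \<Longrightarrow> \<rho> \<in> column_stabilizer l t \<Longrightarrow> \<pi> \<circ> \<rho> \<in> column_stabilizer l t"
    "\<pi> \<in> column_stabilizer l t \<Longrightarrow> inv \<pi> \<in> column_stabilizer l t"
proof -
  show "id \<in> column_stabilizer l t" by (simp add: column_stabilizer_iff[OF assms] permutes_id)
  show "\<pi> \<in> column_stabilizer l t \<Longrightarrow> \<rho> \<in> column_stabilizer l t \<Longrightarrow> \<pi> \<circ> \<rho> \<in> column_stabilizer l t"
    by (auto simp: column_stabilizer_iff[OF assms] permutes_compose permutes_less)
  assume p: "\<pi> \<in> column_stabilizer l t"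
  have q: "\<pi> permutes {..<sum_list l}" using p by (simp add: column_stabilizer_iff[OF assms])
  have "col_idx l t (inv \<pi> a) = col_idx l t a" if "a < sum_list l" for a
    using p permutes_less[OF permutes_inv[OF q] that] permutes_inverses[OF q]
    by (auto simp: column_stabilizer_iff[OF assms])
  then show "inv \<pi> \<in> column_stabilizer l t" using permutes_inv[OF q] by (simp add: column_stabilizer_iff[OF assms])
qed

lemma column_stabilizer_permutes: "\<pi> \<in> column_stabilizer l t \<Longrightarrow> \<pi> permutes {..<sum_list l}"
  by (simp add: column_stabilizer_def)

lemma finite_column_stabilizer [simp]: "finite (column_stabilizer l t)"
  by (rule finite_subset[OF _ finite_Sym[of "sum_list l"]]) (auto simp: column_stabilizer_def)

lemma column_stabilizer_comp:
  assumes t: "t \<in> tableaux l" and w: "w permutes {..<sum_list l}"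
  shows "column_stabilizer l (w \<circ> t) = (\<lambda>\<pi>. w \<circ> \<pi> \<circ> inv w) ` column_stabilizer l t"
proof -
  have "\<pi> \<in> column_stabilizer l (w \<circ> t) \<longleftrightarrow> inv w \<circ> \<pi> \<circ> w \<in> column_stabilizer l t"
    if p: "\<pi> permutes {..<sum_list l}" for \<pi>
  proof -
    have "inv w \<circ> \<pi> \<circ> w permutes {..<sum_list l}" using p w by (intro permutes_compose permutes_inv)
    moreover have "\<pi> (w a) = w b \<longleftrightarrow> inv w (\<pi> (w a)) = b" for a b
      using permutes_inverses[OF w] by metis
    ultimately show ?thesis using p by (simp add: column_stabilizer_def)
  qed
  note * = this
  show ?thesis
  proof (intro Set.set_eqI iffI)
    fix \<pi> assume h: "\<pi> \<in> column_stabilizer l (w \<circ> t)"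
    then have "inv w \<circ> \<pi> \<circ> w \<in> column_stabilizer l t" using * column_stabilizer_permutes by blast
    moreover have "\<pi> = w \<circ> (inv w \<circ> \<pi> \<circ> w) \<circ> inv w" using permutes_inverses[OF w] by (simp add: fun_eq_iff)
    ultimately show "\<pi> \<in> (\<lambda>\<pi>. w \<circ> \<pi> \<circ> inv w) ` column_stabilizer l t" by blast
  next
    fix \<pi> assume "\<pi> \<in> (\<lambda>\<pi>. w \<circ> \<pi> \<circ> inv w) ` column_stabilizer l t"
    then obtain \<rho> where r: "\<rho> \<in> column_stabilizer l t" "\<pi> = w \<circ> \<rho> \<circ> inv w" by blast
    have "inv w \<circ> \<pi> \<circ> w = \<rho>" using permutes_inverses[OF w] r by (simp add: fun_eq_iff)
    moreover have "\<pi> permutes {..<sum_list l}"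
      unfolding r
      by (rule permutes_compose[OF permutes_inv[OF w] permutes_compose[OF column_stabilizer_permutes[OF r(1)] w]])
    ultimately show "\<pi> \<in> column_stabilizer l (w \<circ> t)" using * r by simp
  qed
qed

lemma polytabloid_cong:
  assumes "\<And>c. c \<in> cells l \<Longrightarrow> t c = t' c"
  shows "polytabloid l t = polytabloid l t'"
proof -
  have "column_stabilizer l t = column_stabilizer l t'"
    unfolding column_stabilizer_def using assms by (metis (mono_tags, lifting))
  moreover have "tabloid l (\<pi> \<circ> t) = tabloid l (\<pi> \<circ> t')" for \<pi>
    by (rule tabloid_cong) (simp add: assms)
  ultimately show ?thesis unfolding polytabloid_def by simp
qed

lemma tableaux_transitive:
  assumes "t \<in> tableaux l" "t' \<in> tableaux l"
  shows "\<exists>w. w permutes {..<sum_list l} \<and> (\<forall>c\<in>cells l. t' c = (w \<circ> t) c)"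
proof -
  define w where "w a = (if a < sum_list l then t' (row_idx l t a, col_idx l t a) else a)" for a
  have "bij_betw w {..<sum_list l} {..<sum_list l}"
  proof -
    have "bij_betw (t' \<circ> inv_into (cells l) t) {..<sum_list l} {..<sum_list l}"
      using assms by (auto simp: tableaux_def intro: bij_betw_trans bij_betw_inv_into)
    then show ?thesis by (rule bij_betw_cong[THEN iffD1, rotated]) (auto simp: w_def row_idx_def col_idx_def)
  qed
  then have "w permutes {..<sum_list l}" by (rule bij_imp_permutes) (simp add: w_def)
  moreover have "t' c = (w \<circ> t) c" if "c \<in> cells l" for c
    using that assms by (cases c) (auto simp: w_def)
  ultimately show ?thesis by blast
qed

text \<open>The column stabilizer of \<open>w \<circ> t\<close> is the conjugate of that of
  \<open>t\<close>, and conjugation preserves signs.\<close>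

lemma polytabloid_comp:
  assumes t: "t \<in> tableaux l" and w: "w permutes {..<sum_list l}"
  shows "polytabloid l (w \<circ> t) T = polytabloid l t (pact (inv w) T)"
proof -
  have inj: "inj_on (\<lambda>\<pi>. w \<circ> \<pi> \<circ> inv w) (column_stabilizer l t)"
  proof (rule inj_onI)
    fix x y assume "w \<circ> x \<circ> inv w = w \<circ> y \<circ> inv w"
    then have "inv w \<circ> (w \<circ> x \<circ> inv w) \<circ> w = inv w \<circ> (w \<circ> y \<circ> inv w) \<circ> w" by simp
    then show "x = y" using permutes_inverses[OF w] by (simp add: fun_eq_iff)
  qed
  have s: "sign (w \<circ> \<pi> \<circ> inv w) = sign \<pi>" if "\<pi> \<in> column_stabilizer l t" for \<pi>
  proof -
    have "permutation w" "permutation \<pi>"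
      using w column_stabilizer_permutes[OF that] by (auto simp: permutation_permutes)
    then show ?thesis
      by (simp add: sign_compose sign_inverse permutation_compose permutation_inverse sign_idempotent
          mult.commute mult.left_commute)
  qed
  have i: "w \<circ> \<pi> \<circ> inv w \<circ> (w \<circ> t) = w \<circ> (\<pi> \<circ> t)" for \<pi>
    using permutes_inverses[OF w] by (simp add: fun_eq_iff)
  show ?thesis
    unfolding polytabloid_def column_stabilizer_comp[OF assms] sum.reindex[OF inj]
    by (intro sum.cong refl, subst o_apply) (simp only: s i tabloid_comp[of l w] pact_eq_iff[OF w])
qed

section \<open>The submodule theorem\<close>

text \<open>Partitions are compared in the dominance order through these sums.\<close>

definition partial_sum :: "nat list \<Rightarrow> nat \<Rightarrow> nat" where "partial_sum l i = sum_list (take i l)"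

lemma card_row_idx_less:
  assumes "t \<in> tableaux l"
  shows "card {a. a < sum_list l \<and> row_idx l t a < i} = partial_sum l i"
proof -
  have "bij_betw t (cells (take i l)) {a. a < sum_list l \<and> row_idx l t a < i}"
  proof (rule bij_betwI')
    have sub: "cells (take i l) \<subseteq> cells l" by (auto simp: cells_def)
    fix x y assume "x \<in> cells (take i l)" "y \<in> cells (take i l)"
    then show "(t x = t y) = (x = y)" using assms sub by (auto simp: tableaux_def bij_betw_def inj_on_def)
  next
    fix x assume "x \<in> cells (take i l)"
    then show "t x \<in> {a. a < sum_list l \<and> row_idx l t a < i}"
      using row_idx_col_idx_tableau[OF assms, of "fst x" "snd x"] by (auto simp: cells_def)
  next
    fix a assume a: "a \<in> {a. a < sum_list l \<and> row_idx l t a < i}"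
    then show "\<exists>x\<in>cells (take i l). a = t x"
      using tableaux_row_idx_col_idx[OF assms, of a] by (intro bexI[of _ "(row_idx l t a, col_idx l t a)"])
        (auto simp: cells_def)
  qed
  from bij_betw_same_card[OF this] show ?thesis by (simp add: card_cells partial_sum_def)
qed

lemma partition_cells_down:
  assumes "partition_list l" "(i, j) \<in> cells l" "i' \<le> i"
  shows "(i', j) \<in> cells l"
proof -
  have "l ! i \<le> l ! i'" using assms
    by (cases "i = i'") (auto simp: partition_list_def sorted_wrt_iff_nth_less cells_def)
  then show ?thesis using assms by (auto simp: cells_def)
qed

text \<open>In each column of \<open>t\<close>, at most \<open>i\<close> entries lie in the first \<open>i\<close> rows of \<open>t'\<close>, and a column that
  is shorter than \<open>i\<close> lies in the first \<open>i\<close> rows of \<open>t\<close> altogether.\<close>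

lemma dominance:
  assumes t: "t \<in> tableaux l" and t': "t' \<in> tableaux l'" and p: "partition_list l"
    and k: "sum_list l = k" "sum_list l' = k"
    and inj: "inj_on (\<lambda>a. (row_idx l' t' a, col_idx l t a)) {..<k}"
  shows "partial_sum l' i \<le> partial_sum l i"
    and "l = l' \<Longrightarrow> a < k \<Longrightarrow> (row_idx l' t' a, col_idx l t a) \<in> cells l"
proof -
  define A where "A j i = {a. a < k \<and> row_idx l' t' a < i \<and> col_idx l t a = j}" for j i
  define B where "B j i = {a. a < k \<and> row_idx l t a < i \<and> col_idx l t a = j}" for j i
  have fin: "finite (A j i)" "finite (B j i)" for j i by (auto simp: A_def B_def)
  have full: "B j i = {a. a < k \<and> col_idx l t a = j}" if "(i, j) \<notin> cells l" for i j
  proof -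
    have "row_idx l t a < i" if "a < k" "col_idx l t a = j" for a
    proof (rule ccontr)
      assume "\<not> row_idx l t a < i"
      then show False
        using tableaux_row_idx_col_idx(1)[OF t, of a] partition_cells_down[OF p, of
          "row_idx l t a" j i] \<open>(i, j) \<notin> cells l\<close> that k
        by simp
    qed
    then show ?thesis by (auto simp: B_def)
  qed
  have AB: "card (A j i) \<le> card (B j i)" for i j
  proof (cases "\<forall>i'<i. (i', j) \<in> cells l")
    case True
    have "inj_on (\<lambda>i'. t (i', j)) {..<i}"
      using True t by (auto simp: tableaux_def bij_betw_def inj_on_def)
    moreover have "(\<lambda>i'. t (i', j)) ` {..<i} \<subseteq> B j i" using True row_idx_col_idx_tableau[OF t] k by (auto simp: B_def)
    ultimately have "i \<le> card (B j i)" using card_inj_on_le[OF _ _ fin(2)] by (metis card_lessThan)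
    moreover have "inj_on (row_idx l' t') (A j i)" "row_idx l' t' ` A j i \<subseteq> {..<i}"
      using inj by (auto simp: A_def inj_on_def)
    then have "card (A j i) \<le> i" using card_inj_on_le[of "row_idx l' t'" "A j i" "{..<i}"] by simp
    ultimately show ?thesis by simp
  next
    case False
    then obtain i' where "i' < i" "(i', j) \<notin> cells l" by blast
    then have "(i, j) \<notin> cells l" using partition_cells_down[OF p, of i j i'] by auto
    from full[OF this] show ?thesis by (intro card_mono fin) (auto simp: A_def)
  qed
  define J where "J = col_idx l t ` {..<k}"
  have sumA: "partial_sum l' i = (\<Sum>j\<in>J. card (A j i))" for i
  proof -
    have "card {a. a < k \<and> row_idx l' t' a < i} = card (\<Union>j\<in>J. A j i)"
      by (rule arg_cong[of _ _ card]) (auto simp: A_def J_def)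
    also have "\<dots> = (\<Sum>j\<in>J. card (A j i))" by (rule card_UN_disjoint) (auto simp: J_def A_def)
    finally show ?thesis using card_row_idx_less[OF t', of i] k by simp
  qed
  have sumB: "partial_sum l i = (\<Sum>j\<in>J. card (B j i))" for i
  proof -
    have "card {a. a < k \<and> row_idx l t a < i} = card (\<Union>j\<in>J. B j i)"
      by (rule arg_cong[of _ _ card]) (auto simp: B_def J_def)
    also have "\<dots> = (\<Sum>j\<in>J. card (B j i))" by (rule card_UN_disjoint) (auto simp: J_def B_def)
    finally show ?thesis using card_row_idx_less[OF t, of i] k by simp
  qed
  show "partial_sum l' i \<le> partial_sum l i" unfolding sumA sumB by (rule sum_mono) (rule AB)
  assume eq: "l = l'" and a: "a < k"
  define j where "j = col_idx l t a"
  \<comment> \<open>\<open>i\<close> is the length of column \<open>j\<close>. For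
    \<open>l = l'\<close> the column estimates have equal totals, so each of them is an equality;
    for this \<open>i\<close> the set \<open>B j i\<close> is the whole column, hence so is
    \<open>A j i\<close>.\<close>
  define i where "i = (LEAST i. (i, j) \<notin> cells l)"
  have "(length l, j) \<notin> cells l" by (simp add: cells_def)
  then have i: "(i, j) \<notin> cells l" unfolding i_def by (rule LeastI)
  have less: "(i', j) \<in> cells l" if "i' < i" for i' using that not_less_Least unfolding i_def by blast
  have "(\<Sum>j\<in>J. card (A j i)) = (\<Sum>j\<in>J. card (B j i))" using sumA[of i] sumB[of i] eq by simp
  then have "card (A j i) = card (B j i)" if "j \<in> J" for j
    using sum_mono_inv[of "\<lambda>j. card (A j i)" J "\<lambda>j. card (B j i)"] AB that by (simp add: J_def)
  moreover have "j \<in> J" using a by (auto simp: J_def j_def)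
  ultimately have "card (A j i) = card (B j i)" by blast
  moreover have "A j i \<subseteq> B j i" unfolding full[OF i] by (auto simp: A_def)
  ultimately have "A j i = B j i" using card_subset_eq fin by metis
  then have "a \<in> A j i" using full[OF i] a by (auto simp: j_def)
  then show "(row_idx l' t' a, col_idx l t a) \<in> cells l" using less by (auto simp: A_def j_def)
qed

text \<open>Differences of partial sums recover the parts padded by zeros, and the lengths agree
  because a partition has no zero part.\<close>

lemma dominance_antisym:
  assumes "partition_list l" "partition_list l'" "\<And>i. partial_sum l i = partial_sum l' i"
  shows "l = l'"
proof -
  define nz where "nz l i = (if i < length l then l ! i else 0)" for l :: "nat list" and i
  have nz: "partial_sum l (Suc i) = partial_sum l i + nz l i" for l i
    by (auto simp: partial_sum_def nz_def take_Suc_conv_app_nth)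
  have eq: "nz l i = nz l' i" for i using nz[of l i] nz[of l' i] assms(3) by simp
  have len: "length l \<le> length l'" if "partition_list l" "\<And>i. nz l i = nz l' i" for l l'
  proof (rule ccontr)
    assume "\<not> length l \<le> length l'"
    then have h: "length l' < length l" by simp
    then have "l ! length l' = 0" using that(2)[of "length l'"] by (simp add: nz_def)
    then show False using that(1) h nth_mem[OF h] by (auto simp: partition_list_def)
  qed
  have L: "length l = length l'" using len[of l l'] len[of l' l] assms(1,2) eq by (simp add: le_antisym)
  show ?thesis
  proof (rule nth_equalityI[OF L])
    fix i assume "i < length l" then show "l ! i = l' ! i" using eq[of i] L by (simp add: nz_def)
  qed
qed

lemma transpose_column_stabilizer:
  assumes "t \<in> tableaux l" "a < sum_list l" "b < sum_list l" "col_idx l t a = col_idx l t b"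
  shows "transpose a b \<in> column_stabilizer l t"
  unfolding column_stabilizer_iff[OF assms(1)]
proof
  show "transpose a b permutes {..<sum_list l}" using assms by (intro permutes_swap_id) auto
  show "\<forall>x<sum_list l. col_idx l t (transpose a b x) = col_idx l t x" using assms(4) by (simp add: transpose_def)
qed

lemma pact_transpose_tabloid:
  assumes "t \<in> tableaux l" "a < sum_list l" "b < sum_list l" "row_idx l t a = row_idx l t b"
  shows "pact (transpose a b) (tabloid l t) = tabloid l t"
proof (rule nth_equalityI)
  fix i assume "i < length (pact (transpose a b) (tabloid l t))"
  then have i: "i < length l" by (simp add: pact_def)
  have "transpose a b ` {a. a < sum_list l \<and> row_idx l t a = i} = {a. a < sum_list l \<and> row_idx l t a = i}"
  proof -
    have "transpose a b x \<in> {a. a < sum_list l \<and> row_idx l t a = i} \<longleftrightarrow> x \<in> {a. a < sum_list l \<and> row_idx l t a = i}"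
      for x
      using assms by (auto simp: transpose_def)
    then show ?thesis by (metis (no_types, lifting) ext image_iff Set.set_eqI transpose_involutory)
  qed
  then show "pact (transpose a b) (tabloid l t) ! i = tabloid l t ! i"
    using i assms by (simp add: pact_def tabloid_nth)
qed (simp add: pact_def)

lemma tabs_pact:
  assumes "T \<in> tabs l" "w permutes {..<sum_list l}"
  shows "pact w T \<in> tabs l"
  using assms tableaux_comp unfolding tabs_def by (force simp flip: tabloid_comp)

lemma tabs_pact_iff:
  assumes "w permutes {..<sum_list l}"
  shows "pact w T \<in> tabs l \<longleftrightarrow> T \<in> tabs l"
  using tabs_pact[OF _ assms] tabs_pact[OF _ permutes_inv[OF assms], of "pact w T"] assms by auto

text \<open>Each entry is sent to the cell in its row of \<open>t'\<close> and its column of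
  \<open>t\<close>. The second part of \<open>dominance\<close> places this cell inside the shape,
  and injectivity makes the map a column permutation of \<open>t\<close> that carries the tabloid of
  \<open>t'\<close> to that of \<open>t\<close>.\<close>

lemma column_orbit:
  assumes t: "t \<in> tableaux l" and t': "t' \<in> tableaux l" and p: "partition_list l"
    and inj: "inj_on (\<lambda>a. (row_idx l t' a, col_idx l t a)) {..<sum_list l}"
  shows "\<exists>\<rho>\<in>column_stabilizer l t. tabloid l t' = pact \<rho> (tabloid l t)"
proof -
  let ?k = "sum_list l"
  define \<psi> where "\<psi> a = (if a < ?k then t (row_idx l t' a, col_idx l t a) else a)" for a
  have c: "(row_idx l t' a, col_idx l t a) \<in> cells l" if "a < ?k" for a
    using dominance(2)[OF t t' p refl refl inj refl that] .
  have "inj_on \<psi> {..<?k}"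
  proof (rule inj_onI)
    fix a b assume ab: "a \<in> {..<?k}" "b \<in> {..<?k}" "\<psi> a = \<psi> b"
    then have "(row_idx l t' a, col_idx l t a) = (row_idx l t' b, col_idx l t b)"
      using c[of a] c[of b] t by (auto simp: \<psi>_def tableaux_def bij_betw_def dest: inj_onD)
    then show "a = b" using inj ab by (auto dest: inj_onD)
  qed
  moreover have "\<psi> ` {..<?k} \<subseteq> {..<?k}" using c row_idx_col_idx_tableau(3)[OF t] by (auto simp: \<psi>_def)
  ultimately have "bij_betw \<psi> {..<?k} {..<?k}" by (simp add: bij_betw_def endo_inj_surj)
  then have psi: "\<psi> permutes {..<?k}" by (rule bij_imp_permutes) (simp add: \<psi>_def)
  have C: "\<psi> \<in> column_stabilizer l t" using psi c t by (auto simp: column_stabilizer_iff \<psi>_def)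
  have "pact \<psi> (tabloid l t') = tabloid l t"
  proof (rule nth_equalityI)
    fix i assume "i < length (pact \<psi> (tabloid l t'))"
    then have i: "i < length l" by (simp add: pact_def)
    have rwp: "row_idx l t (\<psi> a) = row_idx l t' a" if "a < ?k" for a using c[OF that] t that by (simp add: \<psi>_def)
    have "\<psi> ` {a. a < ?k \<and> row_idx l t' a = i} = {a. a < ?k \<and> row_idx l t a = i}"
    proof (intro Set.set_eqI iffI)
      fix b assume "b \<in> {a. a < ?k \<and> row_idx l t a = i}"
      then have b: "b < ?k" "row_idx l t b = i" by auto
      have "\<psi> (inv \<psi> b) = b" "inv \<psi> b < ?k"
        using permutes_inverses[OF psi] permutes_less[OF permutes_inv[OF psi] b(1)] by auto
      then show "b \<in> \<psi> ` {a. a < ?k \<and> row_idx l t' a = i}" using rwp[of "inv \<psi> b"] b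
        by (metis (mono_tags) image_eqI mem_Collect_eq)
    qed (use rwp permutes_less[OF psi] in auto)
    then show "pact \<psi> (tabloid l t') ! i = tabloid l t ! i" using i t t' by (simp add: pact_def tabloid_nth)
  qed (simp add: pact_def)
  then have "tabloid l t' = pact (inv \<psi>) (tabloid l t)" by (simp add: pact_eq_iff[OF psi])
  then show ?thesis using column_stabilizer_group(3)[OF t C] by blast
qed

lemma column_stabilizer_tabloid_free:
  assumes t: "t \<in> tableaux l" and C: "\<pi> \<in> column_stabilizer l t"
    and eq: "pact \<pi> (tabloid l t) = tabloid l t"
  shows "\<pi> = id"
proof
  fix a
  have p: "\<pi> permutes {..<sum_list l}" using C by (rule column_stabilizer_permutes)
  show "\<pi> a = id a"
  proof (cases "a < sum_list l")
    case True
    have i: "row_idx l t a < length l" using tableaux_row_idx_col_idx(1)[OF t True] by (auto simp: cells_def)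
    have "\<pi> a \<in> pact \<pi> (tabloid l t) ! row_idx l t a" using i True t by (simp add: pact_def tabloid_nth)
    then have "row_idx l t (\<pi> a) = row_idx l t a" using i t by (simp add: eq tabloid_nth)
    moreover have "col_idx l t (\<pi> a) = col_idx l t a" using C t True by (simp add: column_stabilizer_iff)
    ultimately show ?thesis using row_idx_col_idx_inj[OF t permutes_less[OF p True] True] by simp
  next
    case False then show ?thesis using p by (simp add: permutes_def)
  qed
qed

lemma polytabloid_alternating:
  assumes t: "t \<in> tableaux l" and C: "\<pi> \<in> column_stabilizer l t"
  shows "polytabloid l t (pact \<pi> T) = of_int (sign \<pi>) * polytabloid l t T"
proof -
  have p: "\<pi> permutes {..<sum_list l}" using C by (rule column_stabilizer_permutes)
  have bij: "bij_betw ((\<circ>) \<pi>) (column_stabilizer l t) (column_stabilizer l t)"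
  proof (rule bij_betwI[where g = "(\<circ>) (inv \<pi>)"])
    show "(\<circ>) \<pi> \<in> column_stabilizer l t \<rightarrow> column_stabilizer l t"
      using column_stabilizer_group(2)[OF t C] by auto
    show "(\<circ>) (inv \<pi>) \<in> column_stabilizer l t \<rightarrow> column_stabilizer l t"
      using column_stabilizer_group(2)[OF t column_stabilizer_group(3)[OF t C]] by auto
  qed (simp_all add: comp_assoc[symmetric] permutes_inv_o[OF p])
  have s: "sign (\<pi> \<circ> \<rho>) = sign \<pi> * sign \<rho>" if "\<rho> \<in> column_stabilizer l t" for \<rho>
    using p column_stabilizer_permutes[OF that] by (intro sign_compose) (auto simp: permutation_permutes)
  have "polytabloid l t (pact \<pi> T) = (\<Sum>\<rho>\<in>column_stabilizer l t.
     of_int (sign (\<pi> \<circ> \<rho>)) * (if tabloid l (\<pi> \<circ> \<rho> \<circ> t) = pact \<pi> T then 1 else 0))"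
    unfolding polytabloid_def by (rule sum.reindex_bij_betw[OF bij, symmetric])
  also have "\<dots> = of_int (sign \<pi>) * polytabloid l t T"
    unfolding polytabloid_def sum_distrib_left
  proof (intro sum.cong refl)
    fix \<rho> assume r: "\<rho> \<in> column_stabilizer l t"
    have "tabloid l (\<pi> \<circ> \<rho> \<circ> t) = pact \<pi> T \<longleftrightarrow> tabloid l (\<rho> \<circ> t) = T"
      unfolding comp_assoc tabloid_comp[of l \<pi>] using p by (metis pact_inv(1))
    then show "complex_of_int (sign (\<pi> \<circ> \<rho>)) * (if tabloid l (\<pi> \<circ> \<rho> \<circ> t) = pact \<pi> T then 1 else 0) =
      of_int (sign \<pi>) * (of_int (sign \<rho>) * (if tabloid l (\<rho> \<circ> t) = T then 1 else 0))"
      using s[OF r] by simp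
  qed
  finally show ?thesis .
qed

lemma polytabloid_self:
  assumes t: "t \<in> tableaux l"
  shows "polytabloid l t (tabloid l t) = 1"
proof -
  have "polytabloid l t (tabloid l t) = (\<Sum>\<pi>\<in>{id}. of_int (sign \<pi>) * (if tabloid l (\<pi> \<circ> t)
    = tabloid l t then 1 else 0))"
    unfolding polytabloid_def
    using column_stabilizer_tabloid_free[OF t] column_stabilizer_group(1)[OF t]
    by (intro sum.mono_neutral_right) (auto simp: tabloid_comp)
  then show ?thesis by (simp add: sign_id)
qed

lemma polytabloid_outside:
  assumes t: "t \<in> tableaux l" and T: "T \<notin> tabs l"
  shows "polytabloid l t T = 0"
proof -
  have "tabloid l (\<pi> \<circ> t) \<noteq> T" if "\<pi> \<in> column_stabilizer l t" for \<pi>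
    using tableaux_comp[OF t column_stabilizer_permutes[OF that]] T unfolding tabs_def by blast
  then show ?thesis by (simp add: polytabloid_def)
qed

text \<open>Two entries that share a row of \<open>t'\<close> and a column of \<open>t\<close> have
  a transposition that fixes the tabloid of \<open>t'\<close> but acts on \<open>z\<close> by -1, so
  the value equals its negative.\<close>

lemma alternating_nongood:
  fixes z :: "nat set list \<Rightarrow> complex"
  assumes t: "t \<in> tableaux l" and t': "t' \<in> tableaux l'"
    and k: "sum_list l = k" "sum_list l' = k"
    and z: "\<And>\<pi>. \<pi> \<in> column_stabilizer l t \<Longrightarrow> z (pact \<pi> (tabloid l' t')) = of_int (sign \<pi>) * z (tabloid l' t')"
    and n: "\<not> inj_on (\<lambda>a. (row_idx l' t' a, col_idx l t a)) {..<k}"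
  shows "z (tabloid l' t') = 0"
proof -
  obtain a b where ab: "a < k" "b < k" "a \<noteq> b" "row_idx l' t' a = row_idx l' t' b" "col_idx l t a = col_idx l t b"
    using n by (auto simp: inj_on_def)
  have "transpose a b \<in> column_stabilizer l t" using transpose_column_stabilizer[OF t] ab k by simp
  from z[OF this] have "z (tabloid l' t') = - z (tabloid l' t')"
    using pact_transpose_tabloid[OF t'] ab k by (simp add: sign_swap_id)
  then show ?thesis by simp
qed

text \<open>An index at which \<open>l'\<close> exceeds \<open>l\<close> excludes, by dominance,
  every tabloid that separates the columns of \<open>t\<close> by its rows; at all others an
  alternating function vanishes.\<close>

lemma alternating_zero:
  fixes z :: "nat set list \<Rightarrow> complex"
  assumes t: "t \<in> tableaux l" and p: "partition_list l" and k: "sum_list l = sum_list l'"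
    and z: "\<And>\<pi> x. \<pi> \<in> column_stabilizer l t \<Longrightarrow> x \<in> tabs l' \<Longrightarrow> z (pact \<pi> x) = of_int (sign \<pi>) * z x"
    and nd: "partial_sum l i < partial_sum l' i" and x: "x \<in> tabs l'"
  shows "z x = 0"
proof -
  obtain t' where t': "t' \<in> tableaux l'" "x = tabloid l' t'" using x by (auto simp: tabs_def)
  have "\<not> inj_on (\<lambda>a. (row_idx l' t' a, col_idx l t a)) {..<sum_list l}"
    using dominance(1)[OF t t'(1) p refl k[symmetric]] nd by (metis not_le)
  then show ?thesis using alternating_nongood[OF t t'(1) refl k[symmetric]] z x t'(2) by metis
qed

text \<open>The submodule theorem of James in terms of functions: the alternating functions form a
  line. The tabloids that separate the columns of \<open>t\<close> lie in one orbit of its column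
  stabilizer, the others carry 0, and the value 1 of the polytabloid at its own tabloid fixes the
  scalar.\<close>

lemma alternating_scalar:
  fixes z :: "nat set list \<Rightarrow> complex"
  assumes t: "t \<in> tableaux l" and p: "partition_list l"
    and z: "\<And>\<pi> x. \<pi> \<in> column_stabilizer l t \<Longrightarrow> x \<in> tabs l \<Longrightarrow> z (pact \<pi> x) = of_int (sign \<pi>) * z x"
    and x: "x \<in> tabs l"
  shows "z x = z (tabloid l t) * polytabloid l t x"
proof -
  obtain t' where t': "t' \<in> tableaux l" "x = tabloid l t'" using x by (auto simp: tabs_def)
  show ?thesis
  proof (cases "inj_on (\<lambda>a. (row_idx l t' a, col_idx l t a)) {..<sum_list l}")
    case True
    then obtain \<rho> where r: "\<rho> \<in> column_stabilizer l t" "x = pact \<rho> (tabloid l t)"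
      using column_orbit[OF t t'(1) p] t'(2) by blast
    have "tabloid l t \<in> tabs l" using t by (simp add: tabs_def)
    then show ?thesis using z[OF r(1)] polytabloid_alternating[OF t r(1)] polytabloid_self[OF t] r(2) by simp
  next
    case False
    have "z x = 0" using alternating_nongood[OF t t'(1) refl refl _ False] z x t'(2) by metis
    moreover have "polytabloid l t x = 0"
      using alternating_nongood[OF t t'(1) refl refl _ False] polytabloid_alternating[OF t] t'(2) by metis
    ultimately show ?thesis by simp
  qed
qed

section \<open>Projection kernels of Specht modules\<close>

definition base_tableau :: "nat list \<Rightarrow> nat \<times> nat \<Rightarrow> nat" where
  "base_tableau l = (SOME t. t \<in> tableaux l)"

definition base_ptab :: "nat list \<Rightarrow> nat set list \<Rightarrow> complex" where
  "base_ptab l = polytabloid l (base_tableau l)"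

definition gram :: "nat list \<Rightarrow> nat set list \<Rightarrow> nat set list \<Rightarrow> complex" where
  "gram l x y = (\<Sum>w\<in>Sym (sum_list l). base_ptab l (pact (inv w) x) * base_ptab l (pact (inv w) y))"

text \<open>The eigenvalue of \<open>gram l\<close> on the base polytabloid, read off at the base
  tabloid, where the polytabloid has the value 1.\<close>

definition kernel_norm :: "nat list \<Rightarrow> complex" where
  "kernel_norm l = (\<Sum>y\<in>tabs l. gram l (tabloid l (base_tableau l)) y * base_ptab l y)"

text \<open>The matrix, in the basis of tabloids, of the projection onto the Specht module: the Gram matrix of
  the orbit of a polytabloid, normalized to an idempotent.\<close>

definition skernel :: "nat list \<Rightarrow> nat set list \<Rightarrow> nat set list \<Rightarrow> complex" where
  "skernel l x y = gram l x y / kernel_norm l"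

text \<open>The trace of the projection, hence the dimension of the Specht module, kept as a complex
  number because it serves as a factor or divisor.\<close>

definition sdim :: "nat list \<Rightarrow> complex" where
  "sdim l = (\<Sum>x\<in>tabs l. skernel l x x)"

lemma base_tableau [simp]: "base_tableau l \<in> tableaux l"
  unfolding base_tableau_def using tableaux_nonempty by (rule someI_ex)

lemma finite_tabs [simp]: "finite (tabs l)"
proof -
  have "tabs l \<subseteq> (\<lambda>w. pact w (tabloid l (base_tableau l))) ` Sym (sum_list l)"
  proof
    fix T assume "T \<in> tabs l"
    then obtain t where t: "t \<in> tableaux l" "T = tabloid l t" by (auto simp: tabs_def)
    obtain w where w: "w permutes {..<sum_list l}" "\<And>c. c \<in> cells l \<Longrightarrow> t c = (w \<circ> base_tableau l) c"
      using tableaux_transitive[OF base_tableau t(1)] by blast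
    have "T = pact w (tabloid l (base_tableau l))" unfolding t(2) tabloid_comp[symmetric]
      by (rule tabloid_cong) (rule w(2))
    then show "T \<in> (\<lambda>w. pact w (tabloid l (base_tableau l))) ` Sym (sum_list l)" using w(1) by blast
  qed
  then show ?thesis by (rule finite_subset) simp
qed

lemma tabloid_base_tableau [simp]: "tabloid l (base_tableau l) \<in> tabs l"
  by (simp add: tabs_def)

lemma card_Sym: "card (Sym k) = fact k"
  by (simp add: card_permutations)

lemma inv_comp_permutes:
  assumes "u permutes S" "w permutes S" shows "inv (u \<circ> w) = inv w \<circ> inv u"
  using assms by (simp add: o_inv_distrib permutes_bij)

lemma sum_Sym_left:
  assumes "u permutes {..<k}" shows "(\<Sum>w\<in>Sym k. f (u \<circ> w)) = (\<Sum>w\<in>Sym k. f w)"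
proof (rule sum.reindex_bij_witness[of _ "\<lambda>w. inv u \<circ> w" "\<lambda>w. u \<circ> w"])
qed (use assms in \<open>auto simp: comp_assoc[symmetric] permutes_inv_o intro: permutes_compose permutes_inv\<close>)

lemma sum_Sym_inv: "(\<Sum>w\<in>Sym k. f (inv w)) = (\<Sum>w\<in>Sym k. f w)"
  by (rule sum.reindex_bij_witness[of _ inv inv]) (auto simp: permutes_inv permutes_inv_inv)

lemma sum_tabs_pact:
  assumes "w permutes {..<sum_list l}"
  shows "(\<Sum>y\<in>tabs l. f (pact w y)) = (\<Sum>y\<in>tabs l. f y)"
  by (rule sum.reindex_bij_witness[of _ "pact (inv w)" "pact w"])
     (use assms in \<open>auto simp: tabs_pact permutes_inv\<close>)

lemma base_ptab_outside: "x \<notin> tabs l \<Longrightarrow> base_ptab l x = 0"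
  by (simp add: base_ptab_def polytabloid_outside)

lemma gram_sym: "gram l x y = gram l y x"
  by (simp add: gram_def mult.commute)

lemma gram_outside: "x \<notin> tabs l \<Longrightarrow> gram l x y = 0"
  unfolding gram_def
  by (intro sum.neutral ballI) (simp add: base_ptab_outside tabs_pact_iff permutes_inv)

lemma gram_pact:
  assumes "w permutes {..<sum_list l}"
  shows "gram l (pact w x) (pact w y) = gram l x y"
proof -
  have "gram l (pact w x) (pact w y)
    = (\<Sum>v\<in>Sym (sum_list l). base_ptab l (pact (inv (w \<circ> v)) (pact w x)) * base_ptab l (pact (inv (w \<circ> v))
      (pact w y)))"
    unfolding gram_def by (rule sum_Sym_left[OF assms, symmetric])
  also have "\<dots> = gram l x y" unfolding gram_def
    by (intro sum.cong refl) (use assms in \<open>simp add: inv_comp_permutes pact_comp\<close>)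
  finally show ?thesis .
qed

lemma skernel_sym: "skernel l x y = skernel l y x"
  by (simp add: skernel_def gram_sym)

lemma skernel_pact: "w permutes {..<sum_list l} \<Longrightarrow> skernel l (pact w x) (pact w y) = skernel l x y"
  by (simp add: skernel_def gram_pact)

lemma skernel_pact_left:
  assumes "w permutes {..<sum_list l}" shows "skernel l (pact w x) y = skernel l x (pact (inv w) y)"
  using skernel_pact[OF assms, of x "pact (inv w) y"] assms by simp

lemma skernel_outside: "x \<notin> tabs l \<Longrightarrow> skernel l x y = 0" "y \<notin> tabs l \<Longrightarrow> skernel l x y = 0"
proof -
  show 1: "skernel l x y = 0" if "x \<notin> tabs l" for x y using that by (simp add: skernel_def gram_outside)
  show "y \<notin> tabs l \<Longrightarrow> skernel l x y = 0" using 1[of y x] skernel_sym[of l x y] by simp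
qed

text \<open>\<open>gram l\<close> commutes with the symmetric group, so it sends the base
  polytabloid to a function that is again alternating, and \<open>alternating_scalar\<close> makes
  this a multiple.\<close>

lemma gram_base_ptab:
  assumes p: "partition_list l"
  shows "(\<Sum>y\<in>tabs l. gram l x y * base_ptab l y) = kernel_norm l * base_ptab l x"
proof (cases "x \<in> tabs l")
  case True
  define z where "z x = (\<Sum>y\<in>tabs l. gram l x y * base_ptab l y)" for x
  have "z (pact \<pi> x) = of_int (sign \<pi>) * z x" if C: "\<pi> \<in> column_stabilizer l (base_tableau l)" for \<pi> x
  proof -
    have q: "\<pi> permutes {..<sum_list l}" using C by (rule column_stabilizer_permutes)
    have "z (pact \<pi> x) = (\<Sum>y\<in>tabs l. gram l (pact \<pi> x) (pact \<pi> y) * base_ptab l (pact \<pi> y))"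
      unfolding z_def by (rule sum_tabs_pact[OF q, symmetric])
    also have "\<dots> = of_int (sign \<pi>) * z x"
      unfolding z_def sum_distrib_left
      by (intro sum.cong refl) (simp add: gram_pact[OF q] base_ptab_def polytabloid_alternating[OF base_tableau C])
    finally show ?thesis .
  qed
  then show ?thesis using alternating_scalar[OF base_tableau p, of z x] True
    by (simp add: z_def kernel_norm_def base_ptab_def)
next
  case False then show ?thesis by (simp add: gram_outside base_ptab_outside)
qed

lemma base_ptab_int: "\<exists>i::int. base_ptab l x = of_int i"
proof -
  have "base_ptab l x = of_int (\<Sum>\<pi>\<in>column_stabilizer l (base_tableau l). sign \<pi>
    * (if tabloid l (\<pi> \<circ> base_tableau l) = x then 1 else 0))"
    unfolding base_ptab_def polytabloid_def by (simp add: of_int_sum if_distrib cong: if_cong)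
  then show ?thesis by blast
qed

text \<open>Pairing the base polytabloid with its image under \<open>gram l\<close> gives the sum of
  the squares of its inner products with all its translates. These are integers, so if the sum were
  0 then also the term at the identity, the square norm of a vector that has a coefficient
  1.\<close>

lemma kernel_norm_nonzero:
  assumes p: "partition_list l" shows "kernel_norm l \<noteq> 0"
proof
  assume k0: "kernel_norm l = 0"
  define S where "S w = (\<Sum>x\<in>tabs l. base_ptab l (pact (inv w) x) * base_ptab l x)" for w
  have "\<exists>f. \<forall>x. base_ptab l x = complex_of_int (f x)" using base_ptab_int by (intro choice) blast
  then obtain f where f: "\<And>x. base_ptab l x = complex_of_int (f x)" by blast
  define s where "s w = (\<Sum>x\<in>tabs l. f (pact (inv w) x) * f x)" for w
  have Ss: "S w = of_int (s w)" for w by (simp add: S_def s_def f)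
  have "0 = (\<Sum>x\<in>tabs l. base_ptab l x * (\<Sum>y\<in>tabs l. gram l x y * base_ptab l y))"
    by (simp add: gram_base_ptab[OF p] k0)
  also have "\<dots> = (\<Sum>x\<in>tabs l. \<Sum>y\<in>tabs l. \<Sum>w\<in>Sym (sum_list l).
      (base_ptab l (pact (inv w) x) * base_ptab l x) * (base_ptab l (pact (inv w) y) * base_ptab l y))"
    by (simp add: gram_def sum_distrib_left sum_distrib_right mult_ac)
  also have "\<dots> = (\<Sum>x\<in>tabs l. \<Sum>w\<in>Sym (sum_list l). \<Sum>y\<in>tabs l.
      (base_ptab l (pact (inv w) x) * base_ptab l x) * (base_ptab l (pact (inv w) y) * base_ptab l y))"
    by (intro sum.cong refl sum.swap)
  also have "\<dots> = (\<Sum>w\<in>Sym (sum_list l). \<Sum>x\<in>tabs l. \<Sum>y\<in>tabs l.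
      (base_ptab l (pact (inv w) x) * base_ptab l x) * (base_ptab l (pact (inv w) y) * base_ptab l y))"
    by (rule sum.swap)
  also have "\<dots> = (\<Sum>w\<in>Sym (sum_list l). S w * S w)"
    by (simp add: S_def sum_product)
  also have "\<dots> = of_int (\<Sum>w\<in>Sym (sum_list l). s w * s w)" by (simp add: Ss)
  finally have "(\<Sum>w\<in>Sym (sum_list l). s w * s w) = 0" by (metis of_int_0_eq_iff)
  then have "s id * s id = 0"
    by (subst (asm) sum_nonneg_eq_0_iff) (auto simp: permutes_id)
  then have "(\<Sum>x\<in>tabs l. f x * f x) = 0" by (simp add: s_def)
  then have "f (tabloid l (base_tableau l)) * f (tabloid l (base_tableau l)) = 0"
    by (subst (asm) sum_nonneg_eq_0_iff) auto
  then have "base_ptab l (tabloid l (base_tableau l)) = 0" using f by simp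
  then show False by (simp add: base_ptab_def polytabloid_self)
qed

lemma skernel_base_ptab:
  assumes p: "partition_list l" and w: "w permutes {..<sum_list l}"
  shows "(\<Sum>y\<in>tabs l. skernel l x y * base_ptab l (pact (inv w) y)) = base_ptab l (pact (inv w) x)"
proof -
  have "(\<Sum>y\<in>tabs l. skernel l x y * base_ptab l (pact (inv w) y))
    = (\<Sum>y\<in>tabs l. skernel l x (pact w y) * base_ptab l y)"
    using sum_tabs_pact[OF w, of "\<lambda>y. skernel l x y * base_ptab l (pact (inv w) y)"] w by simp
  also have "\<dots> = (\<Sum>y\<in>tabs l. gram l (pact (inv w) x) y * base_ptab l y) / kernel_norm l"
  proof -
    have *: "skernel l x (pact w y) = skernel l (pact (inv w) x) y" for y
      using skernel_pact_left[OF permutes_inv[OF w], of x y] w by (simp add: permutes_inv_inv)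
    show ?thesis unfolding sum_divide_distrib * by (simp add: skernel_def)
  qed
  also have "\<dots> = base_ptab l (pact (inv w) x)" using gram_base_ptab[OF p] kernel_norm_nonzero[OF p] by simp
  finally show ?thesis .
qed

lemma skernel_expand: "skernel l x y
  = (\<Sum>w\<in>Sym (sum_list l). base_ptab l (pact (inv w) x) * base_ptab l (pact (inv w) y)) / kernel_norm l"
  by (simp add: skernel_def gram_def)

lemma skernel_idem:
  assumes p: "partition_list l"
  shows "(\<Sum>y\<in>tabs l. skernel l x y * skernel l y z) = skernel l x z"
proof -
  have "(\<Sum>y\<in>tabs l. skernel l x y * skernel l y z) =
     (\<Sum>y\<in>tabs l. \<Sum>w\<in>Sym (sum_list l). skernel l x y * base_ptab l (pact (inv w) y) * base_ptab l
       (pact (inv w) z) / kernel_norm l)"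
    unfolding skernel_expand[of l _ z] by (simp add: sum_distrib_left sum_divide_distrib mult.assoc)
  also have "\<dots> = (\<Sum>w\<in>Sym (sum_list l). (\<Sum>y\<in>tabs l. skernel l x y * base_ptab l (pact (inv w) y))
    * base_ptab l (pact (inv w) z) / kernel_norm l)"
    by (subst sum.swap) (simp add: sum_distrib_right sum_divide_distrib)
  also have "\<dots> = skernel l x z"
    unfolding skernel_expand[of l x z] sum_divide_distrib by (intro sum.cong refl) (simp add: skernel_base_ptab[OF p])
  finally show ?thesis .
qed

text \<open>Multiplied by \<open>kernel_norm l\<close>, the trace is the order of the group times
  the square norm of an integral vector.\<close>

lemma sdim_nonzero:
  assumes p: "partition_list l" shows "sdim l \<noteq> 0"
proof
  assume 0: "sdim l = 0"
  define N where "N = (\<Sum>x\<in>tabs l. base_ptab l x * base_ptab l x)"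
  have "sdim l = (\<Sum>w\<in>Sym (sum_list l). (\<Sum>x\<in>tabs l. base_ptab l (pact (inv w) x)
    * base_ptab l (pact (inv w) x))) / kernel_norm l"
    unfolding sdim_def skernel_expand sum_divide_distrib[symmetric] by (subst sum.swap) (rule refl)
  also have "\<dots> = (\<Sum>w\<in>Sym (sum_list l). N) / kernel_norm l"
    by (intro arg_cong[of _ _ "\<lambda>x. x / kernel_norm l"] sum.cong refl)
       (simp add: N_def sum_tabs_pact[of _ l "\<lambda>x. base_ptab l x * base_ptab l x"] permutes_inv)
  finally have "N = 0" using 0 kernel_norm_nonzero[OF p] by (simp add: card_Sym)
  moreover have "\<exists>f. \<forall>x. base_ptab l x = complex_of_int (f x)" using base_ptab_int by (intro choice) blast
  then obtain f where f: "\<And>x. base_ptab l x = complex_of_int (f x)" by blast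
  ultimately have "(of_int (\<Sum>x\<in>tabs l. f x * f x) :: complex) = 0" by (simp add: N_def f)
  then have "(\<Sum>x\<in>tabs l. f x * f x) = 0" by (metis of_int_0_eq_iff)
  then have "f (tabloid l (base_tableau l)) * f (tabloid l (base_tableau l)) = 0"
    by (subst (asm) sum_nonneg_eq_0_iff) auto
  then have "base_ptab l (tabloid l (base_tableau l)) = 0" using f by simp
  then show False by (simp add: base_ptab_def polytabloid_self)
qed

section \<open>Specht modules as images of the projection kernels\<close>

lemma cfun_vector_space: "vector_space cscale"
  by unfold_locales (auto simp: cscale_def fun_eq_iff algebra_simps)

interpretation cfun: vector_space cscale by (rule cfun_vector_space)

lemma sum_fun_apply: "(\<Sum>i\<in>A. f i) x = (\<Sum>i\<in>A. f i x)"
  by (induction A rule: infinite_finite_induct) auto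

lemma skernel_in_specht:
  assumes y: "y \<in> tabs l"
  shows "(\<lambda>x. skernel l x y) \<in> specht l"
proof -
  have "(\<lambda>x. skernel l x y)
    = (\<Sum>w\<in>Sym (sum_list l). cscale (base_ptab l (pact (inv w) y) / kernel_norm l)
      (polytabloid l (w \<circ> base_tableau l)))"
    by (rule ext) (simp add: sum_fun_apply cscale_def skernel_expand polytabloid_comp base_ptab_def
      sum_divide_distrib mult.commute)
  also have "\<dots> \<in> specht l" unfolding specht_def
    by (intro cfun.span_sum cfun.span_scale cfun.span_base imageI tableaux_comp) auto
  finally show ?thesis .
qed

text \<open>The kernel fixes every polytabloid, and its columns lie in the Specht module. Membership
  thereby becomes a linear equation with an explicit kernel, the form in which Specht modules are
  used from here on.\<close>

lemma specht_iff:
  assumes p: "partition_list l"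
  shows "f \<in> specht l \<longleftrightarrow> (\<forall>x. f x = (\<Sum>y\<in>tabs l. skernel l x y * f y))"
proof
  assume "f \<in> specht l"
  then show "\<forall>x. f x = (\<Sum>y\<in>tabs l. skernel l x y * f y)" unfolding specht_def
  proof (induction rule: cfun.span_induct_alt)
    case base then show ?case by simp
  next
    case (step c f g)
    then obtain t where t: "t \<in> tableaux l" "f = polytabloid l t" by blast
    obtain w where w: "w permutes {..<sum_list l}" "\<And>c. c \<in> cells l \<Longrightarrow> t c = (w \<circ> base_tableau l) c"
      using tableaux_transitive[OF base_tableau t(1)] by blast
    have "f = polytabloid l (w \<circ> base_tableau l)" unfolding t(2) by (rule polytabloid_cong) (rule w(2))
    then have f: "f x = base_ptab l (pact (inv w) x)"
      for x by (simp add: polytabloid_comp[OF base_tableau w(1)] base_ptab_def)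
    show ?case
    proof
      fix x
      have "(\<Sum>y\<in>tabs l. skernel l x y * (cscale c f + g) y)
        = c * (\<Sum>y\<in>tabs l. skernel l x y * f y) + (\<Sum>y\<in>tabs l. skernel l x y * g y)"
        by (simp add: cscale_def sum.distrib sum_distrib_left algebra_simps)
      then show "(cscale c f + g) x = (\<Sum>y\<in>tabs l. skernel l x y * (cscale c f + g) y)"
        by (simp only: step.IH[rule_format, of x, symmetric] f skernel_base_ptab[OF p w(1)] plus_fun_apply cscale_def)
    qed
  qed
next
  assume *: "\<forall>x. f x = (\<Sum>y\<in>tabs l. skernel l x y * f y)"
  have "f = (\<Sum>y\<in>tabs l. cscale (f y) (\<lambda>x. skernel l x y))"
    by (rule ext) (subst *[rule_format], simp add: sum_fun_apply cscale_def mult.commute)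
  also have "\<dots> \<in> specht l" using skernel_in_specht unfolding specht_def
    by (intro cfun.span_sum cfun.span_scale) auto
  finally show "f \<in> specht l" .
qed

section \<open>Schur orthogonality\<close>

text \<open>The second argument of \<open>K\<close> passes through the projection, which is a sum
  over translates of the base polytabloid. Equivariance moves the translation to the first argument,
  so that \<open>K\<close> is determined by its pairing with \<open>base_ptab m\<close>.\<close>

lemma equivariant_expand:
  assumes p: "partition_list m" and k: "sum_list l = sum_list m"
    and eq: "\<And>u x y. u permutes {..<sum_list m} \<Longrightarrow> K (pact u x) (pact u y) = K x y"
    and KE: "\<And>y. K x y = (\<Sum>y'\<in>tabs m. K x y' * skernel m y' y)"
  shows "K x y = (\<Sum>w\<in>Sym (sum_list m). (\<Sum>y'\<in>tabs m. K (pact (inv w) x) y' * base_ptab m y')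
    * base_ptab m (pact (inv w) y)) / kernel_norm m"
proof -
  have "K x y = (\<Sum>y'\<in>tabs m. \<Sum>w\<in>Sym (sum_list m). K x y' * base_ptab m (pact (inv w) y')
    * base_ptab m (pact (inv w) y) / kernel_norm m)"
    by (subst KE) (simp add: skernel_expand sum_distrib_left sum_divide_distrib mult.assoc)
  also have "\<dots> = (\<Sum>w\<in>Sym (sum_list m). (\<Sum>y'\<in>tabs m. K x y' * base_ptab m (pact (inv w) y'))
    * base_ptab m (pact (inv w) y)) / kernel_norm m"
    by (subst sum.swap) (simp add: sum_distrib_right sum_divide_distrib)
  also have "(\<Sum>w\<in>Sym (sum_list m). (\<Sum>y'\<in>tabs m. K x y' * base_ptab m (pact (inv w) y'))
    * base_ptab m (pact (inv w) y)) =
     (\<Sum>w\<in>Sym (sum_list m). (\<Sum>y'\<in>tabs m. K (pact (inv w) x) y' * base_ptab m y') * base_ptab m (pact (inv w) y))"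
  proof (rule sum.cong[OF refl])
    fix w assume "w \<in> Sym (sum_list m)"
    then have w: "w permutes {..<sum_list m}" by simp
    have "(\<Sum>y'\<in>tabs m. K x y' * base_ptab m (pact (inv w) y')) = (\<Sum>y'\<in>tabs m. K x (pact w y') * base_ptab m y')"
      using sum_tabs_pact[OF w, of "\<lambda>y. K x y * base_ptab m (pact (inv w) y)"] w by simp
    also have "\<dots> = (\<Sum>y'\<in>tabs m. K (pact (inv w) x) y' * base_ptab m y')"
      using eq[OF w, of "pact (inv w) x"] w by simp
    finally show "(\<Sum>y'\<in>tabs m. K x y' * base_ptab m (pact (inv w) y')) * base_ptab m (pact (inv w) y) =
      (\<Sum>y'\<in>tabs m. K (pact (inv w) x) y' * base_ptab m y') * base_ptab m (pact (inv w) y)" by simp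
  qed
  finally show ?thesis .
qed

lemma equivariant_alternating:
  assumes eq: "\<And>u x y. u permutes {..<sum_list m} \<Longrightarrow> K (pact u x) (pact u y) = K x y"
    and C: "\<pi> \<in> column_stabilizer m (base_tableau m)"
  shows "(\<Sum>y'\<in>tabs m. K (pact \<pi> x) y' * base_ptab m y') = of_int (sign \<pi>) * (\<Sum>y'\<in>tabs m. K x y' * base_ptab m y')"
proof -
  have q: "\<pi> permutes {..<sum_list m}" using C by (rule column_stabilizer_permutes)
  have "(\<Sum>y'\<in>tabs m. K (pact \<pi> x) y' * base_ptab m y')
    = (\<Sum>y\<in>tabs m. K (pact \<pi> x) (pact \<pi> y) * base_ptab m (pact \<pi> y))"
    by (rule sum_tabs_pact[OF q, symmetric])
  also have "\<dots> = of_int (sign \<pi>) * (\<Sum>y'\<in>tabs m. K x y' * base_ptab m y')"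
    unfolding sum_distrib_left
    by (intro sum.cong refl) (simp add: eq[OF q] base_ptab_def polytabloid_alternating[OF base_tableau C])
  finally show ?thesis .
qed

text \<open>The pairing of \<open>K\<close> with the base polytabloid of \<open>m\<close> is an
  alternating function on tabloids of shape \<open>l\<close>, and this is 0 when \<open>m\<close>
  fails to dominate \<open>l\<close>.\<close>

lemma schur_zero:
  assumes p: "partition_list m" and k: "sum_list l = sum_list m"
    and eq: "\<And>u x y. u permutes {..<sum_list m} \<Longrightarrow> K (pact u x) (pact u y) = K x y"
    and KE: "\<And>x y. K x y = (\<Sum>y'\<in>tabs m. K x y' * skernel m y' y)"
    and nd: "partial_sum m i < partial_sum l i" and x: "x \<in> tabs l"
  shows "K x y = 0"
proof -
  have "(\<Sum>y'\<in>tabs m. K x y' * base_ptab m y') = 0" if "x \<in> tabs l" for x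
    by (rule alternating_zero[OF base_tableau[of m] p k[symmetric] _ nd that, of
      "\<lambda>x. \<Sum>y'\<in>tabs m. K x y' * base_ptab m y'"])
       (rule equivariant_alternating[where K = K, OF eq])
  then have "(\<Sum>y'\<in>tabs m. K (pact (inv w) x) y' * base_ptab m y') = 0" if "w \<in> Sym (sum_list m)" for w
    using tabs_pact[OF x, of "inv w"] that k by (simp add: permutes_inv)
  then show ?thesis by (subst equivariant_expand[OF p k eq KE]) simp_all
qed

text \<open>For equal shapes the pairing lies on the line of the base polytabloid; its coefficient
  is the scalar of Schur's lemma.\<close>

lemma schur_scalar:
  assumes p: "partition_list m"
    and eq: "\<And>u x y. u permutes {..<sum_list m} \<Longrightarrow> K (pact u x) (pact u y) = K x y"
    and KE: "\<And>x y. K x y = (\<Sum>y'\<in>tabs m. K x y' * skernel m y' y)"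
    and x: "x \<in> tabs m"
  shows "K x y = (\<Sum>y'\<in>tabs m. K (tabloid m (base_tableau m)) y' * base_ptab m y') * skernel m x y"
proof -
  define c where "c = (\<Sum>y'\<in>tabs m. K (tabloid m (base_tableau m)) y' * base_ptab m y')"
  have "(\<Sum>y'\<in>tabs m. K x y' * base_ptab m y') = c * base_ptab m x" if "x \<in> tabs m" for x
    unfolding c_def base_ptab_def[of m, symmetric]
    using alternating_scalar[OF base_tableau[of m] p _ that, of "\<lambda>x. \<Sum>y'\<in>tabs m. K x y' * base_ptab m y'"]
      equivariant_alternating[of m K, OF eq] by (simp add: base_ptab_def)
  then have *: "(\<Sum>y'\<in>tabs m. K (pact (inv w) x) y' * base_ptab m y') = c * base_ptab m (pact (inv w) x)"
    if "w \<in> Sym (sum_list m)" for w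
    using tabs_pact[OF x, of "inv w"] that by (simp add: permutes_inv)
  have "K x y = (\<Sum>w\<in>Sym (sum_list m). c * base_ptab m (pact (inv w) x)
    * base_ptab m (pact (inv w) y)) / kernel_norm m"
    by (subst equivariant_expand[OF p refl eq KE]) (simp_all add: *)
  then show ?thesis by (simp add: c_def[symmetric] skernel_expand sum_distrib_left mult.assoc)
qed

text \<open>The averaged product is an equivariant kernel that passes through the projections on
  both sides, so that \<open>schur_scalar\<close> or \<open>schur_zero\<close> applies.\<close>

theorem skernel_orthogonality:
  assumes pl: "partition_list l" and pm: "partition_list m"
    and k: "sum_list l = k" "sum_list m = k"
  shows "(\<Sum>w\<in>Sym k. skernel l x (pact w a) * skernel m (pact w b) y) =
    (if l = m then of_nat (card (Sym k)) / sdim l * skernel l a b * skernel l x y else 0)"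
proof -
  define K where "K x y = (\<Sum>w\<in>Sym k. skernel l x (pact w a) * skernel m (pact w b) y)" for x y
  have K_eq: "K (pact u x) (pact u y) = K x y" if u: "u permutes {..<k}" for u x y
  proof -
    have "K (pact u x) (pact u y)
      = (\<Sum>w\<in>Sym k. skernel l (pact u x) (pact (u \<circ> w) a) * skernel m (pact (u \<circ> w) b) (pact u y))"
      unfolding K_def by (rule sum_Sym_left[OF u, symmetric])
    also have "\<dots> = K x y" unfolding K_def using u k by (simp add: pact_comp skernel_pact)
    finally show ?thesis .
  qed
  have KE: "K x y = (\<Sum>y'\<in>tabs m. K x y' * skernel m y' y)" for x y
  proof -
    have "(\<Sum>y'\<in>tabs m. K x y' * skernel m y' y)
      = (\<Sum>w\<in>Sym k. skernel l x (pact w a) * (\<Sum>y'\<in>tabs m. skernel m (pact w b) y' * skernel m y' y))"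
      unfolding K_def sum_distrib_left sum_distrib_right by (subst sum.swap) (simp add: mult.assoc)
    then show ?thesis by (simp add: K_def skernel_idem[OF pm])
  qed
  have EK: "K x y = (\<Sum>x'\<in>tabs l. K x' y * skernel l x' x)" for x y
  proof -
    have "(\<Sum>x'\<in>tabs l. K x' y * skernel l x' x)
      = (\<Sum>w\<in>Sym k. (\<Sum>x'\<in>tabs l. skernel l x x' * skernel l x' (pact w a)) * skernel m (pact w b) y)"
      unfolding K_def sum_distrib_left sum_distrib_right by (subst sum.swap) (simp add: mult_ac skernel_sym[of l x])
    then show ?thesis by (simp add: K_def skernel_idem[OF pl])
  qed
  show ?thesis
  proof (cases "l = m")
    case True
    define c where "c = (\<Sum>y'\<in>tabs m. K (tabloid m (base_tableau m)) y' * base_ptab m y')"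
    have c: "K x y = c * skernel l x y" for x y
    proof (cases "x \<in> tabs m")
      case t: True
      show ?thesis using schur_scalar[of m K, OF pm _ KE t] K_eq k True by (simp add: c_def)
    next
      case False then show ?thesis using True by (simp add: K_def skernel_outside)
    qed
    \<comment> \<open>The scalar is found by taking traces: by idempotence and equivariance every
      group element contributes the same value.\<close>
    have "c * sdim l = (\<Sum>x\<in>tabs l. K x x)" by (simp add: c sdim_def sum_distrib_left)
    also have "\<dots> = (\<Sum>w\<in>Sym k. \<Sum>x\<in>tabs l. skernel l (pact w b) x * skernel l x (pact w a))"
      unfolding K_def by (subst sum.swap) (simp add: True mult.commute)
    also have "\<dots> = of_nat (card (Sym k)) * skernel l a b" using k
      by (simp add: skernel_idem[OF pl] skernel_pact skernel_sym[of l b])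
    finally have "c = of_nat (card (Sym k)) / sdim l * skernel l a b" using sdim_nonzero[OF pl]
      by (simp add: field_simps)
    then show ?thesis using True c K_def by simp
  next
    case False
    then obtain i where i: "partial_sum l i \<noteq> partial_sum m i" using dominance_antisym[OF pl pm] by blast
    have "K x y = 0"
    proof (cases "partial_sum m i < partial_sum l i")
      case True
      show ?thesis
      proof (cases "x \<in> tabs l")
        case t: True
        show ?thesis using schur_zero[OF pm, of l K, OF _ _ KE True t] K_eq k by simp
      next
        case False then show ?thesis by (simp add: K_def skernel_outside)
      qed
    next
      case False
      \<comment> \<open>Dominance is a partial order, and only one index with different partial sums
        is at hand; for the reverse inequality the transposed kernel is used.\<close>
      then have lt: "partial_sum l i < partial_sum m i" using i by simp
      show ?thesis
      proof (cases "y \<in> tabs m")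
        case t: True
        show ?thesis using schur_zero[OF pl, of m "\<lambda>y x. K x y", OF _ _ EK lt t] K_eq k by simp
      next
        case False then show ?thesis by (simp add: K_def skernel_outside)
      qed
    qed
    then show ?thesis using False by (simp add: K_def)
  qed
qed

section \<open>Completeness of the Specht characters\<close>

definition parts :: "nat \<Rightarrow> nat list set" where
  "parts k = {l. partition_list l \<and> sum_list l = k}"

text \<open>The character of the Specht module: the trace of \<open>w\<close> composed with the
  projection.\<close>

definition schar :: "nat list \<Rightarrow> (nat \<Rightarrow> nat) \<Rightarrow> complex" where
  "schar l w = (\<Sum>x\<in>tabs l. skernel l x (pact w x))"

text \<open>Expresses that \<open>w\<close> has cycle type \<open>l\<close>: it turns the rows of a
  tableau of shape \<open>l\<close> cyclically.\<close>

definition row_cycles :: "nat list \<Rightarrow> (nat \<Rightarrow> nat) \<Rightarrow> bool" where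
  "row_cycles l w \<longleftrightarrow> (\<exists>t\<in>tableaux l. \<forall>i j. (i, j) \<in> cells l \<longrightarrow> w (t (i, j)) = t (i, Suc j mod (l ! i)))"

lemma finite_parts [simp]: "finite (parts k)"
proof (rule finite_subset)
  have "length l \<le> sum_list l" if "0 \<notin> set l" for l :: "nat list"
    using that by (induction l) auto
  then show "parts k \<subseteq> {l. set l \<subseteq> {..k} \<and> length l \<le> k}"
    by (auto simp: parts_def partition_list_def member_le_sum_list)
  show "finite {l. set l \<subseteq> {..k} \<and> length l \<le> k}" by (rule finite_lists_length_le) simp
qed

lemma schar_id: "schar l id = sdim l"
  by (simp add: schar_def sdim_def)

lemma schar_conj:
  assumes u: "u permutes {..<sum_list l}" and w: "w permutes {..<sum_list l}"
  shows "schar l (u \<circ> w \<circ> inv u) = schar l w"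
proof -
  have "schar l (u \<circ> w \<circ> inv u) = (\<Sum>x\<in>tabs l. skernel l (pact u x) (pact (u \<circ> w \<circ> inv u) (pact u x)))"
    unfolding schar_def by (rule sum_tabs_pact[OF u, symmetric])
  also have "\<dots> = schar l w" unfolding schar_def using u by (simp add: pact_comp skernel_pact)
  finally show ?thesis .
qed

text \<open>The orthogonality of the kernels, taken at diagonal entries. The product carries no
  conjugation because \<open>skernel\<close> is symmetric.\<close>

lemma schar_orthogonality:
  assumes "l \<in> parts k" "m \<in> parts k"
  shows "(\<Sum>w\<in>Sym k. schar l w * schar m w) = (if l = m then fact k else 0)"
proof -
  have p: "partition_list l" "partition_list m" "sum_list l = k" "sum_list m = k"
    using assms by (auto simp: parts_def)
  have "(\<Sum>w\<in>Sym k. schar l w * schar m w) =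
     (\<Sum>w\<in>Sym k. \<Sum>x\<in>tabs l. \<Sum>y\<in>tabs m. skernel l x (pact w x) * skernel m (pact w y) y)"
    by (simp add: schar_def sum_product skernel_sym[of m])
  also have "\<dots> = (\<Sum>x\<in>tabs l. \<Sum>w\<in>Sym k. \<Sum>y\<in>tabs m. skernel l x (pact w x) * skernel m (pact w y) y)"
    by (rule sum.swap)
  also have "\<dots> = (\<Sum>x\<in>tabs l. \<Sum>y\<in>tabs m. \<Sum>w\<in>Sym k. skernel l x (pact w x) * skernel m (pact w y) y)"
    by (intro sum.cong refl sum.swap)
  also have "\<dots> = (\<Sum>x\<in>tabs l. \<Sum>y\<in>tabs m. if l = m then fact k / sdim l * (skernel l x y * skernel l y x) else 0)"
    unfolding skernel_orthogonality[OF p] card_Sym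
    by (intro sum.cong refl) (auto simp: skernel_sym[of m])
  also have "\<dots> = (if l = m then fact k else 0)"
  proof (cases "l = m")
    case True
    have "(\<Sum>x\<in>tabs l. \<Sum>y\<in>tabs l. skernel l x y * skernel l y x) = sdim l"
      using p by (simp add: skernel_idem sdim_def)
    moreover have "(\<Sum>x\<in>tabs l. \<Sum>y\<in>tabs l. fact k / sdim l * (skernel l x y * skernel l y x)) =
        fact k / sdim l * (\<Sum>x\<in>tabs l. \<Sum>y\<in>tabs l. skernel l x y * skernel l y x)"
      by (simp only: sum_distrib_left)
    ultimately show ?thesis using True sdim_nonzero[OF p(1)] by simp
  qed simp
  finally show ?thesis .
qed

section \<open>Cycle types and the square character table\<close>

lemma cycle_lists_exist:
  fixes w :: "nat \<Rightarrow> nat"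
  assumes "finite S" "w permutes S"
  shows "\<exists>cs. distinct (concat cs) \<and> set (concat cs) = S \<and> [] \<notin> set cs \<and>
    (\<forall>c\<in>set cs. \<forall>j<length c. w (c ! j) = c ! (Suc j mod length c))"
  using assms
proof (induction "card S" arbitrary: S w rule: less_induct)
  case less
  show ?case
  proof (cases "S = {}")
    case True then show ?thesis by (intro exI[of _ "[]"]) simp
  next
    case False
    then obtain a where a: "a \<in> S" by blast
    have perm: "permutation w" using less.prems by (auto simp: permutation_permutes)
    define c where "c = support w a"
    have dc: "distinct c" unfolding c_def using cycle_of_permutation[OF perm] .
    have lp: "(w ^^ least_power w a) a = a" "least_power w a > 0"
      using least_power_of_permutation[OF perm] by auto
    have lc: "length c = least_power w a" by (simp add: c_def)
    have wc: "w (c ! j) = c ! (Suc j mod length c)" if "j < length c" for j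
    proof (cases "Suc j = length c")
      case True
      have "w (c ! j) = (w ^^ Suc j) a" using that by (simp add: c_def)
      then show ?thesis using True lp lc by (simp add: c_def)
    next
      case False then show ?thesis using that by (simp add: c_def)
    qed
    have inj: "inj w" using less.prems(2) permutes_inj by blast
    have img: "w ` set c = set c"
    proof -
      have "w ` set c \<subseteq> set c"
      proof
        fix y assume "y \<in> w ` set c"
        then obtain j where "j < length c" "y = w (c ! j)" by (auto simp: in_set_conv_nth)
        then show "y \<in> set c" using wc lp(2) lc by simp
      qed
      then show ?thesis using endo_inj_surj[of "set c" w] inj by (simp add: inj_on_subset)
    qed
    have cS: "set c \<subseteq> S"
    proof -
      have "(w ^^ i) a \<in> S" for i using a permutes_in_image[OF less.prems(2)] by (induction i) auto
      then show ?thesis by (auto simp: c_def)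
    qed
    have ac: "a \<in> set c" using lp(2) by (auto simp: c_def intro!: image_eqI[of _ _ 0])
    define w' where "w' x = (if x \<in> set c then x else w x)" for x
    have w': "w' permutes (S - set c)"
    proof (rule bij_imp_permutes)
      have "w' ` (S - set c) \<subseteq> S - set c"
      proof
        fix y assume "y \<in> w' ` (S - set c)"
        then obtain x where x: "x \<in> S" "x \<notin> set c" "y = w x" by (auto simp: w'_def)
        have "y \<notin> set c" using img x inj by (metis image_iff injD)
        then show "y \<in> S - set c" using x permutes_in_image[OF less.prems(2)] by simp
      qed
      moreover have i: "inj_on w' (S - set c)" using inj by (auto simp: w'_def inj_on_def dest: injD)
      ultimately show "bij_betw w' (S - set c) (S - set c)"
        using endo_inj_surj[of "S - set c" w'] less.prems(1) by (simp add: bij_betw_def)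
      show "w' x = x" if "x \<notin> S - set c" for x using that less.prems(2) by (auto simp: w'_def permutes_def)
    qed
    have "card (S - set c) < card S" using a ac less.prems(1) by (intro psubset_card_mono) auto
    from less.hyps[OF this _ w'] less.prems(1) obtain cs
      where cs: "distinct (concat cs)" "set (concat cs) = S - set c"
      "[] \<notin> set cs" "\<forall>d\<in>set cs. \<forall>j<length d. w' (d ! j) = d ! (Suc j mod length d)" by auto
    have tensor_dim: "d ! j \<notin> set c" if "d \<in> set cs" "j < length d" for d j
      using cs(2) that nth_mem by fastforce
    have "\<forall>d\<in>set cs. \<forall>j<length d. w (d ! j) = d ! (Suc j mod length d)"
      using cs(4) tensor_dim by (simp add: w'_def)
    moreover have "[] \<noteq> c" using ac by auto
    ultimately show ?thesis using dc cs cS wc by (intro exI[of _ "c # cs"]) auto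
  qed
qed

lemma row_cycles_exists:
  assumes "w permutes {..<k}"
  shows "\<exists>l\<in>parts k. row_cycles l w"
proof -
  obtain cs0 where cs0: "distinct (concat cs0)" "set (concat cs0) = {..<k}" "[] \<notin> set cs0"
    "\<forall>c\<in>set cs0. \<forall>j<length c. w (c ! j) = c ! (Suc j mod length c)"
    using cycle_lists_exist[OF finite_lessThan assms] by blast
  \<comment> \<open>Decreasing order of the lengths turns the list of cycle lengths into a
    partition.\<close>
  define cs where "cs = rev (sort_key length cs0)"
  have ms: "mset cs = mset cs0" by (simp add: cs_def)
  then have st: "set cs = set cs0" by (metis set_mset_mset)
  have mc: "mset (concat cs) = mset (concat cs0)"
    unfolding mset_concat by (metis ms mset_map sum_mset_sum_list)
  have dist: "distinct (concat cs)" using mset_eq_imp_distinct_iff[OF mc] cs0(1) by blast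
  have setc: "set (concat cs) = {..<k}" using mset_eq_setD[OF mc] cs0(2) by simp
  define l where "l = map length cs"
  define t where "t = (\<lambda>(i, j). cs ! i ! j)"
  have sl: "sum_list l = k"
    using distinct_card[OF dist] setc by (simp add: l_def length_concat)
  have part: "partition_list l"
  proof -
    have "sorted (map length (sort_key length cs0))" by simp
    then have "sorted_wrt (\<ge>) l" unfolding l_def cs_def rev_map[symmetric]
      by (simp add: sorted_wrt_rev)
    moreover have "0 \<notin> set l" using cs0(3) st by (auto simp: l_def)
    ultimately show ?thesis by (simp add: partition_list_def)
  qed
  have dcs: "distinct cs" using dist cs0(3) st by (simp add: distinct_concat_iff)
  have "bij_betw t (cells l) {..<sum_list l}" unfolding bij_betw_def
  proof
    show "inj_on t (cells l)"
    proof (rule inj_onI)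
      fix x y assume "x \<in> cells l" "y \<in> cells l" "t x = t y"
      then obtain i j i' j' where e: "x = (i, j)" "y = (i', j')" "i < length cs" "j < length (cs ! i)"
         "i' < length cs" "j' < length (cs ! i')" "cs ! i ! j = cs ! i' ! j'"
        by (auto simp: cells_def l_def t_def)
      have "cs ! i ! j \<in> set (cs ! i) \<inter> set (cs ! i')" using e by (metis IntI nth_mem)
      then have "set (cs ! i) \<inter> set (cs ! i') \<noteq> {}" by blast
      then have "cs ! i = cs ! i'" using dist e nth_mem unfolding distinct_concat_iff by blast
      then have "i = i'" using dcs e by (simp add: nth_eq_iff_index_eq)
      moreover have "distinct (cs ! i)" using dist e(3) nth_mem unfolding distinct_concat_iff by blast
      ultimately show "x = y" using e by (simp add: nth_eq_iff_index_eq)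
    qed
    have "t ` cells l = set (concat cs)"
    proof (intro Set.set_eqI iffI)
      fix a assume "a \<in> set (concat cs)"
      then obtain c where "c \<in> set cs" "a \<in> set c" by auto
      then obtain i j where "i < length cs" "j < length (cs ! i)" "a = cs ! i ! j"
        by (metis in_set_conv_nth)
      then show "a \<in> t ` cells l" by (intro image_eqI[of _ _ "(i, j)"]) (auto simp: t_def cells_def l_def)
    next
      fix a assume "a \<in> t ` cells l"
      then obtain i j where "i < length cs" "j < length (cs ! i)" "a = cs ! i ! j"
        by (auto simp: t_def cells_def l_def)
      then have "cs ! i \<in> set cs" "a \<in> set (cs ! i)" by auto
      then show "a \<in> set (concat cs)" by auto
    qed
    then show "t ` cells l = {..<sum_list l}" using setc sl by simp
  qed
  then have t: "t \<in> tableaux l" by (simp add: tableaux_def)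
  have "w (t (i, j)) = t (i, Suc j mod (l ! i))" if "(i, j) \<in> cells l" for i j
  proof -
    have ij: "i < length cs" "j < length (cs ! i)" using that by (auto simp: l_def cells_def)
    then have "cs ! i \<in> set cs0" using st nth_mem by blast
    then show ?thesis using cs0(4) ij by (simp add: t_def l_def)
  qed
  then have "row_cycles l w" using t unfolding row_cycles_def by blast
  then show ?thesis using part sl by (auto simp: parts_def)
qed

text \<open>The permutation that carries one tableau to the other conjugates one rotation of the
  rows into the other.\<close>

lemma row_cycles_conj:
  assumes "row_cycles l v" "row_cycles l w" "v permutes {..<sum_list l}" "w permutes {..<sum_list l}"
  shows "\<exists>u. u permutes {..<sum_list l} \<and> w = u \<circ> v \<circ> inv u"
proof -
  obtain t t' where t: "t \<in> tableaux l" "t' \<in> tableaux l"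
    and v: "\<And>i j. (i, j) \<in> cells l \<Longrightarrow> v (t (i, j)) = t (i, Suc j mod (l ! i))"
    and w: "\<And>i j. (i, j) \<in> cells l \<Longrightarrow> w (t' (i, j)) = t' (i, Suc j mod (l ! i))"
    using assms(1,2) unfolding row_cycles_def by metis
  obtain u where u: "u permutes {..<sum_list l}" "\<And>c. c \<in> cells l \<Longrightarrow> t' c = u (t c)"
    using tableaux_transitive[OF t] by auto
  have "w (u a) = u (v a)" for a
  proof (cases "a < sum_list l")
    case True
    define i j where "i = row_idx l t a" and "j = col_idx l t a"
    have c: "(i, j) \<in> cells l" "t (i, j) = a" using tableaux_row_idx_col_idx[OF t(1) True] by (auto simp: i_def j_def)
    then have c': "(i, Suc j mod (l ! i)) \<in> cells l" by (auto simp: cells_def)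
    show ?thesis using v[OF c(1)] w[OF c(1)] u(2)[OF c(1)] u(2)[OF c'] c(2) by simp
  next
    case False
    then show ?thesis using assms(3,4) u(1) by (simp add: permutes_def)
  qed
  then have "w = u \<circ> v \<circ> inv u" using permutes_inverses[OF u(1)] by (metis (no_types, lifting) comp_apply ext)
  then show ?thesis using u(1) by blast
qed

text \<open>Column orthogonality of the character table, at the column of the identity. Rows and
  columns are both indexed by \<open>parts k\<close>, so row orthogonality gives a square matrix
  with a right inverse, which is then also a left inverse.\<close>

theorem schar_completeness:
  assumes w: "w permutes {..<k}"
  shows "(\<Sum>l\<in>parts k. sdim l * schar l w) = (if w = id then fact k else 0)"
proof -
  \<comment> \<open>\<open>ct\<close> picks one cycle type per permutation. A shape that is never
    picked would have class size \<open>sz\<close> 0, which leaves the computation of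
    \<open>X * Y\<close> valid.\<close>
  define ct where "ct w = (SOME l. l \<in> parts k \<and> row_cycles l w)" for w
  have ct: "ct w \<in> parts k" "row_cycles (ct w) w" if "w permutes {..<k}" for w
    using someI_ex[OF row_cycles_exists[OF that, unfolded Bex_def]] by (auto simp: ct_def)
  define rep where "rep l = (SOME w. w permutes {..<k} \<and> ct w = l)" for l
  have rep: "rep (ct w) permutes {..<k}" "ct (rep (ct w)) = ct w" if "w permutes {..<k}" for w
    using someI[of "\<lambda>v. v permutes {..<k} \<and> ct v = ct w" w] that by (auto simp: rep_def)
  have sc: "schar l w = schar l (rep (ct w))" if w: "w permutes {..<k}" and l: "l \<in> parts k" for l w
  proof -
    have s: "sum_list (ct w) = k" using ct[OF w] by (simp add: parts_def)
    have "row_cycles (ct w) (rep (ct w))" using ct(2)[OF rep(1)[OF w]] rep(2)[OF w] by simp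
    then obtain u where "u permutes {..<k}" "w = u \<circ> rep (ct w) \<circ> inv u"
      using row_cycles_conj[of "ct w" "rep (ct w)" w] ct[OF w] rep[OF w] w s by auto
    then show ?thesis using schar_conj[of u l "rep (ct w)"] rep[OF w] l by (auto simp: parts_def)
  qed
  define sz where "sz l = (of_nat (card {w \<in> Sym k. ct w = l}) :: complex)" for l :: "nat list"
  have sum_sz: "(\<Sum>w\<in>Sym k. schar l w * schar m w) = (\<Sum>c\<in>parts k. sz c * (schar l (rep c) * schar m (rep c)))"
    if "l \<in> parts k" "m \<in> parts k" for l m
  proof -
    have "(\<Sum>w\<in>Sym k. schar l w * schar m w) = (\<Sum>w\<in>Sym k. schar l (rep (ct w)) * schar m (rep (ct w)))"
      using sc that by (intro sum.cong) auto
    also have "\<dots> = (\<Sum>c\<in>parts k. \<Sum>w\<in>{w \<in> Sym k. ct w = c}. schar l (rep (ct w)) * schar m (rep (ct w)))"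
      by (rule sum.group[symmetric]) (use ct in auto)
    also have "\<dots> = (\<Sum>c\<in>parts k. sz c * (schar l (rep c) * schar m (rep c)))"
      by (intro sum.cong refl) (simp add: sz_def)
    finally show ?thesis .
  qed
  obtain ps where ps: "set ps = parts k" "distinct ps" using finite_distinct_list[OF finite_parts] by blast
  define N where "N = length ps"
  have partial_sum: "(\<Sum>l\<in>parts k. f l) = (\<Sum>i<N. f (ps ! i))" for f :: "nat list \<Rightarrow> complex"
    using sum.reindex_bij_betw[OF bij_betw_nth[OF ps(2) refl ps(1)[symmetric]], of f] by (simp add: N_def)
  have psm: "ps ! i \<in> parts k" if "i < N" for i using ps(1) that nth_mem[of i ps] by (simp add: N_def)
  define X where "X = mat N N (\<lambda>(i, j). schar (ps ! i) (rep (ps ! j)))"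
  define Y where "Y = mat N N (\<lambda>(j, i). sz (ps ! j) * schar (ps ! i) (rep (ps ! j)) / fact k)"
  have "X * Y = 1\<^sub>m N"
  proof (rule eq_matI)
    fix i j assume ij: "i < dim_row (1\<^sub>m N)" "j < dim_col (1\<^sub>m N)"
    then have "(X * Y) $$ (i, j)
      = (\<Sum>c<N. sz (ps ! c) * (schar (ps ! i) (rep (ps ! c)) * schar (ps ! j) (rep (ps ! c)))) / fact k"
      by (simp add: X_def Y_def scalar_prod_def sum_divide_distrib atLeast0LessThan mult_ac)
    also have "\<dots> = (if ps ! i = ps ! j then 1 else 0)"
    proof -
      have m: "ps ! i \<in> parts k" "ps ! j \<in> parts k" using ij psm by auto
      show ?thesis unfolding partial_sum[symmetric, of "\<lambda>c. sz c * (schar (ps ! i) (rep c) * schar (ps ! j) (rep c))"]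
          sum_sz[OF m, symmetric] schar_orthogonality[OF m] by simp
    qed
    finally show "(X * Y) $$ (i, j) = 1\<^sub>m N $$ (i, j)"
      using ij ps by (simp add: nth_eq_iff_index_eq N_def)
  qed (simp_all add: X_def Y_def)
  then have YX: "Y * X = 1\<^sub>m N"
    by (intro mat_mult_left_right_inverse[of X N Y]) (simp_all add: X_def Y_def)
  have col: "sz c * (\<Sum>l\<in>parts k. schar l (rep c) * schar l (rep d)) = (if c = d then fact k else 0)"
    if c: "c \<in> parts k" and d: "d \<in> parts k" for c d
  proof -
    obtain i j where ij: "i < N" "j < N" "c = ps ! i" "d = ps ! j"
      using c d ps by (metis N_def in_set_conv_nth)
    have "(Y * X) $$ (i, j) = (\<Sum>l<N. sz c * schar (ps ! l) (rep c) / fact k * schar (ps ! l) (rep d))"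
      using ij by (simp add: X_def Y_def scalar_prod_def atLeast0LessThan)
    also have "\<dots> = sz c * (\<Sum>l\<in>parts k. schar l (rep c) * schar l (rep d)) / fact k"
      unfolding partial_sum sum_distrib_left sum_divide_distrib by (simp add: mult_ac)
    finally have "sz c * (\<Sum>l\<in>parts k. schar l (rep c) * schar l (rep d)) / fact k = (if i = j then 1 else 0)"
      using ij by (simp add: YX)
    moreover have "c = d \<longleftrightarrow> i = j" using ij ps by (simp add: nth_eq_iff_index_eq N_def)
    ultimately show ?thesis by (auto simp: field_simps)
  qed
  have idp: "id permutes {..<k}" by (rule permutes_id)
  \<comment> \<open>A permutation with the type of the identity is conjugate to the identity, so
    this class has one element.\<close>
  have ct_id: "ct v = ct id \<longleftrightarrow> v = id" if v: "v permutes {..<k}" for v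
  proof
    assume e: "ct v = ct id"
    have "sum_list (ct id) = k" using ct[OF idp] by (simp add: parts_def)
    then obtain u where "u permutes {..<k}" "v = u \<circ> id \<circ> inv u"
      using row_cycles_conj[of "ct id" id v] ct[OF idp] ct[OF v] e v idp by auto
    then show "v = id" by (simp add: permutes_inv_o)
  qed simp
  have "sz (ct id) = 1"
  proof -
    have "{v \<in> Sym k. ct v = ct id} = {id}" using ct_id idp by auto
    then show ?thesis by (simp add: sz_def)
  qed
  then have "(\<Sum>l\<in>parts k. schar l (rep (ct id)) * schar l (rep (ct w))) = (if w = id then fact k else 0)"
    using col[OF ct(1)[OF idp] ct(1)[OF w]] ct_id[OF w] by auto
  moreover have "(\<Sum>l\<in>parts k. schar l (rep (ct id)) * schar l (rep (ct w))) = (\<Sum>l\<in>parts k. sdim l * schar l w)"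
    using sc[OF w] sc[OF idp] by (intro sum.cong refl) (simp add: schar_id)
  ultimately show ?thesis by simp
qed

text \<open>Keeps \<open>Young_group (map sum_list L)\<close> in its folded form; fusing the two
  maps would hide the list of block sizes.\<close>

declare map_map [simp del]

section \<open>Young subgroups\<close>

abbreviation Young_group :: "nat list \<Rightarrow> (nat \<Rightarrow> nat) list set" where
  "Young_group ss \<equiv> listset (map Sym ss)"

abbreviation tabs_list :: "nat list list \<Rightarrow> nat set list list set" where
  "tabs_list L \<equiv> listset (map tabs L)"

abbreviation parts_list :: "nat list \<Rightarrow> nat list list set" where
  "parts_list ss \<equiv> listset (map parts ss)"

text \<open>The matrix of the projection onto the tensor product of the Specht modules of
  \<open>L\<close>. Lists of unequal lengths get 0, so that the kernel vanishes outside
  \<open>tabs_list L\<close>.\<close>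

fun tkernel :: "nat list list \<Rightarrow> nat set list list \<Rightarrow> nat set list list \<Rightarrow> complex" where
  "tkernel [] [] [] = 1"
| "tkernel (l # L) (y # ys) (z # zs) = skernel l y z * tkernel L ys zs"
| "tkernel _ _ _ = 0"

definition lact :: "(nat \<Rightarrow> nat) list \<Rightarrow> nat set list list \<Rightarrow> nat set list list" where
  "lact us ys = map2 pact us ys"

definition list_id :: "nat list \<Rightarrow> (nat \<Rightarrow> nat) list" where
  "list_id ss = map (\<lambda>_. id) ss"

definition list_comp :: "(nat \<Rightarrow> nat) list \<Rightarrow> (nat \<Rightarrow> nat) list \<Rightarrow> (nat \<Rightarrow> nat) list" where
  "list_comp us vs = map2 (\<circ>) us vs"

definition list_inv :: "(nat \<Rightarrow> nat) list \<Rightarrow> (nat \<Rightarrow> nat) list" where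
  "list_inv us = map inv us"

definition tensor_dim :: "nat list list \<Rightarrow> complex" where
  "tensor_dim L = prod_list (map sdim L)"

fun block_perm :: "nat list \<Rightarrow> (nat \<Rightarrow> nat) list \<Rightarrow> nat \<Rightarrow> nat" where
  "block_perm (s # ss) (u # us) q = (if q < s then u q else s + block_perm ss us (q - s))"
| "block_perm _ _ q = q"

text \<open>A position beyond the last block gets the number \<open>length ss\<close>, so that
  appending further blocks continues the numbering.\<close>

fun block_of :: "nat list \<Rightarrow> nat \<Rightarrow> nat" where
  "block_of (s # ss) q = (if q < s then 0 else Suc (block_of ss (q - s)))"
| "block_of [] q = 0"

lemma mem_set_Cons [simp]: "z \<in> set_Cons A B \<longleftrightarrow> (\<exists>x xs. z = x # xs \<and> x \<in> A \<and> xs \<in> B)"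
  by (auto simp: set_Cons_def)

lemma set_Cons_image: "set_Cons A B = (\<lambda>(a, b). a # b) ` (A \<times> B)"
  by (auto simp: image_iff)

lemma sum_set_Cons: "(\<Sum>z\<in>set_Cons A B. f z) = (\<Sum>a\<in>A. \<Sum>b\<in>B. f (a # b))"
proof -
  have "(\<Sum>z\<in>set_Cons A B. f z) = (\<Sum>x\<in>A \<times> B. f (fst x # snd x))"
    unfolding set_Cons_image by (subst sum.reindex) (auto simp: inj_on_def case_prod_beta)
  then show ?thesis by (simp add: sum.cartesian_product case_prod_beta)
qed

lemma finite_listset: "(\<And>A. A \<in> set As \<Longrightarrow> finite A) \<Longrightarrow> finite (listset As)"
  by (induction As) (auto simp: set_Cons_image)

lemma finite_Young_group [simp]: "finite (Young_group ss)" by (rule finite_listset) auto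
lemma finite_tabs_list [simp]: "finite (tabs_list L)" by (rule finite_listset) auto
lemma finite_parts_list [simp]: "finite (parts_list ss)" by (rule finite_listset) auto

lemma listset_iff: "xs \<in> listset As \<longleftrightarrow> length xs = length As \<and> (\<forall>i<length As. xs ! i \<in> As ! i)"
proof (induction As arbitrary: xs)
  case (Cons A As)
  show ?case by (cases xs) (auto simp: Cons nth_Cons split: nat.splits)
qed auto

lemma length_listset: "xs \<in> listset As \<Longrightarrow> length xs = length As"
  by (simp add: listset_iff)

lemma parts_list_sum_list: "L \<in> parts_list ss \<Longrightarrow> map sum_list L = ss"
  by (induction ss arbitrary: L) (auto simp: parts_def)

lemma parts_list_partition: "L \<in> parts_list ss \<Longrightarrow> \<forall>l\<in>set L. partition_list l"
  by (induction ss arbitrary: L) (auto simp: parts_def)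

lemma lact_Cons [simp]: "lact (u # us) (y # ys) = pact u y # lact us ys"
  by (simp add: lact_def)

lemma lact_Nil [simp]: "lact [] ys = []" "lact us [] = []"
  by (simp_all add: lact_def)

lemma tlist_simps [simp]:
  "list_id [] = []" "list_id (s # ss) = id # list_id ss"
  "list_comp [] vs = []" "list_comp us [] = []" "list_comp (u # us) (v # vs) = (u \<circ> v) # list_comp us vs"
  "list_inv [] = []" "list_inv (u # us) = inv u # list_inv us"
  by (simp_all add: list_id_def list_comp_def list_inv_def)

lemma length_tlist [simp]: "length (list_id ss) = length ss" "length (list_inv us) = length us"
  "length us = length vs \<Longrightarrow> length (list_comp us vs) = length vs"
  by (simp_all add: list_id_def list_comp_def list_inv_def)

lemma tkernel_sym: "tkernel L x y = tkernel L y x"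
  by (induction L x y rule: tkernel.induct) (simp_all add: skernel_sym)

lemma tkernel_outside: "x \<notin> tabs_list L \<Longrightarrow> tkernel L x y = 0"
  by (induction L x y rule: tkernel.induct) (auto simp: skernel_outside)

lemma tkernel_outside2: "y \<notin> tabs_list L \<Longrightarrow> tkernel L x y = 0"
  using tkernel_outside tkernel_sym by metis

lemma tabs_list_lact:
  "us \<in> Young_group (map sum_list L) \<Longrightarrow> y \<in> tabs_list L \<Longrightarrow> lact us y \<in> tabs_list L"
proof (induction L arbitrary: us y)
  case (Cons l L) then show ?case by (auto simp: tabs_pact)
qed auto

lemma tkernel_lact:
  "us \<in> Young_group (map sum_list L) \<Longrightarrow> length y = length L \<Longrightarrow> length z = length L \<Longrightarrow>
    tkernel L (lact us y) (lact us z) = tkernel L y z"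
proof (induction L arbitrary: us y z)
  case (Cons l L) then show ?case by (cases y; cases z) (auto simp: skernel_pact)
qed auto

lemma Young_group_inv: "us \<in> Young_group ss \<Longrightarrow> list_inv us \<in> Young_group ss"
  by (induction ss arbitrary: us) (auto simp: permutes_inv)

lemma Young_group_inv_inv: "us \<in> Young_group ss \<Longrightarrow> list_inv (list_inv us) = us"
  by (induction ss arbitrary: us) (auto simp: permutes_inv_inv)

lemma Young_group_comp: "us \<in> Young_group ss \<Longrightarrow> vs \<in> Young_group ss \<Longrightarrow> list_comp us vs \<in> Young_group ss"
  by (induction ss arbitrary: us vs) (auto simp: permutes_compose)

lemma Young_group_id: "list_id ss \<in> Young_group ss"
  by (induction ss) (auto simp: permutes_id)

lemma Young_group_inv_comp:
  "us \<in> Young_group ss \<Longrightarrow> list_comp us (list_inv us) = list_id ss"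
  "us \<in> Young_group ss \<Longrightarrow> list_comp (list_inv us) us = list_id ss"
  by (induction ss arbitrary: us) (auto simp: permutes_inv_o)

lemma Young_group_inv_of_comp:
  "us \<in> Young_group ss \<Longrightarrow> vs \<in> Young_group ss \<Longrightarrow> list_inv (list_comp us vs) = list_comp (list_inv vs) (list_inv us)"
  by (induction ss arbitrary: us vs) (auto simp: inv_comp_permutes)

lemma lact_comp: "length us = length vs \<Longrightarrow> lact (list_comp us vs) y = lact us (lact vs y)"
proof (induction us vs arbitrary: y rule: list_induct2)
  case (Cons u us v vs) then show ?case by (cases y) (auto simp: pact_comp)
qed auto

lemma lact_id: "length ss = length y \<Longrightarrow> lact (list_id ss) y = y"
  by (induction ss y rule: list_induct2) auto

lemma lact_inv:
  assumes "us \<in> Young_group ss" "length y = length ss"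
  shows "lact us (lact (list_inv us) y) = y" "lact (list_inv us) (lact us y) = y"
  using assms length_listset[OF assms(1)]
  by (simp_all add: Young_group_inv_comp lact_id flip: lact_comp)

lemma length_lact [simp]: "length us = length y \<Longrightarrow> length (lact us y) = length y"
  by (simp add: lact_def)

lemma tkernel_lact_left:
  assumes "us \<in> Young_group (map sum_list L)" "length y = length L" "length z = length L"
  shows "tkernel L (lact us y) z = tkernel L y (lact (list_inv us) z)"
  using tkernel_lact[OF assms(1,2), of "lact (list_inv us) z"] assms length_listset[OF assms(1)]
  by (simp add: lact_inv(1)[OF assms(1)])

lemma sum_tabs_list_lact:
  assumes us: "us \<in> Young_group (map sum_list L)"
  shows "(\<Sum>y\<in>tabs_list L. f (lact us y)) = (\<Sum>y\<in>tabs_list L. f y)"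
  by (rule sum.reindex_bij_witness[of _ "lact (list_inv us)" "lact us"])
     (use us Young_group_inv[OF us] in \<open>auto simp: tabs_list_lact lact_inv(1)[OF us] lact_inv(2)[OF us]
       length_listset\<close>)

lemma sum_Young_group_left:
  assumes v: "vs \<in> Young_group ss"
  shows "(\<Sum>us\<in>Young_group ss. f (list_comp vs us)) = (\<Sum>us\<in>Young_group ss. f us)"
  using v
proof (induction ss arbitrary: vs f)
  case (Cons s ss)
  then obtain v vs' where v: "vs = v # vs'" "v permutes {..<s}" "vs' \<in> Young_group ss" by auto
  have "(\<Sum>us\<in>Young_group (s # ss). f (list_comp vs us))
    = (\<Sum>u\<in>Sym s. \<Sum>us\<in>Young_group ss. f ((v \<circ> u) # list_comp vs' us))"
    by (simp add: sum_set_Cons v(1))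
  also have "\<dots> = (\<Sum>u\<in>Sym s. \<Sum>us\<in>Young_group ss. f ((v \<circ> u) # us))"
    by (rule sum.cong[OF refl], rule Cons.IH[OF v(3)])
  also have "\<dots> = (\<Sum>u\<in>Sym s. \<Sum>us\<in>Young_group ss. f (u # us))"
    using sum_Sym_left[OF v(2), of "\<lambda>u. \<Sum>us\<in>Young_group ss. f (u # us)"] .
  finally show ?case by (simp add: sum_set_Cons)
qed auto

lemma sum_Young_group_inv: "(\<Sum>us\<in>Young_group ss. f (list_inv us)) = (\<Sum>us\<in>Young_group ss. f us)"
  by (rule sum.reindex_bij_witness[of _ "list_inv" "list_inv"]) (simp_all add: Young_group_inv Young_group_inv_inv)

lemma sum_Young_group_right:
  assumes v: "vs \<in> Young_group ss"
  shows "(\<Sum>us\<in>Young_group ss. f (list_comp us vs)) = (\<Sum>us\<in>Young_group ss. f us)"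
proof -
  have "(\<Sum>us\<in>Young_group ss. f (list_comp us vs)) = (\<Sum>us\<in>Young_group ss. f (list_comp (list_inv us) vs))"
    by (rule sum_Young_group_inv[symmetric])
  also have "\<dots> = (\<Sum>us\<in>Young_group ss. f (list_inv (list_comp (list_inv vs) us)))"
    by (intro sum.cong refl) (simp add: Young_group_inv_of_comp[OF Young_group_inv[OF v]] Young_group_inv_inv[OF v])
  also have "\<dots> = (\<Sum>us\<in>Young_group ss. f (list_inv us))" by (rule sum_Young_group_left[OF Young_group_inv[OF v]])
  finally show ?thesis by (simp only: sum_Young_group_inv)
qed

lemma tkernel_idem:
  "\<forall>l\<in>set L. partition_list l \<Longrightarrow> (\<Sum>y\<in>tabs_list L. tkernel L x y * tkernel L y z) = tkernel L x z"
proof (induction L arbitrary: x z)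
  case Nil show ?case by (cases x; cases z) auto
next
  case (Cons l L)
  show ?case
  proof (cases "x = [] \<or> z = []")
    case True then show ?thesis by (auto simp: sum_set_Cons)
  next
    case False
    then obtain x1 xs z1 zs where e: "x = x1 # xs" "z = z1 # zs" by (cases x; cases z) auto
    have "(\<Sum>y\<in>tabs_list (l # L). tkernel (l # L) x y * tkernel (l # L) y z) =
      (\<Sum>y\<in>tabs l. skernel l x1 y * skernel l y z1) * (\<Sum>ys\<in>tabs_list L. tkernel L xs ys * tkernel L ys zs)"
      by (simp add: sum_set_Cons e sum_product mult_ac)
    then show ?thesis using Cons by (simp add: e skernel_idem)
  qed
qed

text \<open>The sum over a Young subgroup factors into sums over its blocks, each governed by
  \<open>skernel_orthogonality\<close>.\<close>

lemma tkernel_orthogonality: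
  assumes "L \<in> parts_list ss" "M \<in> parts_list ss" "length a = length ss" "length b = length ss"
  shows "(\<Sum>us\<in>Young_group ss. tkernel L x (lact us a) * tkernel M (lact us b) y) =
    (if L = M then of_nat (card (Young_group ss)) / tensor_dim L * tkernel L a b * tkernel L x y else 0)"
  using assms
proof (induction ss arbitrary: L M a b x y)
  case Nil
  show ?case using Nil by (cases x; cases y) (auto simp: tensor_dim_def)
next
  case (Cons s ss)
  then obtain l L' m M' a1 a' b1 b' where e: "L = l # L'" "M = m # M'" "a = a1 # a'" "b = b1 # b'"
    "l \<in> parts s" "m \<in> parts s" "L' \<in> parts_list ss" "M' \<in> parts_list ss" "length a' = length ss" "length b'
      = length ss"
    by (cases a; cases b) auto
  have card: "of_nat (card (Young_group (s # ss)))
    = (of_nat (card (Sym s)) * of_nat (card (Young_group ss)) :: complex)"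
    by (simp add: set_Cons_image card_image inj_on_def card_cartesian_product)
  show ?case
  proof (cases "x = [] \<or> y = []")
    case True then show ?thesis by (auto simp: sum_set_Cons e)
  next
    case False
    then obtain x1 xs y1 ys where xy: "x = x1 # xs" "y = y1 # ys" by (cases x; cases y) auto
    have "(\<Sum>us\<in>Young_group (s # ss). tkernel L x (lact us a) * tkernel M (lact us b) y) =
      (\<Sum>u\<in>Sym s. skernel l x1 (pact u a1) * skernel m (pact u b1) y1) *
      (\<Sum>us\<in>Young_group ss. tkernel L' xs (lact us a') * tkernel M' (lact us b') ys)"
      by (simp add: sum_set_Cons e xy sum_product mult_ac)
    also have "(\<Sum>u\<in>Sym s. skernel l x1 (pact u a1) * skernel m (pact u b1) y1) =
      (if l = m then of_nat (card (Sym s)) / sdim l * skernel l a1 b1 * skernel l x1 y1 else 0)"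
      by (rule skernel_orthogonality) (use e in \<open>auto simp: parts_def\<close>)
    finally show ?thesis unfolding Cons.IH[OF e(7-10)] card by (simp add: e(1-4) xy tensor_dim_def)
  qed
qed

text \<open>The product over the blocks of \<open>schar_completeness\<close>; it is the character
  identity behind Fourier inversion.\<close>

lemma tkernel_completeness:
  "us \<in> Young_group ss \<Longrightarrow> (\<Sum>L\<in>parts_list ss. tensor_dim L * (\<Sum>x\<in>tabs_list L. tkernel L x (lact us x))) =
    (if us = list_id ss then of_nat (card (Young_group ss)) else 0)"
proof (induction ss arbitrary: us)
  case Nil then show ?case by (simp add: tensor_dim_def)
next
  case (Cons s ss)
  then obtain u us' where e: "us = u # us'" "u permutes {..<s}" "us' \<in> Young_group ss" by auto
  have card: "of_nat (card (Young_group (s # ss)))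
    = (of_nat (card (Sym s)) * of_nat (card (Young_group ss)) :: complex)"
    by (simp add: set_Cons_image card_image inj_on_def card_cartesian_product)
  have "(\<Sum>L\<in>parts_list (s # ss). tensor_dim L * (\<Sum>x\<in>tabs_list L. tkernel L x (lact us x))) =
    (\<Sum>l\<in>parts s. \<Sum>L\<in>parts_list ss. (sdim l * schar l u) * (tensor_dim L * (\<Sum>x\<in>tabs_list L. tkernel L x
      (lact us' x))))"
    unfolding list.map listset.simps sum_set_Cons
  proof (intro sum.cong refl)
    fix l L
    have "(\<Sum>a\<in>tabs l. \<Sum>b\<in>tabs_list L. tkernel (l # L) (a # b) (lact us (a # b)))
      = schar l u * (\<Sum>x\<in>tabs_list L. tkernel L x (lact us' x))"
      by (simp add: e schar_def sum_product)
    then show "tensor_dim (l # L) * (\<Sum>a\<in>tabs l. \<Sum>b\<in>tabs_list L. tkernel (l # L) (a # b) (lact us (a # b))) =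
      sdim l * schar l u * (tensor_dim L * (\<Sum>x\<in>tabs_list L. tkernel L x (lact us' x)))"
      by (simp add: tensor_dim_def mult_ac)
  qed
  also have "\<dots> = (\<Sum>l\<in>parts s. sdim l * schar l u) * (\<Sum>L\<in>parts_list ss. tensor_dim L
    * (\<Sum>x\<in>tabs_list L. tkernel L x (lact us' x)))"
    by (simp add: sum_product)
  finally show ?case
    unfolding Cons.IH[OF e(3)] schar_completeness[OF e(2)] card by (simp add: e(1) card_Sym)
qed

lemma tensor_dim_nonzero: "L \<in> parts_list ss \<Longrightarrow> tensor_dim L \<noteq> 0"
  using parts_list_partition sdim_nonzero by (fastforce simp: tensor_dim_def prod_list_zero_iff)

lemma card_Young_group_nonzero: "card (Young_group ss) \<noteq> 0"
  using Young_group_id by (auto simp: card_eq_0_iff)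

section \<open>Permutations that preserve the blocks\<close>

lemma block_perm_less: "us \<in> Young_group ss \<Longrightarrow> q < sum_list ss \<Longrightarrow> block_perm ss us q < sum_list ss"
proof (induction ss arbitrary: us q)
  case (Cons s ss)
  then obtain u us' where e: "us = u # us'" "u permutes {..<s}" "us' \<in> Young_group ss" by auto
  show ?case
  proof (cases "q < s")
    case True then show ?thesis using permutes_less[OF e(2) True] by (simp add: e)
  next
    case False then show ?thesis using Cons.IH[OF e(3), of "q - s"] Cons.prems(2) by (simp add: e)
  qed
qed simp

lemma block_perm_ge: "us \<in> Young_group ss \<Longrightarrow> \<not> q < sum_list ss \<Longrightarrow> block_perm ss us q = q"
  by (induction ss arbitrary: us q) auto

lemma block_perm_comp: "us \<in> Young_group ss \<Longrightarrow> vs \<in> Young_group ss \<Longrightarrow> block_perm ss (list_comp us vs)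
  = block_perm ss us \<circ> block_perm ss vs"
proof (induction ss arbitrary: us vs)
  case (Cons s ss)
  then obtain u us' v vs' where e: "us = u # us'" "u permutes {..<s}" "us' \<in> Young_group ss"
    "vs = v # vs'" "v permutes {..<s}" "vs' \<in> Young_group ss" by auto
  show ?case using Cons.IH[OF e(3,6)] permutes_less[OF e(5)] by (auto simp: e(1,4) fun_eq_iff)
qed (simp add: fun_eq_iff)

lemma block_perm_id: "block_perm ss (list_id ss) = id"
proof
  fix q show "block_perm ss (list_id ss) q = id q" by (induction ss arbitrary: q) auto
qed

lemma block_perm_inv_comp:
  assumes "us \<in> Young_group ss"
  shows "block_perm ss us \<circ> block_perm ss (list_inv us) = id" "block_perm ss (list_inv us) \<circ> block_perm ss us = id"
  using assms Young_group_inv[OF assms] by (simp_all add: Young_group_inv_comp block_perm_id flip: block_perm_comp)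

lemma block_perm_permutes:
  assumes "us \<in> Young_group ss" shows "block_perm ss us permutes {..<sum_list ss}"
proof (rule bij_imp_permutes)
  show "bij_betw (block_perm ss us) {..<sum_list ss} {..<sum_list ss}"
    by (rule bij_betwI[where g = "block_perm ss (list_inv us)"])
       (use block_perm_less[OF assms] block_perm_less[OF Young_group_inv[OF assms]] block_perm_inv_comp[OF assms]
         in \<open>auto simp: fun_eq_iff\<close>)
qed (simp add: block_perm_ge[OF assms])

lemma inv_block_perm:
  assumes "us \<in> Young_group ss" shows "inv (block_perm ss us) = block_perm ss (list_inv us)"
  using block_perm_inv_comp[OF assms] by (rule inv_unique_comp)

lemma block_of_block_perm: "us \<in> Young_group ss \<Longrightarrow> q < sum_list ss \<Longrightarrow> block_of ss (block_perm ss us q) = block_of ss q"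
proof (induction ss arbitrary: us q)
  case (Cons s ss)
  then obtain u us' where e: "us = u # us'" "u permutes {..<s}" "us' \<in> Young_group ss" by auto
  show ?case using Cons.IH[OF e(3), of "q - s"] Cons.prems(2) permutes_less[OF e(2), of q] by (simp add: e(1))
qed simp

lemma block_of_less: "q < sum_list ss \<Longrightarrow> block_of ss q < length ss"
  by (induction ss arbitrary: q) auto

text \<open>A permutation that preserves block numbers maps the first block and the rest to
  themselves; the first action is split off, and the rest is treated by induction.\<close>

lemma block_perm_exists:
  "u permutes {..<sum_list ss} \<Longrightarrow> (\<And>q. q < sum_list ss \<Longrightarrow> block_of ss (u q) = block_of ss q) \<Longrightarrow>
    \<exists>us\<in>Young_group ss. u = block_perm ss us"
proof (induction ss arbitrary: u)
  case Nil then show ?case by (auto simp: fun_eq_iff)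
next
  case (Cons s ss)
  let ?n = "s + sum_list ss"
  have pu: "u permutes {..<?n}" using Cons.prems(1) by simp
  have lt: "u q < s \<longleftrightarrow> q < s" for q
  proof (cases "q < ?n")
    case True
    then have "block_of (s # ss) (u q) = block_of (s # ss) q" using Cons.prems(2) by simp
    then show ?thesis by (auto split: if_splits)
  next
    case False then show ?thesis using pu by (simp add: permutes_def)
  qed
  define v where "v q = (if q < s then u q else q)" for q
  define w where "w q = u (q + s) - s" for q
  have inj: "inj u" using pu by (rule permutes_inj)
  have v: "v permutes {..<s}"
  proof (rule bij_imp_permutes)
    have "inj_on v {..<s}" using inj by (auto simp: v_def inj_on_def dest: injD)
    moreover have "v ` {..<s} \<subseteq> {..<s}" using lt by (auto simp: v_def)
    ultimately show "bij_betw v {..<s} {..<s}" by (simp add: bij_betw_def endo_inj_surj)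
  qed (simp add: v_def)
  have ge: "u (q + s) \<ge> s" for q using lt[of "q + s"] by simp
  have w: "w permutes {..<sum_list ss}"
  proof (rule bij_imp_permutes)
    have "inj_on w {..<sum_list ss}"
    proof (rule inj_onI)
      fix a b assume "w a = w b"
      then have "u (a + s) = u (b + s)" using ge[of a] ge[of b] by (simp add: w_def)
      then show "a = b" using injD[OF inj, of "a + s" "b + s"] by simp
    qed
    moreover have "w ` {..<sum_list ss} \<subseteq> {..<sum_list ss}"
    proof
      fix y assume "y \<in> w ` {..<sum_list ss}"
      then obtain q where q: "q < sum_list ss" "y = w q" by auto
      have "u (q + s) < ?n" using permutes_less[OF pu, of "q + s"] q(1) by simp
      then show "y \<in> {..<sum_list ss}" using ge[of q] q by (simp add: w_def)
    qed
    ultimately show "bij_betw w {..<sum_list ss} {..<sum_list ss}" by (simp add: bij_betw_def endo_inj_surj)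
    show "w q = q" if "q \<notin> {..<sum_list ss}" for q
      using permutes_not_in[OF pu, of "q + s"] that by (simp add: w_def)
  qed
  have "block_of ss (w q) = block_of ss q" if "q < sum_list ss" for q
    using Cons.prems(2)[of "q + s"] that ge[of q] by (simp add: w_def)
  from Cons.IH[OF w this] obtain us where us: "us \<in> Young_group ss" "w = block_perm ss us" by blast
  have "u = block_perm (s # ss) (v # us)"
  proof
    fix q show "u q = block_perm (s # ss) (v # us) q"
      using ge[of "q - s"] by (auto simp: us(2)[symmetric] v_def w_def)
  qed
  then show ?case using us(1) v by (intro bexI[of _ "v # us"]) auto
qed

section \<open>Fourier transform along a Young subgroup\<close>

definition halves_perm :: "nat \<Rightarrow> (nat \<Rightarrow> nat) \<Rightarrow> (nat \<Rightarrow> nat) \<Rightarrow> nat \<Rightarrow> nat" where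
  "halves_perm N u v = block_perm [N, N] [u, v]"

definition swap_halves :: "nat \<Rightarrow> nat \<Rightarrow> nat" where
  "swap_halves N q = (if q < N then q + N else if q < 2 * N then q - N else q)"

text \<open>The entry at \<open>y\<close> and \<open>z\<close> of the Fourier coefficient at
  \<open>L\<close> of \<open>f\<close>, restricted to the coset of \<open>w\<close> under the Young
  subgroup of the first half. The guard excludes lists \<open>y\<close> that are too long, which
  \<open>lact\<close> would truncate to valid ones.\<close>

definition young_fourier :: "nat list \<Rightarrow> nat list list \<Rightarrow> ((nat \<Rightarrow> nat) \<Rightarrow> complex) \<Rightarrow> (nat \<Rightarrow> nat)
    \<Rightarrow> nat set list list \<Rightarrow> nat set list list \<Rightarrow> complex" where
  "young_fourier \<tau> L f w y z = (if y \<in> tabs_list L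
     then \<Sum>us\<in>Young_group \<tau>. f (w \<circ> halves_perm (sum_list \<tau>) (block_perm \<tau> us) id) * tkernel L
       (lact (list_inv us) y) z else 0)"

definition diag_invariant :: "nat list \<Rightarrow> ((nat \<Rightarrow> nat) \<Rightarrow> complex) \<Rightarrow> bool" where
  "diag_invariant \<tau> f \<longleftrightarrow> (\<forall>w us. w permutes {..<2 * sum_list \<tau>} \<longrightarrow> us \<in> Young_group \<tau> \<longrightarrow>
     f (w \<circ> halves_perm (sum_list \<tau>) (block_perm \<tau> us) (block_perm \<tau> us)) = f w)"

definition swap_odd :: "nat list \<Rightarrow> ((nat \<Rightarrow> nat) \<Rightarrow> complex) \<Rightarrow> bool" where
  "swap_odd \<tau> f \<longleftrightarrow> (\<forall>w. w permutes {..<2 * sum_list \<tau>} \<longrightarrow> f (w \<circ> swap_halves (sum_list \<tau>)) = - f w)"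

text \<open>The equations that a vector of the -1 eigenspace of \<open>S_op\<close> satisfies when
  written as a function on permutations: two projections, covariance under the Young subgroups of
  both halves, and the sign under their exchange.\<close>

definition admissible ::
  "nat list \<Rightarrow> nat list list \<Rightarrow> ((nat \<Rightarrow> nat) \<Rightarrow> nat set list list \<Rightarrow> nat set list list \<Rightarrow> complex) \<Rightarrow> bool" where
  "admissible \<tau> L H \<longleftrightarrow> (\<forall>w. w permutes {..<2 * sum_list \<tau>} \<longrightarrow>
     (\<forall>y z. H w y z = (\<Sum>x\<in>tabs_list L. tkernel L y x * H w x z)) \<and>
     (\<forall>y z. H w y z = (\<Sum>x\<in>tabs_list L. tkernel L z x * H w y x)) \<and>
     (\<forall>us\<in>Young_group \<tau>. \<forall>vs\<in>Young_group \<tau>. \<forall>y\<in>tabs_list L. \<forall>z\<in>tabs_list L.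
        H (w \<circ> halves_perm (sum_list \<tau>) (block_perm \<tau> us) (block_perm \<tau> vs)) y z = H w (lact us y) (lact vs z)) \<and>
     (\<forall>y z. H (w \<circ> swap_halves (sum_list \<tau>)) y z = - H w z y))"

text \<open>Fourier inversion of a single coefficient; the constant is the dimension divided by the
  order of the group, and the sum is a trace.\<close>

definition synthesis :: "nat list \<Rightarrow> nat list list \<Rightarrow> ((nat \<Rightarrow> nat) \<Rightarrow> nat set list list \<Rightarrow> nat set list list \<Rightarrow> complex)
    \<Rightarrow> (nat \<Rightarrow> nat) \<Rightarrow> complex" where
  "synthesis \<tau> L H w = tensor_dim L / of_nat (card (Young_group \<tau>)) * (\<Sum>y\<in>tabs_list L. H w y y)"

lemma halves_perm_apply: "halves_perm N u v q = (if q < N then u q else if q < 2 * N then N + v (q - N) else q)"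
  by (auto simp: halves_perm_def)

lemma halves_perm_comp:
  assumes "u permutes {..<N}" "v permutes {..<N}" "u' permutes {..<N}" "v' permutes {..<N}"
  shows "halves_perm N u v \<circ> halves_perm N u' v' = halves_perm N (u \<circ> u') (v \<circ> v')"
  using block_perm_comp[of "[u, v]" "[N, N]" "[u', v']"] assms by (simp add: halves_perm_def)

lemma halves_perm_permutes:
  assumes "u permutes {..<N}" "v permutes {..<N}" shows "halves_perm N u v permutes {..<2 * N}"
  using block_perm_permutes[of "[u, v]" "[N, N]"] assms by (simp add: halves_perm_def mult_2)

lemma halves_perm_id: "halves_perm N id id = id"
  using block_perm_id[of "[N, N]"] by (simp add: halves_perm_def list_id_def)

lemma inv_halves_perm:
  assumes "u permutes {..<N}" "v permutes {..<N}" shows "inv (halves_perm N u v) = halves_perm N (inv u) (inv v)"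
  using inv_block_perm[of "[u, v]" "[N, N]"] assms by (simp add: halves_perm_def)

lemma swap_halves_swap_halves: "swap_halves N \<circ> swap_halves N = id"
  by (auto simp: swap_halves_def fun_eq_iff)

lemma swap_halves_permutes: "swap_halves N permutes {..<2 * N}"
  by (rule bij_imp_permutes, rule bij_betwI[where g = "swap_halves N"]) (auto simp: swap_halves_def)

lemma inv_swap_halves: "inv (swap_halves N) = swap_halves N"
  by (rule inv_unique_comp) (rule swap_halves_swap_halves)+

lemma swap_halves_halves_perm:
  assumes "u permutes {..<N}" "v permutes {..<N}"
  shows "swap_halves N \<circ> halves_perm N u v = halves_perm N v u \<circ> swap_halves N"
  using permutes_less[OF assms(1)] permutes_less[OF assms(2)]
    by (auto simp: fun_eq_iff halves_perm_apply swap_halves_def)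

lemma young_fourier_tkernel_left:
  assumes L: "L \<in> parts_list \<tau>"
  shows "young_fourier \<tau> L f w y z = (\<Sum>x\<in>tabs_list L. tkernel L y x * young_fourier \<tau> L f w x z)"
proof (cases "y \<in> tabs_list L")
  case y: True
  have \<tau>: "\<tau> = map sum_list L" using parts_list_sum_list[OF L] by simp
  have "(\<Sum>x\<in>tabs_list L. tkernel L y x * young_fourier \<tau> L f w x z) =
    (\<Sum>us\<in>Young_group \<tau>. f (w \<circ> halves_perm (sum_list \<tau>) (block_perm \<tau> us) id) *
      (\<Sum>x\<in>tabs_list L. tkernel L y x * tkernel L (lact (list_inv us) x) z))"
    unfolding young_fourier_def sum_distrib_left by (subst sum.swap) (simp add: sum_distrib_left mult_ac)
  also have "\<dots> = young_fourier \<tau> L f w y z"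
  proof -
    have "(\<Sum>x\<in>tabs_list L. tkernel L y x * tkernel L (lact (list_inv us) x) z) = tkernel L (lact (list_inv us) y) z"
      if us: "us \<in> Young_group \<tau>" for us
    proof -
      have us': "us \<in> Young_group (map sum_list L)" "list_inv us \<in> Young_group (map sum_list L)"
        using us Young_group_inv \<tau> by auto
      have "(\<Sum>x\<in>tabs_list L. tkernel L y x * tkernel L (lact (list_inv us) x) z) =
          (\<Sum>x\<in>tabs_list L. tkernel L y (lact us x) * tkernel L x z)"
        using sum_tabs_list_lact[OF us'(1), of "\<lambda>x. tkernel L y x * tkernel L (lact (list_inv us) x) z"]
        by (simp add: lact_inv[OF us'(1)] length_listset)
      also have "\<dots> = (\<Sum>x\<in>tabs_list L. tkernel L (lact (list_inv us) y) x * tkernel L x z)"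
        using tkernel_lact_left[OF us'(2)] y by (simp add: Young_group_inv_inv[OF us] length_listset)
      also have "\<dots> = tkernel L (lact (list_inv us) y) z" by (rule tkernel_idem[OF parts_list_partition[OF L]])
      finally show ?thesis .
    qed
    then show ?thesis using y by (simp add: young_fourier_def)
  qed
  finally show ?thesis by simp
qed (simp add: young_fourier_def tkernel_outside)

lemma young_fourier_tkernel_right:
  assumes L: "L \<in> parts_list \<tau>"
  shows "young_fourier \<tau> L f w y z = (\<Sum>x\<in>tabs_list L. tkernel L z x * young_fourier \<tau> L f w y x)"
proof (cases "y \<in> tabs_list L")
  case y: True
  have "(\<Sum>x\<in>tabs_list L. tkernel L z x * young_fourier \<tau> L f w y x) =
    (\<Sum>us\<in>Young_group \<tau>. f (w \<circ> halves_perm (sum_list \<tau>) (block_perm \<tau> us) id) * (\<Sum>x\<in>tabs_list L. tkernel L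
      (lact (list_inv us) y) x * tkernel L x z))"
    using y unfolding young_fourier_def sum_distrib_left by (simp add: sum_distrib_left)
      (subst sum.swap, simp add: mult_ac tkernel_sym[of L z])
  then show ?thesis using y by (simp add: tkernel_idem[OF parts_list_partition[OF L]] young_fourier_def)
qed (simp add: young_fourier_def)

text \<open>The pair of \<open>vs us\<close> and \<open>ws\<close> equals the pair of
  \<open>vs us inv(ws)\<close> and the identity, followed by the diagonal element of
  \<open>ws\<close>, which \<open>f\<close> ignores. Translating the summation variable on both
  sides moves \<open>vs\<close> and \<open>ws\<close> to the two indices.\<close>

lemma young_fourier_halves_perm:
  assumes L: "L \<in> parts_list \<tau>" and f: "diag_invariant \<tau> f" and w: "w permutes {..<2 * sum_list \<tau>}"
    and vs: "vs \<in> Young_group \<tau>" and ws: "ws \<in> Young_group \<tau>" and y: "y \<in> tabs_list L" and z: "z \<in> tabs_list L"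
  shows "young_fourier \<tau> L f (w \<circ> halves_perm (sum_list \<tau>) (block_perm \<tau> vs) (block_perm \<tau> ws)) y z
    = young_fourier \<tau> L f w (lact vs y) (lact ws z)"
proof -
  let ?N = "sum_list \<tau>"
  have \<tau>: "\<tau> = map sum_list L" using parts_list_sum_list[OF L] by simp
  note len = length_listset[OF vs] length_listset[OF ws] length_listset[OF y] length_listset[OF z]
  define g where "g us = f (w \<circ> halves_perm ?N (block_perm \<tau> us) id)
    * tkernel L (lact (list_inv us) (lact vs y)) (lact ws z)" for us
  have "f (w \<circ> halves_perm ?N (block_perm \<tau> vs) (block_perm \<tau> ws) \<circ> halves_perm ?N (block_perm \<tau> us) id)
    * tkernel L (lact (list_inv us) y) z
      = g (list_comp (list_comp vs us) (list_inv ws))" if us: "us \<in> Young_group \<tau>" for us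
  proof -
    have m: "list_comp vs us \<in> Young_group \<tau>" "list_inv ws \<in> Young_group \<tau>"
      "list_comp (list_comp vs us) (list_inv ws) \<in> Young_group \<tau>"
      using Young_group_comp Young_group_inv us vs ws by auto
    note lus = length_listset[OF us]
    have B: "block_perm \<tau> vs \<circ> block_perm \<tau> us
      = block_perm \<tau> (list_comp (list_comp vs us) (list_inv ws)) \<circ> block_perm \<tau> ws"
      using block_perm_inv_comp[OF ws] by (simp add: block_perm_comp[OF m(1,2)] block_perm_comp[OF vs us] comp_assoc)
    have "halves_perm ?N (block_perm \<tau> vs) (block_perm \<tau> ws) \<circ> halves_perm ?N (block_perm \<tau> us) id =
       halves_perm ?N (block_perm \<tau> (list_comp (list_comp vs us) (list_inv ws))) id \<circ> halves_perm ?N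
         (block_perm \<tau> ws) (block_perm \<tau> ws)"
      using block_perm_permutes[OF us] block_perm_permutes[OF vs] block_perm_permutes[OF ws]
        block_perm_permutes[OF m(3)]
      by (simp add: halves_perm_comp permutes_id B)
    then have e: "w \<circ> halves_perm ?N (block_perm \<tau> vs) (block_perm \<tau> ws) \<circ> halves_perm ?N (block_perm \<tau> us) id =
       w \<circ> halves_perm ?N (block_perm \<tau> (list_comp (list_comp vs us) (list_inv ws))) id \<circ> halves_perm ?N
         (block_perm \<tau> ws) (block_perm \<tau> ws)"
      by (simp add: comp_assoc)
    have "f (w \<circ> halves_perm ?N (block_perm \<tau> vs) (block_perm \<tau> ws) \<circ> halves_perm ?N (block_perm \<tau> us) id) =
      f (w \<circ> halves_perm ?N (block_perm \<tau> (list_comp (list_comp vs us) (list_inv ws))) id)"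
      unfolding e
      using f ws permutes_compose[OF halves_perm_permutes[OF block_perm_permutes[OF m(3)] permutes_id] w]
      unfolding diag_invariant_def by blast
    moreover have "tkernel L (lact (list_inv (list_comp (list_comp vs us) (list_inv ws))) (lact vs y)) (lact ws z)
      = tkernel L (lact (list_inv us) y) z"
    proof -
      have "list_inv (list_comp (list_comp vs us) (list_inv ws))
        = list_comp ws (list_comp (list_inv us) (list_inv vs))"
        by (simp add: Young_group_inv_of_comp[OF m(1,2)] Young_group_inv_of_comp[OF vs us] Young_group_inv_inv[OF ws])
      then have "lact (list_inv (list_comp (list_comp vs us) (list_inv ws))) (lact vs y)
        = lact ws (lact (list_inv us) (lact (list_inv vs) (lact vs y)))"
        using len lus by (simp add: lact_comp)
      then show ?thesis using tkernel_lact[of ws L] ws \<tau> len lus by (simp add: lact_inv[OF vs])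
    qed
    ultimately show ?thesis by (simp add: g_def)
  qed
  then have "young_fourier \<tau> L f (w \<circ> halves_perm ?N (block_perm \<tau> vs) (block_perm \<tau> ws)) y z =
      (\<Sum>us\<in>Young_group \<tau>. g (list_comp (list_comp vs us) (list_inv ws)))"
    using y by (simp add: young_fourier_def)
  also have "\<dots> = (\<Sum>us\<in>Young_group \<tau>. g (list_comp us (list_inv ws)))"
    by (rule sum_Young_group_left[OF vs, of "\<lambda>us. g (list_comp us (list_inv ws))"])
  also have "\<dots> = (\<Sum>us\<in>Young_group \<tau>. g us)" by (rule sum_Young_group_right[OF Young_group_inv[OF ws]])
  finally show ?thesis using tabs_list_lact[of vs L y] vs y \<tau> by (simp add: young_fourier_def g_def)
qed

text \<open>Past the exchange of halves, \<open>us\<close> acts on the second half; a diagonal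
  element brings it back to the first half as its inverse. Oddness of \<open>f\<close> gives the
  sign, and the inversion transposes the kernel, hence the indices.\<close>

lemma young_fourier_swap_halves:
  assumes L: "L \<in> parts_list \<tau>" and f: "diag_invariant \<tau> f" "swap_odd \<tau> f" and w: "w permutes {..<2 * sum_list \<tau>}"
  shows "young_fourier \<tau> L f (w \<circ> swap_halves (sum_list \<tau>)) y z = - young_fourier \<tau> L f w z y"
proof (cases "y \<in> tabs_list L \<and> z \<in> tabs_list L")
  case yz: True
  let ?N = "sum_list \<tau>"
  have \<tau>: "\<tau> = map sum_list L" using parts_list_sum_list[OF L] by simp
  define g where "g us = - f (w \<circ> halves_perm ?N (block_perm \<tau> us) id) * tkernel L (lact (list_inv us) z) y" for us
  have "f (w \<circ> swap_halves ?N \<circ> halves_perm ?N (block_perm \<tau> us) id) * tkernel L (lact (list_inv us) y) z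
    = g (list_inv us)"
    if us: "us \<in> Young_group \<tau>" for us
  proof -
    note p = block_perm_permutes[OF us] block_perm_permutes[OF Young_group_inv[OF us]]
    have "halves_perm ?N id (block_perm \<tau> us)
      = halves_perm ?N (block_perm \<tau> (list_inv us)) id \<circ> halves_perm ?N (block_perm \<tau> us) (block_perm \<tau> us)"
      using p by (simp add: halves_perm_comp permutes_id block_perm_inv_comp[OF us])
    moreover have "swap_halves ?N \<circ> halves_perm ?N (block_perm \<tau> us) id
      = halves_perm ?N id (block_perm \<tau> us) \<circ> swap_halves ?N"
      using p by (simp add: swap_halves_halves_perm permutes_id)
    ultimately have e: "w \<circ> swap_halves ?N \<circ> halves_perm ?N (block_perm \<tau> us) id =
      w \<circ> halves_perm ?N (block_perm \<tau> (list_inv us)) id \<circ> halves_perm ?N (block_perm \<tau> us)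
        (block_perm \<tau> us) \<circ> swap_halves ?N"
      by (simp add: comp_assoc)
    have q1: "w \<circ> halves_perm ?N (block_perm \<tau> (list_inv us)) id permutes {..<2 * ?N}"
      using permutes_compose[OF halves_perm_permutes[OF p(2) permutes_id] w] .
    have q2: "w \<circ> halves_perm ?N (block_perm \<tau> (list_inv us)) id \<circ> halves_perm ?N (block_perm \<tau> us)
      (block_perm \<tau> us) permutes {..<2 * ?N}"
      using permutes_compose[OF halves_perm_permutes[OF p(1) p(1)] q1] .
    have "f (w \<circ> swap_halves ?N \<circ> halves_perm ?N (block_perm \<tau> us) id)
      = - f (w \<circ> halves_perm ?N (block_perm \<tau> (list_inv us)) id)"
      using f q1 q2 us unfolding e diag_invariant_def swap_odd_def by simp
    moreover have "tkernel L (lact (list_inv us) y) z = tkernel L (lact us z) y"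
      using tkernel_lact_left[of "list_inv us" L y z] Young_group_inv[OF us] length_listset[of y "map tabs L"]
        length_listset[of z "map tabs L"] yz \<tau>
      by (simp add: Young_group_inv_inv[OF us] tkernel_sym[of L y])
    ultimately show ?thesis by (simp add: g_def Young_group_inv_inv[OF us])
  qed
  then have "young_fourier \<tau> L f (w \<circ> swap_halves ?N) y z = (\<Sum>us\<in>Young_group \<tau>. g (list_inv us))" using yz
    by (simp add: young_fourier_def)
  also have "\<dots> = (\<Sum>us\<in>Young_group \<tau>. g us)" by (rule sum_Young_group_inv)
  finally show ?thesis using yz by (simp add: young_fourier_def g_def sum_negf)
next
  case False
  then show ?thesis by (auto simp: young_fourier_def tkernel_outside2)
qed

theorem young_fourier_admissible:
  assumes "L \<in> parts_list \<tau>" "diag_invariant \<tau> f" "swap_odd \<tau> f"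
  shows "admissible \<tau> L (young_fourier \<tau> L f)"
  unfolding admissible_def
proof (intro allI impI conjI ballI)
qed (rule young_fourier_tkernel_left[OF assms(1)] young_fourier_tkernel_right[OF assms(1)]
  young_fourier_halves_perm[OF assms(1,2)] young_fourier_swap_halves[OF assms]; assumption)+

text \<open>By \<open>tkernel_completeness\<close> the traces of the coefficients, weighted with the
  dimensions, add up to \<open>f w\<close> times the order of the group, so the diagonal entries
  already determine \<open>f\<close>.\<close>

theorem young_fourier_injective:
  assumes w: "w permutes {..<2 * sum_list \<tau>}"
    and 0: "\<And>L y. L \<in> parts_list \<tau> \<Longrightarrow> y \<in> tabs_list L \<Longrightarrow> young_fourier \<tau> L f w y y = 0"
  shows "f w = 0"
proof -
  let ?N = "sum_list \<tau>"
  have "0 = (\<Sum>L\<in>parts_list \<tau>. tensor_dim L * (\<Sum>y\<in>tabs_list L. young_fourier \<tau> L f w y y))" using 0 by simp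
  also have "\<dots> = (\<Sum>L\<in>parts_list \<tau>. \<Sum>us\<in>Young_group \<tau>. f (w \<circ> halves_perm ?N (block_perm \<tau> us) id)
    * (tensor_dim L * (\<Sum>y\<in>tabs_list L. tkernel L (lact (list_inv us) y) y)))"
  proof (intro sum.cong refl)
    fix L assume "L \<in> parts_list \<tau>"
    have "(\<Sum>y\<in>tabs_list L. young_fourier \<tau> L f w y y)
      = (\<Sum>us\<in>Young_group \<tau>. f (w \<circ> halves_perm ?N (block_perm \<tau> us) id) * (\<Sum>y\<in>tabs_list L. tkernel L
        (lact (list_inv us) y) y))"
      unfolding sum_distrib_left by (subst sum.swap) (simp add: young_fourier_def)
    then show "tensor_dim L * (\<Sum>y\<in>tabs_list L. young_fourier \<tau> L f w y y)
      = (\<Sum>us\<in>Young_group \<tau>. f (w \<circ> halves_perm ?N (block_perm \<tau> us) id) *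
        (tensor_dim L * (\<Sum>y\<in>tabs_list L. tkernel L (lact (list_inv us) y) y)))"
      by (simp add: sum_distrib_left mult_ac)
  qed
  also have "\<dots> = (\<Sum>us\<in>Young_group \<tau>. f (w \<circ> halves_perm ?N (block_perm \<tau> us) id) * (\<Sum>L\<in>parts_list \<tau>. tensor_dim L
    * (\<Sum>y\<in>tabs_list L. tkernel L y (lact (list_inv us) y))))"
    by (subst sum.swap) (simp add: sum_distrib_left tkernel_sym)
  also have "\<dots> = (\<Sum>us\<in>Young_group \<tau>. if us = list_id \<tau> then f w * of_nat (card (Young_group \<tau>)) else 0)"
  proof (intro sum.cong refl)
    fix us assume us: "us \<in> Young_group \<tau>"
    have ti: "list_inv (list_id ss) = list_id ss" for ss by (induction ss) simp_all
    have "list_inv us = list_id \<tau> \<longleftrightarrow> us = list_id \<tau>" using Young_group_inv_inv[OF us] ti by metis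
    then show "f (w \<circ> halves_perm ?N (block_perm \<tau> us) id) * (\<Sum>L\<in>parts_list \<tau>. tensor_dim L
      * (\<Sum>y\<in>tabs_list L. tkernel L y (lact (list_inv us) y))) =
       (if us = list_id \<tau> then f w * of_nat (card (Young_group \<tau>)) else 0)"
      using tkernel_completeness[OF Young_group_inv[OF us]] by (auto simp: block_perm_id halves_perm_id)
  qed
  also have "\<dots> = f w * of_nat (card (Young_group \<tau>))" using Young_group_id[of \<tau>] by (simp add: list_id_def)
  finally show ?thesis using card_Young_group_nonzero by simp
qed

lemma admD:
  assumes "admissible \<tau> L H" "w permutes {..<2 * sum_list \<tau>}"
  shows "H w y z = (\<Sum>x\<in>tabs_list L. tkernel L y x * H w x z)"
    "H w y z = (\<Sum>x\<in>tabs_list L. tkernel L z x * H w y x)"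
    "us \<in> Young_group \<tau> \<Longrightarrow> vs \<in> Young_group \<tau> \<Longrightarrow> y \<in> tabs_list L \<Longrightarrow> z \<in> tabs_list L \<Longrightarrow>
       H (w \<circ> halves_perm (sum_list \<tau>) (block_perm \<tau> us) (block_perm \<tau> vs)) y z = H w (lact us y) (lact vs z)"
    "H (w \<circ> swap_halves (sum_list \<tau>)) y z = - H w z y"
  using assms unfolding admissible_def by blast+

lemma synthesis_diag_invariant:
  assumes L: "L \<in> parts_list \<tau>" and H: "admissible \<tau> L H"
  shows "diag_invariant \<tau> (synthesis \<tau> L H)"
  unfolding diag_invariant_def synthesis_def
proof (intro allI impI)
  fix w us assume w: "w permutes {..<2 * sum_list \<tau>}" and us: "us \<in> Young_group \<tau>"
  have "(\<Sum>y\<in>tabs_list L. H (w \<circ> halves_perm (sum_list \<tau>) (block_perm \<tau> us) (block_perm \<tau> us)) y y)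
    = (\<Sum>y\<in>tabs_list L. H w (lact us y) (lact us y))"
    using admD(3)[OF H w us us] by simp
  also have "\<dots> = (\<Sum>y\<in>tabs_list L. H w y y)"
    using sum_tabs_list_lact[of us L "\<lambda>y. H w y y"] us parts_list_sum_list[OF L] by simp
  finally show "tensor_dim L / of_nat (card (Young_group \<tau>))
    * (\<Sum>y\<in>tabs_list L. H (w \<circ> halves_perm (sum_list \<tau>) (block_perm \<tau> us) (block_perm \<tau> us)) y y) =
    tensor_dim L / of_nat (card (Young_group \<tau>)) * (\<Sum>y\<in>tabs_list L. H w y y)" by simp
qed

lemma synthesis_swap_odd:
  assumes H: "admissible \<tau> L H" shows "swap_odd \<tau> (synthesis \<tau> L H)"
  unfolding swap_odd_def synthesis_def using admD(4)[OF H] by (simp add: sum_negf)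

text \<open>Orthogonality annihilates all coefficients but the one at \<open>L\<close>; there it
  leaves two kernels, which the projection equations of \<open>admissible\<close> absorb.\<close>

theorem young_fourier_synthesis:
  assumes M: "M \<in> parts_list \<tau>" and L: "L \<in> parts_list \<tau>" and H: "admissible \<tau> L H" and w:
    "w permutes {..<2 * sum_list \<tau>}"
  shows "young_fourier \<tau> M (synthesis \<tau> L H) w y z = (if M = L \<and> y \<in> tabs_list L then H w y z else 0)"
proof (cases "y \<in> tabs_list M \<and> z \<in> tabs_list M")
  case True
  let ?N = "sum_list \<tau>" let ?c = "of_nat (card (Young_group \<tau>)) :: complex"
  have \<tau>: "\<tau> = map sum_list L" "\<tau> = map sum_list M" using parts_list_sum_list[OF L] parts_list_sum_list[OF M] by auto
  have lens: "length L = length \<tau>" "length M = length \<tau>" using length_listset[OF L] length_listset[OF M] by auto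
  have ly: "length y = length M" "length z = length M" using True by (auto simp: length_listset)
  have S: "synthesis \<tau> L H (w \<circ> halves_perm ?N (block_perm \<tau> us) id) * tkernel M (lact (list_inv us) y) z =
     (\<Sum>x\<in>tabs_list L. \<Sum>x1\<in>tabs_list L. tensor_dim L / ?c * (H w x1 x * (tkernel L x1 (lact us x) * tkernel M
       (lact us z) y)))"
    if us: "us \<in> Young_group \<tau>" for us
  proof -
    have id: "H (w \<circ> halves_perm ?N (block_perm \<tau> us) id) x x = H w (lact us x) x" if "x \<in> tabs_list L" for x
      using admD(3)[OF H w us Young_group_id that that] that lens
        by (simp add: block_perm_id lact_id length_listset list_id_def[symmetric])
    have "list_inv us \<in> Young_group (map sum_list M)" unfolding \<tau>(2)[symmetric] by (rule Young_group_inv[OF us])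
    then have "tkernel M (lact (list_inv us) y) z = tkernel M (lact us z) y"
      using tkernel_lact_left[of "list_inv us" M y z] ly by (simp add: Young_group_inv_inv[OF us] tkernel_sym[of M y])
    then have "synthesis \<tau> L H (w \<circ> halves_perm ?N (block_perm \<tau> us) id) * tkernel M (lact (list_inv us) y) z =
       tensor_dim L / ?c * (\<Sum>x\<in>tabs_list L. H w (lact us x) x) * tkernel M (lact us z) y"
      by (simp add: synthesis_def id)
    \<comment> \<open>The projection equation of \<open>H\<close> is applied backwards, so that the
      sum over \<open>us\<close> contains a product of two kernels as in
      \<open>tkernel_orthogonality\<close>.\<close>
    also have "(\<Sum>x\<in>tabs_list L. H w (lact us x) x)
      = (\<Sum>x\<in>tabs_list L. \<Sum>x1\<in>tabs_list L. tkernel L x1 (lact us x) * H w x1 x)"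
      using admD(1)[OF H w, of "lact us _"] by (simp add: tkernel_sym[of L "lact us _"])
    also have "tensor_dim L / ?c * (\<Sum>x\<in>tabs_list L. \<Sum>x1\<in>tabs_list L. tkernel L x1 (lact us x) * H w x1 x)
      * tkernel M (lact us z) y =
      (\<Sum>x\<in>tabs_list L. \<Sum>x1\<in>tabs_list L. tensor_dim L / ?c * (H w x1 x * (tkernel L x1 (lact us x) * tkernel M
        (lact us z) y)))"
      by (simp add: sum_distrib_left sum_distrib_right mult_ac)
    finally show ?thesis .
  qed
  have "young_fourier \<tau> M (synthesis \<tau> L H) w y z = (\<Sum>us\<in>Young_group \<tau>. \<Sum>x\<in>tabs_list L. \<Sum>x1\<in>tabs_list L.
      tensor_dim L / ?c * (H w x1 x * (tkernel L x1 (lact us x) * tkernel M (lact us z) y)))"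
    using True by (simp add: young_fourier_def S)
  also have "\<dots> = (\<Sum>x\<in>tabs_list L. \<Sum>us\<in>Young_group \<tau>. \<Sum>x1\<in>tabs_list L.
      tensor_dim L / ?c * (H w x1 x * (tkernel L x1 (lact us x) * tkernel M (lact us z) y)))" by (rule sum.swap)
  also have "\<dots> = (\<Sum>x\<in>tabs_list L. \<Sum>x1\<in>tabs_list L. \<Sum>us\<in>Young_group \<tau>.
      tensor_dim L / ?c * (H w x1 x * (tkernel L x1 (lact us x) * tkernel M
        (lact us z) y)))" by (intro sum.cong refl sum.swap)
  also have "\<dots> = (\<Sum>x\<in>tabs_list L. \<Sum>x1\<in>tabs_list L. tensor_dim L / ?c * (H w x1 x *
      (if L = M then ?c / tensor_dim L * tkernel L x z * tkernel L x1 y else 0)))"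
  proof (intro sum.cong refl)
    fix x x1 assume x: "x \<in> tabs_list L" "x1 \<in> tabs_list L"
    have "(\<Sum>us\<in>Young_group \<tau>. tkernel L x1 (lact us x) * tkernel M (lact us z) y)
      = (if L = M then ?c / tensor_dim L * tkernel L x z * tkernel L x1 y else 0)"
      by (rule tkernel_orthogonality[OF L M]) (use x ly lens in \<open>auto simp: length_listset\<close>)
    then show "(\<Sum>us\<in>Young_group \<tau>. tensor_dim L / ?c
      * (H w x1 x * (tkernel L x1 (lact us x) * tkernel M (lact us z) y))) =
      tensor_dim L / ?c * (H w x1 x * (if L = M then ?c / tensor_dim L * tkernel L x z * tkernel L x1 y else 0))"
      by (simp only: sum_distrib_left[symmetric])
  qed
  also have "\<dots> = (if M = L \<and> y \<in> tabs_list L then H w y z else 0)"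
  proof (cases "L = M")
    case e: True
    have "(\<Sum>x\<in>tabs_list L. \<Sum>x1\<in>tabs_list L. tensor_dim L / ?c * (H w x1 x * (?c / tensor_dim L * tkernel L x z
      * tkernel L x1 y))) =
      (\<Sum>x\<in>tabs_list L. tkernel L z x * (\<Sum>x1\<in>tabs_list L. tkernel L y x1 * H w x1 x))"
      using tensor_dim_nonzero[OF L] card_Young_group_nonzero[of \<tau>]
      by (simp add: sum_distrib_left mult_ac tkernel_sym[of L y] tkernel_sym[of L z])
    also have "\<dots> = H w y z" by (simp only: admD(1)[OF H w, symmetric] admD(2)[OF H w, symmetric])
    finally show ?thesis using e True by simp
  qed auto
  finally show ?thesis .
next
  case False
  have "H w y z = 0" if "z \<notin> tabs_list L" using admD(2)[OF H w, of y z] that by (simp add: tkernel_outside)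
  then show ?thesis using False by (auto simp: young_fourier_def tkernel_outside2)
qed

section \<open>Rotation of the list of block sizes\<close>

definition cyclic_shift :: "nat \<Rightarrow> nat \<Rightarrow> nat \<Rightarrow> nat" where
  "cyclic_shift N s q = (if q < 2 * N then (if q + s < 2 * N then q + s else q + s - 2 * N) else q)"

lemma cyclic_shift_permutes: "s \<le> N \<Longrightarrow> cyclic_shift N s permutes {..<2 * N}"
proof (rule bij_imp_permutes)
  assume s: "s \<le> N"
  show "bij_betw (cyclic_shift N s) {..<2 * N} {..<2 * N}"
    by (rule bij_betwI[where g = "\<lambda>q. if s \<le> q then q - s else q + 2 * N - s"])
       (use s in \<open>auto simp: cyclic_shift_def\<close>)
qed (auto simp: cyclic_shift_def)

lemma block_perm_append:
  "us \<in> Young_group ss \<Longrightarrow> block_perm (ss @ [s]) (us @ [u]) q =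
     (if q < sum_list ss then block_perm ss us q else
       if q < sum_list ss + s then sum_list ss + u (q - sum_list ss) else q)"
proof (induction ss arbitrary: us q)
  case (Cons s' ss)
  then obtain u' us' where e: "us = u' # us'" "us' \<in> Young_group ss" by auto
  show ?case using Cons.IH[OF e(2), of "q - s'"] by (auto simp: e(1))
qed auto

lemma sum_Young_group_append:
  "(\<Sum>us\<in>Young_group (ss @ [s]). g us) = (\<Sum>us\<in>Young_group ss. \<Sum>u\<in>Sym s. g (us @ [u]))"
proof (induction ss arbitrary: g)
  case Nil
  have "Young_group [s] = set_Cons (Sym s) {[]}" by simp
  then show ?case using sum_set_Cons[of g "Sym s" "{[]}"] by simp
next
  case (Cons s' ss) then show ?case by (simp add: sum_set_Cons)
qed

lemma tkernel_append:
  "length ys = length L \<Longrightarrow> length zs = length L \<Longrightarrow>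
    tkernel (L @ [l]) (ys @ [y]) (zs @ [z]) = tkernel L ys zs * skernel l y z"
proof (induction L arbitrary: ys zs)
  case Nil
  then show ?case by simp
next
  case (Cons l' L)
  then show ?case by (cases ys; cases zs) auto
qed

lemma lact_append:
  "length us = length ys \<Longrightarrow> lact (us @ [u]) (ys @ [y]) = lact us ys @ [pact u y]"
  by (induction us ys rule: list_induct2) auto

lemma listset_append1: "xs @ [x] \<in> listset (As @ [A]) \<longleftrightarrow> xs \<in> listset As \<and> x \<in> A"
proof (induction As arbitrary: xs)
  case Nil then show ?case by (cases xs) auto
next
  case (Cons B As) then show ?case by (cases xs) (auto dest: length_listset)
qed

text \<open>The shift by \<open>s\<close> turns the layout \<open>ss @ [s]\<close> of both halves
  into \<open>s # ss\<close>. The last block of each half becomes the first block of the other half,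
  which is why \<open>u\<close> and \<open>v\<close> change places.\<close>

lemma cyclic_shift_conj:
  assumes us: "us \<in> Young_group ss" and u: "u permutes {..<s}" and vs: "vs \<in> Young_group ss" and v:
    "v permutes {..<s}"
    and N: "N = s + sum_list ss"
  shows "cyclic_shift N s \<circ> halves_perm N (block_perm (ss @ [s]) (us @ [u])) (block_perm (ss @ [s]) (vs @ [v])) =
    halves_perm N (block_perm (s # ss) (v # us)) (block_perm (s # ss) (u # vs)) \<circ> cyclic_shift N s"
proof
  fix q
  note b = block_perm_less[OF us] block_perm_less[OF vs] permutes_less[OF u] permutes_less[OF v]
  consider "q < sum_list ss" | "sum_list ss \<le> q" "q < N" | "N \<le> q" "q < N + sum_list ss"
    | "N + sum_list ss \<le> q" "q < 2 * N" | "2 * N \<le> q" by linarith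
  then show "(cyclic_shift N s \<circ> halves_perm N (block_perm (ss @ [s]) (us @ [u])) (block_perm (ss @ [s])
    (vs @ [v]))) q =
    (halves_perm N (block_perm (s # ss) (v # us)) (block_perm (s # ss) (u # vs)) \<circ> cyclic_shift N s) q"
  proof cases
    case 1 then show ?thesis using b(1)[of q] N by
      (simp add: halves_perm_apply block_perm_append[OF us] cyclic_shift_def)
  next
    case 2
    define x where "x = q - sum_list ss"
    have x: "q = sum_list ss + x" "x < s" using 2 N by (auto simp: x_def)
    show ?thesis using b(3)[OF x(2)] x N by (simp add: halves_perm_apply block_perm_append[OF us] cyclic_shift_def)
  next
    case 3
    define x where "x = q - N"
    have x: "q = N + x" "x < sum_list ss" using 3 by (auto simp: x_def)
    show ?thesis using b(2)[OF x(2)] x N by (simp add: halves_perm_apply block_perm_append[OF vs] cyclic_shift_def)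
  next
    case 4
    define x where "x = q - N - sum_list ss"
    have x: "q = N + (sum_list ss + x)" "x < s" using 4 N by (auto simp: x_def)
    show ?thesis using b(4)[OF x(2)] x N by (simp add: halves_perm_apply block_perm_append[OF vs] cyclic_shift_def)
  next
    case 5 then show ?thesis using N by (simp add: halves_perm_apply cyclic_shift_def)
  qed
qed

lemma conj_inv:
  assumes "\<rho> permutes S" "\<rho> \<circ> D = B \<circ> \<rho>" shows "D \<circ> inv \<rho> = inv \<rho> \<circ> B"
proof
  fix x
  have "inv \<rho> (\<rho> (D (inv \<rho> x))) = inv \<rho> (B (\<rho> (inv \<rho> x)))"
    using fun_cong[OF assms(2), of "inv \<rho> x"] unfolding comp_apply by (rule arg_cong)
  then show "(D \<circ> inv \<rho>) x = (inv \<rho> \<circ> B) x" unfolding comp_apply permutes_inverses[OF assms(1)] .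
qed

text \<open>The moved block changes halves. Its permutation \<open>u\<close> arrives in the second
  half and returns to the first as an inverse, so that the two indices of this block,
  \<open>y0\<close> and \<open>z0\<close>, are exchanged while the others stay.\<close>

theorem young_fourier_rotate1:
  assumes L: "l # L \<in> parts_list (s # ss)" and f: "diag_invariant (s # ss) f"
    and f': "\<And>w. w permutes {..<2 * sum_list (s # ss)} \<Longrightarrow> f' w = c * f (w \<circ> inv (cyclic_shift (sum_list (s # ss)) s))"
    and w: "w permutes {..<2 * sum_list (s # ss)}"
    and y: "ys \<in> tabs_list L" "y0 \<in> tabs l" and z: "zs \<in> tabs_list L" "z0 \<in> tabs l"
  shows "young_fourier (ss @ [s]) (L @ [l]) f' w (ys @ [y0]) (zs @ [z0]) =
    c * young_fourier (s # ss) (l # L) f (w \<circ> inv (cyclic_shift (sum_list (s # ss)) s)) (z0 # ys) (y0 # zs)"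
proof -
  define N where "N = s + sum_list ss"
  define \<rho> where "\<rho> = cyclic_shift N s"
  define w' where "w' = w \<circ> inv \<rho>"
  have rp: "\<rho> permutes {..<2 * N}" unfolding \<rho>_def by (rule cyclic_shift_permutes) (simp add: N_def)
  have w': "w' permutes {..<2 * N}" unfolding w'_def using permutes_compose[OF permutes_inv[OF rp]] w
    by (simp add: N_def)
  have Ls: "s = sum_list l" "ss = map sum_list L" "l \<in> parts s" "L \<in> parts_list ss"
    using parts_list_sum_list[OF L] L by auto
  have lens: "length ys = length ss" "length zs = length ss" "length L = length ss"
    using length_listset[OF y(1)] length_listset[OF z(1)] length_listset[OF Ls(4)] by simp_all
  have ff: "f' (w \<circ> halves_perm N (block_perm (ss @ [s]) (us @ [u])) id)
    = c * f (w' \<circ> halves_perm N (block_perm (s # ss) (inv u # us)) id)"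
    if us: "us \<in> Young_group ss" and u: "u permutes {..<s}" for us u
  proof -
    have m: "us @ [u] \<in> Young_group (ss @ [s])" using us u by (simp add: listset_append1)
    have m1: "id # us \<in> Young_group (s # ss)" "u # list_id ss \<in> Young_group (s # ss)"
      "inv u # us \<in> Young_group (s # ss)"
      using us u by (auto simp: permutes_id Young_group_id permutes_inv)
    note p = block_perm_permutes[OF m1(1)] block_perm_permutes[OF m1(2)] block_perm_permutes[OF m1(3)]
    have N': "sum_list (s # ss) = N" "sum_list (ss @ [s]) = N" by (auto simp: N_def)
    have "halves_perm N (block_perm (ss @ [s]) (us @ [u])) id permutes {..<2 * N}"
      using block_perm_permutes[OF m] unfolding N' by (intro halves_perm_permutes permutes_id)
    then have "w \<circ> halves_perm N (block_perm (ss @ [s]) (us @ [u])) id permutes {..<2 * N}"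
      using permutes_compose w N' by metis
    then have 1: "f' (w \<circ> halves_perm N (block_perm (ss @ [s]) (us @ [u])) id)
      = c * f (w \<circ> halves_perm N (block_perm (ss @ [s]) (us @ [u])) id \<circ> inv \<rho>)"
      using f'[of "w \<circ> halves_perm N (block_perm (ss @ [s]) (us @ [u])) id"] unfolding N' \<rho>_def by blast
    have idb: "block_perm (ss @ [s]) (list_id ss @ [id]) = id"
      using block_perm_id[of "ss @ [s]"] by (simp add: list_id_def)
    have "halves_perm N (block_perm (ss @ [s]) (us @ [u])) id \<circ> inv \<rho> =
        inv \<rho> \<circ> halves_perm N (block_perm (s # ss) (id # us)) (block_perm (s # ss) (u # list_id ss))"
      using cyclic_shift_conj[OF us u Young_group_id permutes_id N_def] unfolding idb \<rho>_def[symmetric]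
        by (rule conj_inv[OF rp])
    then have 2: "w \<circ> halves_perm N (block_perm (ss @ [s]) (us @ [u])) id \<circ> inv \<rho> =
        w' \<circ> halves_perm N (block_perm (s # ss) (id # us)) (block_perm (s # ss) (u # list_id ss))"
      by (simp add: w'_def comp_assoc)
    \<comment> \<open>Splitting off the diagonal element of \<open>u # list_id ss\<close>, which
      \<open>f\<close> ignores, replaces \<open>u\<close> in the second half by \<open>inv u\<close>
      in the first.\<close>
    have "block_perm (s # ss) (id # us) = block_perm (s # ss) (inv u # us) \<circ> block_perm (s # ss) (u # list_id ss)"
    proof -
      have "list_comp us (list_id ss) = us" using us by (induction ss arbitrary: us) auto
      then show ?thesis using block_perm_comp[OF m1(3,2)] permutes_inv_o[OF u] by simp
    qed
    then have 3: "halves_perm N (block_perm (s # ss) (id # us)) (block_perm (s # ss) (u # list_id ss)) =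
      halves_perm N (block_perm (s # ss) (inv u # us)) id \<circ> halves_perm N (block_perm (s # ss) (u # list_id ss))
        (block_perm (s # ss) (u # list_id ss))"
      using p N' by (simp add: halves_perm_comp permutes_id)
    have "w' \<circ> halves_perm N (block_perm (s # ss) (inv u # us)) id permutes {..<2 * N}"
      using p(3) w' N' by (metis permutes_compose halves_perm_permutes permutes_id)
    then have "f (w' \<circ> halves_perm N (block_perm (s # ss) (id # us)) (block_perm (s # ss) (u # list_id ss))) =
       f (w' \<circ> halves_perm N (block_perm (s # ss) (inv u # us)) id)"
      using f m1(2) unfolding 3 comp_assoc[symmetric] diag_invariant_def N' by blast
    then show ?thesis using 1 2 by simp
  qed
  have "young_fourier (ss @ [s]) (L @ [l]) f' w (ys @ [y0]) (zs @ [z0]) =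
    (\<Sum>us\<in>Young_group ss. \<Sum>u\<in>Sym s. c * f (w' \<circ> halves_perm N (block_perm (s # ss) (inv u # us)) id) *
       (tkernel L (lact (list_inv us) ys) zs * skernel l (pact (inv u) y0) z0))"
  proof -
    have N': "sum_list (ss @ [s]) = N" by (simp add: N_def)
    have t: "list_inv (us @ [u]) = list_inv us @ [inv u]" for us u by (simp add: list_inv_def)
    have "ys @ [y0] \<in> tabs_list (L @ [l])" using y by (simp add: listset_append1)
    then have "young_fourier (ss @ [s]) (L @ [l]) f' w (ys @ [y0]) (zs @ [z0]) = (\<Sum>us\<in>Young_group ss. \<Sum>u\<in>Sym s.
       f' (w \<circ> halves_perm N (block_perm (ss @ [s]) (us @ [u])) id) * tkernel (L @ [l])
         (lact (list_inv us @ [inv u]) (ys @ [y0])) (zs @ [z0]))"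
      unfolding young_fourier_def N' sum_Young_group_append t by simp
    also have "\<dots> = (\<Sum>us\<in>Young_group ss. \<Sum>u\<in>Sym s. c * f (w' \<circ> halves_perm N (block_perm (s # ss) (inv u # us)) id) *
       (tkernel L (lact (list_inv us) ys) zs * skernel l (pact (inv u) y0) z0))"
    proof (intro sum.cong refl)
      fix us u assume a: "us \<in> Young_group ss" "u \<in> Sym s"
      have "length (list_inv us) = length ys" using length_listset[OF a(1)] lens by simp
      then have "tkernel (L @ [l]) (lact (list_inv us @ [inv u]) (ys @ [y0])) (zs @ [z0])
        = tkernel L (lact (list_inv us) ys) zs * skernel l (pact (inv u) y0) z0"
        using lens by (simp add: lact_append tkernel_append)
      then show "f' (w \<circ> halves_perm N (block_perm (ss @ [s]) (us @ [u])) id)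
        * tkernel (L @ [l]) (lact (list_inv us @ [inv u]) (ys @ [y0])) (zs @ [z0]) =
        c * f (w' \<circ> halves_perm N (block_perm (s # ss) (inv u # us)) id) *
          (tkernel L (lact (list_inv us) ys) zs * skernel l (pact (inv u) y0) z0)"
        using ff[OF a(1)] a(2) by simp
    qed
    finally show ?thesis .
  qed
  also have "\<dots> = (\<Sum>us\<in>Young_group ss. \<Sum>u\<in>Sym s. c * f (w' \<circ> halves_perm N (block_perm (s # ss) (u # us)) id) *
       (tkernel L (lact (list_inv us) ys) zs * skernel l (pact u y0) z0))"
  proof (rule sum.cong[OF refl])
    fix us
    show "(\<Sum>u\<in>Sym s. c * f (w' \<circ> halves_perm N (block_perm (s # ss) (inv u # us)) id) *
       (tkernel L (lact (list_inv us) ys) zs * skernel l (pact (inv u) y0) z0)) =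
         (\<Sum>u\<in>Sym s. c * f (w' \<circ> halves_perm N (block_perm (s # ss) (u # us)) id) *
       (tkernel L (lact (list_inv us) ys) zs * skernel l (pact u y0) z0))"
      by (rule sum_Sym_inv[of "\<lambda>v. c * f (w' \<circ> halves_perm N (block_perm (s # ss) (v # us)) id) *
       (tkernel L (lact (list_inv us) ys) zs * skernel l (pact v y0) z0)"])
  qed
  also have "\<dots> = c * young_fourier (s # ss) (l # L) f w' (z0 # ys) (y0 # zs)"
  proof -
    have N': "sum_list (s # ss) = N" by (simp add: N_def)
    have m: "z0 # ys \<in> tabs_list (l # L)" using y z by simp
    have "young_fourier (s # ss) (l # L) f w' (z0 # ys) (y0 # zs) = (\<Sum>us\<in>Young_group ss. \<Sum>u\<in>Sym s.
       f (w' \<circ> halves_perm N (block_perm (s # ss) (u # us)) id) * (skernel l (pact (inv u) z0) y0 * tkernel L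
         (lact (list_inv us) ys) zs))"
      unfolding young_fourier_def N' using m by (simp only: if_True list.map listset.simps sum_set_Cons)
        (subst sum.swap, simp)
    also have "\<dots> = (\<Sum>us\<in>Young_group ss. \<Sum>u\<in>Sym s.
       f (w' \<circ> halves_perm N (block_perm (s # ss) (u # us)) id) *
         (tkernel L (lact (list_inv us) ys) zs * skernel l (pact u y0) z0))"
    proof (intro sum.cong refl)
      fix us u assume "u \<in> Sym s"
      then have "skernel l (pact (inv u) z0) y0 = skernel l (pact u y0) z0"
        using skernel_pact_left[of "inv u" l z0 y0] Ls(1) by
          (simp add: permutes_inv permutes_inv_inv skernel_sym[of l z0])
      then show "f (w' \<circ> halves_perm N (block_perm (s # ss) (u # us)) id) * (skernel l (pact (inv u) z0) y0
        * tkernel L (lact (list_inv us) ys) zs) =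
        f (w' \<circ> halves_perm N (block_perm (s # ss) (u # us)) id) *
          (tkernel L (lact (list_inv us) ys) zs * skernel l (pact u y0) z0)" by simp
    qed
    finally show ?thesis by (simp add: sum_distrib_left mult_ac)
  qed
  finally show ?thesis by (simp add: w'_def \<rho>_def N_def)
qed

definition young_fourier_vanishes :: "nat list \<Rightarrow> nat list list \<Rightarrow> ((nat \<Rightarrow> nat) \<Rightarrow> complex) \<Rightarrow> bool" where
  "young_fourier_vanishes \<tau> L f \<longleftrightarrow> (\<forall>w y z. w permutes {..<2 * sum_list \<tau>} \<longrightarrow> y \<in> tabs_list L \<longrightarrow> z \<in> tabs_list L
    \<longrightarrow> young_fourier \<tau> L f w y z = 0)"

text \<open>Accumulates the inverse shifts of \<open>k\<close> single rotations; the amount of each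
  shift is the size of the block that stands first at that stage.\<close>

primrec rotation_perm :: "nat list \<Rightarrow> nat \<Rightarrow> nat \<Rightarrow> nat" where
  "rotation_perm \<tau> 0 = id"
| "rotation_perm \<tau> (Suc k) = inv (cyclic_shift (sum_list \<tau>) (hd (rotate k \<tau>))) \<circ> rotation_perm \<tau> k"

lemma sum_list_rotate [simp]: "sum_list (rotate k \<tau>) = sum_list (\<tau> :: nat list)"
proof (induction k)
  case (Suc k)
  have "sum_list (rotate1 xs) = sum_list xs" for xs :: "nat list" by (cases xs) auto
  then show ?case using Suc by simp
qed simp

lemma parts_list_rotate: "L \<in> parts_list \<tau> \<Longrightarrow> rotate k L \<in> parts_list (rotate k \<tau>)"
proof (induction k)
  case (Suc k)
  have "rotate1 xs \<in> parts_list (rotate1 ss)" if "xs \<in> parts_list ss" for xs ss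
    using that by (cases ss) (auto simp: listset_append1)
  then show ?case using Suc by simp
qed simp

lemma diag_invariant_rotate1:
  assumes f: "diag_invariant (s # ss) f"
  shows "diag_invariant (ss @ [s]) (\<lambda>w. f (w \<circ> inv (cyclic_shift (sum_list (s # ss)) s)))"
  unfolding diag_invariant_def
proof (intro allI impI)
  fix w us' assume w: "w permutes {..<2 * sum_list (ss @ [s])}" and us': "us' \<in> Young_group (ss @ [s])"
  define N where "N = s + sum_list ss"
  have N': "sum_list (ss @ [s]) = N" "sum_list (s # ss) = N" by (auto simp: N_def)
  have rp: "cyclic_shift N s permutes {..<2 * N}" by (rule cyclic_shift_permutes) (simp add: N_def)
  have "us' \<noteq> []" using length_listset[OF us'] by auto
  then obtain us u where e: "us' = us @ [u]" by (metis rev_exhaust)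
  have us: "us \<in> Young_group ss" "u permutes {..<s}" using us' by (auto simp: e listset_append1)
  have "w \<circ> inv (cyclic_shift N s) permutes {..<2 * N}" using w permutes_compose[OF permutes_inv[OF rp]]
    by (simp only: N')
  moreover have "halves_perm N (block_perm (ss @ [s]) us') (block_perm (ss @ [s]) us') \<circ> inv (cyclic_shift N s) =
      inv (cyclic_shift N s) \<circ> halves_perm N (block_perm (s # ss) (u # us)) (block_perm (s # ss) (u # us))"
    unfolding e by (rule conj_inv[OF rp cyclic_shift_conj[OF us us N_def]])
  then have e2: "w \<circ> halves_perm N (block_perm (ss @ [s]) us') (block_perm (ss @ [s]) us') \<circ> inv (cyclic_shift N s) =
    w \<circ> inv (cyclic_shift N s) \<circ> halves_perm N (block_perm (s # ss) (u # us)) (block_perm (s # ss)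
      (u # us))" by (simp add: comp_assoc)
  moreover have "u # us \<in> Young_group (s # ss)" using us by simp
  ultimately show "f (w \<circ> halves_perm (sum_list (ss @ [s])) (block_perm (ss @ [s]) us') (block_perm (ss @ [s])
    us') \<circ> inv (cyclic_shift (sum_list (s # ss)) s)) =
      f (w \<circ> inv (cyclic_shift (sum_list (s # ss)) s))"
    using f unfolding N' e2 diag_invariant_def by blast
qed

text \<open>Translating \<open>w\<close> and exchanging the indices of one block are bijections, so
  the coefficients vanish together even though they are not equal entry by entry.\<close>

lemma young_fourier_vanishes_rotate1:
  assumes L: "l # L \<in> parts_list (s # ss)" and f: "diag_invariant (s # ss) f"
  shows "young_fourier_vanishes (ss @ [s]) (L @ [l]) (\<lambda>w. f (w \<circ> inv (cyclic_shift (sum_list (s # ss)) s))) \<longleftrightarrow>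
    young_fourier_vanishes (s # ss) (l # L) f"
proof -
  define N where "N = s + sum_list ss"
  have N': "sum_list (ss @ [s]) = N" "sum_list (s # ss) = N" by (auto simp: N_def)
  have rp: "cyclic_shift N s permutes {..<2 * N}" by (rule cyclic_shift_permutes) (simp add: N_def)
  have rot: "young_fourier (ss @ [s]) (L @ [l]) (\<lambda>w. f (w \<circ> inv (cyclic_shift N s))) w (ys @ [y0]) (zs @ [z0]) =
    young_fourier (s # ss) (l # L) f (w \<circ> inv (cyclic_shift N s)) (z0 # ys) (y0 # zs)"
    if "w permutes {..<2 * N}" "ys \<in> tabs_list L" "y0 \<in> tabs l" "zs \<in> tabs_list L" "z0 \<in> tabs l" for w ys y0 zs z0
    using young_fourier_rotate1[OF L f, of "\<lambda>w. f (w \<circ> inv (cyclic_shift N s))" 1 w ys y0 zs z0] that unfolding N'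
      by simp
  show ?thesis unfolding N' young_fourier_vanishes_def
  proof (intro iffI allI impI)
    fix w y z
    assume h: "\<forall>w y z. w permutes {..<2 * N} \<longrightarrow> y \<in> tabs_list (L @ [l]) \<longrightarrow> z \<in> tabs_list (L @ [l]) \<longrightarrow>
        young_fourier (ss @ [s]) (L @ [l]) (\<lambda>w. f (w \<circ> inv (cyclic_shift N s))) w y z = 0"
      and w: "w permutes {..<2 * N}" and y: "y \<in> tabs_list (l # L)" and z: "z \<in> tabs_list (l # L)"
    obtain y0 ys z0 zs where e: "y = y0 # ys" "z = z0 # zs" "y0 \<in> tabs l" "z0 \<in> tabs l" "ys \<in> tabs_list L"
      "zs \<in> tabs_list L"
      using y z by auto
    have w': "w \<circ> cyclic_shift N s permutes {..<2 * N}" using permutes_compose[OF rp w] .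
    have "w \<circ> cyclic_shift N s \<circ> inv (cyclic_shift N s) = w" by (simp add: comp_assoc permutes_inv_o[OF rp])
    then have "young_fourier (s # ss) (l # L) f w y z
      = young_fourier (ss @ [s]) (L @ [l]) (\<lambda>w. f (w \<circ> inv (cyclic_shift N s))) (w \<circ> cyclic_shift N s) (ys @ [z0])
        (zs @ [y0])"
      using rot[OF w' e(5,4,6,3)] e by simp
    moreover have "ys @ [z0] \<in> tabs_list (L @ [l])" "zs @ [y0] \<in> tabs_list (L @ [l])" using e
      by (auto simp: listset_append1)
    ultimately show "young_fourier (s # ss) (l # L) f w y z = 0" using h w' by simp
  next
    fix w y z
    assume h: "\<forall>w y z. w permutes {..<2 * N} \<longrightarrow> y \<in> tabs_list (l # L) \<longrightarrow> z \<in> tabs_list (l # L)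
      \<longrightarrow> young_fourier (s # ss) (l # L) f w y z = 0"
      and w: "w permutes {..<2 * N}" and y: "y \<in> tabs_list (L @ [l])" and z: "z \<in> tabs_list (L @ [l])"
    have "y \<noteq> []" "z \<noteq> []" using length_listset[OF y] length_listset[OF z] by auto
    then obtain y0 ys z0 zs where e: "y = ys @ [y0]" "z = zs @ [z0]" by (metis rev_exhaust)
    then have m: "ys \<in> tabs_list L" "y0 \<in> tabs l" "zs \<in> tabs_list L" "z0 \<in> tabs l" using y z
      by (auto simp: listset_append1)
    have w': "w \<circ> inv (cyclic_shift N s) permutes {..<2 * N}" using permutes_compose[OF permutes_inv[OF rp] w] .
    have "z0 # ys \<in> tabs_list (l # L)" "y0 # zs \<in> tabs_list (l # L)" using m by auto
    then show "young_fourier (ss @ [s]) (L @ [l]) (\<lambda>w. f (w \<circ> inv (cyclic_shift N s))) w y z = 0"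
      using rot[OF w m] h w' by (simp add: e)
  qed
qed

lemma young_fourier_vanishes_rotate:
  assumes "L \<in> parts_list \<tau>" "diag_invariant \<tau> f" "\<tau> \<noteq> []"
  shows "diag_invariant (rotate k \<tau>) (\<lambda>w. f (w \<circ> rotation_perm \<tau> k)) \<and>
    (young_fourier_vanishes (rotate k \<tau>) (rotate k L) (\<lambda>w. f (w \<circ> rotation_perm \<tau> k)) \<longleftrightarrow> young_fourier_vanishes \<tau> L f)"
proof (induction k)
  case 0 then show ?case using assms by simp
next
  case (Suc k)
  obtain s ss where t: "rotate k \<tau> = s # ss" using assms(3) by (cases "rotate k \<tau>") auto
  have "rotate k L \<in> parts_list (s # ss)" using parts_list_rotate[OF assms(1), of k] t by simp
  then obtain l L' where l: "rotate k L = l # L'" by auto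
  have L': "l # L' \<in> parts_list (s # ss)" using parts_list_rotate[OF assms(1), of k] t l by simp
  have N: "sum_list \<tau> = sum_list (s # ss)" using sum_list_rotate[of k \<tau>] t by simp
  have r: "(\<lambda>w. f (w \<circ> rotation_perm \<tau> (Suc k)))
    = (\<lambda>w. (\<lambda>w. f (w \<circ> rotation_perm \<tau> k)) (w \<circ> inv (cyclic_shift (sum_list (s # ss)) s)))"
    by (simp add: comp_assoc t N)
  show ?case unfolding r rotate_Suc t l rotate1.simps
    using diag_invariant_rotate1[of s ss "\<lambda>w. f (w \<circ> rotation_perm \<tau> k)"] young_fourier_vanishes_rotate1[OF L', of
      "\<lambda>w. f (w \<circ> rotation_perm \<tau> k)"] Suc t l
    by (simp add: comp_def)
qed

lemma rotation_perm_permutes: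
  assumes "\<tau> \<noteq> []" shows "rotation_perm \<tau> k permutes {..<2 * sum_list \<tau>}"
proof (induction k)
  case (Suc k)
  have "hd (rotate k \<tau>) \<le> sum_list (rotate k \<tau>)" using assms by (intro member_le_sum_list hd_in_set) simp_all
  then have "cyclic_shift (sum_list \<tau>) (hd (rotate k \<tau>)) permutes {..<2 * sum_list \<tau>}"
    by (intro cyclic_shift_permutes) simp
  from permutes_compose[OF Suc permutes_inv[OF this]] show ?case by (simp add: comp_def)
qed (simp add: permutes_id[unfolded id_def])

section \<open>Monomial matrices\<close>

lemma zeta_power: "zeta r ^ j = cis (2 * pi * real j / real r)"
proof -
  have "zeta r = cis (2 * pi / real r)" by (simp add: zeta_def cis_conv_exp mult.commute)
  then show ?thesis by (simp add: DeMoivre mult_ac)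
qed

lemma zeta_bij: "r > 0 \<Longrightarrow> bij_betw (\<lambda>j. zeta r ^ j) {..<r} {z. z ^ r = 1}"
  unfolding zeta_power by (rule bij_betw_roots_unity)

lemma zeta_nonzero [simp]: "zeta r \<noteq> 0"
  by (simp add: zeta_def)

lemma zeta_pow_self: "r > 0 \<Longrightarrow> zeta r ^ r = 1"
  by (simp add: zeta_power)

lemma zeta_pow_mod: "r > 0 \<Longrightarrow> zeta r ^ (j mod r) = zeta r ^ j"
proof -
  assume r: "r > 0"
  have "zeta r ^ j = zeta r ^ (j mod r + r * (j div r))" by simp
  then show ?thesis unfolding power_add power_mult zeta_pow_self[OF r] by simp
qed

lemma zeta_pow_eq_iff:
  assumes "r > 0" shows "zeta r ^ i = zeta r ^ j \<longleftrightarrow> i mod r = j mod r"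
proof -
  have "inj_on (\<lambda>j. zeta r ^ j) {..<r}" using zeta_bij[OF assms] by (simp add: bij_betw_def)
  then have "zeta r ^ (i mod r) = zeta r ^ (j mod r) \<longleftrightarrow> i mod r = j mod r"
    using assms by (auto dest: inj_onD)
  then show ?thesis using assms by (simp add: zeta_pow_mod)
qed

lemma zeta_pow_eq_1: "r > 0 \<Longrightarrow> zeta r ^ i = 1 \<longleftrightarrow> r dvd i"
  using zeta_pow_eq_iff[of r i 0] by (simp add: dvd_eq_mod_eq_0)

lemma zeta_dvd:
  assumes "p dvd r" "r > 0" shows "zeta r ^ (r div p) = zeta p"
  using assms zeta_power[of p 1] by (auto simp: zeta_power field_simps elim!: dvdE)

lemma zeta_half: "even r \<Longrightarrow> r > 0 \<Longrightarrow> zeta r ^ (r div 2) = -1"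
  by (auto simp: zeta_power elim!: evenE)

definition monomial :: "nat \<Rightarrow> nat \<Rightarrow> (nat \<Rightarrow> nat) \<Rightarrow> (nat \<Rightarrow> nat) \<Rightarrow> complex mat" where
  "monomial r n \<sigma> z = mat n n (\<lambda>(i, j). if i = \<sigma> j then zeta r ^ z j else 0)"

lemma monomial_carrier [simp]: "monomial r n \<sigma> z \<in> carrier_mat n n" "dim_row (monomial r n \<sigma> z)
  = n" "dim_col (monomial r n \<sigma> z) = n"
  by (simp_all add: monomial_def)

lemma monomial_index: "i < n \<Longrightarrow> j < n \<Longrightarrow> monomial r n \<sigma> z $$ (i, j) = (if i = \<sigma> j then zeta r ^ z j else 0)"
  by (simp add: monomial_def)

lemma monomial_cong:
  assumes "r > 0" "\<And>j. j < n \<Longrightarrow> \<sigma> j = \<rho> j" "\<And>j. j < n \<Longrightarrow> z j mod r = y j mod r"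
  shows "monomial r n \<sigma> z = monomial r n \<rho> y"
  by (rule eq_matI) (use assms in \<open>auto simp: monomial_index zeta_pow_eq_iff\<close>)

lemma perm_of_monomial [simp]:
  assumes "\<sigma> permutes {..<n}" shows "perm_of (monomial r n \<sigma> z) = \<sigma>"
proof
  fix j show "perm_of (monomial r n \<sigma> z) j = \<sigma> j"
  proof (cases "j < n")
    case True
    have "(THE i. i < n \<and> monomial r n \<sigma> z $$ (i, j) \<noteq> 0) = \<sigma> j"
      by (rule the_equality) (use True permutes_less[OF assms True] in \<open>auto simp: monomial_index split: if_splits\<close>)
    then show ?thesis using True by (simp add: perm_of_def)
  next
    case False then show ?thesis using permutes_not_in[OF assms] by (simp add: perm_of_def)
  qed
qed

lemma zexp_monomial [simp]:
  assumes "\<sigma> permutes {..<n}" "j < n" "r > 0" shows "zexp r (monomial r n \<sigma> z) j = z j mod r"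
proof -
  have "(THE k. k < r \<and> zeta r ^ z j = zeta r ^ k) = z j mod r"
    by (rule the_equality) (use assms in \<open>auto simp: zeta_pow_eq_iff\<close>)
  then show ?thesis using assms permutes_less[OF assms(1,2)] by (simp add: zexp_def monomial_index)
qed

lemma monomial_eq_iff:
  assumes "\<sigma> permutes {..<n}" "\<rho> permutes {..<n}" "r > 0"
  shows "monomial r n \<sigma> z = monomial r n \<rho> y \<longleftrightarrow> \<sigma> = \<rho> \<and> (\<forall>j<n. z j mod r = y j mod r)"
proof
  assume e: "monomial r n \<sigma> z = monomial r n \<rho> y"
  show "\<sigma> = \<rho> \<and> (\<forall>j<n. z j mod r = y j mod r)"
    using perm_of_monomial[OF assms(1)] perm_of_monomial[OF assms(2)] zexp_monomial[OF assms(1) _ assms(3)]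
      zexp_monomial[OF assms(2) _ assms(3)] e by metis
qed (auto intro: monomial_cong[OF assms(3)])

lemma monomial_in_Grn:
  assumes "\<sigma> permutes {..<n}" "r > 0" shows "monomial r n \<sigma> z \<in> carrier (Grn r n)"
proof -
  have "\<exists>!j. j < n \<and> monomial r n \<sigma> z $$ (i, j) \<noteq> 0" if "i < n" for i
    by (rule ex1I[of _ "inv \<sigma> i"])
       (use that permutes_less[OF permutes_inv[OF assms(1)] that] permutes_inverses[OF assms(1)] in \<open>auto simp:
         monomial_index split: if_splits\<close>)
  moreover have "\<exists>!i. i < n \<and> monomial r n \<sigma> z $$ (i, j) \<noteq> 0" if "j < n" for j
    by (rule ex1I[of _ "\<sigma> j"])
      (use that permutes_less[OF assms(1) that] in \<open>auto simp: monomial_index split: if_splits\<close>)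
  moreover have "(monomial r n \<sigma> z $$ (i, j)) ^ r = 1" if "i < n" "j < n" "monomial r n \<sigma> z $$ (i, j) \<noteq> 0" for i j
  proof -
    have "(monomial r n \<sigma> z $$ (i, j)) ^ r = (zeta r ^ r) ^ z j"
      using that by (auto simp: monomial_index mult.commute simp flip: power_mult split: if_splits)
    then show ?thesis using assms(2) by (simp add: zeta_pow_self)
  qed
  ultimately show ?thesis by (simp add: Grn_def)
qed

text \<open>Reduces every computation in \<open>Grn r n\<close> to permutations and
  exponents.\<close>

lemma Grn_monomial:
  assumes g: "g \<in> carrier (Grn r n)" and r: "r > 0"
  shows "\<exists>\<sigma> z. \<sigma> permutes {..<n} \<and> (\<forall>j. z j < r) \<and> g = monomial r n \<sigma> z"
proof -
  have c: "g \<in> carrier_mat n n" and row: "\<And>i. i < n \<Longrightarrow> \<exists>!j. j < n \<and> g $$ (i, j) \<noteq> 0"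
    and col_idx: "\<And>j. j < n \<Longrightarrow> \<exists>!i. i < n \<and> g $$ (i, j) \<noteq> 0"
    and rt: "\<And>i j. i < n \<Longrightarrow> j < n \<Longrightarrow> g $$ (i, j) \<noteq> 0 \<Longrightarrow> (g $$ (i, j)) ^ r = 1"
    using g by (auto simp: Grn_def)
  define \<sigma> where "\<sigma> j = (if j < n then (THE i. i < n \<and> g $$ (i, j) \<noteq> 0) else j)" for j
  have s: "\<sigma> j < n" "g $$ (\<sigma> j, j) \<noteq> 0" if "j < n" for j
    using theI'[OF col_idx[OF that]] that by (auto simp: \<sigma>_def)
  have s_eq: "i = \<sigma> j" if "j < n" "i < n" "g $$ (i, j) \<noteq> 0" for i j using col_idx[OF that(1)] s[OF that(1)] that
    by blast
  have "inj_on \<sigma> {..<n}"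
  proof (rule inj_onI)
    fix a b assume "a \<in> {..<n}" "b \<in> {..<n}" "\<sigma> a = \<sigma> b"
    then show "a = b" using row[of "\<sigma> a"] s[of a] s[of b] by auto
  qed
  moreover have "\<sigma> ` {..<n} \<subseteq> {..<n}" using s by auto
  ultimately have "bij_betw \<sigma> {..<n} {..<n}" by (simp add: bij_betw_def endo_inj_surj)
  then have p: "\<sigma> permutes {..<n}" by (rule bij_imp_permutes) (simp add: \<sigma>_def)
  have "\<exists>k<r. j < n \<longrightarrow> g $$ (\<sigma> j, j) = zeta r ^ k" for j
  proof (cases "j < n")
    case True
    then have "g $$ (\<sigma> j, j) \<in> (\<lambda>j. zeta r ^ j) ` {..<r}"
      using zeta_bij[OF r] rt s[OF True] by (simp add: bij_betw_def)
    then show ?thesis by auto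
  qed (use r in auto)
  then obtain z where z: "\<And>j. z j < r" "\<And>j. j < n \<Longrightarrow> g $$ (\<sigma> j, j) = zeta r ^ z j" by metis
  have "g = monomial r n \<sigma> z"
  proof (rule eq_matI)
    fix i j assume "i < dim_row (monomial r n \<sigma> z)" "j < dim_col (monomial r n \<sigma> z)"
    then have ij: "i < n" "j < n" by auto
    show "g $$ (i, j) = monomial r n \<sigma> z $$ (i, j)" 
    proof (cases "i = \<sigma> j")
      case True then show ?thesis using z(2)[OF ij(2)] ij by (simp add: monomial_index)
    next
      case False then show ?thesis using s_eq[OF ij(2,1)] ij by (auto simp: monomial_index)
    qed
  qed (use c in auto)
  then show ?thesis using p z(1) by blast
qed

lemma monomial_mult:
  assumes "\<rho> permutes {..<n}"
  shows "monomial r n \<sigma> z * monomial r n \<rho> y = monomial r n (\<sigma> \<circ> \<rho>) (\<lambda>j. y j + z (\<rho> j))"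
proof (rule eq_matI)
  fix i j assume "i < dim_row (monomial r n (\<sigma> \<circ> \<rho>) (\<lambda>j. y j + z (\<rho> j)))"
    "j < dim_col (monomial r n (\<sigma> \<circ> \<rho>) (\<lambda>j. y j + z (\<rho> j)))"
  then have ij: "i < n" "j < n" by auto
  have "(monomial r n \<sigma> z * monomial r n \<rho> y) $$ (i, j)
    = (\<Sum>k<n. monomial r n \<sigma> z $$ (i, k) * monomial r n \<rho> y $$ (k, j))"
    using ij by (simp add: scalar_prod_def atLeast0LessThan)
  also have "\<dots> = (\<Sum>k<n. if k = \<rho> j then (if i = \<sigma> k then zeta r ^ z k else 0) * zeta r ^ y j else 0)"
    using ij by (intro sum.cong) (auto simp: monomial_index)
  also have "\<dots> = monomial r n (\<sigma> \<circ> \<rho>) (\<lambda>j. y j + z (\<rho> j)) $$ (i, j)"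
    using ij permutes_less[OF assms ij(2)] by (simp add: monomial_index power_add)
  finally show "(monomial r n \<sigma> z * monomial r n \<rho> y) $$ (i, j)
    = monomial r n (\<sigma> \<circ> \<rho>) (\<lambda>j. y j + z (\<rho> j)) $$ (i, j)" .
qed auto

lemma perm_mat_monomial: "perm_mat n \<sigma> = monomial r n \<sigma> (\<lambda>_. 0)"
  by (rule eq_matI) (auto simp: perm_mat_def monomial_index)

lemma monomial_conj:
  assumes "\<sigma> permutes {..<n}" "\<pi> permutes {..<n}"
  shows "perm_mat n \<sigma> * monomial r n \<pi> y * perm_mat n (inv \<sigma>) = monomial r n (\<sigma> \<circ> \<pi> \<circ> inv \<sigma>) (y \<circ> inv \<sigma>)"
  unfolding perm_mat_monomial[of n _ r] monomial_mult[OF assms(2)] monomial_mult[OF permutes_inv[OF assms(1)]]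
  by (simp add: comp_def)

lemma monomial_smult: "zeta r ^ k \<cdot>\<^sub>m monomial r n \<sigma> z = monomial r n \<sigma> (\<lambda>j. z j + k)"
  by (rule eq_matI) (auto simp: monomial_index power_add)

lemma monomial_uminus: "even r \<Longrightarrow> r > 0 \<Longrightarrow> - monomial r n \<sigma> z = monomial r n \<sigma> (\<lambda>j. z j + r div 2)"
  by (rule eq_matI) (auto simp: monomial_index power_add zeta_half)

lemma monomial_transpose:
  assumes "\<sigma> permutes {..<n}"
  shows "transpose_mat (monomial r n \<sigma> z) = monomial r n (inv \<sigma>) (z \<circ> inv \<sigma>)"
  by (rule eq_matI) (use permutes_inverses[OF assms] in \<open>auto simp: monomial_index\<close>)

lemma monomial_one: "monomial r n id (\<lambda>_. 0) = 1\<^sub>m n"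
  by (rule eq_matI) (auto simp: monomial_index)

text \<open>Stated for powers of \<open>zeta r\<close> because \<open>zexp\<close> reduces the
  exponents modulo \<open>r\<close>.\<close>

lemma ztotal_monomial:
  assumes "\<sigma> permutes {..<n}" "r > 0"
  shows "zeta r ^ ztotal r (monomial r n \<sigma> z) = zeta r ^ (\<Sum>j<n. z j)"
proof -
  have "zeta r ^ ztotal r (monomial r n \<sigma> z) = (\<Prod>j<n. zeta r ^ (z j mod r))"
    using assms by (simp add: ztotal_def power_sum)
  then show ?thesis using assms(2) by (simp add: zeta_pow_mod power_sum)
qed

section \<open>The antisymmetric matrices of a given type\<close>

text \<open>Concatenating \<open>\<tau>\<close> with itself makes the exponents of the two entries of a cycle differ by
  \<open>r div 2\<close>, that is, makes the entries opposite.\<close>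

definition antisym_mat :: "nat \<Rightarrow> nat list \<Rightarrow> (nat \<Rightarrow> nat) \<Rightarrow> complex mat" where
  "antisym_mat r \<tau> w = monomial r (2 * sum_list \<tau>) (w \<circ> swap_halves (sum_list \<tau>) \<circ> inv w) (block_of (\<tau> @ \<tau>) \<circ> inv w)"

lemma swap_halves_conj_permutes:
  "w permutes {..<2 * N} \<Longrightarrow> w \<circ> swap_halves N \<circ> inv w permutes {..<2 * N}"
  by (intro permutes_compose permutes_inv swap_halves_permutes)

lemma block_of_append: "block_of (ss @ ts) q
  = (if q < sum_list ss then block_of ss q else length ss + block_of ts (q - sum_list ss))"
  by (induction ss arbitrary: q) auto

lemma block_of_double_less: "length \<tau> = m \<Longrightarrow> q < 2 * sum_list \<tau> \<Longrightarrow> block_of (\<tau> @ \<tau>) q < 2 * m"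
  using block_of_less[of q "\<tau> @ \<tau>"] by simp

lemma zexp_antisym_mat:
  assumes "w permutes {..<2 * sum_list \<tau>}" "length \<tau> = r div 2" "even r" "r > 0" "j < 2 * sum_list \<tau>"
  shows "zexp r (antisym_mat r \<tau> w) j = block_of (\<tau> @ \<tau>) (inv w j)"
  using block_of_double_less[OF assms(2), of "inv w j"] permutes_less[OF permutes_inv[OF assms(1)] assms(5)] assms
  by (simp add: antisym_mat_def swap_halves_conj_permutes)

lemma antisym_mat_conj:
  assumes "w permutes {..<2 * sum_list \<tau>}" "\<sigma> permutes {..<2 * sum_list \<tau>}"
  shows "perm_mat (2 * sum_list \<tau>) \<sigma> * antisym_mat r \<tau> w * perm_mat (2 * sum_list \<tau>) (inv \<sigma>)
    = antisym_mat r \<tau> (\<sigma> \<circ> w)"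
  unfolding antisym_mat_def monomial_conj[OF assms(2) swap_halves_conj_permutes[OF assms(1)]]
  by (simp add: inv_comp_permutes[OF assms(2,1)] comp_assoc)

lemma antisym_mat_Grn: "w permutes {..<2 * sum_list \<tau>} \<Longrightarrow> r > 0 \<Longrightarrow> antisym_mat r \<tau> w \<in> carrier (Grn r (2 * sum_list \<tau>))"
  unfolding antisym_mat_def by (intro monomial_in_Grn swap_halves_conj_permutes)

text \<open>A diagonal Young permutation commutes with the exchange of halves and preserves the
  block numbers, so it fixes both the cycles and the exponents.\<close>

lemma antisym_mat_halves_perm:
  assumes w: "w permutes {..<2 * sum_list \<tau>}" and us: "us \<in> Young_group \<tau>" and r: "r > 0"
  shows "antisym_mat r \<tau> (w \<circ> halves_perm (sum_list \<tau>) (block_perm \<tau> us) (block_perm \<tau> us)) = antisym_mat r \<tau> w"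
proof -
  let ?N = "sum_list \<tau>" let ?u = "block_perm \<tau> us"
  have u: "?u permutes {..<?N}" "inv ?u permutes {..<?N}" using block_perm_permutes[OF us] permutes_inv by auto
  have d: "halves_perm ?N ?u ?u permutes {..<2 * ?N}" using halves_perm_permutes[OF u(1) u(1)] .
  have "halves_perm ?N ?u ?u \<circ> swap_halves ?N \<circ> inv (halves_perm ?N ?u ?u) = swap_halves ?N"
    unfolding swap_halves_halves_perm[OF u(1) u(1), symmetric] by (simp add: comp_assoc permutes_inv_o[OF d])
  then have 2: "w \<circ> (halves_perm ?N ?u ?u \<circ> swap_halves ?N \<circ> inv (halves_perm ?N ?u ?u)) \<circ> inv w
    = w \<circ> swap_halves ?N \<circ> inv w" by simp
  have 1: "w \<circ> halves_perm ?N ?u ?u \<circ> swap_halves ?N \<circ> inv (w \<circ> halves_perm ?N ?u ?u) = w \<circ> swap_halves ?N \<circ> inv w"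
    unfolding inv_comp_permutes[OF w d] 2[symmetric] by (simp only: comp_assoc)
  have "block_of (\<tau> @ \<tau>) (inv (halves_perm ?N ?u ?u) q) = block_of (\<tau> @ \<tau>) q" if "q < 2 * ?N" for q
    using that block_of_block_perm[OF Young_group_inv[OF us]] block_perm_less[OF Young_group_inv[OF us]]
    by (auto simp: inv_halves_perm[OF u(1) u(1)] inv_block_perm[OF us] halves_perm_apply block_of_append)
  then show ?thesis unfolding antisym_mat_def 1
    by (intro monomial_cong[OF r])
      (use permutes_less[OF permutes_inv[OF w]] in \<open>auto simp: inv_comp_permutes[OF w d]\<close>)
qed

text \<open>The exchange of halves keeps the cycles but adds \<open>r div 2\<close>, modulo
  \<open>r\<close>, to every block number of \<open>\<tau> @ \<tau>\<close>; this is multiplication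
  by -1.\<close>

lemma antisym_mat_swap_halves:
  assumes w: "w permutes {..<2 * sum_list \<tau>}" and r: "even r" "r > 0" and len: "length \<tau> = r div 2"
  shows "antisym_mat r \<tau> (w \<circ> swap_halves (sum_list \<tau>)) = - antisym_mat r \<tau> w"
proof -
  let ?N = "sum_list \<tau>"
  have 1: "w \<circ> swap_halves ?N \<circ> swap_halves ?N \<circ> inv (w \<circ> swap_halves ?N) = w \<circ> swap_halves ?N \<circ> inv w"
    by (simp add: inv_comp_permutes[OF w swap_halves_permutes] inv_swap_halves comp_assoc swap_halves_swap_halves)
  have r2: "r div 2 + r div 2 = r" using r by auto
  have "block_of (\<tau> @ \<tau>) (swap_halves ?N q) mod r = (block_of (\<tau> @ \<tau>) q + r div 2) mod r" if "q < 2 * ?N" for q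
  proof (cases "q < ?N")
    case True then show ?thesis using len by (simp add: swap_halves_def block_of_append add.commute)
  next
    case False
    have "length \<tau> + block_of \<tau> (q - ?N) + r div 2 = block_of \<tau> (q - ?N) + r" using len r2 by simp
    then have "(length \<tau> + block_of \<tau> (q - ?N) + r div 2) mod r = block_of \<tau> (q - ?N) mod r"
      by (simp only: mod_add_self2)
    then show ?thesis using that False by (simp add: swap_halves_def block_of_append)
  qed
  then show ?thesis unfolding antisym_mat_def monomial_uminus[OF r] 1
    by (intro monomial_cong[OF r(2)])
      (use permutes_less[OF permutes_inv[OF w]] in \<open>auto simp: inv_comp_permutes[OF w swap_halves_permutes]
        inv_swap_halves\<close>)
qed

text \<open>Multiplication by \<open>zeta r\<close> raises every exponent by 1. Block numbers of the
  rotated layout plus 1 are, modulo \<open>r\<close>, the block numbers after the cyclic shift,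
  which commutes with the exchange of halves.\<close>

lemma antisym_mat_rotate1:
  assumes w: "w permutes {..<2 * sum_list (s # ss)}" and r: "even r" "r > 0" and len: "length (s # ss) = r div 2"
  shows "zeta r \<cdot>\<^sub>m antisym_mat r (ss @ [s]) w
    = antisym_mat r (s # ss) (w \<circ> inv (cyclic_shift (sum_list (s # ss)) s))"
proof -
  define N where "N = s + sum_list ss"
  have N': "sum_list (ss @ [s]) = N" "sum_list (s # ss) = N" by (auto simp: N_def)
  let ?\<rho> = "cyclic_shift N s"
  have rp: "?\<rho> permutes {..<2 * N}" by (rule cyclic_shift_permutes) (simp add: N_def)
  have w': "w permutes {..<2 * N}" using w by (simp only: N')
  have "?\<rho> \<circ> swap_halves N = swap_halves N \<circ> ?\<rho>" by (auto simp: fun_eq_iff cyclic_shift_def swap_halves_def N_def)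
  then have sw: "swap_halves N \<circ> inv ?\<rho> = inv ?\<rho> \<circ> swap_halves N" by (rule conj_inv[OF rp])
  have 1: "w \<circ> inv ?\<rho> \<circ> swap_halves N \<circ> inv (w \<circ> inv ?\<rho>) = w \<circ> swap_halves N \<circ> inv w"
  proof -
    have "inv (w \<circ> inv ?\<rho>) = ?\<rho> \<circ> inv w"
      using inv_comp_permutes[OF w' permutes_inv[OF rp]] by (simp add: permutes_inv_inv[OF rp])
    then have "w \<circ> inv ?\<rho> \<circ> swap_halves N \<circ> inv (w \<circ> inv ?\<rho>) = w \<circ> (inv ?\<rho> \<circ> swap_halves N) \<circ> ?\<rho> \<circ> inv w"
      by (simp add: comp_assoc)
    also have "\<dots> = w \<circ> swap_halves N \<circ> (inv ?\<rho> \<circ> ?\<rho>) \<circ> inv w" unfolding sw[symmetric] by (simp only: comp_assoc)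
    finally show ?thesis by (simp add: permutes_inv_o[OF rp])
  qed
  have r2: "r div 2 + r div 2 = r" using r by auto
  have c: "(block_of ((ss @ [s]) @ (ss @ [s])) q + 1) mod r = block_of ((s # ss) @ (s # ss)) (?\<rho> q) mod r"
    if "q < 2 * N" for q
  proof -
    have L: "length ss + 1 = r div 2" using len by simp
    consider "q < sum_list ss" | "sum_list ss \<le> q" "q < N" | "N \<le> q" "q < N + sum_list ss"
      | "N + sum_list ss \<le> q" using that by linarith
    then show ?thesis
    proof cases
      case 1 then show ?thesis by (simp add: cyclic_shift_def N_def block_of_append)
    next
      case 2
      then show ?thesis using L that by (simp add: cyclic_shift_def N_def block_of_append)
    next
      case 3
      then show ?thesis using L that by (simp add: cyclic_shift_def N_def block_of_append)
    next
      \<comment> \<open>The last block has the number \<open>r - 1\<close> in the rotated layout and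
        wraps around to 0.\<close>
      case 4
      have "Suc (Suc (length ss + length ss)) = r" using L r2 by simp
      moreover have "q + s - 2 * N < s" using 4 that by (simp add: N_def)
      ultimately show ?thesis using 4 that by (simp add: cyclic_shift_def N_def block_of_append)
    qed
  qed
  have "zeta r \<cdot>\<^sub>m antisym_mat r (ss @ [s]) w = zeta r ^ 1 \<cdot>\<^sub>m antisym_mat r (ss @ [s]) w" by simp
  also have "\<dots> = antisym_mat r (s # ss) (w \<circ> inv ?\<rho>)"
    unfolding antisym_mat_def monomial_smult N' 1
    by (intro monomial_cong[OF r(2)])
       (use permutes_less[OF permutes_inv[OF w']] c in \<open>auto simp: inv_comp_permutes[OF w' permutes_inv[OF rp]]
         permutes_inv_inv[OF rp]\<close>)
  finally show ?thesis unfolding N' .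
qed

lemma antisym_mat_rotate:
  assumes w: "w permutes {..<2 * sum_list \<tau>}" and r: "even r" "r > 0" and len: "length \<tau> = r div 2"
  shows "zeta r ^ k \<cdot>\<^sub>m antisym_mat r (rotate k \<tau>) w = antisym_mat r \<tau> (w \<circ> rotation_perm \<tau> k)"
  using w
proof (induction k arbitrary: w)
  case 0
  have "\<And>A :: complex mat. 1 \<cdot>\<^sub>m A = A" by (rule eq_matI) auto
  then show ?case by (simp add: comp_def)
next
  case (Suc k)
  have ne: "\<tau> \<noteq> []" using len r by auto
  then obtain s ss where t: "rotate k \<tau> = s # ss" by (cases "rotate k \<tau>") auto
  have N: "sum_list \<tau> = sum_list (s # ss)" using sum_list_rotate[of k \<tau>] t by simp
  have L: "length (s # ss) = r div 2" using len t length_rotate[of k \<tau>] by simp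
  have wp: "w permutes {..<2 * sum_list (s # ss)}" using Suc.prems N by simp
  have "s \<le> sum_list (s # ss)" by simp
  then have w': "w \<circ> inv (cyclic_shift (sum_list (s # ss)) s) permutes {..<2 * sum_list \<tau>}"
    using permutes_compose[OF permutes_inv[OF cyclic_shift_permutes] wp] N by simp
  have "\<And>a b (A :: complex mat). (b * a) \<cdot>\<^sub>m A = a \<cdot>\<^sub>m (b \<cdot>\<^sub>m A)" by (rule eq_matI) auto
  then have "zeta r ^ Suc k \<cdot>\<^sub>m antisym_mat r (rotate (Suc k) \<tau>) w
    = zeta r ^ k \<cdot>\<^sub>m (zeta r \<cdot>\<^sub>m antisym_mat r (ss @ [s]) w)"
    by (simp add: t)
  also have "\<dots> = antisym_mat r \<tau> (w \<circ> inv (cyclic_shift (sum_list (s # ss)) s) \<circ> rotation_perm \<tau> k)"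
    unfolding antisym_mat_rotate1[OF wp r L] using Suc.IH[OF w'] t by (simp add: comp_def)
  finally show ?case using t N by (simp add: comp_def)
qed

lemma concat_nth_block_of:
  "q < length (concat xss) \<Longrightarrow> concat xss ! q \<in> set (xss ! block_of (map length xss) q)
    \<and> block_of (map length xss) q < length xss"
proof (induction xss arbitrary: q)
  case (Cons xs xss)
  then show ?case using Cons.IH[of "q - length xs"] by (auto simp: nth_append)
qed simp

text \<open>The two exponents of a cycle differ by \<open>r div 2\<close> modulo \<open>r\<close>,
  so every cycle has a preferred entry, the one with the smaller exponent. Listing these entries by
  exponent, and then their partners in the same order, produces \<open>w\<close>.\<close>

theorem antisymmetric_antisym_mat:
  assumes A: "A \<in> carrier (Grn r n)" and anti: "transpose_mat A = - A" and r: "even r" "r > 0"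
  shows "length (antisym_type r A) = r div 2" "n = 2 * sum_list (antisym_type r A)"
    "\<exists>w. w permutes {..<n} \<and> A = antisym_mat r (antisym_type r A) w"
proof -
  define m where "m = r div 2"
  have m: "r = 2 * m" "m > 0" using r by (auto simp: m_def)
  obtain \<sigma> z where s: "\<sigma> permutes {..<n}" and z: "\<And>j. z j < r" and Am: "A = monomial r n \<sigma> z"
    using Grn_monomial[OF A r(2)] by blast
  have "monomial r n (inv \<sigma>) (z \<circ> inv \<sigma>) = monomial r n \<sigma> (\<lambda>j. z j + r div 2)"
    using anti unfolding Am monomial_transpose[OF s] monomial_uminus[OF r] .
  then have inv: "inv \<sigma> = \<sigma>" and zz: "\<And>j. j < n \<Longrightarrow> z (\<sigma> j) mod r = (z j + r div 2) mod r"
    using monomial_eq_iff[OF permutes_inv[OF s] s r(2)] by auto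
  have ss: "\<sigma> (\<sigma> j) = j" for j using permutes_inverses[OF s] inv by metis
  have sl: "\<sigma> j < n" if "j < n" for j using permutes_less[OF s that] .
  \<comment> \<open>Both exponents are reduced below \<open>2 * m\<close>, so adding
    \<open>m\<close> modulo \<open>2 * m\<close> is an addition or a subtraction.\<close>
  have zs: "z (\<sigma> j) = (if z j < m then z j + m else z j - m)" if "j < n" for j
  proof -
    have "z (\<sigma> j) = (z j + m) mod (2 * m)" using zz[OF that] z[of "\<sigma> j"] m by simp
    also have "\<dots> = (if z j < m then z j + m else z j - m)"
    proof (cases "z j < m")
      case False
      then have "z j + m = (z j - m) + 2 * m" by simp
      then have "(z j + m) mod (2 * m) = (z j - m) mod (2 * m)" by (simp only: mod_add_self2)
      then show ?thesis using z[of j] m False by simp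
    qed simp
    finally show ?thesis .
  qed
  \<comment> \<open>Exactly one entry of each cycle has an exponent below \<open>m\<close>;
    \<open>J\<close> lists these entries in the order of their exponents.\<close>
  define js where "js i = filter (\<lambda>j. z j = i) [0..<n]" for i
  define J where "J = concat (map js [0..<m])"
  have setJ: "set J = {j. j < n \<and> z j < m}" by (auto simp: J_def js_def)
  have "distinct (concat (map js ks)) \<and> set (concat (map js ks)) \<subseteq> {j. z j \<in> set ks}" if "distinct ks" for ks
    using that by (induction ks) (auto simp: js_def)
  then have distJ: "distinct J" unfolding J_def by simp
  define \<tau> where "\<tau> = map length (map js [0..<m])"
  have type: "antisym_type r A = \<tau>"
  proof (rule nth_equalityI)
    show "length (antisym_type r A) = length \<tau>" by (simp add: antisym_type_def \<tau>_def m_def)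
    fix i assume "i < length (antisym_type r A)"
    then have i: "i < m" by (simp add: antisym_type_def m_def)
    have "{{a, perm_of A a} |a. a < dim_col A \<and> zexp r A a mod (r div 2) = i} = (\<lambda>a. {a, \<sigma> a}) ` {a. a < n \<and> z a = i}"
    proof -
      \<comment> \<open>The type may be read at either entry of a cycle; passing to the entry with
        exponent below \<open>m\<close> makes the counting map injective.\<close>
      have "\<exists>b<n. z b = i \<and> {a, \<sigma> a} = {b, \<sigma> b}" if a: "a < n" "z a mod m = i" for a
      proof (cases "z a < m")
        case True then show ?thesis using a by auto
      next
        case False
        then have "z a mod m = z a - m" using z[of a] m by (simp add: le_mod_geq)
        then have "z (\<sigma> a) = i" using zs[OF a(1)] False a by simp
        then show ?thesis using sl[OF a(1)] ss[of a] by (intro exI[of _ "\<sigma> a"]) auto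
      qed
      note ex = this
      have A': "zexp r A a = z a" "perm_of A a = \<sigma> a" "dim_col A = n" if "a < n" for a
        using that s r z by (simp_all add: Am)
      show ?thesis
      proof (intro Set.set_eqI iffI)
        fix X assume "X \<in> {{a, perm_of A a} |a. a < dim_col A \<and> zexp r A a mod (r div 2) = i}"
        then obtain a where a: "X = {a, perm_of A a}" "a < n" "zexp r A a mod m = i" by (auto simp: m_def Am)
        then show "X \<in> (\<lambda>a. {a, \<sigma> a}) ` {a. a < n \<and> z a = i}" using ex[of a] A'[OF a(2)] by auto
      next
        fix X assume "X \<in> (\<lambda>a. {a, \<sigma> a}) ` {a. a < n \<and> z a = i}"
        then obtain a where a: "a < n" "z a = i" "X = {a, \<sigma> a}" by auto
        have "X = {a, perm_of A a} \<and> a < dim_col A \<and> zexp r A a mod (r div 2) = i"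
          using A'[OF a(1)] a i by (simp add: m_def)
        then show "X \<in> {{a, perm_of A a} |a. a < dim_col A \<and> zexp r A a mod (r div 2) = i}" by blast
      qed
    qed
    moreover have "inj_on (\<lambda>a. {a, \<sigma> a}) {a. a < n \<and> z a = i}"
    proof (rule inj_onI)
      fix a b assume h: "a \<in> {a. a < n \<and> z a = i}" "b \<in> {a. a < n \<and> z a = i}" "{a, \<sigma> a} = {b, \<sigma> b}"
      show "a = b"
      proof (rule ccontr)
        assume "a \<noteq> b"
        then have "b = \<sigma> a" using h(3) by (auto simp: doubleton_eq_iff)
        then show False using zs[of a] h i m by auto
      qed
    qed
    moreover have "card {a. a < n \<and> z a = i} = length (js i)"
      by (subst distinct_card[symmetric]) (auto simp: js_def intro!: arg_cong[of _ _ card])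
    ultimately show "antisym_type r A ! i = \<tau> ! i"
      using i by (simp add: antisym_type_def \<tau>_def card_image m_def)
  qed
  show "length (antisym_type r A) = r div 2" by (simp add: type \<tau>_def m_def)
  define N where "N = sum_list \<tau>"
  have lJ: "length J = N" by (simp add: J_def N_def \<tau>_def length_concat)
  have cJ: "card (set J) = N" using distJ lJ distinct_card by metis
  have compl: "\<sigma> ` set J = {..<n} - set J"
  proof (intro Set.set_eqI iffI)
    fix j assume "j \<in> {..<n} - set J"
    then have "\<sigma> j \<in> set J" using zs[of j] sl[of j] z[of j] m by (auto simp: setJ)
    then show "j \<in> \<sigma> ` set J" using ss[of j] by (metis image_eqI)
  qed (use zs sl in \<open>auto simp: setJ\<close>)
  have "inj \<sigma>" using s by (rule permutes_inj)
  then have "card (\<sigma> ` set J) = N" using cJ by (simp add: card_image inj_on_subset)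
  then have nN: "n = 2 * N"
  proof -
    have sub: "set J \<subseteq> {..<n}" using setJ by auto
    have "card ({..<n} - set J) = n - N" using card_Diff_subset[OF finite_set sub] cJ by simp
    moreover have "N \<le> n" using card_mono[OF _ sub] cJ by simp
    ultimately show ?thesis using \<open>card (\<sigma> ` set J) = N\<close> compl by simp
  qed
  show "n = 2 * sum_list (antisym_type r A)" using nN by (simp add: type N_def)
  \<comment> \<open>Preferred entries fill the first half and their partners the second, so that
    \<sigma> becomes the exchange of halves after conjugation by \<open>w\<close>.\<close>
  define w where "w q = (if q < N then J ! q else if q < 2 * N then \<sigma> (J ! (q - N)) else q)" for q
  have Jm: "J ! q < n" "z (J ! q) < m" if "q < N" for q
    using nth_mem[of q J] that lJ setJ by auto
  have zJ: "z (J ! q) = block_of \<tau> q" if "q < N" for q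
  proof -
    have "q < length (concat (map js [0..<m]))" using that lJ by (simp add: J_def)
    from concat_nth_block_of[OF this] show ?thesis by (auto simp: J_def[symmetric] \<tau>_def js_def)
  qed
  have inj: "inj_on w {..<n}"
  proof (rule inj_onI)
    fix a b assume ab: "a \<in> {..<n}" "b \<in> {..<n}" "w a = w b"
    have JJ: "x = y" if "J ! x = J ! y" "x < N" "y < N" for x y
      using that distJ lJ by (simp add: nth_eq_iff_index_eq)
    have no: "J ! x \<noteq> \<sigma> (J ! y)" if "x < N" "y < N" for x y
      using Jm[OF that(1)] Jm[OF that(2)] zs[of "J ! y"] by auto
    consider "a < N" "b < N" | "a < N" "\<not> b < N" | "\<not> a < N" "b < N" | "\<not> a < N" "\<not> b < N" by blast
    then show "a = b"
    proof cases
      case 1 then show ?thesis using ab JJ by (simp add: w_def)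
    next
      case 2 then show ?thesis using ab nN no[of a "b - N"] by (simp add: w_def)
    next
      case 3 then show ?thesis using ab nN no[of b "a - N", symmetric] by (simp add: w_def)
    next
      case 4
      then have "\<sigma> (J ! (a - N)) = \<sigma> (J ! (b - N))" using ab nN by (simp add: w_def)
      then have "J ! (a - N) = J ! (b - N)" using injD[OF \<open>inj \<sigma>\<close>] by blast
      then have "a - N = b - N" using JJ[of "a - N" "b - N"] 4 ab nN by simp
      then show ?thesis using 4 by simp
    qed
  qed
  have "w ` {..<n} \<subseteq> {..<n}" using Jm sl nN by (auto simp: w_def)
  then have "bij_betw w {..<n} {..<n}" using inj by (simp add: bij_betw_def endo_inj_surj)
  then have w: "w permutes {..<n}" by (rule bij_imp_permutes) (simp add: w_def nN)
  have sw: "\<sigma> (w q) = w (swap_halves N q)" for q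
    using ss permutes_not_in[OF s, of q] nN by (auto simp: w_def swap_halves_def)
  have zw: "z (w q) = block_of (\<tau> @ \<tau>) q" if "q < n" for q
  proof (cases "q < N")
    case True then show ?thesis using zJ by (simp add: w_def block_of_append N_def)
  next
    case False
    then have q: "q - N < N" using that nN by simp
    then have "z (w q) = z (J ! (q - N)) + m" using zs[OF Jm(1)[OF q]] Jm(2)[OF q] False that nN by (simp add: w_def)
    then show ?thesis using zJ[OF q] False by (simp add: block_of_append N_def \<tau>_def)
  qed
  have "A = antisym_mat r \<tau> w"
    unfolding Am antisym_mat_def N_def[symmetric] nN[symmetric]
  proof (rule monomial_cong[OF r(2)])
    fix j assume "j < n"
    then have j: "inv w j < n" using permutes_less[OF permutes_inv[OF w]] by simp
    show "\<sigma> j = (w \<circ> swap_halves N \<circ> inv w) j" using sw[of "inv w j"] permutes_inverses[OF w] by simp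
    show "z j mod r = (block_of (\<tau> @ \<tau>) \<circ> inv w) j mod r" using zw[OF j] permutes_inverses[OF w] by simp
  qed
  then show "\<exists>w. w permutes {..<n} \<and> A = antisym_mat r (antisym_type r A) w" unfolding type using w by blast
qed

section \<open>Functions on a class of antisymmetric elements\<close>

definition zeta_coset :: "nat \<Rightarrow> complex mat \<Rightarrow> complex mat set" where
  "zeta_coset p A = {zeta p ^ k \<cdot>\<^sub>m A | k. True}"

text \<open>The factor makes a coboundary of the exponent \<open>a_exp\<close> in the Gelfand model.\<close>

definition normalized :: "nat \<Rightarrow> nat \<Rightarrow> (complex mat set \<Rightarrow> complex) \<Rightarrow> complex mat \<Rightarrow> complex" where
  "normalized r p f A = zeta r ^ zexp r A 0 * f (zeta_coset p A)"

locale gelfand_setting =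
  fixes r n p :: nat
  assumes r: "r > 0" and n: "n > 0" and p: "p dvd r" and gcd: "gcd p n = 2"
begin

lemma p0: "p > 0" using p r by (auto intro: Nat.gr0I)

lemma even_p: "even p" using gcd by (metis gcd_dvd1)

lemma even_r: "even r" using even_p p by (meson dvd_trans)

lemma zeta_p: "zeta p ^ k = zeta r ^ (k * (r div p))"
  using zeta_dvd[OF p r] by (metis mult.commute power_mult)

lemma zeta_coset_smult: "zeta_coset p (zeta p ^ k \<cdot>\<^sub>m A) = zeta_coset p A"
proof -
  have a: "zeta p ^ i \<cdot>\<^sub>m (zeta p ^ k \<cdot>\<^sub>m A) = zeta p ^ (i + k) \<cdot>\<^sub>m A" for i by (rule eq_matI) (auto simp: power_add)
  \<comment> \<open>\<open>p - k mod p\<close> is a natural exponent whose power inverts the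
    \<open>k\<close>-th power of \<open>zeta p\<close>.\<close>
  have "zeta p ^ i \<cdot>\<^sub>m A = zeta p ^ (i + (p - k mod p)) \<cdot>\<^sub>m (zeta p ^ k \<cdot>\<^sub>m A)" for i
  proof -
    have "zeta p ^ (p - k mod p + k) = 1"
    proof -
      have "p - k mod p + k = p + p * (k div p)"
        using mod_mult_div_eq[of k p] mod_less_divisor[OF p0, of k] by linarith
      then have "p dvd (p - k mod p + k)" by simp
      then show ?thesis using p0 by (simp add: zeta_pow_eq_1)
    qed
    then show ?thesis unfolding a by (simp add: power_add mult.assoc)
  qed
  note b = this
  show ?thesis
  proof (intro subset_antisym subsetI)
    fix B assume "B \<in> zeta_coset p (zeta p ^ k \<cdot>\<^sub>m A)"
    then show "B \<in> zeta_coset p A" unfolding zeta_coset_def a by blast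
  next
    fix B assume "B \<in> zeta_coset p A"
    then obtain i where "B = zeta p ^ i \<cdot>\<^sub>m A" by (auto simp: zeta_coset_def)
    then have "B = zeta p ^ (i + (p - k mod p)) \<cdot>\<^sub>m (zeta p ^ k \<cdot>\<^sub>m A)" using b[of i] by (rule trans)
    then show "B \<in> zeta_coset p (zeta p ^ k \<cdot>\<^sub>m A)" unfolding zeta_coset_def by blast
  qed
qed

lemma zexp_smult:
  assumes A: "A \<in> carrier (Grn r n)" and j: "j < n"
  shows "zexp r (zeta p ^ k \<cdot>\<^sub>m A) j = (zexp r A j + k * (r div p)) mod r"
    and "perm_of (zeta p ^ k \<cdot>\<^sub>m A) = perm_of A"
proof -
  obtain \<sigma> z where s: "\<sigma> permutes {..<n}" "A = monomial r n \<sigma> z" using Grn_monomial[OF A r] by blast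
  show "zexp r (zeta p ^ k \<cdot>\<^sub>m A) j = (zexp r A j + k * (r div p)) mod r"
    using j s r by (simp add: zeta_p monomial_smult mod_add_left_eq)
  show "perm_of (zeta p ^ k \<cdot>\<^sub>m A) = perm_of A" using s by (simp add: zeta_p monomial_smult)
qed

text \<open>\<open>f\<close> sees only the coset, whereas the normalizing entry is multiplied by
  \<open>zeta p ^ k\<close>. The normalized function is therefore homogeneous, and in particular odd
  under negation of the lift.\<close>

lemma normalized_smult:
  assumes A: "A \<in> carrier (Grn r n)"
  shows "normalized r p f (zeta p ^ k \<cdot>\<^sub>m A) = zeta p ^ k * normalized r p f A"
proof -
  have "zeta r ^ zexp r (zeta p ^ k \<cdot>\<^sub>m A) 0 = zeta p ^ k * zeta r ^ zexp r A 0"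
    using zexp_smult(1)[OF A n] by (simp add: zeta_pow_mod[OF r] power_add zeta_p)
  then show ?thesis by (simp add: normalized_def zeta_coset_smult)
qed

lemma neg_smult: "- A = zeta p ^ (p div 2) \<cdot>\<^sub>m (A :: complex mat)"
  using even_p p0 by (intro eq_matI) (auto simp: zeta_half)

lemma normalized_uminus: "A \<in> carrier (Grn r n) \<Longrightarrow> normalized r p f (- A) = - normalized r p f A"
  unfolding neg_smult by (subst normalized_smult) (simp_all add: zeta_half even_p p0)

lemma antisym_mat_Grn': "n = 2 * sum_list \<tau> \<Longrightarrow> w permutes {..<n} \<Longrightarrow> antisym_mat r \<tau> w \<in> carrier (Grn r n)"
  using antisym_mat_Grn r by simp

definition lifted :: "(complex mat set \<Rightarrow> complex) \<Rightarrow> nat list \<Rightarrow> (nat \<Rightarrow> nat) \<Rightarrow> complex" where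
  "lifted f \<tau> w = normalized r p f (antisym_mat r \<tau> w)"

lemma lifted_diag_invariant: "n = 2 * sum_list \<tau> \<Longrightarrow> diag_invariant \<tau> (lifted f \<tau>)"
  by (simp add: diag_invariant_def lifted_def antisym_mat_halves_perm r)

lemma lifted_swap_odd:
  assumes "n = 2 * sum_list \<tau>" "length \<tau> = r div 2" shows "swap_odd \<tau> (lifted f \<tau>)"
  unfolding swap_odd_def lifted_def using antisym_mat_swap_halves[OF _ even_r r assms(2)] normalized_uminus
    antisym_mat_Grn' assms by simp

lemma lifted_rotate:
  assumes "n = 2 * sum_list \<tau>" "length \<tau> = r div 2" "w permutes {..<n}"
  shows "zeta p ^ k * lifted f (rotate (k * (r div p)) \<tau>) w = lifted f \<tau> (w \<circ> rotation_perm \<tau> (k * (r div p)))"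
proof -
  have "antisym_mat r (rotate (k * (r div p)) \<tau>) w \<in> carrier (Grn r n)" using assms
    by (intro antisym_mat_Grn') simp_all
  then show ?thesis using antisym_mat_rotate[OF _ even_r r assms(2), of w "k * (r div p)"] assms(1,3)
    by (simp add: lifted_def flip: normalized_smult zeta_p)
qed

text \<open>Both matrices have the same multiset of exponents, hence the same product of nonzero
  entries. The scalar thus satisfies \<open>zeta p ^ (k * n) = 1\<close>, so that \<open>p\<close>
  divides \<open>k * n\<close> and the gcd leaves only the multiples of \<open>p div 2\<close> for
  \<open>k\<close>.\<close>

lemma antisym_mat_zeta_p:
  assumes t: "n = 2 * sum_list \<tau>" "length \<tau> = r div 2" and w: "w permutes {..<n}" and w': "w' permutes {..<n}"
    and e: "antisym_mat r \<tau> w' = zeta p ^ k \<cdot>\<^sub>m antisym_mat r \<tau> w"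
  shows "antisym_mat r \<tau> w' = antisym_mat r \<tau> w \<or> antisym_mat r \<tau> w' = - antisym_mat r \<tau> w" "p div 2 dvd k"
proof -
  let ?c = "\<lambda>q. block_of (\<tau> @ \<tau>) q"
  have m: "monomial r n (w' \<circ> swap_halves (sum_list \<tau>) \<circ> inv w') (?c \<circ> inv w') =
    monomial r n (w \<circ> swap_halves (sum_list \<tau>) \<circ> inv w) (\<lambda>j. (?c \<circ> inv w) j + k * (r div p))"
    using e by (simp add: antisym_mat_def t(1) zeta_p monomial_smult)
  have "(w' \<circ> swap_halves (sum_list \<tau>) \<circ> inv w') permutes {..<n}"
    "(w \<circ> swap_halves (sum_list \<tau>) \<circ> inv w) permutes {..<n}"
    using w w' t(1) swap_halves_conj_permutes by auto
  then have "\<forall>j<n. ?c (inv w' j) mod r = (?c (inv w j) + k * (r div p)) mod r"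
    using m monomial_eq_iff[OF _ _ r] by simp
  \<comment> \<open>The exponents agree modulo \<open>r\<close> only, so products of roots of unity
    take the place of sums; the permutations merely reorder the factors.\<close>
  then have "(\<Prod>j<n. zeta r ^ ?c (inv w' j)) = (\<Prod>j<n. zeta r ^ (?c (inv w j) + k * (r div p)))"
    by (intro prod.cong refl) (simp add: zeta_pow_eq_iff r)
  moreover have P: "(\<Prod>j<n. zeta r ^ ?c (inv w j)) = (\<Prod>j<n. zeta r ^ ?c j)" if "w permutes {..<n}" for w
    using prod.permute[OF permutes_inv[OF that], of "\<lambda>j. zeta r ^ ?c j"] by (simp add: comp_def)
  ultimately have "(\<Prod>j<n. zeta r ^ ?c j) = (\<Prod>j<n. zeta r ^ ?c j) * zeta r ^ (n * (k * (r div p)))"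
    by (simp add: power_add prod.distrib P w w' flip: power_mult) (simp add: mult.commute)
  then have "zeta r ^ (n * (k * (r div p))) = 1" by simp
  then have "r dvd n * k * (r div p)" using zeta_pow_eq_1[OF r] by (simp add: mult.assoc)
  moreover have rp: "r = p * (r div p)" using p by simp
  ultimately have "p * (r div p) dvd n * k * (r div p)" by simp
  moreover have "r div p > 0" using rp r by (metis gr0I mult_0_right)
  ultimately have "p dvd n * k" by simp
  then have "2 * (p div 2) dvd 2 * (sum_list \<tau> * k)" using even_p t(1) by (simp add: mult.assoc)
  then have d: "p div 2 dvd sum_list \<tau> * k" by simp
  \<comment> \<open>Halving both arguments shows that \<open>p div 2\<close> is prime to
    \<open>sum_list \<tau>\<close>.\<close>
  have "gcd (2 * (p div 2)) (2 * sum_list \<tau>) = 2" using gcd t(1) even_p by simp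
  then have "coprime (p div 2) (sum_list \<tau>)" by (simp add: coprime_iff_gcd_eq_1 gcd_mult_distrib_nat[symmetric])
  then show dk: "p div 2 dvd k" using d by (simp add: coprime_dvd_mult_right_iff)
  then obtain i where i: "k = (p div 2) * i" by auto
  have "zeta p ^ k = (-1) ^ i" unfolding i power_mult using even_p p0 by (simp add: zeta_half)
  moreover have "1 \<cdot>\<^sub>m A = A" "(-1) \<cdot>\<^sub>m A = - A" for A :: "complex mat" by (auto intro!: eq_matI)
  ultimately show "antisym_mat r \<tau> w' = antisym_mat r \<tau> w \<or> antisym_mat r \<tau> w' = - antisym_mat r \<tau> w"
    using e by (cases "even i") auto
qed

text \<open>The quotient of the two permutations commutes with the exchange of halves and preserves
  the block numbers of \<open>\<tau> @ \<tau>\<close>. The latter confines it to the halves and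
  their blocks, the former makes it act alike on both.\<close>

lemma antisym_mat_eq:
  assumes t: "n = 2 * sum_list \<tau>" "length \<tau> = r div 2" and w: "w permutes {..<n}" and w': "w' permutes {..<n}"
    and e: "antisym_mat r \<tau> w' = antisym_mat r \<tau> w"
  shows "\<exists>us\<in>Young_group \<tau>. w' = w \<circ> halves_perm (sum_list \<tau>) (block_perm \<tau> us) (block_perm \<tau> us)"
proof -
  let ?c = "\<lambda>q. block_of (\<tau> @ \<tau>) q" let ?N = "sum_list \<tau>"
  define x where "x = inv w \<circ> w'"
  have x: "x permutes {..<n}" unfolding x_def by (intro permutes_compose permutes_inv w w')
  have wx: "w' = w \<circ> x" unfolding x_def by (simp add: permutes_inv_o[OF w] flip: comp_assoc)
  have pp: "(w' \<circ> swap_halves ?N \<circ> inv w') permutes {..<n}" "(w \<circ> swap_halves ?N \<circ> inv w) permutes {..<n}"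
    using w w' t(1) swap_halves_conj_permutes by auto
  have m: "w' \<circ> swap_halves ?N \<circ> inv w' = w \<circ> swap_halves ?N \<circ> inv w" "\<forall>j<n. ?c (inv w' j) mod r = ?c (inv w j) mod r"
    using e monomial_eq_iff[OF pp r] by (auto simp: antisym_mat_def t(1))
  have xs: "x (swap_halves ?N q) = swap_halves ?N (x q)" for q
  proof -
    have "w' (swap_halves ?N (inv w' (w' q))) = w (swap_halves ?N (inv w (w' q)))"
      using fun_cong[OF m(1), of "w' q"] by simp
    then have "w (x (swap_halves ?N q)) = w (swap_halves ?N (x q))" unfolding permutes_inverses[OF w']
      by (simp add: wx permutes_inverses[OF w])
    then show ?thesis using injD[OF permutes_inj[OF w]] by blast
  qed
  have cx: "?c (x q) = ?c q" if q: "q < n" for q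
  proof -
    have "?c (inv w' (w' q)) mod r = ?c (inv w (w' q)) mod r" using m(2) permutes_less[OF w' q] by blast
    then have "?c q mod r = ?c (x q) mod r" by (simp add: permutes_inverses[OF w'] x_def)
    moreover have "?c q < r" "?c (x q) < r"
      using block_of_double_less[OF t(2)] q permutes_less[OF x q] t(1) even_r by auto
    ultimately show ?thesis by simp
  qed
  have half: "x q < ?N \<longleftrightarrow> q < ?N" if "q < n" for q
  proof -
    \<comment> \<open>The first half consists of the positions with block number below
      \<open>length \<tau>\<close>, so preserving block numbers preserves the halves.\<close>
    have "?c q < length \<tau> \<longleftrightarrow> q < ?N" for q using block_of_less[of q \<tau>] by (simp add: block_of_append)
    then show ?thesis using cx[OF that] by metis
  qed
  define u where "u q = (if q < ?N then x q else q)" for q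
  have u: "u permutes {..<?N}"
  proof (rule bij_imp_permutes)
    have "inj_on u {..<?N}" using permutes_inj[OF x] by (auto simp: u_def inj_on_def dest: injD)
    moreover have "u ` {..<?N} \<subseteq> {..<?N}" using half t(1) by (auto simp: u_def)
    ultimately show "bij_betw u {..<?N} {..<?N}" by (simp add: bij_betw_def endo_inj_surj)
  qed (simp add: u_def)
  have "block_of \<tau> (u q) = block_of \<tau> q" if "q < ?N" for q
    using cx[of q] half[of q] that t(1) by (simp add: u_def block_of_append)
  from block_perm_exists[OF u this] obtain us where us: "us \<in> Young_group \<tau>" "u = block_perm \<tau> us" by blast
  have "x = halves_perm ?N u u"
  proof
    fix q
    consider "q < ?N" | "?N \<le> q" "q < 2 * ?N" | "2 * ?N \<le> q" by linarith
    then show "x q = halves_perm ?N u u q"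
    proof cases
      case 1 then show ?thesis by (simp add: halves_perm_apply u_def)
    next
      case 2
      then have "swap_halves ?N (q - ?N) = q" "x (q - ?N) < ?N" using half[of "q - ?N"] t(1)
        by (simp_all add: swap_halves_def)
      then have "x q = x (q - ?N) + ?N" using xs[of "q - ?N"] by (simp add: swap_halves_def)
      then show ?thesis using 2 by (simp add: halves_perm_apply u_def)
    next
      case 3 then show ?thesis using permutes_not_in[OF x, of q] t(1) by (simp add: halves_perm_apply)
    qed
  qed
  then show ?thesis using us wx by blast
qed

text \<open>Shows that dividing \<open>h\<close> by the normalizing entry gives a function of the
  coset: two lifts of the same coset are equal or opposite, and in the second case numerator and
  denominator both change sign.\<close>

lemma zeta_coset_antisym_mat_quotient:
  assumes t: "n = 2 * sum_list \<tau>" "length \<tau> = r div 2" and w: "w permutes {..<n}" and w': "w' permutes {..<n}"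
    and e: "zeta_coset p (antisym_mat r \<tau> w') = zeta_coset p (antisym_mat r \<tau> w)"
    and h: "diag_invariant \<tau> h" "swap_odd \<tau> h"
  shows "h w' / zeta r ^ zexp r (antisym_mat r \<tau> w') 0 = h w / zeta r ^ zexp r (antisym_mat r \<tau> w) 0"
proof -
  have "1 \<cdot>\<^sub>m A = A" for A :: "complex mat" by (auto intro!: eq_matI)
  then have "antisym_mat r \<tau> w' \<in> zeta_coset p (antisym_mat r \<tau> w')"
    by (auto simp: zeta_coset_def intro!: exI[of _ 0])
  then obtain k where "antisym_mat r \<tau> w' = zeta p ^ k \<cdot>\<^sub>m antisym_mat r \<tau> w" unfolding e
    by (auto simp: zeta_coset_def)
  from antisym_mat_zeta_p(1)[OF t w w' this] show ?thesis
  proof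
    assume a: "antisym_mat r \<tau> w' = antisym_mat r \<tau> w"
    have "h w' = h w" using antisym_mat_eq[OF t w w' a] h(1) w t(1) by (auto simp: diag_invariant_def)
    then show ?thesis using a by simp
  next
    assume a: "antisym_mat r \<tau> w' = - antisym_mat r \<tau> w"
    have ws: "w \<circ> swap_halves (sum_list \<tau>) permutes {..<n}"
      using permutes_compose[OF swap_halves_permutes w[unfolded t(1)]] t(1) by simp
    have "antisym_mat r \<tau> w' = antisym_mat r \<tau> (w \<circ> swap_halves (sum_list \<tau>))"
      using antisym_mat_swap_halves[OF _ even_r r t(2), of w] w t(1) a by simp
    then have "h w' = h (w \<circ> swap_halves (sum_list \<tau>))" using antisym_mat_eq[OF t ws w'] h(1) ws t(1)
      by (auto simp: diag_invariant_def)
    then have hw: "h w' = - h w" using h(2) w t(1) by (simp add: swap_odd_def)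
    \<comment> \<open>For the constant function 1, \<open>normalized\<close> is the normalizing
      entry itself.\<close>
    have "normalized r p (\<lambda>_. 1) (antisym_mat r \<tau> w') = - normalized r p (\<lambda>_. 1) (antisym_mat r \<tau> w)"
      unfolding a using normalized_uminus[OF antisym_mat_Grn'[OF t(1) w]] by simp
    then have "zeta r ^ zexp r (antisym_mat r \<tau> w') 0 = - (zeta r ^ zexp r (antisym_mat r \<tau> w) 0)"
      by (simp add: normalized_def)
    then show ?thesis using hw by simp
  qed
qed

text \<open>The quotient may be evaluated at any chosen \<open>w\<close> of a coset. Hence every odd
  function that is invariant under the diagonal Young subgroup comes from a function supported on
  the class.\<close>

theorem lifted_surj:
  assumes t: "n = 2 * sum_list \<tau>" "length \<tau> = r div 2" and h: "diag_invariant \<tau> h" "swap_odd \<tau> h"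
  shows "\<exists>f. (\<forall>v. v \<notin> {zeta_coset p (antisym_mat r \<tau> w) |w. w permutes {..<n}} \<longrightarrow> f v = 0) \<and>
    (\<forall>w. w permutes {..<n} \<longrightarrow> lifted f \<tau> w = h w)"
proof -
  define W where "W v = (SOME w. w permutes {..<n} \<and> v = zeta_coset p (antisym_mat r \<tau> w))" for v
  define f where "f v = (if \<exists>w. w permutes {..<n} \<and> v = zeta_coset p (antisym_mat r \<tau> w)
     then h (W v) / zeta r ^ zexp r (antisym_mat r \<tau> (W v)) 0 else 0)" for v
  have "lifted f \<tau> w = h w" if w: "w permutes {..<n}" for w
  proof -
    define v where "v = zeta_coset p (antisym_mat r \<tau> w)"
    have W: "W v permutes {..<n} \<and> v = zeta_coset p (antisym_mat r \<tau> (W v))"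
      unfolding W_def by (rule someI[of _ w]) (use w v_def in simp)
    have "f v = h (W v) / zeta r ^ zexp r (antisym_mat r \<tau> (W v)) 0" unfolding f_def using w v_def by auto
    also have "\<dots> = h w / zeta r ^ zexp r (antisym_mat r \<tau> w) 0"
      by (rule zeta_coset_antisym_mat_quotient[OF t w _ _ h]) (use W v_def in auto)
    finally show ?thesis by (simp add: lifted_def normalized_def v_def)
  qed
  then show ?thesis by (intro exI[of _ f]) (auto simp: f_def)
qed

end

section \<open>The Gelfand model on a class\<close>

text \<open>Evaluates the choice in \<open>lin_op\<close>: an explicit linear map with the
  prescribed values agrees with it on the span. All operators given on generators become formulas in
  this way.\<close>

lemma lin_op_eq:
  assumes L: "clinear L" "\<And>i. i \<in> I \<Longrightarrow> L (b i) = d i" and f: "f \<in> cspan (b ` I)"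
  shows "lin_op I b d f = L f"
proof -
  interpret vector_space_pair cscale cscale ..
  have "clinear (lin_op I b d) \<and> (\<forall>i\<in>I. lin_op I b d (b i) = d i)"
    unfolding lin_op_def by (rule someI[of _ L]) (use L in blast)
  then show ?thesis using L f by (intro linear_eq_on[of "lin_op I b d" L f "b ` I"]) auto
qed

lemma clinearI:
  assumes "\<And>f g x. L (f + g) x = L f x + L g x" "\<And>c f x. L (cscale c f) x = c * L f x"
  shows "clinear L"
  unfolding linear_iff_module_hom
  by unfold_locales (use assms in \<open>auto simp: fun_eq_iff cscale_def algebra_simps\<close>)

lemma C_basis_span:
  assumes "finite c"
  shows "f \<in> cspan (C_basis ` c) \<longleftrightarrow> (\<forall>v. v \<notin> c \<longrightarrow> f v = 0)"
proof
  assume "f \<in> cspan (C_basis ` c)"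
  then show "\<forall>v. v \<notin> c \<longrightarrow> f v = 0"
    by (induction rule: cfun.span_induct_alt) (auto simp: C_basis_def cscale_def split: if_splits)
next
  assume f: "\<forall>v. v \<notin> c \<longrightarrow> f v = 0"
  have "f = (\<Sum>v\<in>c. cscale (f v) (C_basis v))"
  proof
    fix u
    have "(\<Sum>v\<in>c. cscale (f v) (C_basis v)) u = (\<Sum>v\<in>c. if u = v then f v else 0)"
      unfolding sum_fun_apply by (intro sum.cong refl) (simp add: cscale_def C_basis_def)
    then show "f u = (\<Sum>v\<in>c. cscale (f v) (C_basis v)) u" using f assms by simp
  qed
  also have "\<dots> \<in> cspan (C_basis ` c)" by (intro cfun.span_sum cfun.span_scale cfun.span_base imageI)
  finally show "f \<in> cspan (C_basis ` c)" .
qed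

lemma funpow_rotate: "(rotate a ^^ k) xs = rotate (k * a) xs"
  by (induction k) (simp_all add: rotate_rotate add.commute)

lemma type_orbit_iff: "\<sigma> \<in> type_orbit r p \<tau> \<longleftrightarrow> (\<exists>k. \<sigma> = rotate (k * (r div p)) \<tau>)"
  by (auto simp: type_orbit_def funpow_rotate)

lemma smult_one_mult: "A \<in> carrier_mat n n \<Longrightarrow> (c \<cdot>\<^sub>m 1\<^sub>m n) * A = c \<cdot>\<^sub>m (A :: complex mat)"
  by (simp add: mult_smult_assoc_mat[of "1\<^sub>m n" n n])

lemma smult_smult_mat: "(a :: complex) \<cdot>\<^sub>m (b \<cdot>\<^sub>m A) = (a * b) \<cdot>\<^sub>m A"
  by (rule eq_matI) auto

lemma zeta_coset_self: "A \<in> zeta_coset p A"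
proof -
  have "1 \<cdot>\<^sub>m A = A" by (auto intro!: eq_matI)
  then show ?thesis by (auto simp: zeta_coset_def intro!: exI[of _ 0])
qed

lemma monomial_cnj: "r > 0 \<Longrightarrow> map_mat cnj (monomial r n \<sigma> z) = monomial r n \<sigma> (\<lambda>j. (r - 1) * z j)"
proof (rule eq_matI)
  assume r: "r > 0"
  have "cnj (zeta r) = zeta r ^ (r - 1)"
  proof -
    have "zeta r * cnj (zeta r) = 1" using zeta_power[of r 1] by (simp add: complex_norm_square[symmetric])
    also have "1 = zeta r * zeta r ^ (r - 1)" using zeta_pow_self[OF r] r by (simp flip: power_Suc)
    finally show ?thesis by simp
  qed
  then show "map_mat cnj (monomial r n \<sigma> z) $$ (i, j) = monomial r n \<sigma> (\<lambda>j. (r - 1) * z j) $$ (i, j)"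
    if "i < dim_row (monomial r n \<sigma> (\<lambda>j. (r - 1) * z j))" "j < dim_col (monomial r n \<sigma> (\<lambda>j. (r - 1) * z j))" for i j
    using that by (simp add: monomial_index power_mult)
qed auto

section \<open>Cosets, absolute involutions and the Gelfand coefficient\<close>

context gelfand_setting begin

lemma zeta_coset_rotate:
  assumes "n = 2 * sum_list \<tau>" "length \<tau> = r div 2" "w permutes {..<n}"
  shows "zeta_coset p (antisym_mat r (rotate (k * (r div p)) \<tau>) w)
    = zeta_coset p (antisym_mat r \<tau> (w \<circ> rotation_perm \<tau> (k * (r div p))))"
proof -
  have "zeta p ^ k \<cdot>\<^sub>m antisym_mat r (rotate (k * (r div p)) \<tau>) w
    = antisym_mat r \<tau> (w \<circ> rotation_perm \<tau> (k * (r div p)))"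
    using antisym_mat_rotate[OF _ even_r r assms(2), of w "k * (r div p)"] assms(1,3) by (simp add: zeta_p)
  from arg_cong[OF this, of "zeta_coset p"] show ?thesis by (simp only: zeta_coset_smult)
qed

lemma zeta_coset_r_coset:
  assumes "A \<in> carrier_mat n n" shows "Cp p n #>\<^bsub>Grn r n\<^esub> A = zeta_coset p A"
  using assms by (auto simp: r_coset_def Cp_def zeta_coset_def Grn_def smult_one_mult)

lemma Mod_carrier: "v \<in> carrier (Grn r n Mod Cp p n) \<longleftrightarrow> (\<exists>A\<in>carrier (Grn r n). v = zeta_coset p A)"
proof -
  have "A \<in> carrier_mat n n" if "A \<in> carrier (Grn r n)" for A using that by (simp add: Grn_def)
  then show ?thesis using zeta_coset_r_coset by (auto simp: FactGroup_def RCOSETS_def)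
qed

lemma perm_conj_zeta_coset:
  assumes A: "A \<in> carrier_mat n n"
  shows "perm_conj n \<sigma> (zeta_coset p A) = zeta_coset p (perm_mat n \<sigma> * A * perm_mat n (inv \<sigma>))"
proof -
  have "perm_mat n \<sigma> * (zeta p ^ k \<cdot>\<^sub>m A) * perm_mat n (inv \<sigma>)
    = zeta p ^ k \<cdot>\<^sub>m (perm_mat n \<sigma> * A * perm_mat n (inv \<sigma>))" for k
  proof -
    have P: "perm_mat n \<sigma> \<in> carrier_mat n n" "perm_mat n (inv \<sigma>) \<in> carrier_mat n n" for \<sigma>
      by (simp_all add: perm_mat_def)
    show ?thesis
      using mult_smult_distrib[OF P(1) A] mult_smult_assoc_mat[OF mult_carrier_mat[OF P(1) A] P(2)] by metis
  qed
  moreover have "F ` zeta_coset p A = {F (zeta p ^ k \<cdot>\<^sub>m A) |k. True}" for F :: "complex mat \<Rightarrow> complex mat"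
    unfolding zeta_coset_def by blast
  ultimately show ?thesis unfolding perm_conj_def zeta_coset_def[of p "_ * _"] by simp
qed

lemma antisym_mat_carrier [simp]: "n = 2 * sum_list \<tau> \<Longrightarrow> antisym_mat r \<tau> w \<in> carrier_mat n n"
  by (simp add: antisym_mat_def)

lemma perm_conj_antisym_mat:
  assumes "n = 2 * sum_list \<tau>" "w permutes {..<n}" "\<sigma> permutes {..<n}"
  shows "perm_conj n \<sigma> (zeta_coset p (antisym_mat r \<tau> w)) = zeta_coset p (antisym_mat r \<tau> (\<sigma> \<circ> w))"
  unfolding perm_conj_zeta_coset[OF antisym_mat_carrier[OF assms(1)]]
  using antisym_mat_conj[of w \<tau> \<sigma> r] assms(2,3) unfolding assms(1)[symmetric] by simp

text \<open>An antisymmetric unitary matrix has product -1 with its complex conjugate, and -1 is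
  \<open>zeta p ^ (p div 2)\<close> because \<open>p\<close> is even.\<close>

lemma antisym_mat_mult_cnj:
  assumes t: "n = 2 * sum_list \<tau>" "length \<tau> = r div 2" and w: "w permutes {..<n}"
  shows "antisym_mat r \<tau> w * map_mat cnj (antisym_mat r \<tau> w) = zeta p ^ (p div 2) \<cdot>\<^sub>m 1\<^sub>m n"
proof -
  let ?N = "sum_list \<tau>" let ?z = "block_of (\<tau> @ \<tau>) \<circ> inv w" let ?\<pi> = "w \<circ> swap_halves ?N \<circ> inv w"
  have pp: "?\<pi> permutes {..<n}" using w t(1) swap_halves_conj_permutes by auto
  have ii: "?\<pi> \<circ> ?\<pi> = id"
    using permutes_inverses[OF w] fun_cong[OF swap_halves_swap_halves[of ?N]] by (simp add: fun_eq_iff)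
  have "antisym_mat r \<tau> (w \<circ> swap_halves ?N) = - antisym_mat r \<tau> w"
    using antisym_mat_swap_halves[OF _ even_r r t(2)] w t(1) by simp
  moreover have "inv (w \<circ> swap_halves ?N) = swap_halves ?N \<circ> inv w"
    using inv_comp_permutes[OF w[unfolded t(1)] swap_halves_permutes] by (simp add: inv_swap_halves)
  moreover have "(w \<circ> swap_halves ?N \<circ> swap_halves ?N \<circ> inv (w \<circ> swap_halves ?N)) permutes {..<n}"
    using swap_halves_conj_permutes[of
      "w \<circ> swap_halves ?N" ?N] permutes_compose[OF swap_halves_permutes w[unfolded t(1)]] t(1) by simp
  ultimately have zz: "\<forall>j<n. block_of (\<tau> @ \<tau>) (swap_halves ?N (inv w j)) mod r = (?z j + r div 2) mod r"
    using monomial_eq_iff[OF _ pp r] unfolding antisym_mat_def monomial_uminus[OF even_r r] t(1)[symmetric]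
      by (metis comp_apply)
  have "antisym_mat r \<tau> w * map_mat cnj (antisym_mat r \<tau> w) = monomial r n id (\<lambda>_. r div 2)"
    unfolding antisym_mat_def t(1)[symmetric] monomial_cnj[OF r] monomial_mult[OF pp] ii
  proof (rule monomial_cong[OF r refl])
    fix j assume j: "j < n"
    have "((r - 1) * ?z j + ?z (?\<pi> j)) mod r = ((r - 1) * ?z j + (?z j + r div 2)) mod r"
      using zz j permutes_inverses[OF w] by (metis (no_types, lifting) comp_apply mod_add_right_eq)
    also have "(r - 1) * ?z j + (?z j + r div 2) = r * ?z j + r div 2"
      using r by (cases r) auto
    finally show "((r - 1) * ?z j + ?z (?\<pi> j)) mod r = r div 2 mod r" by simp
  qed
  also have "\<dots> = monomial r n id (\<lambda>_. 0 + (p div 2) * (r div p))"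
  proof -
    have "(p div 2) * (r div p) = r div 2" using p even_p p0 by (auto elim!: dvdE)
    then show ?thesis by simp
  qed
  also have "\<dots> = zeta p ^ (p div 2) \<cdot>\<^sub>m 1\<^sub>m n" unfolding monomial_smult[symmetric] monomial_one zeta_p ..
  finally show ?thesis .
qed

text \<open>Places the class among the elements whose basis vectors define
  \<open>gelfand_act\<close>.\<close>

lemma zeta_coset_antisym_mat_abs_involution:
  assumes t: "n = 2 * sum_list \<tau>" "length \<tau> = r div 2" and w: "w permutes {..<n}"
  shows "zeta_coset p (antisym_mat r \<tau> w) \<in> abs_involutions r p n"
proof -
  let ?A = "antisym_mat r \<tau> w"
  have A: "?A \<in> carrier_mat n n" by (rule antisym_mat_carrier[OF t(1)])
  have cz: "cnj (zeta p ^ j) = zeta p ^ ((p - 1) * j)" for j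
  proof -
    have "map_mat cnj (monomial p 1 id (\<lambda>_. j)) $$ (0, 0) = monomial p 1 id (\<lambda>_. (p - 1) * j) $$ (0, 0)"
      using monomial_cnj[OF p0] by simp
    then show ?thesis by (simp add: monomial_index)
  qed
  have prod: "(zeta p ^ i \<cdot>\<^sub>m ?A) * map_mat cnj (zeta p ^ j \<cdot>\<^sub>m ?A)
    = zeta p ^ (i + (p - 1) * j + p div 2) \<cdot>\<^sub>m 1\<^sub>m n" for i j
  proof -
    have "map_mat cnj (zeta p ^ j \<cdot>\<^sub>m ?A) = zeta p ^ ((p - 1) * j) \<cdot>\<^sub>m map_mat cnj ?A"
      using cz[of j] by (intro eq_matI) auto
    moreover have "(zeta p ^ i \<cdot>\<^sub>m ?A) * (zeta p ^ ((p - 1) * j) \<cdot>\<^sub>m map_mat cnj ?A) =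
      zeta p ^ i \<cdot>\<^sub>m (zeta p ^ ((p - 1) * j) \<cdot>\<^sub>m (?A * map_mat cnj ?A))"
      using A by (simp add: mult_smult_distrib[of _ n n] mult_smult_assoc_mat[of _ n n] smult_smult_mat mult_ac)
    ultimately show ?thesis by (simp add: antisym_mat_mult_cnj[OF t w] smult_smult_mat power_add mult.assoc)
  qed
  have "zeta_coset p ?A <#>\<^bsub>Grn r n\<^esub> (map_mat cnj ` zeta_coset p ?A) = Cp p n"
  proof (intro subset_antisym subsetI)
    fix X assume "X \<in> zeta_coset p ?A <#>\<^bsub>Grn r n\<^esub> (map_mat cnj ` zeta_coset p ?A)"
    then obtain i j where "X = (zeta p ^ i \<cdot>\<^sub>m ?A) * map_mat cnj (zeta p ^ j \<cdot>\<^sub>m ?A)"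
      by (auto simp: set_mult_def zeta_coset_def Grn_def)
    then show "X \<in> Cp p n" unfolding prod Cp_def by blast
  next
    fix X assume "X \<in> Cp p n"
    then obtain k where k: "X = zeta p ^ k \<cdot>\<^sub>m 1\<^sub>m n" by (auto simp: Cp_def)
    \<comment> \<open>The extra \<open>p div 2\<close> compensates the scalar -1 in the product of a
      lift with its conjugate.\<close>
    have "p div 2 + p div 2 = p" using even_p by auto
    then have "zeta p ^ ((k + p div 2) + (p - 1) * 0 + p div 2) = zeta p ^ k"
      by (simp add: add.assoc power_add[of _ k] zeta_pow_self[OF p0])
    then have "X = (zeta p ^ (k + p div 2) \<cdot>\<^sub>m ?A) * map_mat cnj (zeta p ^ 0 \<cdot>\<^sub>m ?A)" unfolding prod k by simp
    then show "X \<in> zeta_coset p ?A <#>\<^bsub>Grn r n\<^esub> (map_mat cnj ` zeta_coset p ?A)"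
      unfolding set_mult_def zeta_coset_def Grn_def by (simp, blast)
  qed
  moreover have "zeta_coset p ?A \<in> carrier (Grn r n Mod Cp p n)"
    unfolding Mod_carrier using antisym_mat_Grn'[OF t(1) w] by blast
  ultimately show ?thesis by (simp add: abs_involutions_def FactGroup_def)
qed

text \<open>Selects the second branch of \<open>gelfand_coeff\<close>: a lift that is both symmetric
  and antisymmetric would equal its negative and have no nonzero entry.\<close>

lemma antisym_mat_transpose:
  assumes t: "n = 2 * sum_list \<tau>" "length \<tau> = r div 2" and w: "w permutes {..<n}" and k: "A
    = zeta p ^ k \<cdot>\<^sub>m antisym_mat r \<tau> w"
    and v: "antisymmetric_elt (zeta_coset p (antisym_mat r \<tau> w))"
  shows "\<not> symmetric_elt (zeta_coset p (antisym_mat r \<tau> w))"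
proof
  assume "symmetric_elt (zeta_coset p (antisym_mat r \<tau> w))"
  then have e: "antisym_mat r \<tau> w = - antisym_mat r \<tau> w"
    using v zeta_coset_self[of "antisym_mat r \<tau> w" p] unfolding symmetric_elt_def antisymmetric_elt_def by metis
  let ?i = "(w \<circ> swap_halves (sum_list \<tau>) \<circ> inv w) 0"
  have "?i < n" using permutes_less[OF swap_halves_conj_permutes] w n t(1) by simp
  then have "antisym_mat r \<tau> w $$ (?i, 0) = zeta r ^ block_of (\<tau> @ \<tau>) (inv w 0)" using n t(1)
    by (simp add: antisym_mat_def monomial_index)
  moreover have "(- antisym_mat r \<tau> w) $$ (?i, 0) = - (antisym_mat r \<tau> w $$ (?i, 0))"
    using \<open>?i < n\<close> n t(1) by (simp add: antisym_mat_def)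
  ultimately show False using e by simp
qed

text \<open>\<open>a_exp\<close> compares the exponents of a lift at 0 and at
  \<open>inv (perm_of g) 0\<close>. The latter is, up to the scalar of the lift, the exponent at 0
  of the conjugated matrix, so the normalization absorbs this factor.\<close>

lemma gelfand_coeff_antisym_mat:
  assumes t: "n = 2 * sum_list \<tau>" "length \<tau> = r div 2" and w: "w permutes {..<n}" and g: "g \<in> Grpn r p n"
    and v: "antisymmetric_elt (zeta_coset p (antisym_mat r \<tau> w))"
  shows "zeta r ^ zexp r (antisym_mat r \<tau> (perm_of g \<circ> w)) 0 * gelfand_coeff r g (zeta_coset p (antisym_mat r \<tau> w)) =
    zeta r ^ (\<Sum>q<n. zexp r g (w q) * block_of (\<tau> @ \<tau>) q) * zeta r ^ zexp r (antisym_mat r \<tau> w) 0"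
proof -
  let ?v = "zeta_coset p (antisym_mat r \<tau> w)"
  have gG: "g \<in> carrier (Grn r n)" "p dvd ztotal r g" using g by (auto simp: Grpn_def)
  obtain \<sigma> z where s: "\<sigma> permutes {..<n}" "g = monomial r n \<sigma> z" using Grn_monomial[OF gG(1) r] by blast
  have pg: "perm_of g = \<sigma>" "dim_col g = n" using s by auto
  have "lift ?v \<in> ?v" unfolding lift_def using zeta_coset_self by (rule someI)
  then obtain k where k: "lift ?v = zeta p ^ k \<cdot>\<^sub>m antisym_mat r \<tau> w" by (auto simp: zeta_coset_def)
  have ze: "zexp r (antisym_mat r \<tau> w) j = block_of (\<tau> @ \<tau>) (inv w j)" if "j < n" for j
    using zexp_antisym_mat[OF _ t(2) even_r r, of w j] w that t(1) by simp
  have zl: "zeta r ^ zexp r (lift ?v) j = zeta r ^ block_of (\<tau> @ \<tau>) (inv w j) * zeta p ^ k" if "j < n" for j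
    unfolding k using zexp_smult(1)[OF antisym_mat_Grn'[OF t(1) w] that] ze[OF that]
    by (simp add: zeta_pow_mod[OF r] power_add zeta_p)
  have s0: "inv \<sigma> 0 < n" using permutes_less[OF permutes_inv[OF s(1)] n] .
  have "zeta r powi a_exp r g ?v = zeta r ^ zexp r (lift ?v) 0 / zeta r ^ zexp r (lift ?v) (inv \<sigma> 0)"
    unfolding a_exp_def pg by (simp add: power_int_diff)
  also have "\<dots> = zeta r ^ block_of (\<tau> @ \<tau>) (inv w 0) / zeta r ^ block_of (\<tau> @ \<tau>) (inv w (inv \<sigma> 0))"
    unfolding zl[OF n] zl[OF s0] by simp
  finally have a: "zeta r powi a_exp r g ?v
    = zeta r ^ block_of (\<tau> @ \<tau>) (inv w 0) / zeta r ^ block_of (\<tau> @ \<tau>) (inv w (inv \<sigma> 0))" .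
  have "zeta r ^ pairing r g ?v = (\<Prod>j<n. (zeta r ^ zexp r (lift ?v) j) ^ zexp r g j)"
    unfolding pairing_def pg(2) power_sum by (intro prod.cong refl) (subst mult.commute, simp add: power_mult)
  also have "\<dots> = (\<Prod>j<n. zeta r ^ (zexp r g j * block_of (\<tau> @ \<tau>) (inv w j)) * (zeta p ^ k) ^ zexp r g j)"
    by (intro prod.cong refl) (simp add: zl power_mult_distrib mult.commute flip: power_mult)
  also have "\<dots> = zeta r ^ (\<Sum>j<n. zexp r g j * block_of (\<tau> @ \<tau>) (inv w j)) * zeta p ^ (k * ztotal r g)"
    unfolding prod.distrib by (simp add: ztotal_def pg(2) power_sum sum_distrib_left power_mult)
  \<comment> \<open>Membership of \<open>g\<close> in \<open>Grpn r p n\<close> makes the pairing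
    independent of the chosen lift; in \<open>a_exp\<close> the scalar of the lift has
    cancelled.\<close>
  also have "zeta p ^ (k * ztotal r g) = 1" using gG(2) by (simp add: zeta_pow_eq_1[OF p0])
  also have "(\<Sum>j<n. zexp r g j * block_of (\<tau> @ \<tau>) (inv w j)) = (\<Sum>q<n. zexp r g (w q) * block_of (\<tau> @ \<tau>) q)"
    using sum.permute[OF w, of "\<lambda>j. zexp r g j * block_of (\<tau> @ \<tau>) (inv w j)"] permutes_inverses[OF w]
      by (simp add: comp_def)
  finally have pr: "zeta r ^ pairing r g ?v = zeta r ^ (\<Sum>q<n. zexp r g (w q) * block_of (\<tau> @ \<tau>) q)" by simp
  have "zexp r (antisym_mat r \<tau> (\<sigma> \<circ> w)) 0 = block_of (\<tau> @ \<tau>) (inv w (inv \<sigma> 0))"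
    using zexp_antisym_mat[OF _ t(2) even_r r, of
      "\<sigma> \<circ> w" 0] permutes_compose[OF w s(1)] n t(1) inv_comp_permutes[OF s(1) w] by simp
  then show ?thesis
    using antisym_mat_transpose[OF t w refl v] unfolding gelfand_coeff_def pr a pg ze[OF n] by (simp add: mult_ac)
qed

end

section \<open>A conjugacy class of antisymmetric elements\<close>

locale gelfand_class = gelfand_setting +
  fixes \<tau> :: "nat list" and c :: "complex mat set set"
  assumes tau: "\<tau> \<in> antisym_type r ` {A \<in> carrier (Grn r n). transpose_mat A = - A}"
    and c: "c \<in> Sn_classes r p n"
    and c_type: "\<forall>v\<in>c. antisymmetric_elt v \<and> has_type r p v (type_orbit r p \<tau>)"
begin

lemma tau_type: "n = 2 * sum_list \<tau>" "length \<tau> = r div 2"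
  using tau antisymmetric_antisym_mat(1,2)[OF _ _ even_r r] by auto

text \<open>A lift of a representative has some type in the orbit of \<tau>; multiplying it by a
  power of \<open>zeta p\<close> rotates this type to \<tau> without leaving the coset. Conjugation
  then runs through all \<open>w\<close>.\<close>

lemma c_antisym_mat: "c = {zeta_coset p (antisym_mat r \<tau> w) |w. w permutes {..<n}}"
proof -
  obtain v0 where v0: "v0 \<in> abs_involutions r p n" "c = {perm_conj n \<sigma> v0 | \<sigma>. \<sigma> permutes {..<n}}"
    using c by (auto simp: Sn_classes_def)
  obtain A where A: "A \<in> carrier (Grn r n)" "v0 = zeta_coset p A"
    using v0(1) Mod_carrier by (auto simp: abs_involutions_def)
  have Ac: "A \<in> carrier_mat n n" using A by (simp add: Grn_def)
  have "perm_mat n id = (1\<^sub>m n :: complex mat)" "inv id = id"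
    using perm_mat_monomial[of n id 1] monomial_one[of 1 n] by simp_all
  then have "perm_conj n id v0 = v0" using Ac by (simp add: A(2) perm_conj_zeta_coset)
  moreover have "perm_conj n id v0 \<in> c" unfolding v0(2) using permutes_id by blast
  ultimately have "v0 \<in> c" by simp
  then have anti: "transpose_mat A = - A" and ty: "type_orbit r p (antisym_type r A) = type_orbit r p \<tau>"
    using c_type zeta_coset_self[of A p] unfolding A(2) antisymmetric_elt_def has_type_def by auto
  define \<tau>' where "\<tau>' = antisym_type r A"
  obtain w where t': "length \<tau>' = r div 2" "n = 2 * sum_list \<tau>'" and w: "w permutes {..<n}" "A = antisym_mat r \<tau>' w"
    using antisymmetric_antisym_mat[OF A(1) anti even_r r] unfolding \<tau>'_def by blast
  have "\<tau> \<in> type_orbit r p \<tau>" unfolding type_orbit_iff by (intro exI[of _ 0]) simp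
  then obtain k where k: "\<tau> = rotate (k * (r div p)) \<tau>'"
    using ty unfolding \<tau>'_def[symmetric] type_orbit_iff by (metis type_orbit_iff)
  let ?\<rho> = "rotation_perm \<tau>' (k * (r div p))"
  have "\<tau>' \<noteq> []" using t'(2) n by auto
  then have rho: "?\<rho> permutes {..<n}" using rotation_perm_permutes t'(2) by simp
  define w1 where "w1 = w \<circ> inv ?\<rho>"
  have w1: "w1 permutes {..<n}" unfolding w1_def by (intro permutes_compose permutes_inv rho w)
  have "w1 \<circ> ?\<rho> = w" by (simp add: w1_def comp_assoc permutes_inv_o[OF rho])
  then have v0w: "v0 = zeta_coset p (antisym_mat r \<tau> w1)"
    using zeta_coset_rotate[OF t'(2,1) w1, of k] A(2) w(2) k by simp
  have pc: "perm_conj n \<sigma> v0 = zeta_coset p (antisym_mat r \<tau> (\<sigma> \<circ> w1))" if "\<sigma> permutes {..<n}" for \<sigma>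
    unfolding v0w by (rule perm_conj_antisym_mat[OF tau_type(1) w1 that])
  show ?thesis
  proof (intro subset_antisym subsetI)
    fix v assume "v \<in> c"
    then obtain \<sigma> where "\<sigma> permutes {..<n}" "v = zeta_coset p (antisym_mat r \<tau> (\<sigma> \<circ> w1))" using pc v0(2) by auto
    then show "v \<in> {zeta_coset p (antisym_mat r \<tau> w) |w. w permutes {..<n}}" using permutes_compose[OF w1] by blast
  next
    fix v assume "v \<in> {zeta_coset p (antisym_mat r \<tau> w) |w. w permutes {..<n}}"
    then obtain u where u: "u permutes {..<n}" "v = zeta_coset p (antisym_mat r \<tau> u)" by blast
    have "u \<circ> inv w1 \<circ> w1 = u" by (simp add: comp_assoc permutes_inv_o[OF w1])
    moreover have "u \<circ> inv w1 permutes {..<n}" by (intro permutes_compose permutes_inv w1 u)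
    ultimately show "v \<in> c" using pc[of "u \<circ> inv w1"] u v0(2) by auto
  qed
qed

lemma finite_c: "finite c"
proof -
  have "c = (\<lambda>w. zeta_coset p (antisym_mat r \<tau> w)) ` Sym n" unfolding c_antisym_mat by auto
  then show ?thesis by simp
qed

lemma rot_type: "n = 2 * sum_list (rotate k \<tau>)" "length (rotate k \<tau>) = r div 2"
  using tau_type by simp_all

text \<open>The class has one such description for every rotation of \<tau> in its orbit; these
  serve the orbit representatives whose block sizes are a rotation of \<tau>.\<close>

lemma c_antisym_mat_rotate: "c = {zeta_coset p (antisym_mat r (rotate (k * (r div p)) \<tau>) w) |w. w permutes {..<n}}"
proof -
  let ?\<rho> = "rotation_perm \<tau> (k * (r div p))"
  have "\<tau> \<noteq> []" using tau_type n by auto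
  then have rho: "?\<rho> permutes {..<n}" using rotation_perm_permutes tau_type by simp
  show ?thesis
  proof (intro subset_antisym subsetI)
    fix v assume "v \<in> c"
    then obtain w where w: "w permutes {..<n}" "v = zeta_coset p (antisym_mat r \<tau> w)" using c_antisym_mat by blast
    have "w \<circ> inv ?\<rho> \<circ> ?\<rho> = w" by (simp add: comp_assoc permutes_inv_o[OF rho])
    moreover have "w \<circ> inv ?\<rho> permutes {..<n}" by (intro permutes_compose permutes_inv rho w)
    ultimately show "v \<in> {zeta_coset p (antisym_mat r (rotate (k * (r div p)) \<tau>) w) |w. w permutes {..<n}}"
      using zeta_coset_rotate[OF tau_type, of "w \<circ> inv ?\<rho>" k] w(2) by auto
  next
    fix v assume "v \<in> {zeta_coset p (antisym_mat r (rotate (k * (r div p)) \<tau>) w) |w. w permutes {..<n}}"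
    then obtain w where "w permutes {..<n}" "v = zeta_coset p (antisym_mat r (rotate (k * (r div p)) \<tau>) w)" by blast
    then show "v \<in> c" using zeta_coset_rotate[OF tau_type, of w k] permutes_compose[OF rho]
      unfolding c_antisym_mat by auto
  qed
qed

lemma gelfand_space: "f \<in> rspace (gelfand_sub r p n c) \<longleftrightarrow> (\<forall>v. v \<notin> c \<longrightarrow> f v = 0)"
  using C_basis_span[OF finite_c] by (simp add: gelfand_sub_def)

text \<open>Conjugation by a permutation is injective on the absolute involutions, so the operator
  defined on basis vectors has a closed formula on functions.\<close>

lemma gelfand_act_conj:
  assumes f: "f \<in> rspace (gelfand_sub r p n c)" and g: "g \<in> carrier (Grn r n)" and v: "v \<in> c"
  shows "gelfand_act r p n g f (perm_conj n (perm_of g) v) = gelfand_coeff r g v * f v"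
proof -
  let ?I = "abs_involutions r p n"
  obtain \<sigma> z where s: "\<sigma> permutes {..<n}" "g = monomial r n \<sigma> z" using Grn_monomial[OF g r] by blast
  have pg: "perm_of g = \<sigma>" using s by simp
  have inv: "perm_conj n (inv \<sigma>) (perm_conj n \<sigma> v) = v" if v: "v \<in> ?I" for v
  proof -
    obtain A where A: "A \<in> carrier (Grn r n)" "v = zeta_coset p A"
      using v Mod_carrier by (auto simp: abs_involutions_def)
    obtain \<pi> y where q: "\<pi> permutes {..<n}" "A = monomial r n \<pi> y" using Grn_monomial[OF A(1) r] by blast
    have qc: "\<sigma> \<circ> \<pi> \<circ> inv \<sigma> permutes {..<n}" using s(1) q(1) by (intro permutes_compose permutes_inv)
    have "inv \<sigma> \<circ> (\<sigma> \<circ> \<pi> \<circ> inv \<sigma>) \<circ> \<sigma> = \<pi>" "y \<circ> inv \<sigma> \<circ> \<sigma> = y"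
      using permutes_inverses[OF s(1)] by (auto simp: fun_eq_iff)
    then show ?thesis
      using monomial_conj[OF permutes_inv[OF s(1)] qc, of r "y \<circ> inv \<sigma>"]
      by (simp add: A(2) q(2) perm_conj_zeta_coset monomial_conj[OF s(1) q(1)] permutes_inv_inv[OF s(1)])
  qed
  \<comment> \<open>A function is evaluated at the element conjugated back, which turns the action
    on basis vectors into one on values.\<close>
  define L where "L f u = (if u \<in> perm_conj n \<sigma> ` ?I
    then gelfand_coeff r g (perm_conj n (inv \<sigma>) u) * f (perm_conj n (inv \<sigma>) u) else 0)" for f u
  have cI: "c \<subseteq> ?I" using zeta_coset_antisym_mat_abs_involution[OF tau_type] unfolding c_antisym_mat by auto
  have "gelfand_act r p n g f = L f"
    unfolding gelfand_act_def
  proof (rule lin_op_eq)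
    show "clinear L" by (rule clinearI) (auto simp: L_def cscale_def algebra_simps)
    show "L (C_basis v) = cscale (gelfand_coeff r g v) (C_basis (perm_conj n (perm_of g) v))" if "v \<in> ?I" for v
      using that inv by (auto simp: L_def C_basis_def cscale_def pg fun_eq_iff)
    have "cspan (C_basis ` c) \<subseteq> cspan (C_basis ` ?I)" using cI by (intro cfun.span_mono) auto
    then show "f \<in> cspan (C_basis ` ?I)" using f by (auto simp: gelfand_sub_def)
  qed
  then show ?thesis using v cI inv[of v] by (auto simp: L_def pg)
qed

text \<open>After normalization only the pairing survives, written in the coordinates of
  \<open>w\<close>: exponents of \<open>g\<close> weighted with block numbers. In this form it can
  be compared with the induced side.\<close>

theorem lifted_gelfand_act:
  assumes f: "f \<in> rspace (gelfand_sub r p n c)" and g: "g \<in> Grpn r p n" and w: "w permutes {..<n}"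
    and \<tau>': "\<tau>' = rotate (k * (r div p)) \<tau>"
  shows "lifted (gelfand_act r p n g f) \<tau>' (perm_of g \<circ> w) =
    zeta r ^ (\<Sum>q<n. zexp r g (w q) * block_of (\<tau>' @ \<tau>') q) * lifted f \<tau>' w"
proof -
  have gG: "g \<in> carrier (Grn r n)" using g by (auto simp: Grpn_def)
  obtain \<sigma> z where s: "\<sigma> permutes {..<n}" "g = monomial r n \<sigma> z" using Grn_monomial[OF gG r] by blast
  have t: "n = 2 * sum_list \<tau>'" "length \<tau>' = r div 2" using rot_type \<tau>' by auto
  have v: "zeta_coset p (antisym_mat r \<tau>' w) \<in> c" using w unfolding c_antisym_mat_rotate[of k] \<tau>' by blast
  have "perm_conj n (perm_of g) (zeta_coset p (antisym_mat r \<tau>' w)) = zeta_coset p (antisym_mat r \<tau>' (perm_of g \<circ> w))"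
    using s by (intro perm_conj_antisym_mat[OF t(1) w]) simp
  then have "gelfand_act r p n g f (zeta_coset p (antisym_mat r \<tau>' (perm_of g \<circ> w))) =
      gelfand_coeff r g (zeta_coset p (antisym_mat r \<tau>' w)) * f (zeta_coset p (antisym_mat r \<tau>' w))"
    using gelfand_act_conj[OF f gG v] by simp
  then show ?thesis using gelfand_coeff_antisym_mat[OF t w g] c_type v
    by (simp add: lifted_def normalized_def flip: mult.assoc)
qed

end

section \<open>Tensor products of Specht modules and induction\<close>

lemma pure_tensor_simps [simp]:
  "pure_tensor [] [] = 1" "pure_tensor [] (y # ys) = 0" "pure_tensor (f # fs) [] = 0"
  "pure_tensor (f # fs) (y # ys) = f y * pure_tensor fs ys"
  by (simp_all add: pure_tensor_def prod.lessThan_Suc_shift del: prod.lessThan_Suc)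

lemma pure_tensor_tkernel:
  "\<forall>l\<in>set L. partition_list l \<Longrightarrow> fs \<in> listset (map specht L) \<Longrightarrow>
    pure_tensor fs Y = (\<Sum>Y'\<in>tabs_list L. tkernel L Y Y' * pure_tensor fs Y')"
proof (induction L arbitrary: fs Y)
  case Nil then show ?case by (cases Y) auto
next
  case (Cons l L)
  then obtain f fs' where f: "fs = f # fs'" "f \<in> specht l" "fs' \<in> listset (map specht L)" by auto
  have pl: "partition_list l" "\<forall>l\<in>set L. partition_list l" using Cons.prems(1) by auto
  have IH: "pure_tensor fs' Y' = (\<Sum>X\<in>tabs_list L. tkernel L Y' X * pure_tensor fs' X)" for Y'
    by (rule Cons.IH[OF pl(2) f(3)])
  have f2: "f y = (\<Sum>x\<in>tabs l. skernel l y x * f x)" for y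
    using f(2) unfolding specht_iff[OF pl(1)] by (rule spec)
  show ?case
  proof (cases "Y = []")
    case False
    then obtain y Y' where Y: "Y = y # Y'" by (cases Y) auto
    have "f y * pure_tensor fs' Y'
      = (\<Sum>x\<in>tabs l. skernel l y x * f x) * (\<Sum>X\<in>tabs_list L. tkernel L Y' X * pure_tensor fs' X)"
      by (rule arg_cong2[OF f2 IH])
    also have "\<dots> = (\<Sum>x\<in>tabs l. \<Sum>X\<in>tabs_list L. tkernel (l # L) (y # Y') (x # X) * pure_tensor (f # fs') (x # X))"
      by (simp add: sum_product mult_ac)
    finally show ?thesis by (simp add: f(1) Y sum_set_Cons)
  qed (auto simp: f(1) sum_set_Cons)
qed

lemma tkernel_pure_tensor:
  "Z \<in> tabs_list L \<Longrightarrow> \<exists>fs\<in>listset (map specht L). (\<lambda>Y. tkernel L Y Z) = pure_tensor fs"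
proof (induction L arbitrary: Z)
  case Nil
  have "tkernel [] Y [] = pure_tensor [] Y" for Y by (cases Y) auto
  then show ?case using Nil by (auto simp: fun_eq_iff)
next
  case (Cons l L)
  then obtain z Z' where z: "Z = z # Z'" "z \<in> tabs l" "Z' \<in> tabs_list L" by auto
  obtain fs where fs: "fs \<in> listset (map specht L)" "(\<lambda>Y. tkernel L Y Z') = pure_tensor fs" using Cons.IH[OF z(3)]
    by blast
  have "tkernel (l # L) Y Z = pure_tensor ((\<lambda>x. skernel l x z) # fs) Y" for Y
    using fun_cong[OF fs(2)] by (cases Y) (auto simp: z(1))
  moreover have "(\<lambda>x. skernel l x z) # fs \<in> listset (map specht (l # L))" using fs(1) skernel_in_specht[OF z(2)]
    by simp
  ultimately show ?case by blast
qed

text \<open>The tensor product of the projections fixes every pure tensor of Specht vectors, and its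
  columns are themselves such pure tensors.\<close>

lemma outer_specht_iff:
  assumes L: "\<forall>l\<in>set L. partition_list l"
  shows "f \<in> cspan (pure_tensor ` listset (map specht L)) \<longleftrightarrow> (\<forall>Y. f Y = (\<Sum>Y'\<in>tabs_list L. tkernel L Y Y' * f Y'))"
proof
  assume "f \<in> cspan (pure_tensor ` listset (map specht L))"
  then show "\<forall>Y. f Y = (\<Sum>Y'\<in>tabs_list L. tkernel L Y Y' * f Y')"
  proof (induction rule: cfun.span_induct_alt)
    case (step c f g)
    then obtain fs where fs: "fs \<in> listset (map specht L)" "f = pure_tensor fs" by blast
    show ?case
    proof
      fix Y
      have "(\<Sum>Y'\<in>tabs_list L. tkernel L Y Y' * (cscale c f + g) Y')
        = c * (\<Sum>Y'\<in>tabs_list L. tkernel L Y Y' * f Y') + (\<Sum>Y'\<in>tabs_list L. tkernel L Y Y' * g Y')"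
        by (simp add: cscale_def sum.distrib sum_distrib_left algebra_simps)
      also have "\<dots> = c * f Y + g Y"
        using step.IH[rule_format, of Y] pure_tensor_tkernel[OF L fs(1), of Y] by (simp only: fs(2))
      finally show "(cscale c f + g) Y = (\<Sum>Y'\<in>tabs_list L. tkernel L Y Y' * (cscale c f + g) Y')"
        by (simp add: cscale_def)
    qed
  qed simp
next
  assume f: "\<forall>Y. f Y = (\<Sum>Y'\<in>tabs_list L. tkernel L Y Y' * f Y')"
  have "f = (\<Sum>Z\<in>tabs_list L. cscale (f Z) (\<lambda>Y. tkernel L Y Z))"
    by (rule ext) (subst f[rule_format], simp add: sum_fun_apply cscale_def mult.commute)
  also have "\<dots> \<in> cspan (pure_tensor ` listset (map specht L))"
  proof (intro cfun.span_sum cfun.span_scale)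
    fix Z assume "Z \<in> tabs_list L"
    from tkernel_pure_tensor[OF this] show "(\<lambda>Y. tkernel L Y Z) \<in> cspan (pure_tensor ` listset (map specht L))"
      by (auto intro: cfun.span_base)
  qed
  finally show "f \<in> cspan (pure_tensor ` listset (map specht L))" .
qed

abbreviation OT :: "nat \<Rightarrow> nat list list \<Rightarrow> (complex mat list, nat set list list) rep" where
  "OT r L \<equiv> outer_tensor_rep (map (\<lambda>i. twisted_specht_rep r i (L ! i)) [0..<r])"

abbreviation HB :: "nat \<Rightarrow> nat list list \<Rightarrow> complex mat list set" where
  "HB r L \<equiv> listset (map (\<lambda>l. carrier (Grn r (sum_list l))) L)"

lemma rspace_OT:
  assumes "length L = r"
  shows "rspace (OT r L) = cspan (pure_tensor ` listset (map specht L))"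
proof -
  have "map rspace (map (\<lambda>i. twisted_specht_rep r i (L ! i)) [0..<r]) = map specht L"
    using assms by (intro nth_equalityI) (auto simp: twisted_specht_rep_def)
  then show ?thesis by (simp add: outer_tensor_rep_def)
qed

text \<open>The guard on the length matches \<open>pure_tensor\<close>, which vanishes on lists of
  any other length.\<close>

lemma ract_OT:
  assumes len: "length L = r" and f: "f \<in> rspace (OT r L)"
  shows "ract (OT r L) hs f =
    (\<lambda>Y. if length Y = r then (\<Prod>i<r. (zeta r ^ ztotal r (hs ! i)) ^ i) * f
      (map (\<lambda>i. pact (inv (perm_of (hs ! i))) (Y ! i)) [0..<r]) else 0)"
proof -
  define L0 where "L0 f = (\<lambda>Y. if length Y = r then (\<Prod>i<r. (zeta r ^ ztotal r (hs ! i)) ^ i) *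
     f (map (\<lambda>i. pact (inv (perm_of (hs ! i))) (Y ! i)) [0..<r]) else 0)" for f :: "nat set list list \<Rightarrow> complex"
  let ?Rs = "map (\<lambda>i. twisted_specht_rep r i (L ! i)) [0..<r]"
  have "lin_op (listset (map rspace ?Rs)) pure_tensor
     (\<lambda>fs. pure_tensor (map (\<lambda>i. ract (?Rs ! i) (hs ! i) (fs ! i)) [0..<length ?Rs])) f = L0 f"
  proof (rule lin_op_eq)
    show "clinear L0" by (rule clinearI) (auto simp: L0_def cscale_def algebra_simps)
    fix fs assume "fs \<in> listset (map rspace ?Rs)"
    then have lf: "length fs = r" using length_listset by force
    show "L0 (pure_tensor fs) = pure_tensor (map (\<lambda>i. ract (?Rs ! i) (hs ! i) (fs ! i)) [0..<length ?Rs])"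
    proof
      fix Y
      show "L0 (pure_tensor fs) Y = pure_tensor (map (\<lambda>i. ract (?Rs ! i) (hs ! i) (fs ! i)) [0..<length ?Rs]) Y"
      proof (cases "length Y = r")
        case True
        then show ?thesis
          by (simp add: L0_def pure_tensor_def lf twisted_specht_rep_def cscale_def specht_act_def
              pact_def[symmetric] prod.distrib[symmetric])
      qed (simp add: L0_def pure_tensor_def)
    qed
  next
    show "f \<in> cspan (pure_tensor ` listset (map rspace ?Rs))" using f by (simp add: outer_tensor_rep_def)
  qed
  then show ?thesis by (simp add: outer_tensor_rep_def L0_def)
qed

section \<open>Induced representations as functions on the symmetric group\<close>

fun block_fun :: "nat list \<Rightarrow> (nat \<Rightarrow> nat) list \<Rightarrow> nat \<Rightarrow> nat" where
  "block_fun (s # ss) (z # zs) q = (if q < s then z q else block_fun ss zs (q - s))"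
| "block_fun _ _ q = 0"

lemma diag_block_monomial:
  "us \<in> Young_group ss \<Longrightarrow> length zs = length ss \<Longrightarrow>
    diag_block_mat (map (\<lambda>i. monomial r (ss ! i) (us ! i) (zs ! i)) [0..<length ss]) =
    monomial r (sum_list ss) (block_perm ss us) (block_fun ss zs)"
proof (induction ss arbitrary: us zs)
  case Nil
  then show ?case by (intro eq_matI) auto
next
  case (Cons s ss)
  then obtain u us' z zs'
    where e: "us = u # us'" "u permutes {..<s}" "us' \<in> Young_group ss" "zs = z # zs'" "length zs' = length ss"
    by (cases zs) auto
  have m: "map (\<lambda>i. monomial r ((s # ss) ! i) (us ! i) (zs ! i)) [0..<length (s # ss)] =
     monomial r s u z # map (\<lambda>i. monomial r (ss ! i) (us' ! i) (zs' ! i)) [0..<length ss]"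
    by (simp add: e upt_conv_Cons map_Suc_upt[symmetric] map_map comp_def del: upt_Suc)
  show ?case unfolding m diag_block_mat.simps Cons.IH[OF e(3,5)] Let_def
  proof (rule eq_matI)
    fix i j assume "i < dim_row (monomial r (sum_list (s # ss)) (block_perm (s # ss) us) (block_fun (s # ss) zs))"
      "j < dim_col (monomial r (sum_list (s # ss)) (block_perm (s # ss) us) (block_fun (s # ss) zs))"
    then show "four_block_mat (monomial r s u z) (0\<^sub>m (dim_row (monomial r s u z))
      (dim_col (monomial r (sum_list ss) (block_perm ss us') (block_fun ss zs'))))
       (0\<^sub>m (dim_row (monomial r (sum_list ss) (block_perm ss us') (block_fun ss zs'))) (dim_col (monomial r s u z)))
       (monomial r (sum_list ss) (block_perm ss us') (block_fun ss zs')) $$ (i, j) =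
      monomial r (sum_list (s # ss)) (block_perm (s # ss) us) (block_fun (s # ss) zs) $$ (i, j)"
      using permutes_less[OF e(2), of j] by (auto simp: monomial_index e(1,4))
  qed auto
qed

lemma HB_monomial:
  assumes r: "r > 0"
  shows "hs \<in> HB r L \<Longrightarrow> \<exists>us\<in>Young_group (map sum_list L). \<exists>zs. length zs = length L \<and>
    hs = map (\<lambda>i. monomial r (map sum_list L ! i) (us ! i) (zs ! i)) [0..<length L]"
proof (induction L arbitrary: hs)
  case (Cons l L)
  then obtain h hs' where h: "hs = h # hs'" "h \<in> carrier (Grn r (sum_list l))" "hs' \<in> HB r L" by auto
  obtain u z where u: "u permutes {..<sum_list l}" "h = monomial r (sum_list l) u z" using Grn_monomial[OF h(2) r]
    by blast
  obtain us zs where us: "us \<in> Young_group (map sum_list L)" "length zs = length L"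
    "hs' = map (\<lambda>i. monomial r (map sum_list L ! i) (us ! i) (zs ! i)) [0..<length L]" using Cons.IH[OF h(3)] by blast
  have "hs = map (\<lambda>i. monomial r (map sum_list (l # L) ! i) ((u # us) ! i) ((z # zs) ! i)) [0..<length (l # L)]"
    by (simp add: h(1) u(2) us(3) upt_conv_Cons map_Suc_upt[symmetric] map_map comp_def del: upt_Suc)
  moreover have "u # us \<in> Young_group (map sum_list (l # L))" using u us by simp
  ultimately show ?case using us(2) by (intro bexI[of _ "u # us"] exI[of _ "z # zs"]) auto
qed auto

lemma monomial_HB:
  assumes r: "r > 0" and us: "us \<in> Young_group (map sum_list L)"
  shows "map (\<lambda>i. monomial r (map sum_list L ! i) (us ! i) (zs ! i)) [0..<length L] \<in> HB r L"
proof -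
  have "monomial r (map sum_list L ! i) (us ! i) (zs ! i) \<in> carrier (Grn r (sum_list (L ! i)))" if "i < length L"
    for i
    using us that by (auto simp: listset_iff intro!: monomial_in_Grn r)
  then show ?thesis by (auto simp: listset_iff)
qed

lemma sum_lessThan_add: "(\<Sum>q<s + t. f q) = (\<Sum>q<s. f q) + (\<Sum>q<t. f (s + q :: nat) :: nat)"
  by (induction t) (auto simp: add.assoc)

text \<open>The offset \<open>k\<close> counts the blocks already removed in the induction; for
  \<open>k = 0\<close> this is the scalar of the powers of the linear character.\<close>

lemma block_fun_block_of:
  "length zs = length ss \<Longrightarrow>
    (\<Prod>i<length ss. (zeta r ^ (\<Sum>a<ss ! i. (zs ! i) a)) ^ (i + k)) = zeta r ^ (\<Sum>q<sum_list ss. block_fun ss zs q *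
      (block_of ss q + k))"
proof (induction ss arbitrary: zs k)
  case (Cons s ss)
  then obtain z zs' where e: "zs = z # zs'" "length zs' = length ss" by (cases zs) auto
  have S: "(\<Sum>q<sum_list (s # ss). block_fun (s # ss) zs q * (block_of (s # ss) q + k)) =
    (\<Sum>q<s. z q) * k + (\<Sum>q<sum_list ss. block_fun ss zs' q * (block_of ss q + Suc k))"
    by (simp add: sum_lessThan_add e sum_distrib_right)
  have "(\<Prod>i<length (s # ss). (zeta r ^ (\<Sum>a<(s # ss) ! i. (zs ! i) a)) ^ (i + k)) =
     (zeta r ^ (\<Sum>q<s. z q)) ^ k * (\<Prod>i<length ss. (zeta r ^ (\<Sum>a<ss ! i. (zs' ! i) a)) ^ (i + Suc k))"
    by (simp add: prod.lessThan_Suc_shift e(1) del: prod.lessThan_Suc power_Suc)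
  then show ?case unfolding Cons.IH[OF e(2)] S by (simp add: power_add power_mult)
qed simp

text \<open>The scalar that separates an induced function at \<open>x\<close> from its value at the
  permutation \<open>perm_of x\<close>: the exponents of \<open>x\<close>, each weighted with the
  number of the block to which its position is sent.\<close>

definition colour_char :: "nat \<Rightarrow> nat list \<Rightarrow> complex mat \<Rightarrow> complex" where
  "colour_char r ss x = zeta r ^ (\<Sum>j<dim_col x. zexp r x j * block_of ss (perm_of x j))"

lemma zeta_pow_sum_mod:
  assumes "r > 0" shows "zeta r ^ (\<Sum>j\<in>A. (z j mod r) * b j) = zeta r ^ (\<Sum>j\<in>A. z j * b j)"
  by (simp add: power_sum power_mult zeta_pow_mod[OF assms])

lemma colour_char_monomial:
  assumes "\<sigma> permutes {..<n}" "r > 0"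
  shows "colour_char r ss (monomial r n \<sigma> z) = zeta r ^ (\<Sum>j<n. z j * block_of ss (\<sigma> j))"
  using assms by (simp add: colour_char_def zeta_pow_sum_mod)

text \<open>Describes the restrictions to permutation matrices of the functions that form the
  induced module.\<close>

definition specht_covariant :: "nat list list \<Rightarrow> ((nat \<Rightarrow> nat) \<Rightarrow> nat set list list \<Rightarrow> complex) \<Rightarrow> bool" where
  "specht_covariant L h \<longleftrightarrow> (\<forall>w. w permutes {..<sum_list (map sum_list L)} \<longrightarrow>
     (\<forall>Y. h w Y = (\<Sum>Y'\<in>tabs_list L. tkernel L Y Y' * h w Y')) \<and>
     (\<forall>us\<in>Young_group (map sum_list L). \<forall>Y\<in>tabs_list L. h (block_perm (map sum_list L) us \<circ> w) (lact us Y) = h w Y))"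

definition V_of :: "nat \<Rightarrow> nat list list \<Rightarrow> ((nat \<Rightarrow> nat) \<Rightarrow> nat set list list \<Rightarrow> complex) \<Rightarrow> complex mat \<times> nat set list
  list \<Rightarrow> complex" where
  "V_of r L h = (\<lambda>(x, Y). if x \<in> carrier (Grn r (sum_list (map sum_list L)))
     then colour_char r (map sum_list L) x * h (perm_of x) Y else 0)"

lemma ract_OT_monomial:
  assumes r: "r > 0" and len: "length L = r" and f: "f \<in> rspace (OT r L)"
    and us: "us \<in> Young_group (map sum_list L)" and zs: "length zs = length L"
  shows "ract (OT r L) (map (\<lambda>i. monomial r (map sum_list L ! i) (us ! i) (zs ! i)) [0..<length L]) f =
    (\<lambda>Y. if length Y = r then zeta r ^ (\<Sum>q<sum_list (map sum_list L). block_fun (map sum_list L) zs q * block_of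
      (map sum_list L) q)
        * f (lact (list_inv us) Y) else 0)"
proof -
  let ?ss = "map sum_list L"
  have u: "us ! i permutes {..<?ss ! i}" if "i < r" for i using us that len by (auto simp: listset_iff)
  have "(\<Prod>i<r. (zeta r ^ ztotal r (map (\<lambda>i. monomial r (?ss ! i) (us ! i) (zs ! i)) [0..<length L] ! i)) ^ i) =
     (\<Prod>i<length ?ss. (zeta r ^ (\<Sum>a<?ss ! i. (zs ! i) a)) ^ (i + 0))"
    using u r len by (intro prod.cong) (auto simp: ztotal_monomial)
  also have "\<dots> = zeta r ^ (\<Sum>q<sum_list ?ss. block_fun ?ss zs q * (block_of ?ss q + 0))"
    by (rule block_fun_block_of) (use zs in simp)
  finally have 1: "(\<Prod>i<r. (zeta r ^ ztotal r (map (\<lambda>i. monomial r (?ss ! i) (us ! i) (zs ! i)) [0..<length L] !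
    i)) ^ i) =
     zeta r ^ (\<Sum>q<sum_list ?ss. block_fun ?ss zs q * block_of ?ss q)" by simp
  have 2: "map (\<lambda>i. pact (inv (perm_of (map (\<lambda>i. monomial r (?ss ! i) (us ! i) (zs ! i)) [0..<length L] ! i)))
    (Y ! i)) [0..<r] = lact (list_inv us) Y"
    if "length Y = r" for Y
    using u len that length_listset[OF us] by (intro nth_equalityI) (auto simp: lact_def list_inv_def)
  show ?thesis unfolding ract_OT[OF len f] 1 using 2 by (intro ext) simp
qed

text \<open>Every monomial matrix is a diagonal matrix times a permutation matrix. The diagonal
  matrices lie in the block subgroup and act by scalars, so an induced function is determined by its
  values at permutations, where covariance under the block permutations remains.\<close>

theorem V_iff:
  assumes r: "r > 0" and len: "length L = r" and L: "\<forall>l\<in>set L. partition_list l" and N: "N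
    = sum_list (map sum_list L)"
  shows "F \<in> rspace (rho r N L) \<longleftrightarrow> (\<exists>h. specht_covariant L h \<and> F = V_of r L h)"
proof -
  let ?ss = "map sum_list L"
  have OT: "f \<in> rspace (OT r L) \<longleftrightarrow> (\<forall>Y. f Y = (\<Sum>Y'\<in>tabs_list L. tkernel L Y Y' * f Y'))" for f
    unfolding rspace_OT[OF len] by (rule outer_specht_iff[OF L])
  have out: "f Y = 0" if "f \<in> rspace (OT r L)" "Y \<notin> tabs_list L" for f Y
    using that unfolding OT by (metis (no_types, lifting) tkernel_outside mult_zero_left sum.neutral)
  have lss: "length ?ss = length L" by simp
  show ?thesis
  proof
    assume F: "F \<in> rspace (rho r N L)"
    define h where "h w Y = F (monomial r N w (\<lambda>_. 0), Y)" for w Y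
    have F1: "(\<lambda>y. F (x, y)) \<in> rspace (OT r L)" if "x \<in> carrier (Grn r N)" for x
      using F that by (simp add: rho_def ind_rep_def)
    have F2: "F (x, y) = 0" if "x \<notin> carrier (Grn r N)" for x y using F that by (simp add: rho_def ind_rep_def)
    have F3: "(\<lambda>y. F (diag_block_mat hs * x, y)) = ract (OT r L) hs (\<lambda>y. F (x, y))"
      if "hs \<in> HB r L" "x \<in> carrier (Grn r N)" for hs x using F that by (simp add: rho_def ind_rep_def)
    have F4: "F (monomial r N (block_perm ?ss us \<circ> \<sigma>) (\<lambda>j. z j + block_fun ?ss zs (\<sigma> j)), Y) =
        (if length Y = r then zeta r ^ (\<Sum>q<N. block_fun ?ss zs q * block_of ?ss q) * F (monomial r N \<sigma> z, lact
          (list_inv us) Y) else 0)"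
      if us: "us \<in> Young_group ?ss" and zs: "length zs = length L" and s: "\<sigma> permutes {..<N}" for us zs \<sigma> z Y
    proof -
      have x: "monomial r N \<sigma> z \<in> carrier (Grn r N)" by (rule monomial_in_Grn[OF s r])
      have zs': "length zs = length ?ss" using zs by simp
      show ?thesis
        using fun_cong[OF F3[OF monomial_HB[OF r us, of zs] x], of Y] ract_OT_monomial[OF r len F1[OF x] us zs]
        using diag_block_monomial[OF us zs', of r] by (simp add: N[symmetric] monomial_mult[OF s])
    qed
    have "specht_covariant L h" unfolding specht_covariant_def N[symmetric]
    proof (intro allI impI conjI ballI)
      fix w assume w: "w permutes {..<N}"
      show "h w Y = (\<Sum>Y'\<in>tabs_list L. tkernel L Y Y' * h w Y')" for Y
        using F1[OF monomial_in_Grn[OF w r, of "\<lambda>_. 0"]] unfolding h_def OT by blast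
      fix us Y assume us: "us \<in> Young_group ?ss" and Y: "Y \<in> tabs_list L"
      define zs where "zs = map (\<lambda>_. (\<lambda>_ :: nat. 0 :: nat)) L"
      have "block_fun ss (map (\<lambda>_. (\<lambda>_ :: nat. 0 :: nat)) K) q = 0" for ss q and K :: "nat list list"
      proof (induction K arbitrary: ss q)
        case Nil show ?case by (cases ss) auto
      next
        case (Cons k K) then show ?case by (cases ss) auto
      qed
      then have z0: "block_fun ?ss zs q = 0" for q by (simp add: zs_def)
      have lY: "length (lact us Y) = r" using length_listset[OF Y] length_listset[OF us] len by simp
      have "h (block_perm ?ss us \<circ> w) (lact us Y) = h w (lact (list_inv us) (lact us Y))"
      proof -
        have "length zs = length L" by (simp add: zs_def)
        from F4[OF us this w, of "\<lambda>_. 0" "lact us Y"] lY show ?thesis by (simp add: h_def z0)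
      qed
      then show "h (block_perm ?ss us \<circ> w) (lact us Y) = h w Y"
        using length_listset[OF Y] by (simp add: lact_inv[OF us])
    qed
    moreover have "F = V_of r L h"
    proof
      fix xY show "F xY = V_of r L h xY"
      proof (cases xY)
        case (Pair x Y)
        show ?thesis
        proof (cases "x \<in> carrier (Grn r N)")
          case x: True
          obtain \<sigma> z where s: "\<sigma> permutes {..<N}" "x = monomial r N \<sigma> z" using Grn_monomial[OF x r] by blast
          \<comment> \<open>Any assignment of exponents to the positions arises from a list of block
            exponents, which lets a diagonal matrix be written as a member of the block
            subgroup.\<close>
          have sec: "\<exists>zs. length zs = length ss \<and> (\<forall>q<sum_list ss. block_fun ss zs q = y q)"
            for ss and y :: "nat \<Rightarrow> nat"
          proof (induction ss arbitrary: y)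
            case (Cons s ss)
            obtain zs where "length zs = length ss" "\<forall>q<sum_list ss. block_fun ss zs q = y (q + s)"
              using Cons.IH[of "\<lambda>q. y (q + s)"] by blast
            then show ?case by (intro exI[of _ "y # zs"]) auto
          qed auto
          obtain zs where zs: "length zs = length ?ss" "\<And>q. q < N \<Longrightarrow> block_fun ?ss zs q = z (inv \<sigma> q)"
            using sec[of ?ss "z \<circ> inv \<sigma>"] N by auto
          have "monomial r N (block_perm ?ss (list_id ?ss) \<circ> \<sigma>) (\<lambda>j. 0 + block_fun ?ss zs (\<sigma> j)) = x"
            unfolding s(2)
            using permutes_less[OF s(1)] by (intro monomial_cong[OF r])
              (auto simp: zs permutes_inverses[OF s(1)] block_perm_id)
          moreover have "lact (list_inv (list_id ?ss)) Y = Y" if "length Y = r"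
          proof -
            have "list_inv (list_id ss) = list_id ss" for ss by (induction ss) simp_all
            then show ?thesis using that len by (simp add: lact_id)
          qed
          ultimately have "F (x, Y)
            = (if length Y = r then zeta r ^ (\<Sum>q<N. block_fun ?ss zs q * block_of ?ss q) * h \<sigma> Y else 0)"
            using F4[OF Young_group_id _ s(1), of zs "\<lambda>_. 0" Y] zs(1) by (simp add: h_def)
          moreover have "h \<sigma> Y = 0" if "length Y \<noteq> r"
            using out[OF F1[OF monomial_in_Grn[OF s(1) r]]] that length_listset[of Y "map tabs L"] len
              unfolding h_def by fastforce
          moreover have "(\<Sum>q<N. block_fun ?ss zs q * block_of ?ss q) = (\<Sum>j<N. z j * block_of ?ss (\<sigma> j))"
          proof -
            have "(\<Sum>q<N. block_fun ?ss zs q * block_of ?ss q) = (\<Sum>q<N. z (inv \<sigma> q) * block_of ?ss q)" using zs(2)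
              by simp
            also have "\<dots> = (\<Sum>j<N. z j * block_of ?ss (\<sigma> j))"
              using sum.permute[OF s(1), of "\<lambda>q. z (inv \<sigma> q) * block_of ?ss q"]
                by (simp add: comp_def permutes_inverses[OF s(1)])
            finally show ?thesis .
          qed
          ultimately show ?thesis using s r by
            (simp add: Pair V_of_def N[symmetric] colour_char_monomial monomial_in_Grn)
        next
          case False then show ?thesis using F2 by (simp add: Pair V_of_def N[symmetric])
        qed
      qed
    qed
    ultimately show "\<exists>h. specht_covariant L h \<and> F = V_of r L h" by blast
  next
    assume "\<exists>h. specht_covariant L h \<and> F = V_of r L h"
    then obtain h where h: "specht_covariant L h" and F: "F = V_of r L h" by blast
    have h1: "h w Y = (\<Sum>Y'\<in>tabs_list L. tkernel L Y Y' * h w Y')" if "w permutes {..<N}" for w Y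
      using h that unfolding specht_covariant_def N by blast
    have h2: "h (block_perm ?ss us \<circ> w) (lact us Y) = h w Y"
      if "w permutes {..<N}" "us \<in> Young_group ?ss" "Y \<in> tabs_list L" for w us Y
      using h that unfolding specht_covariant_def N by blast
    have hO: "h w \<in> rspace (OT r L)" if "w permutes {..<N}" for w using h1[OF that] unfolding OT by blast
    have Fx: "F (monomial r N \<sigma> z, Y) = zeta r ^ (\<Sum>j<N. z j * block_of ?ss (\<sigma> j)) * h \<sigma> Y" if "\<sigma> permutes {..<N}"
      for \<sigma> z Y
      using that r by (simp add: F V_of_def N[symmetric] colour_char_monomial monomial_in_Grn)
    have FO: "(\<lambda>y. F (x, y)) \<in> rspace (OT r L)" if x: "x \<in> carrier (Grn r N)" for x
    proof -
      obtain \<sigma> z where s: "\<sigma> permutes {..<N}" "x = monomial r N \<sigma> z" using Grn_monomial[OF x r] by blast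
      have "(\<Sum>Y'\<in>tabs_list L. tkernel L Y Y' * (c * h \<sigma> Y')) = c * h \<sigma> Y" for Y c
      proof -
        have "(\<Sum>Y'\<in>tabs_list L. tkernel L Y Y' * (c * h \<sigma> Y')) = c * (\<Sum>Y'\<in>tabs_list L. tkernel L Y Y' * h \<sigma> Y')"
          by (simp add: sum_distrib_left mult_ac)
        then show ?thesis by (simp only: h1[OF s(1), symmetric])
      qed
      then show ?thesis unfolding OT s(2) Fx[OF s(1)] by simp
    qed
    have "(\<lambda>y. F (diag_block_mat hs * x, y)) = ract (OT r L) hs (\<lambda>y. F (x, y))"
      if hs: "hs \<in> HB r L" and x: "x \<in> carrier (Grn r N)" for hs x
    proof -
      obtain \<sigma> z where s: "\<sigma> permutes {..<N}" "x = monomial r N \<sigma> z" using Grn_monomial[OF x r] by blast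
      obtain us zs where us: "us \<in> Young_group ?ss" "length zs = length L"
        "hs = map (\<lambda>i. monomial r (?ss ! i) (us ! i) (zs ! i)) [0..<length L]" using HB_monomial[OF r hs] by blast
      have zs': "length zs = length ?ss" using us(2) by simp
      have dm: "diag_block_mat hs * x = monomial r N (block_perm ?ss us \<circ> \<sigma>) (\<lambda>j. z j + block_fun ?ss zs (\<sigma> j))"
        using diag_block_monomial[OF us(1) zs', of r] us(3) by (simp add: s(2) N[symmetric] monomial_mult[OF s(1)])
      have bp: "block_perm ?ss us \<circ> \<sigma> permutes {..<N}"
        using permutes_compose[OF s(1)] block_perm_permutes[OF us(1)] N by simp
      \<comment> \<open>The exponents contributed by the block matrix and those of \<open>x\<close>
        separate because block permutations preserve block numbers.\<close>
      have e: "(\<Sum>j<N. (z j + block_fun ?ss zs (\<sigma> j)) * block_of ?ss (block_perm ?ss us (\<sigma> j))) =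
        (\<Sum>q<N. block_fun ?ss zs q * block_of ?ss q) + (\<Sum>j<N. z j * block_of ?ss (\<sigma> j))"
      proof -
        have "(\<Sum>j<N. (z j + block_fun ?ss zs (\<sigma> j)) * block_of ?ss (block_perm ?ss us (\<sigma> j)))
          = (\<Sum>j<N. (z j + block_fun ?ss zs (\<sigma> j)) * block_of ?ss (\<sigma> j))"
          using block_of_block_perm[OF us(1)] permutes_less[OF s(1)] N by simp
        also have "(\<Sum>j<N. (z j + block_fun ?ss zs (\<sigma> j)) * block_of ?ss (\<sigma> j))
          = (\<Sum>j<N. z j * block_of ?ss (\<sigma> j)) + (\<Sum>j<N. block_fun ?ss zs (\<sigma> j) * block_of ?ss (\<sigma> j))"
          by (simp add: add_mult_distrib sum.distrib)
        also have "(\<Sum>j<N. block_fun ?ss zs (\<sigma> j) * block_of ?ss (\<sigma> j)) = (\<Sum>q<N. block_fun ?ss zs q * block_of ?ss q)"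
          using sum.permute[OF s(1), of "\<lambda>q. block_fun ?ss zs q * block_of ?ss q"] by (simp add: comp_def)
        finally show ?thesis by simp
      qed
      show ?thesis
      proof
        fix Y
        have hY: "h (block_perm ?ss us \<circ> \<sigma>) Y = (if length Y = r then h \<sigma> (lact (list_inv us) Y) else 0)"
        proof (cases "Y \<in> tabs_list L")
          case Y: True
          then have lY: "length Y = r" using length_listset[OF Y] len by simp
          have "lact (list_inv us) Y \<in> tabs_list L" using tabs_list_lact[OF Young_group_inv[OF us(1)] Y] .
          then show ?thesis using h2[OF s(1) us(1), of "lact (list_inv us) Y"] lY len
            by (simp add: lact_inv[OF us(1)])
        next
          case False
          have "h (block_perm ?ss us \<circ> \<sigma>) Y = 0" using out[OF hO[OF bp] False] .
          moreover have "lact (list_inv us) Y \<notin> tabs_list L" if "length Y = r"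
            using tabs_list_lact[OF us(1), of "lact (list_inv us) Y"] False that len
              by (auto simp: lact_inv[OF us(1)])
          ultimately show ?thesis using out[OF hO[OF s(1)]] by simp
        qed
        show "F (diag_block_mat hs * x, Y) = ract (OT r L) hs (\<lambda>y. F (x, y)) Y"
        proof -
          have "ract (OT r L) hs (\<lambda>y. F (x, y)) Y =
            (if length Y = r then zeta r ^ (\<Sum>q<N. block_fun ?ss zs q * block_of ?ss q) * F
              (x, lact (list_inv us) Y) else 0)"
            using fun_cong[OF ract_OT_monomial[OF r len FO[OF x] us(1,2)], of Y]
              unfolding us(3)[symmetric] N[symmetric] .
          moreover have "F (diag_block_mat hs * x, Y) =
            zeta r ^ ((\<Sum>q<N. block_fun ?ss zs q * block_of ?ss q) + (\<Sum>j<N. z j * block_of ?ss (\<sigma> j))) * h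
              (block_perm ?ss us \<circ> \<sigma>) Y"
            unfolding dm Fx[OF bp] comp_apply e ..
          ultimately show ?thesis by (simp add: s(2) Fx[OF s(1)] hY power_add)
        qed
      qed
    qed
    then show "F \<in> rspace (rho r N L)" using FO by (auto simp: rho_def ind_rep_def F V_of_def N)
  qed
qed

section \<open>Tensor squares\<close>

text \<open>A subspace on which finitely many evaluations are jointly injective has an interpolation
  formula with functions of the same subspace. It will decide membership in a tensor square one
  variable at a time.\<close>

lemma subspace_kernel:
  fixes U :: "('x \<Rightarrow> complex) set"
  assumes U: "cfun.subspace U" and D: "finite D"
    and inj: "\<And>f. f \<in> U \<Longrightarrow> \<forall>d\<in>D. f d = 0 \<Longrightarrow> f = 0"
  shows "\<exists>P. (\<forall>d. P d \<in> U) \<and> (\<forall>f\<in>U. \<forall>x. f x = (\<Sum>d\<in>D. f d * P d x))"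
proof -
  interpret vector_space_pair "cscale :: complex \<Rightarrow> ('x \<Rightarrow> complex) \<Rightarrow> _" "cscale :: complex \<Rightarrow> ('x \<Rightarrow> complex) \<Rightarrow> _" ..
  define \<rho> where "\<rho> f x = (if x \<in> D then f x else 0)" for f :: "'x \<Rightarrow> complex" and x
  have lin: "clinear \<rho>" by (rule clinearI) (auto simp: \<rho>_def cscale_def)
  have "inj_on \<rho> U"
  proof (rule inj_onI)
    fix f g assume fg: "f \<in> U" "g \<in> U" "\<rho> f = \<rho> g"
    have *: "f d = g d" if "d \<in> D" for d using fun_cong[OF fg(3), of d] that by (simp add: \<rho>_def)
    have "f - g = 0" by (rule inj[OF cfun.subspace_diff[OF U fg(1,2)]]) (simp add: *)
    then show "f = g" by simp
  qed
  then obtain g where g: "g ` UNIV \<subseteq> U" "clinear g" "\<forall>v\<in>U. g (\<rho> v) = v"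
    using linear_exists_left_inverse_on[OF lin U] by blast
  \<comment> \<open>\<open>g\<close> is a linear left inverse of the restriction to
    \<open>D\<close>; \<open>P d\<close> is what it assigns to the indicator of
    \<open>d\<close>.\<close>
  define P where "P d = g (\<lambda>x. if x = d then 1 else 0)" for d
  have "f x = (\<Sum>d\<in>D. f d * P d x)" if "f \<in> U" for f x
  proof -
    have "\<rho> f = (\<Sum>d\<in>D. cscale (f d) (\<lambda>x. if x = d then 1 else 0))"
    proof
      fix x
      have "(\<Sum>d\<in>D. cscale (f d) (\<lambda>x. if x = d then 1 else 0)) x = (\<Sum>d\<in>D. if x = d then f d else 0)"
        unfolding sum_fun_apply by (intro sum.cong refl) (simp add: cscale_def)
      then show "\<rho> f x = (\<Sum>d\<in>D. cscale (f d) (\<lambda>x. if x = d then 1 else 0)) x" using D by (simp add: \<rho>_def)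
    qed
    then have "g (\<rho> f) = (\<Sum>d\<in>D. cscale (f d) (P d))"
      by (simp add: P_def linear_sum[OF g(2)] linear_scale[OF g(2)])
    then have e: "f = (\<Sum>d\<in>D. cscale (f d) (P d))" using g(3) that by simp
    show ?thesis using fun_cong[OF e, of x] unfolding sum_fun_apply cscale_def .
  qed
  then show ?thesis using g(1) by (intro exI[of _ P]) (auto simp: P_def)
qed

text \<open>Interpolating in each of the two variables writes a function with all slices in
  \<open>U\<close> as a finite sum of pure tensors.\<close>

lemma ptensor_span_iff:
  fixes U :: "('x \<Rightarrow> complex) set"
  assumes U: "cfun.subspace U" and D: "finite D" "\<And>f. f \<in> U \<Longrightarrow> \<forall>d\<in>D. f d = 0 \<Longrightarrow> f = 0" and T: "finite T"
  shows "\<Psi> \<in> cspan (ptensor ` (T \<times> U \<times> U)) \<longleftrightarrow>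
    (\<forall>t a b. t \<notin> T \<longrightarrow> \<Psi> (t, a, b) = 0) \<and> (\<forall>t b. (\<lambda>a. \<Psi> (t, a, b)) \<in> U) \<and> (\<forall>t a. (\<lambda>b. \<Psi> (t, a, b)) \<in> U)"
proof
  assume "\<Psi> \<in> cspan (ptensor ` (T \<times> U \<times> U))"
  then show "(\<forall>t a b. t \<notin> T \<longrightarrow> \<Psi> (t, a, b) = 0) \<and> (\<forall>t b. (\<lambda>a. \<Psi> (t, a, b)) \<in> U) \<and> (\<forall>t a. (\<lambda>b. \<Psi> (t, a, b)) \<in> U)"
  proof (induction rule: cfun.span_induct_alt)
    case base
    have "(\<lambda>_. 0) \<in> U" using cfun.subspace_0[OF U] by (simp add: zero_fun_def)
    then show ?case by simp
  next
    case (step c f g)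
    then obtain t0 v1 v2 where f: "f = ptensor (t0, v1, v2)" "t0 \<in> T" "v1 \<in> U" "v2 \<in> U" by auto
    have "(\<lambda>a. (cscale c f + g) (t, a, b)) = cscale (c * (if t = t0 then 1 else 0) * v2 b) v1 + (\<lambda>a. g (t, a, b))"
      for t b
      by (auto simp: f(1) ptensor_def cscale_def fun_eq_iff)
    moreover have "(\<lambda>b. (cscale c f + g) (t, a, b))
      = cscale (c * (if t = t0 then 1 else 0) * v1 a) v2 + (\<lambda>b. g (t, a, b))" for t a
      by (auto simp: f(1) ptensor_def cscale_def fun_eq_iff)
    ultimately show ?case using step.IH f(2-4) cfun.subspace_add[OF U] cfun.subspace_scale[OF U]
      by (auto simp: f(1) ptensor_def cscale_def)
  qed
next
  assume h: "(\<forall>t a b. t \<notin> T \<longrightarrow> \<Psi> (t, a, b) = 0) \<and> (\<forall>t b. (\<lambda>a. \<Psi> (t, a, b)) \<in> U) \<and> (\<forall>t a. (\<lambda>b. \<Psi> (t, a, b)) \<in> U)"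
  obtain P where P: "\<And>d. P d \<in> U" "\<And>f x. f \<in> U \<Longrightarrow> f x = (\<Sum>d\<in>D. f d * P d x)"
    using subspace_kernel[OF U D] by blast
  have "\<Psi> = (\<Sum>t\<in>T. \<Sum>d\<in>D. \<Sum>e\<in>D. cscale (\<Psi> (t, d, e)) (ptensor (t, P d, P e)))"
  proof
    fix z :: "(nat \<Rightarrow> nat) \<times> 'x \<times> 'x"
    obtain s x y where z: "z = (s, x, y)" by (cases z) auto
    have "(\<Sum>t\<in>T. \<Sum>d\<in>D. \<Sum>e\<in>D. cscale (\<Psi> (t, d, e)) (ptensor (t, P d, P e))) (s, x, y) =
      (\<Sum>t\<in>T. if s = t then \<Sum>d\<in>D. \<Sum>e\<in>D. \<Psi> (t, d, e) * (P d x * P e y) else 0)"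
      unfolding sum_fun_apply by (intro sum.cong refl) (simp add: cscale_def ptensor_def)
    also have "\<dots> = (if s \<in> T then \<Sum>d\<in>D. (\<Sum>e\<in>D. \<Psi> (s, d, e) * P e y) * P d x else 0)"
      using T by (simp add: sum_distrib_left sum_distrib_right mult_ac)
    also have "\<dots> = \<Psi> (s, x, y)"
    proof (cases "s \<in> T")
      case True
      have "(\<Sum>e\<in>D. \<Psi> (s, d, e) * P e y) = \<Psi> (s, d, y)" for d
        using P(2)[of "\<lambda>b. \<Psi> (s, d, b)" y] h by simp
      moreover have "(\<Sum>d\<in>D. \<Psi> (s, d, y) * P d x) = \<Psi> (s, x, y)"
        using P(2)[of "\<lambda>a. \<Psi> (s, a, y)" x] h by simp
      ultimately show ?thesis using True by simp
    next
      case False then show ?thesis using h by simp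
    qed
    finally show "\<Psi> z = (\<Sum>t\<in>T. \<Sum>d\<in>D. \<Sum>e\<in>D. cscale (\<Psi> (t, d, e)) (ptensor (t, P d, P e))) z" by (simp add: z)
  qed
  also have "\<dots> \<in> cspan (ptensor ` (T \<times> U \<times> U))"
    using P(1) by (intro cfun.span_sum cfun.span_scale cfun.span_base imageI) auto
  finally show "\<Psi> \<in> cspan (ptensor ` (T \<times> U \<times> U))" .
qed

section \<open>Shuffles\<close>

lemma Theta_permutes: "t \<in> Theta n \<Longrightarrow> t permutes {..<n}"
  by (simp add: Theta_def)

lemma finite_Theta [simp]: "finite (Theta n)"
  by (rule finite_subset[of _ "Sym n"]) (auto simp: Theta_def)

lemma hat_swap_halves: "even n \<Longrightarrow> t permutes {..<n} \<Longrightarrow> hat n t = t \<circ> swap_halves (n div 2)"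
  using permutes_not_in[of t "{..<n}"] by (auto simp: hat_def swap_halves_def fun_eq_iff)

lemma hat_hat:
  assumes "even n" "t permutes {..<n}" shows "hat n (hat n t) = t"
proof -
  have "t \<circ> swap_halves (n div 2) permutes {..<n}" using permutes_compose[OF swap_halves_permutes, of t
    "n div 2"] assms by simp
  then show ?thesis using assms by (simp add: hat_swap_halves comp_assoc swap_halves_swap_halves)
qed

lemma hat_Theta:
  assumes n: "even n" and t: "t \<in> Theta n" shows "hat n t \<in> Theta n"
proof -
  have "t \<circ> swap_halves (n div 2) permutes {..<n}" using permutes_compose[OF swap_halves_permutes, of t
    "n div 2"] n Theta_permutes[OF t] by simp
  then have "hat n t permutes {..<n}" using hat_swap_halves[OF n Theta_permutes[OF t]] by simp
  moreover obtain b where b: "n = 2 * b" using n by blast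
  have sm: "strict_mono_on {..<b} t" "strict_mono_on {b..<2 * b} t" using t by (simp_all add: Theta_def b)
  have "strict_mono_on {b..<2 * b} (hat n t)"
  proof (rule strict_mono_onI)
    fix i j assume "i \<in> {b..<2 * b}" "j \<in> {b..<2 * b}" "i < j"
    then show "hat n t i < hat n t j" using strict_mono_onD[OF sm(1), of "i - b" "j - b"] by (simp add: hat_def b)
  qed
  moreover have "strict_mono_on {..<b} (hat n t)"
  proof (rule strict_mono_onI)
    fix i j assume "i \<in> {..<b}" "j \<in> {..<b}" "i < j"
    then show "hat n t i < hat n t j" using strict_mono_onD[OF sm(2), of "i + b" "j + b"] by (simp add: hat_def b)
  qed
  ultimately show ?thesis by (simp add: Theta_def b)
qed

lemma strict_mono_on_image_unique:
  fixes f g :: "nat \<Rightarrow> nat"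
  assumes "strict_mono_on {a..<b} f" "strict_mono_on {a..<b} g" "f ` {a..<b} = g ` {a..<b}" "q \<in> {a..<b}"
  shows "f q = g q"
proof -
  have *: "sorted (map f [a..<b])" "distinct (map f [a..<b])" if "strict_mono_on {a..<b} f" for f :: "nat \<Rightarrow> nat"
  proof -
    have "sorted_wrt (<) (map f [a..<b])" by
      (auto simp: sorted_wrt_map sorted_wrt_iff_nth_less intro!: strict_mono_onD[OF that])
    then show "sorted (map f [a..<b])" "distinct (map f [a..<b])" by (simp_all add: strict_sorted_iff)
  qed
  have "map f [a..<b] = map g [a..<b]"
    by (rule sorted_distinct_set_unique) (use *[OF assms(1)] *[OF assms(2)] assms(3) in auto)
  then show ?thesis using assms(4) by simp
qed

lemma halves_perm_image: "u permutes {..<N} \<Longrightarrow> halves_perm N u v ` {..<N} = {..<N}"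
  using permutes_image[of u "{..<N}"] by (auto simp: halves_perm_apply image_def)

lemma halves_perm_inject:
  assumes "halves_perm N u v = halves_perm N u' v'" "u permutes {..<N}" "u' permutes {..<N}" "v permutes {..<N}"
    "v' permutes {..<N}"
  shows "u = u'" "v = v'"
proof -
  have "u q = u' q" if "q < N" for q using fun_cong[OF assms(1), of q] that by (simp add: halves_perm_apply)
  then show "u = u'" using assms(2,3) permutes_not_in by (metis ext lessThan_iff)
  have "v q = v' q" if "q < N" for q using fun_cong[OF assms(1), of "N + q"] that by (simp add: halves_perm_apply)
  then show "v = v'" using assms(4,5) permutes_not_in by (metis ext lessThan_iff)
qed

lemma half_preserving_halves_perm:
  assumes x: "x permutes {..<2 * N}" and h: "\<And>q. q < N \<Longrightarrow> x q < N"
  shows "\<exists>u v. u permutes {..<N} \<and> v permutes {..<N} \<and> x = halves_perm N u v"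
proof -
  have inj: "inj x" using x by (rule permutes_inj)
  define u where "u q = (if q < N then x q else q)" for q
  define v where "v q = (if q < N then x (N + q) - N else q)" for q
  have u: "u permutes {..<N}"
  proof (rule bij_imp_permutes)
    have "inj_on u {..<N}" using inj by (auto simp: u_def inj_on_def dest: injD)
    moreover have "u ` {..<N} \<subseteq> {..<N}" using h by (auto simp: u_def)
    ultimately show "bij_betw u {..<N} {..<N}" by (simp add: bij_betw_def endo_inj_surj)
  qed (simp add: u_def)
  have ge: "N \<le> x (N + q)" if "q < N" for q
  proof (rule ccontr)
    assume "\<not> N \<le> x (N + q)"
    then have "x (N + q) \<in> u ` {..<N}" using permutes_image[OF u] by simp
    then obtain j where "j < N" "x (N + q) = x j" by (auto simp: u_def)
    then show False using injD[OF inj, of "N + q" j] by simp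
  qed
  have lt: "x (N + q) < 2 * N" if "q < N" for q using permutes_less[OF x, of "N + q"] that by simp
  have v: "v permutes {..<N}"
  proof (rule bij_imp_permutes)
    have "inj_on v {..<N}"
    proof (rule inj_onI)
      fix a b assume ab: "a \<in> {..<N}" "b \<in> {..<N}" "v a = v b"
      then have "x (N + a) = x (N + b)" using ge[of a] ge[of b] by (simp add: v_def)
      then show "a = b" using injD[OF inj, of "N + a" "N + b"] by simp
    qed
    moreover have "v q < N" if "q < N" for q using ge[OF that] lt[OF that] that by (simp add: v_def)
    then have "v ` {..<N} \<subseteq> {..<N}" by auto
    ultimately show "bij_betw v {..<N} {..<N}" by (simp add: bij_betw_def endo_inj_surj)
  qed (simp add: v_def)
  have "x q = halves_perm N u v q" for q
  proof -
    consider "q < N" | "N \<le> q" "q < 2 * N" | "2 * N \<le> q" by linarith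
    then show ?thesis
    proof cases
      case 1 then show ?thesis by (simp add: halves_perm_apply u_def)
    next
      case 2
      then have "q - N < N" by linarith
      then show ?thesis using 2 ge[of "q - N"] by (simp add: halves_perm_apply v_def)
    next
      case 3 then show ?thesis using permutes_not_in[OF x, of q] by (simp add: halves_perm_apply)
    qed
  qed
  then show ?thesis using u v by blast
qed

text \<open>The shuffle lists the values of \<open>w\<close> on each half in increasing order; the
  remaining factor preserves the halves and splits into two permutations.\<close>

lemma theta_factor:
  assumes n: "n = 2 * N" and w: "w permutes {..<n}"
  shows "\<exists>t u v. t \<in> Theta n \<and> u permutes {..<N} \<and> v permutes {..<N} \<and> w = t \<circ> halves_perm N u v"
proof -
  define A where "A = sorted_list_of_set (w ` {..<N})"
  define B where "B = sorted_list_of_set (w ` {N..<2 * N})"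
  have inj: "inj w" using w by (rule permutes_inj)
  have A: "length A = N" "set A = w ` {..<N}" "sorted_wrt (<) A"
    using inj by (simp_all add: A_def card_image inj_on_subset)
  have B: "length B = N" "set B = w ` {N..<2 * N}" "sorted_wrt (<) B"
    using inj by (simp_all add: B_def card_image inj_on_subset)
  define t where "t q = (if q < N then A ! q else if q < 2 * N then B ! (q - N) else q)" for q
  have tA: "t ` {..<N} = w ` {..<N}" using A(1,2) by (auto simp: t_def set_conv_nth)
  have "B ! (q - N) \<in> w ` {N..<2 * N}" if "N \<le> q" "q < 2 * N" for q using nth_mem[of "q - N" B] B(1,2) that by auto
  moreover have "\<exists>q. N \<le> q \<and> q < 2 * N \<and> b = B ! (q - N)" if "b \<in> w ` {N..<2 * N}" for b
  proof -
    have "b \<in> set B" using that B(2) by simp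
    then obtain j where "j < length B" "B ! j = b" unfolding in_set_conv_nth by blast
    then have "j < N" "b = B ! j" using B(1) by auto
    then show ?thesis by (intro exI[of _ "N + j"]) simp
  qed
  ultimately have tB: "t ` {N..<2 * N} = w ` {N..<2 * N}"
  proof (intro subset_antisym subsetI)
    fix b assume b: "b \<in> w ` {N..<2 * N}" "\<And>b. b \<in> w ` {N..<2 * N} \<Longrightarrow> \<exists>q. N \<le> q \<and> q < 2 * N \<and> b = B ! (q - N)"
    from b(2)[OF b(1)] obtain q where "N \<le> q" "q < 2 * N" "b = B ! (q - N)" by blast
    then show "b \<in> t ` {N..<2 * N}" by (intro image_eqI[of _ _ q]) (simp_all add: t_def)
  qed (auto simp: t_def)
  have un: "{..<n} = {..<N} \<union> {N..<2 * N}" using n by auto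
  have "t ` {..<n} = {..<n}" using tA tB permutes_image[OF w] unfolding un image_Un by simp
  then have "bij_betw t {..<n} {..<n}" by (simp add: bij_betw_def eq_card_imp_inj_on)
  then have t: "t permutes {..<n}" by (rule bij_imp_permutes) (simp add: t_def n)
  have "strict_mono_on {..<N} t" using A by (auto simp: strict_mono_on_def t_def sorted_wrt_iff_nth_less)
  moreover have "strict_mono_on {N..<n} t" using B n by (auto simp: strict_mono_on_def t_def sorted_wrt_iff_nth_less)
  ultimately have T: "t \<in> Theta n" using t n by (simp add: Theta_def)
  define x where "x = inv t \<circ> w"
  have x: "x permutes {..<2 * N}" unfolding x_def using t w n by (intro permutes_compose permutes_inv) auto
  have "x q < N" if "q < N" for q
  proof -
    have "w q \<in> t ` {..<N}" using tA that by auto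
    then show ?thesis using permutes_inverses[OF t] by (auto simp: x_def)
  qed
  from half_preserving_halves_perm[OF x this] obtain u v
    where uv: "u permutes {..<N}" "v permutes {..<N}" "x = halves_perm N u v" by blast
  have "w = t \<circ> halves_perm N u v" unfolding uv(3)[symmetric] x_def
    by (simp add: permutes_inv_o[OF t] flip: comp_assoc)
  then show ?thesis using T uv by blast
qed

text \<open>A shuffle is determined by its image of the first half, and the factor acting inside the
  halves does not change this image.\<close>

lemma theta_unique:
  assumes n: "n = 2 * N" and T: "t \<in> Theta n" "t' \<in> Theta n"
    and p: "u permutes {..<N}" "v permutes {..<N}" "u' permutes {..<N}" "v' permutes {..<N}"
    and e: "t \<circ> halves_perm N u v = t' \<circ> halves_perm N u' v'"
  shows "t = t' \<and> u = u' \<and> v = v'"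
proof -
  have tp: "t permutes {..<n}" "t' permutes {..<n}" using T Theta_permutes by auto
  have "t ` {..<N} = (t \<circ> halves_perm N u v) ` {..<N}" unfolding image_comp[symmetric] halves_perm_image[OF p(1)] ..
  also have "\<dots> = t' ` {..<N}" unfolding e image_comp[symmetric] halves_perm_image[OF p(3)] ..
  finally have im: "t ` {..<N} = t' ` {..<N}" .
  have Nn: "{N..<n} = {..<n} - {..<N}" using n by auto
  have im2: "t ` {N..<n} = t' ` {N..<n}"
    unfolding Nn image_set_diff[OF permutes_inj[OF tp(1)]] image_set_diff[OF permutes_inj[OF tp(2)]]
    by (simp only: im permutes_image[OF tp(1)] permutes_image[OF tp(2)])
  have sm: "strict_mono_on {0..<N} t" "strict_mono_on {N..<n} t" "strict_mono_on {0..<N} t'"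
    "strict_mono_on {N..<n} t'"
    using T n by (auto simp: Theta_def atLeast0LessThan)
  have "t q = t' q" for q
  proof -
    consider "q < N" | "N \<le> q" "q < n" | "n \<le> q" by linarith
    then show ?thesis
    proof cases
      case 1 then show ?thesis using strict_mono_on_image_unique[OF sm(1,3), of q] im by (simp add: atLeast0LessThan)
    next
      case 2 then show ?thesis using strict_mono_on_image_unique[OF sm(2,4) im2, of q] by simp
    next
      case 3 then show ?thesis using permutes_not_in[OF tp(1), of q] permutes_not_in[OF tp(2), of q] by simp
    qed
  qed
  then have tt: "t = t'" by (rule ext)
  have "inv t \<circ> (t \<circ> halves_perm N u v) = inv t \<circ> (t \<circ> halves_perm N u' v')" using e tt by simp
  then have "halves_perm N u v = halves_perm N u' v'" by (simp add: permutes_inv_o[OF tp(1)] flip: comp_assoc)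
  from halves_perm_inject[OF this p(1,3,2,4)] show ?thesis using tt by simp
qed

lemma diag_block_two:
  assumes "u permutes {..<N}" "v permutes {..<N}"
  shows "diag_block_mat [monomial r N u y, monomial r N v z]
    = monomial r (2 * N) (halves_perm N u v) (block_fun [N, N] [y, z])"
  using diag_block_monomial[of "[u, v]" "[N, N]" "[y, z]" r] assms
  by (simp add: halves_perm_def mult_2 upt_rec numeral_2_eq_2)

text \<open>Evaluates the \<open>THE\<close> in \<open>coset_decomp\<close>. The permutations are
  settled by \<open>theta_unique\<close>, and the exponents of the two blocks are those of
  \<open>x\<close> at the positions listed by the halves of \<open>t\<close>.\<close>

lemma coset_decomp_eq:
  assumes n: "n = 2 * N" and r: "r > 0" and s: "\<sigma> permutes {..<n}" and t: "t \<in> Theta n" "t' \<in> Theta n"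
    and uv: "u permutes {..<N}" "v permutes {..<N}" and e: "\<sigma> \<circ> t = t' \<circ> halves_perm N u v"
  shows "coset_decomp r n (monomial r n \<sigma> z) t
    = (t', monomial r N u (\<lambda>j. z (t j)), monomial r N v (\<lambda>j. z (t (N + j))))"
  unfolding coset_decomp_def
proof (rule the_equality)
  have nN: "n div 2 = N" using n by simp
  have tp: "t permutes {..<n}" "t' permutes {..<n}" using t Theta_permutes by auto
  have L: "monomial r n \<sigma> z * perm_mat n t = monomial r n (\<sigma> \<circ> t) (\<lambda>j. z (t j))"
    unfolding perm_mat_monomial[of n t r] monomial_mult[OF tp(1)] by simp
  have R: "perm_mat n t' * diag_block_mat [monomial r N u' y1, monomial r N v' y2]
    = monomial r n (t' \<circ> halves_perm N u' v') (block_fun [N, N] [y1, y2])"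
    if "u' permutes {..<N}" "v' permutes {..<N}" for t' u' v' y1 y2
    unfolding diag_block_two[OF that] perm_mat_monomial[of n t' r] n[symmetric]
    using monomial_mult[of "halves_perm N u' v'" n r t' "\<lambda>_. 0"] halves_perm_permutes[OF that] n by simp
  have "monomial r n \<sigma> z * perm_mat n t
    = perm_mat n t' * diag_block_mat [monomial r N u (\<lambda>j. z (t j)), monomial r N v (\<lambda>j. z (t (N + j)))]"
    unfolding L R[OF uv] e by (rule monomial_cong[OF r]) (use n in auto)
  then show "case (t', monomial r N u (\<lambda>j. z (t j)), monomial r N v (\<lambda>j. z (t (N + j)))) of (t', x1, x2) \<Rightarrow>
     t' \<in> Theta n \<and> x1 \<in> carrier (Grn r (n div 2)) \<and> x2 \<in> carrier (Grn r (n div 2)) \<and>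
     monomial r n \<sigma> z * perm_mat n t = perm_mat n t' * diag_block_mat [x1, x2]"
    using t(2) monomial_in_Grn[OF uv(1) r] monomial_in_Grn[OF uv(2) r] by (simp add: nN)
  fix q assume "case q of (t', x1, x2) \<Rightarrow>
     t' \<in> Theta n \<and> x1 \<in> carrier (Grn r (n div 2)) \<and> x2 \<in> carrier (Grn r (n div 2)) \<and>
     monomial r n \<sigma> z * perm_mat n t = perm_mat n t' * diag_block_mat [x1, x2]"
  then obtain t1 x1 x2 where q: "q = (t1, x1, x2)" "t1 \<in> Theta n" "x1 \<in> carrier (Grn r N)" "x2 \<in> carrier (Grn r N)"
    "monomial r n \<sigma> z * perm_mat n t = perm_mat n t1 * diag_block_mat [x1, x2]" by (cases q) (auto simp: nN)
  obtain u1 y1 where 1: "u1 permutes {..<N}" "x1 = monomial r N u1 y1" using Grn_monomial[OF q(3) r] by blast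
  obtain v1 y2 where 2: "v1 permutes {..<N}" "x2 = monomial r N v1 y2" using Grn_monomial[OF q(4) r] by blast
  have eq: "monomial r n (\<sigma> \<circ> t) (\<lambda>j. z (t j)) = monomial r n (t1 \<circ> halves_perm N u1 v1) (block_fun [N, N] [y1, y2])"
    using q(5) unfolding L 1(2) 2(2) R[OF 1(1) 2(1)] .
  have "\<sigma> \<circ> t permutes {..<n}" "t1 \<circ> halves_perm N u1 v1 permutes {..<n}"
    using permutes_compose[OF tp(1) s] permutes_compose[OF _ Theta_permutes[OF q(2)]] halves_perm_permutes[OF 1(1)
      2(1)] n by auto
  from eq[unfolded monomial_eq_iff[OF this r]]
  have a: "\<sigma> \<circ> t = t1 \<circ> halves_perm N u1 v1" and b: "\<And>j. j < n \<Longrightarrow> z (t j) mod r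
    = block_fun [N, N] [y1, y2] j mod r" by auto
  have "t' = t1 \<and> u = u1 \<and> v = v1" using theta_unique[OF n t(2) q(2) uv 1(1) 2(1)] a e by simp
  moreover have "x1 = monomial r N u1 (\<lambda>j. z (t j))" unfolding 1(2)
  proof (rule monomial_cong[OF r refl])
    fix j assume "j < N" then show "y1 j mod r = z (t j) mod r" using b[of j] n by simp
  qed
  moreover have "x2 = monomial r N v1 (\<lambda>j. z (t (N + j)))" unfolding 2(2)
  proof (rule monomial_cong[OF r refl])
    fix j assume "j < N" then show "y2 j mod r = z (t (N + j)) mod r" using b[of "N + j"] n by simp
  qed
  ultimately show "q = (t', monomial r N u (\<lambda>j. z (t j)), monomial r N v (\<lambda>j. z (t (N + j))))" by (simp add: q(1))
qed

section \<open>Padding with empty partitions\<close>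

lemma tabs_Nil: "tabs [] = {[]}"
proof -
  have "tabloid [] t = []" for t by (simp add: tabloid_def)
  moreover have "\<exists>t. t \<in> tableaux []" by (rule tableaux_nonempty)
  ultimately show ?thesis by (auto simp: tabs_def)
qed

text \<open>On the single tabloid of the empty partition the kernel is an idempotent number with
  nonzero trace, hence 1.\<close>

lemma skernel_Nil: "skernel [] y z = (if y = [] \<and> z = [] then 1 else 0)"
proof -
  have p: "partition_list []" by (simp add: partition_list_def)
  have "skernel [] [] [] * skernel [] [] [] = skernel [] [] []" using skernel_idem[OF p, of "[]" "[]"]
    by (simp add: tabs_Nil)
  moreover have "skernel [] [] [] \<noteq> 0" using sdim_nonzero[OF p] by (simp add: sdim_def tabs_Nil)
  ultimately have "skernel [] [] [] = 1" by simp
  then show ?thesis by (auto simp: skernel_outside tabs_Nil)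
qed

lemma tkernel_replicate_Nil: "tkernel (replicate m []) Y (replicate m []) = (if Y = replicate m [] then 1 else 0)"
proof (induction m arbitrary: Y)
  case 0 show ?case by (cases Y) auto
next
  case (Suc m) then show ?case by (cases Y) (auto simp: skernel_Nil)
qed

lemma tkernel_pad:
  "length z = length \<mu> \<Longrightarrow> tkernel (\<mu> @ replicate m []) Y (z @ replicate m []) =
    (if drop (length \<mu>) Y = replicate m [] then tkernel \<mu> (take (length \<mu>) Y) z else 0)"
proof (induction \<mu> arbitrary: Y z)
  case Nil
  have "tkernel [] [] [] = 1" by simp
  then show ?case using Nil tkernel_replicate_Nil by simp
next
  case (Cons l \<mu>)
  then obtain z1 z' where z: "z = z1 # z'" "length z' = length \<mu>" by (cases z) auto
  show ?case
  proof (cases Y)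
    case (Cons y Y') then show ?thesis using Cons.IH[OF z(2)] by (simp add: z(1))
  qed (simp add: z(1))
qed

lemma listset_append: "xs \<in> listset (As @ Bs) \<longleftrightarrow> take (length As) xs \<in> listset As \<and> drop (length As) xs \<in> listset Bs"
proof (induction As arbitrary: xs)
  case (Cons A As) show ?case by (cases xs) (auto simp: Cons.IH)
qed simp

lemma listset_replicate_singleton: "xs \<in> listset (replicate m {a}) \<longleftrightarrow> xs = replicate m a"
proof (induction m arbitrary: xs)
  case (Suc m) then show ?case by (cases xs) auto
qed auto

lemma tabs_list_pad: "Y \<in> tabs_list (\<mu> @ replicate m []) \<longleftrightarrow> (\<exists>y\<in>tabs_list \<mu>. Y = y @ replicate m [])"
proof -
  have "Y \<in> tabs_list (\<mu> @ replicate m []) \<longleftrightarrow> take (length \<mu>) Y \<in> tabs_list \<mu> \<and> drop (length \<mu>) Y = replicate m []"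
    by (simp add: listset_append tabs_Nil listset_replicate_singleton)
  also have "\<dots> \<longleftrightarrow> (\<exists>y\<in>tabs_list \<mu>. Y = y @ replicate m [])"
  proof
    assume "take (length \<mu>) Y \<in> tabs_list \<mu> \<and> drop (length \<mu>) Y = replicate m []"
    then show "\<exists>y\<in>tabs_list \<mu>. Y = y @ replicate m []" using append_take_drop_id[of "length \<mu>" Y] by metis
  next
    assume "\<exists>y\<in>tabs_list \<mu>. Y = y @ replicate m []"
    then obtain y where "y \<in> tabs_list \<mu>" "Y = y @ replicate m []" by blast
    then show "take (length \<mu>) Y \<in> tabs_list \<mu> \<and> drop (length \<mu>) Y = replicate m []"
      using length_listset[of y "map tabs \<mu>"] by simp
  qed
  finally show ?thesis .
qed

lemma sum_tabs_list_pad: "(\<Sum>Y\<in>tabs_list (\<mu> @ replicate m []). f Y) = (\<Sum>y\<in>tabs_list \<mu>. f (y @ replicate m []))"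
proof -
  have "tabs_list (\<mu> @ replicate m []) = (\<lambda>y. y @ replicate m []) ` tabs_list \<mu>" using tabs_list_pad by blast
  then show ?thesis by (simp add: sum.reindex inj_on_def)
qed

lemma Young_group_pad: "vs \<in> Young_group (ss @ replicate m 0) \<longleftrightarrow> (\<exists>us\<in>Young_group ss. vs = us @ replicate m id)"
proof -
  have "Sym 0 = {id}" by auto
  then have "vs \<in> Young_group (ss @ replicate m 0) \<longleftrightarrow> take (length ss) vs \<in> Young_group ss \<and> drop (length ss) vs
    = replicate m id"
    by (simp add: listset_append listset_replicate_singleton)
  also have "\<dots> \<longleftrightarrow> (\<exists>us\<in>Young_group ss. vs = us @ replicate m id)"
  proof
    assume "take (length ss) vs \<in> Young_group ss \<and> drop (length ss) vs = replicate m id"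
    then show "\<exists>us\<in>Young_group ss. vs = us @ replicate m id" using append_take_drop_id[of "length ss" vs] by metis
  next
    assume "\<exists>us\<in>Young_group ss. vs = us @ replicate m id"
    then obtain us where "us \<in> Young_group ss" "vs = us @ replicate m id" by blast
    then show "take (length ss) vs \<in> Young_group ss \<and> drop (length ss) vs = replicate m id"
      using length_listset[of us "map Sym ss"] by simp
  qed
  finally show ?thesis .
qed

lemma block_perm_pad: "us \<in> Young_group ss \<Longrightarrow> block_perm (ss @ replicate m 0) (us @ replicate m id) = block_perm ss us"
proof
  fix q assume "us \<in> Young_group ss"
  then show "block_perm (ss @ replicate m 0) (us @ replicate m id) q = block_perm ss us q"
  proof (induction ss arbitrary: us q)
    case Nil
    have "block_perm (replicate m 0) (replicate m id) q = q" for q by (induction m arbitrary: q) auto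
    then show ?case using Nil by (simp add: id_def)
  next
    case (Cons s ss)
    then obtain u us' where "us = u # us'" "us' \<in> Young_group ss" by auto
    then show ?case using Cons.IH by simp
  qed
qed

lemma lact_pad: "length us = length y \<Longrightarrow> lact (us @ replicate m id) (y @ replicate m []) = lact us y @ replicate m []"
proof (induction us y rule: list_induct2)
  case Nil
  have "lact (replicate m id) (replicate m []) = replicate m []" by (induction m) auto
  then show ?case by (simp add: id_def)
qed simp

lemma block_of_pad: "q < sum_list ss \<Longrightarrow> block_of (ss @ ts) q = block_of ss q"
  by (simp add: block_of_append)

section \<open>The tensor model of the split representation as a space of functions\<close>

locale gelfand_mu = gelfand_setting +
  fixes \<mu> :: "nat list list"
  assumes mu: "\<mu> \<in> Fer (r div 2) (n div 2)"
begin

abbreviation "m \<equiv> r div 2"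
abbreviation "N \<equiv> n div 2"
abbreviation "\<tau> \<equiv> map sum_list \<mu>"
abbreviation "L \<equiv> \<mu> @ replicate m []"
abbreviation "pad y \<equiv> y @ replicate m []"
abbreviation "V \<equiv> rspace (rho_mu r n \<mu>)"
abbreviation "P w \<equiv> monomial r N w (\<lambda>_. 0)"

lemma even_n: "even n" using gcd by (metis gcd_dvd2)

lemma nN: "n = 2 * N" using even_n by simp

lemma len_mu: "length \<mu> = m" using mu by (simp add: Fer_def)

lemma sum_tau: "sum_list \<tau> = N" using mu by (simp add: Fer_def)

lemma n_tau: "n = 2 * sum_list \<tau>" using nN sum_tau by simp

lemma L_facts: "length L = r" "\<forall>l\<in>set L. partition_list l" "N = sum_list (map sum_list L)"
  "map sum_list L = \<tau> @ replicate m 0"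
proof -
  have "m + m = r" using even_r by auto
  then show "length L = r" using len_mu by simp
  show "\<forall>l\<in>set L. partition_list l" using mu by (auto simp: Fer_def partition_list_def)
  show "N = sum_list (map sum_list L)" using sum_tau by simp
qed simp

lemmas V_iff' = V_iff[OF r L_facts(1-3), folded rho_mu_def]

text \<open>The appended empty partitions have one tabloid and a trivial group each, so only the
  first \<open>m\<close> entries of an index carry information.\<close>

lemma specht_covariant_mu:
  "specht_covariant L h \<longleftrightarrow> (\<forall>w. w permutes {..<N} \<longrightarrow>
     (\<forall>Y. h w Y = (if drop m Y = replicate m [] then \<Sum>y\<in>tabs_list \<mu>. tkernel \<mu> (take m Y) y * h w (pad y) else 0)) \<and>
     (\<forall>us\<in>Young_group \<tau>. \<forall>y\<in>tabs_list \<mu>. h (block_perm \<tau> us \<circ> w) (pad (lact us y)) = h w (pad y)))"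
proof -
  have 1: "(\<Sum>Y'\<in>tabs_list L. tkernel L Y Y' * h w Y')
    = (if drop m Y = replicate m [] then \<Sum>y\<in>tabs_list \<mu>. tkernel \<mu> (take m Y) y * h w (pad y) else 0)" for w Y
  proof -
    have "tkernel L Y (pad y) = (if drop m Y = replicate m [] then tkernel \<mu> (take m Y) y else 0)"
      if "y \<in> tabs_list \<mu>" for y
      using tkernel_pad[of y \<mu> m Y] length_listset[OF that] len_mu by simp
    then show ?thesis unfolding sum_tabs_list_pad by simp
  qed
  have 2: "(\<forall>vs\<in>Young_group (map sum_list L). \<forall>Y\<in>tabs_list L. h (block_perm (map sum_list L) vs \<circ> w) (lact vs Y)
    = h w Y) \<longleftrightarrow>
    (\<forall>us\<in>Young_group \<tau>. \<forall>y\<in>tabs_list \<mu>. h (block_perm \<tau> us \<circ> w) (pad (lact us y)) = h w (pad y))" for w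
  proof -
    have "h (block_perm (map sum_list L) (us @ replicate m id) \<circ> w) (lact (us @ replicate m id) (pad y)) =
        h (block_perm \<tau> us \<circ> w) (pad (lact us y))" if "us \<in> Young_group \<tau>" "y \<in> tabs_list \<mu>" for us y
      unfolding L_facts(4) block_perm_pad[OF that(1)]
      using lact_pad[of us y m] length_listset[OF that(1)] length_listset[OF that(2)] by simp
    then show ?thesis unfolding Ball_def tabs_list_pad L_facts(4) Young_group_pad by (auto simp: L_facts(4)) 
  qed
  show ?thesis unfolding specht_covariant_def 1 2 L_facts(3)[symmetric] ..
qed

lemma V_space: "cfun.subspace V"
proof (rule cfun.subspaceI)
  have "specht_covariant L (\<lambda>_ _. 0)" by (simp add: specht_covariant_def)
  moreover have "V_of r L (\<lambda>_ _. 0) = 0" by (auto simp: V_of_def fun_eq_iff)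
  ultimately show "0 \<in> V" unfolding V_iff' by metis
next
  fix F G assume "F \<in> V" "G \<in> V"
  then obtain h k where h: "specht_covariant L h" "F = V_of r L h" "specht_covariant L k" "G = V_of r L k"
    unfolding V_iff' by blast
  have "specht_covariant L (\<lambda>w Y. h w Y + k w Y)" unfolding specht_covariant_def
  proof (intro allI impI conjI ballI)
    fix w Y assume w: "w permutes {..<sum_list (map sum_list L)}"
    have "h w Y = (\<Sum>Y'\<in>tabs_list L. tkernel L Y Y' * h w Y')" "k w Y = (\<Sum>Y'\<in>tabs_list L. tkernel L Y Y' * k w Y')"
      using h(1,3) w unfolding specht_covariant_def by blast+
    then have "h w Y + k w Y
      = (\<Sum>Y'\<in>tabs_list L. tkernel L Y Y' * h w Y') + (\<Sum>Y'\<in>tabs_list L. tkernel L Y Y' * k w Y')"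
      by (rule arg_cong2)
    then show "h w Y + k w Y = (\<Sum>Y'\<in>tabs_list L. tkernel L Y Y' * (h w Y' + k w Y'))"
      by (simp add: sum.distrib distrib_left)
  next
    fix w us Y assume "w permutes {..<sum_list (map sum_list L)}" "us \<in> Young_group (map sum_list L)"
      "Y \<in> tabs_list L"
    then show "h (block_perm (map sum_list L) us \<circ> w) (lact us Y)
      + k (block_perm (map sum_list L) us \<circ> w) (lact us Y) = h w Y + k w Y"
      using h(1,3) unfolding specht_covariant_def by simp
  qed
  moreover have "F + G = V_of r L (\<lambda>w Y. h w Y + k w Y)" by (auto simp: h V_of_def fun_eq_iff algebra_simps)
  ultimately show "F + G \<in> V" unfolding V_iff' by blast
next
  fix c F assume "F \<in> V"
  then obtain h where h: "specht_covariant L h" "F = V_of r L h" unfolding V_iff' by blast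
  have "specht_covariant L (\<lambda>w Y. c * h w Y)" unfolding specht_covariant_def
  proof (intro allI impI conjI ballI)
    fix w Y assume w: "w permutes {..<sum_list (map sum_list L)}"
    have "h w Y = (\<Sum>Y'\<in>tabs_list L. tkernel L Y Y' * h w Y')" using h(1) w unfolding specht_covariant_def by blast
    then have "c * h w Y = c * (\<Sum>Y'\<in>tabs_list L. tkernel L Y Y' * h w Y')" by (rule arg_cong)
    then show "c * h w Y = (\<Sum>Y'\<in>tabs_list L. tkernel L Y Y' * (c * h w Y'))" by (simp add: sum_distrib_left mult_ac)
  next
    fix w us Y assume "w permutes {..<sum_list (map sum_list L)}" "us \<in> Young_group (map sum_list L)"
      "Y \<in> tabs_list L"
    then show "c * h (block_perm (map sum_list L) us \<circ> w) (lact us Y) = c * h w Y" using h(1)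
      unfolding specht_covariant_def by simp
  qed
  moreover have "cscale c F = V_of r L (\<lambda>w Y. c * h w Y)" by (auto simp: h V_of_def cscale_def fun_eq_iff)
  ultimately show "cscale c F \<in> V" unfolding V_iff' by blast
qed

lemma V_of_apply: "V_of r L h (x, Y)
  = (if x \<in> carrier (Grn r N) then colour_char r (map sum_list L) x * h (perm_of x) Y else 0)"
  by (simp only: V_of_def L_facts(3)[symmetric] prod.case)

lemma V_of_monomial: "w permutes {..<N} \<Longrightarrow> V_of r L h (P w, Y) = h w Y"
  unfolding V_of_apply by (simp add: monomial_in_Grn r colour_char_monomial)

lemma V_colour_char:
  assumes F: "F \<in> V"
  shows "F (x, Y) = (if x \<in> carrier (Grn r N) then colour_char r \<tau> x * F (P (perm_of x), Y) else 0)"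
proof -
  obtain h where h: "F = V_of r L h" using F unfolding V_iff' by blast
  show ?thesis
  proof (cases "x \<in> carrier (Grn r N)")
    case True
    obtain \<sigma> z where s: "\<sigma> permutes {..<N}" "x = monomial r N \<sigma> z" using Grn_monomial[OF True r] by blast
    have "colour_char r (map sum_list L) x = colour_char r \<tau> x"
      unfolding s(2) colour_char_monomial[OF s(1) r] L_facts(4) using permutes_less[OF s(1)] sum_tau
        by (simp add: block_of_pad)
    then show ?thesis unfolding h V_of_apply using True s by (simp add: monomial_in_Grn r colour_char_monomial)
  next
    case False then show ?thesis unfolding h V_of_apply by simp
  qed
qed

lemma V_tkernel:
  assumes F: "F \<in> V" and w: "w permutes {..<N}"
  shows "F (P w, Y) = (if drop m Y
    = replicate m [] then \<Sum>y\<in>tabs_list \<mu>. tkernel \<mu> (take m Y) y * F (P w, pad y) else 0)"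
proof -
  obtain h where h: "specht_covariant L h" "F = V_of r L h" using F unfolding V_iff' by blast
  show ?thesis using h(1) w unfolding h(2) V_of_monomial[OF w] specht_covariant_mu by blast
qed

lemma V_block_perm:
  assumes F: "F \<in> V" and w: "w permutes {..<N}" and us: "us \<in> Young_group \<tau>" and y: "y \<in> tabs_list \<mu>"
  shows "F (P (block_perm \<tau> us \<circ> w), pad (lact us y)) = F (P w, pad y)"
proof -
  obtain h where h: "specht_covariant L h" "F = V_of r L h" using F unfolding V_iff' by blast
  have "block_perm \<tau> us \<circ> w permutes {..<N}" using permutes_compose[OF w] block_perm_permutes[OF us] sum_tau by simp
  moreover have "h (block_perm \<tau> us \<circ> w) (pad (lact us y)) = h w (pad y)" using h(1) w us y
    unfolding specht_covariant_mu by blast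
  ultimately show ?thesis unfolding h(2) by (simp only: V_of_monomial w)
qed

lemma V_zero:
  assumes F: "F \<in> V" and z: "\<And>w y. w permutes {..<N} \<Longrightarrow> y \<in> tabs_list \<mu> \<Longrightarrow> F (P w, pad y) = 0"
  shows "F = 0"
proof -
  have "F (P w, Y) = 0" if "w permutes {..<N}" for w Y
    using V_tkernel[OF F that, of Y] z[OF that] by simp
  moreover have "perm_of x permutes {..<N}" if x: "x \<in> carrier (Grn r N)" for x
    using Grn_monomial[OF x r] by auto
  ultimately have "F (x, Y) = 0" for x Y using V_colour_char[OF F, of x Y] by simp
  then show ?thesis by (auto simp: fun_eq_iff)
qed

lemma V_intro:
  assumes h: "\<And>w Y. w permutes {..<N} \<Longrightarrow>
      h w Y = (if drop m Y = replicate m [] then \<Sum>y\<in>tabs_list \<mu>. tkernel \<mu> (take m Y) y * h w (pad y) else 0)"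
    and b: "\<And>w us y. w permutes {..<N} \<Longrightarrow> us \<in> Young_group \<tau> \<Longrightarrow> y \<in> tabs_list \<mu>
      \<Longrightarrow> h (block_perm \<tau> us \<circ> w) (pad (lact us y)) = h w (pad y)"
    and F: "\<And>x Y. F (x, Y) = (if x \<in> carrier (Grn r N) then colour_char r \<tau> x * h (perm_of x) Y else 0)"
  shows "F \<in> V"
proof -
  have g: "specht_covariant L h" unfolding specht_covariant_mu using h b by blast
  have "F xY = V_of r L h xY" for xY
  proof (cases xY)
    case (Pair x Y)
    show ?thesis
    proof (cases "x \<in> carrier (Grn r N)")
      case True
      obtain \<sigma> z where s: "\<sigma> permutes {..<N}" "x = monomial r N \<sigma> z" using Grn_monomial[OF True r] by blast
      have "colour_char r (map sum_list L) x = colour_char r \<tau> x"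
        unfolding s(2) colour_char_monomial[OF s(1) r] L_facts(4) using permutes_less[OF s(1)] sum_tau
          by (simp add: block_of_pad)
      then show ?thesis unfolding Pair F V_of_apply using True by simp
    next
      case False then show ?thesis unfolding Pair F V_of_apply by simp
    qed
  qed
  then have "F = V_of r L h" by (rule ext)
  then show ?thesis unfolding V_iff' using g by blast
qed

text \<open>A function in \<open>V\<close> is determined by its values at the finitely many pairs of
  a permutation matrix and a padded list of tabloids, as \<open>ptensor_span_iff\<close>
  requires.\<close>

lemma TVV_iff: "\<Psi> \<in> rspace (TVV_rep r n \<mu>) \<longleftrightarrow>
    (\<forall>t a b. t \<notin> Theta n \<longrightarrow> \<Psi> (t, a, b) = 0) \<and> (\<forall>t b. (\<lambda>a. \<Psi> (t, a, b)) \<in> V) \<and> (\<forall>t a. (\<lambda>b. \<Psi> (t, a, b)) \<in> V)"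
proof -
  define D where "D = (\<lambda>(w, y). (P w, pad y)) ` (Sym N \<times> tabs_list \<mu>)"
  have D: "finite D" by (simp add: D_def)
  have z: "F = 0" if F: "F \<in> V" and d: "\<forall>d\<in>D. F d = 0" for F
  proof (rule V_zero[OF F])
    fix w y assume "w permutes {..<N}" "y \<in> tabs_list \<mu>"
    then have "(P w, pad y) \<in> D" unfolding D_def by (intro image_eqI[of _ _ "(w, y)"]) auto
    then show "F (P w, pad y) = 0" using d by blast
  qed
  show ?thesis using ptensor_span_iff[OF V_space D z finite_Theta] by (simp add: TVV_rep_def TVV_gens_def)
qed

text \<open>\<open>hat n\<close> is an involution of \<open>Theta n\<close>, so the operator on
  tensors becomes a substitution in the shuffle and an exchange of the two arguments.\<close>

lemma S_op_eq:
  assumes "\<Psi> \<in> rspace (TVV_rep r n \<mu>)"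
  shows "S_op r n \<mu> \<Psi> = (\<lambda>(s, a, b). if s \<in> Theta n then \<Psi> (hat n s, b, a) else 0)"
  unfolding S_op_def
proof (rule lin_op_eq)
  show "clinear (\<lambda>\<Psi>. \<lambda>(s, a, b). if s \<in> Theta n then \<Psi> (hat n s, b, a) else 0)"
    by (rule clinearI) (auto simp: cscale_def)
  show "\<Psi> \<in> cspan (ptensor ` TVV_gens r n \<mu>)" using assms by (simp add: TVV_rep_def)
  fix i assume "i \<in> TVV_gens r n \<mu>"
  then obtain t v1 v2 where i: "i = (t, v1, v2)" "t \<in> Theta n" by (auto simp: TVV_gens_def)
  have "s \<in> Theta n \<and> hat n s = t \<longleftrightarrow> s = hat n t" for s
    using hat_hat[OF even_n Theta_permutes] hat_Theta[OF even_n] i(2) by metis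
  note hat_iff = this
  show "(\<lambda>(s, a, b). if s \<in> Theta n then ptensor i (hat n s, b, a) else 0) =
     (case i of (t, v1, v2) \<Rightarrow> ptensor (hat n t, v2, v1))"
  proof
    fix z show "(\<lambda>(s, a, b). if s \<in> Theta n then ptensor i (hat n s, b, a) else 0) z =
     (case i of (t, v1, v2) \<Rightarrow> ptensor (hat n t, v2, v1)) z"
      using hat_iff[of "fst z"] by (cases z) (auto simp: i(1) ptensor_def)
  qed
qed

text \<open>The value at \<open>s\<close> comes from the shuffle \<open>t\<close> that
  \<open>x\<close> sends to the coset of \<open>s\<close>. Summing over all \<open>t\<close> keeps
  this shuffle implicit; the induced action on the two factors is right translation.\<close>

lemma TVV_act_eq:
  assumes "\<Psi> \<in> rspace (TVV_rep r n \<mu>)"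
  shows "ract (TVV_rep r n \<mu>) x \<Psi> = (\<lambda>(s, (b1, Y1), (b2, Y2)). \<Sum>t\<in>Theta n. case coset_decomp r n x t of (t', x1, x2) \<Rightarrow>
     (if s = t' \<and> b1 \<in> carrier (Grn r N) \<and> b2 \<in> carrier (Grn r N) then delta r x2 * \<Psi>
       (t, (b1 * x1, Y1), (b2 * x2, Y2)) else 0))"
  unfolding TVV_rep_def rep.select_convs
proof (rule lin_op_eq)
  let ?L = "\<lambda>\<Psi>. \<lambda>(s, (b1, Y1), (b2, Y2)). \<Sum>t\<in>Theta n. case coset_decomp r n x t of (t', x1, x2) \<Rightarrow>
     (if s = t' \<and> b1 \<in> carrier (Grn r N) \<and> b2 \<in> carrier (Grn r N) then delta r x2 * \<Psi>
       (t, (b1 * x1, Y1), (b2 * x2, Y2)) else 0)"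
  show "clinear ?L"
    by (rule clinearI) (auto simp: cscale_def sum.distrib[symmetric] sum_distrib_left case_prod_beta intro!:
      sum.cong, auto simp: algebra_simps)
  show "\<Psi> \<in> cspan (ptensor ` TVV_gens r n \<mu>)" using assms by (simp add: TVV_rep_def)
  fix i assume "i \<in> TVV_gens r n \<mu>"
  then obtain t0 v1 v2 where i: "i = (t0, v1, v2)" "t0 \<in> Theta n" by (auto simp: TVV_gens_def)
  obtain t' x1 x2 where c: "coset_decomp r n x t0 = (t', x1, x2)" by (cases "coset_decomp r n x t0") auto
  have "?L (ptensor i) (s, (b1, Y1), (b2, Y2)) =
     cscale (delta r x2) (ptensor (t', ract (rho_mu r n \<mu>) x1 v1, ract (rho_mu r n \<mu>) x2 v2))
       (s, (b1, Y1), (b2, Y2))" for s b1 Y1 b2 Y2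
  proof -
    have "?L (ptensor i) (s, (b1, Y1), (b2, Y2)) = (\<Sum>t\<in>Theta n. if t = t0 then
       (if s = t' \<and> b1 \<in> carrier (Grn r N) \<and> b2 \<in> carrier (Grn r N) then delta r x2 * (v1 (b1 * x1, Y1) * v2
         (b2 * x2, Y2)) else 0) else 0)"
      unfolding prod.case by (intro sum.cong refl) (auto simp: i(1) ptensor_def c split: prod.splits)
    also have "\<dots> = (if s = t' \<and> b1 \<in> carrier (Grn r N)
      \<and> b2 \<in> carrier (Grn r N) then delta r x2 * (v1 (b1 * x1, Y1) * v2 (b2 * x2, Y2)) else 0)"
      using i(2) by simp
    finally show ?thesis by (simp add: cscale_def ptensor_def rho_mu_def rho_def ind_rep_def)
  qed
  note * = this
  show "?L (ptensor i) = (case i of (t, v1, v2) \<Rightarrow> case coset_decomp r n x t of (t', x1, x2) \<Rightarrow>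
      cscale (delta r x2) (ptensor (t', ract (rho_mu r n \<mu>) x1 v1, ract (rho_mu r n \<mu>) x2 v2)))"
  proof (intro ext)
    fix z :: "(nat \<Rightarrow> nat) \<times> (complex mat \<times> nat set list list) \<times> (complex mat \<times> nat set list list)"
    obtain s b1 Y1 b2 Y2 where z: "z = (s, (b1, Y1), (b2, Y2))" by (metis surj_pair)
    show "?L (ptensor i) z = (case i of (t, v1, v2) \<Rightarrow> case coset_decomp r n x t of (t', x1, x2) \<Rightarrow>
      cscale (delta r x2) (ptensor (t', ract (rho_mu r n \<mu>) x1 v1, ract (rho_mu r n \<mu>) x2 v2))) z"
      using * unfolding z i(1) prod.case c .
  qed
qed

end

section \<open>Admissible functions and the -1 eigenspace\<close>

context gelfand_mu begin

text \<open>Functions in \<open>V\<close> are covariant under left multiplication, \<open>H\<close>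
  under right multiplication, whence the inverses. The permutations
  \<open>t \<circ> halves_perm N u v\<close> exhaust the group, so \<open>H\<close> is fully
  recorded.\<close>

definition Phi :: "((nat \<Rightarrow> nat) \<Rightarrow> nat set list list \<Rightarrow> nat set list list \<Rightarrow> complex) \<Rightarrow>
    (nat \<Rightarrow> nat) \<times> (complex mat \<times> nat set list list) \<times> (complex mat \<times> nat set list list) \<Rightarrow> complex" where
  "Phi H = (\<lambda>(t, (x1, Y1), (x2, Y2)).
     if t \<in> Theta n \<and> x1 \<in> carrier (Grn r N) \<and> x2 \<in> carrier (Grn r N)
       \<and> drop m Y1 = replicate m [] \<and> drop m Y2 = replicate m []
     then colour_char r \<tau> x1 * colour_char r \<tau> x2 * H (t \<circ> halves_perm N (inv (perm_of x1)) (inv (perm_of x2)))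
       (take m Y1) (take m Y2) else 0)"

lemma admissibleE:
  assumes H: "admissible \<tau> \<mu> H" and w: "w permutes {..<n}"
  shows "H w y z = (\<Sum>x\<in>tabs_list \<mu>. tkernel \<mu> y x * H w x z)"
    "H w y z = (\<Sum>x\<in>tabs_list \<mu>. tkernel \<mu> z x * H w y x)"
    "us \<in> Young_group \<tau> \<Longrightarrow> vs \<in> Young_group \<tau> \<Longrightarrow> y \<in> tabs_list \<mu> \<Longrightarrow> z \<in> tabs_list \<mu> \<Longrightarrow>
       H (w \<circ> halves_perm N (block_perm \<tau> us) (block_perm \<tau> vs)) y z = H w (lact us y) (lact vs z)"
    "H (w \<circ> swap_halves N) y z = - H w z y"
    "y \<notin> tabs_list \<mu> \<Longrightarrow> H w y z = 0" "z \<notin> tabs_list \<mu> \<Longrightarrow> H w y z = 0"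
proof -
  have w': "w permutes {..<2 * sum_list \<tau>}" using w n_tau by simp
  show 1: "H w y z = (\<Sum>x\<in>tabs_list \<mu>. tkernel \<mu> y x * H w x z)" for y z by (rule admD(1)[OF H w'])
  show 2: "H w y z = (\<Sum>x\<in>tabs_list \<mu>. tkernel \<mu> z x * H w y x)" for y z by (rule admD(2)[OF H w'])
  show "us \<in> Young_group \<tau> \<Longrightarrow> vs \<in> Young_group \<tau> \<Longrightarrow> y \<in> tabs_list \<mu> \<Longrightarrow> z \<in> tabs_list \<mu> \<Longrightarrow>
       H (w \<circ> halves_perm N (block_perm \<tau> us) (block_perm \<tau> vs)) y z = H w (lact us y) (lact vs z)"
    using admD(3)[OF H w'] unfolding sum_tau .
  show "H (w \<circ> swap_halves N) y z = - H w z y" using admD(4)[OF H w'] unfolding sum_tau .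
  show "y \<notin> tabs_list \<mu> \<Longrightarrow> H w y z = 0" by (subst 1) (simp add: tkernel_outside)
  show "z \<notin> tabs_list \<mu> \<Longrightarrow> H w y z = 0" by (subst 2) (simp add: tkernel_outside)
qed

lemma Grn_perm: "x \<in> carrier (Grn r N) \<Longrightarrow> perm_of x permutes {..<N}"
  using Grn_monomial[OF _ r] by fastforce

lemma theta_halves_perm_permutes:
  "t \<in> Theta n \<Longrightarrow> u permutes {..<N} \<Longrightarrow> v permutes {..<N} \<Longrightarrow> t \<circ> halves_perm N u v permutes {..<n}"
proof -
  assume a: "t \<in> Theta n" "u permutes {..<N}" "v permutes {..<N}"
  have "halves_perm N u v permutes {..<n}" using halves_perm_permutes[OF a(2,3)] nN by simp
  from permutes_compose[OF this Theta_permutes[OF a(1)]] show ?thesis .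
qed

lemma tabs_list_length [simp]: "y \<in> tabs_list \<mu> \<Longrightarrow> length y = m"
  using length_listset[of y "map tabs \<mu>"] len_mu by simp

lemma colour_char_P [simp]: "u permutes {..<N} \<Longrightarrow> colour_char r \<tau> (P u) = 1"
  by (simp add: colour_char_monomial r)

lemma Phi_P:
  assumes "t \<in> Theta n" "u permutes {..<N}" "v permutes {..<N}" "y \<in> tabs_list \<mu>" "z \<in> tabs_list \<mu>"
  shows "Phi H (t, (P u, pad y), (P v, pad z)) = H (t \<circ> halves_perm N (inv u) (inv v)) y z"
  using assms by (simp add: Phi_def monomial_in_Grn r)

lemma Phi_inject:
  assumes e: "Phi H = Phi H'" and w: "w permutes {..<n}" and y: "y \<in> tabs_list \<mu>" "z \<in> tabs_list \<mu>"
  shows "H w y z = H' w y z"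
proof -
  obtain t u v where t: "t \<in> Theta n" "u permutes {..<N}" "v permutes {..<N}" "w = t \<circ> halves_perm N u v"
    using theta_factor[OF nN w] by blast
  show ?thesis
    using fun_cong[OF e, of "(t, (P (inv u), pad y), (P (inv v), pad z))"]
      Phi_P[OF t(1) permutes_inv[OF t(2)] permutes_inv[OF t(3)] y]
    by (simp add: t(4) permutes_inv_inv[OF t(2)] permutes_inv_inv[OF t(3)])
qed

text \<open>Passing to \<open>hat n t\<close> is composition with the exchange of halves, so the
  last condition of \<open>admissible\<close> becomes the eigenvalue -1.\<close>

lemma Phi_hat:
  assumes H: "admissible \<tau> \<mu> H" and t: "t \<in> Theta n"
  shows "Phi H (hat n t, b, a) = - Phi H (t, a, b)"
proof -
  obtain x1 Y1 x2 Y2 where ab: "a = (x1, Y1)" "b = (x2, Y2)" by (cases a; cases b) auto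
  show ?thesis
  proof (cases "x1 \<in> carrier (Grn r N) \<and> x2 \<in> carrier (Grn r N)")
    case True
    have p: "inv (perm_of x1) permutes {..<N}" "inv (perm_of x2) permutes {..<N}"
      using True Grn_perm permutes_inv by auto
    have "hat n t \<circ> halves_perm N (inv (perm_of x2)) (inv (perm_of x1))
      = t \<circ> halves_perm N (inv (perm_of x1)) (inv (perm_of x2)) \<circ> swap_halves N"
      unfolding hat_swap_halves[OF even_n Theta_permutes[OF t]]
        by (simp add: comp_assoc swap_halves_halves_perm[OF p(2,1)])
    then show ?thesis
      using admissibleE(4)[OF H theta_halves_perm_permutes[OF t p]] hat_Theta[OF even_n t] t by (simp add: ab Phi_def)
  qed (auto simp: ab Phi_def)
qed

text \<open>With the second argument fixed, the first projection equation and the covariance under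
  the first Young subgroup are the two conditions for membership in \<open>V\<close>.\<close>

lemma Phi_slice1:
  assumes H: "admissible \<tau> \<mu> H"
  shows "(\<lambda>a. Phi H (t, a, b)) \<in> V"
proof -
  obtain x2 Y2 where b: "b = (x2, Y2)" by (cases b) auto
  define C where "C \<longleftrightarrow> t \<in> Theta n \<and> x2 \<in> carrier (Grn r N) \<and> drop m Y2 = replicate m []"
  define h where "h w Y = (if C \<and> drop m Y = replicate m []
     then colour_char r \<tau> x2 * H (t \<circ> halves_perm N (inv w) (inv (perm_of x2))) (take m Y)
       (take m Y2) else 0)" for w Y
  show ?thesis
  proof (rule V_intro[of h])
    fix w Y assume w: "w permutes {..<N}"
    show "h w Y = (if drop m Y = replicate m [] then \<Sum>y\<in>tabs_list \<mu>. tkernel \<mu> (take m Y) y * h w (pad y) else 0)"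
    proof (cases "C \<and> drop m Y = replicate m []")
      case True
      then have C: "t \<in> Theta n" "x2 \<in> carrier (Grn r N)" by (auto simp: C_def)
      let ?w = "t \<circ> halves_perm N (inv w) (inv (perm_of x2))"
      have "?w permutes {..<n}" by (intro theta_halves_perm_permutes C permutes_inv w Grn_perm)
      from admissibleE(1)[OF H this, of "take m Y" "take m Y2"]
      have "colour_char r \<tau> x2 * H ?w (take m Y) (take m Y2)
        = (\<Sum>y\<in>tabs_list \<mu>. tkernel \<mu> (take m Y) y * (colour_char r \<tau> x2 * H ?w y (take m Y2)))"
        by (simp add: sum_distrib_left mult_ac)
      then show ?thesis using True by (simp add: h_def)
    qed (auto simp: h_def)
  next
    fix w us y assume w: "w permutes {..<N}" and us: "us \<in> Young_group \<tau>" and y: "y \<in> tabs_list \<mu>"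
    have ty: "lact us y \<in> tabs_list \<mu>" by (rule tabs_list_lact[OF us y])
    show "h (block_perm \<tau> us \<circ> w) (pad (lact us y)) = h w (pad y)"
    proof (cases "C \<and> take m Y2 \<in> tabs_list \<mu>")
      case True
      then have C: "t \<in> Theta n" "x2 \<in> carrier (Grn r N)" by (auto simp: C_def)
      have b: "block_perm \<tau> us permutes {..<N}" "block_perm \<tau> (list_inv us) permutes {..<N}"
        using block_perm_permutes[OF us] block_perm_permutes[OF Young_group_inv[OF us]] sum_tau by auto
      have p: "inv w permutes {..<N}" "inv (perm_of x2) permutes {..<N}"
        using permutes_inv[OF w] permutes_inv[OF Grn_perm[OF C(2)]] .
      have tw: "t \<circ> halves_perm N (inv w) (inv (perm_of x2)) permutes {..<n}"
        by (intro theta_halves_perm_permutes C p)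
      have "halves_perm N (inv w \<circ> block_perm \<tau> (list_inv us)) (inv (perm_of x2) \<circ> id) =
         halves_perm N (inv w) (inv (perm_of x2)) \<circ> halves_perm N (block_perm \<tau> (list_inv us))
           (block_perm \<tau> (list_id \<tau>))"
        using halves_perm_comp[OF p b(2) permutes_id] by (simp add: block_perm_id)
      then have e: "t \<circ> halves_perm N (inv (block_perm \<tau> us \<circ> w)) (inv (perm_of x2)) =
        t \<circ> halves_perm N (inv w) (inv (perm_of x2)) \<circ> halves_perm N (block_perm \<tau> (list_inv us))
          (block_perm \<tau> (list_id \<tau>))"
        by (simp add: inv_comp_permutes[OF b(1) w] inv_block_perm[OF us] comp_assoc)
      have l: "length y = length \<tau>" "length (take m Y2) = length \<tau>"
        using length_listset[OF y] True length_listset[of "take m Y2" "map tabs \<mu>"] by simp_all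
      have "H (t \<circ> halves_perm N (inv (block_perm \<tau> us \<circ> w)) (inv (perm_of x2))) (lact us y) (take m Y2) =
        H (t \<circ> halves_perm N (inv w) (inv (perm_of x2))) (lact (list_inv us) (lact us y))
          (lact (list_id \<tau>) (take m Y2))"
        unfolding e using True by (intro admissibleE(3)[OF H tw Young_group_inv[OF us] Young_group_id ty]) simp
      then have "H (t \<circ> halves_perm N (inv (block_perm \<tau> us \<circ> w)) (inv (perm_of x2))) (lact us y) (take m Y2) =
        H (t \<circ> halves_perm N (inv w) (inv (perm_of x2))) y (take m Y2)"
        using lact_inv(2)[OF us l(1)] lact_id[of \<tau> "take m Y2"] l(2) by simp
      then show ?thesis using y ty by (simp add: h_def)
    next
      case False
      have "H w' y' (take m Y2) = 0" if "w' permutes {..<n}" "take m Y2 \<notin> tabs_list \<mu>" for w' y'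
        using admissibleE(6)[OF H that] .
      moreover have "t \<circ> halves_perm N (inv w') (inv (perm_of x2)) permutes {..<n}" if C "w' permutes {..<N}" for w'
        using that by (intro theta_halves_perm_permutes permutes_inv Grn_perm) (auto simp: C_def)
      moreover have "block_perm \<tau> us \<circ> w permutes {..<N}"
        using permutes_compose[OF w] block_perm_permutes[OF us] sum_tau by simp
      ultimately show ?thesis using False w by (simp add: h_def)
    qed
  next
    fix x Y
    show "Phi H (t, (x, Y), b) = (if x \<in> carrier (Grn r N) then colour_char r \<tau> x * h (perm_of x) Y else 0)"
      by (simp add: b Phi_def h_def C_def)
  qed
qed

lemma Phi_TVV:
  assumes H: "admissible \<tau> \<mu> H" shows "Phi H \<in> rspace (TVV_rep r n \<mu>)"
  unfolding TVV_iff
proof (intro conjI allI impI)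
  show "t \<notin> Theta n \<Longrightarrow> Phi H (t, a, b) = 0" for t a b by (cases a; cases b) (simp add: Phi_def)
  show "(\<lambda>a. Phi H (t, a, b)) \<in> V" for t b by (rule Phi_slice1[OF H])
  show "(\<lambda>b. Phi H (t, a, b)) \<in> V" for t a
  proof (cases "t \<in> Theta n")
    case True
    \<comment> \<open>The sign rule turns a slice in the second argument into a slice in the
      first.\<close>
    have "(\<lambda>b. Phi H (t, a, b)) = cscale (-1) (\<lambda>b. Phi H (hat n t, b, a))"
      using Phi_hat[OF H True, of _ a] by (simp add: cscale_def)
    then show ?thesis by (simp only: cfun.subspace_scale[OF V_space Phi_slice1[OF H]])
  next
    case False
    then have "(\<lambda>b. Phi H (t, a, b)) = 0" by (cases a) (auto simp: Phi_def fun_eq_iff)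
    then show ?thesis using cfun.subspace_0[OF V_space] by simp
  qed
qed

lemma Phi_split:
  assumes H: "admissible \<tau> \<mu> H" shows "Phi H \<in> rspace (rho_split r n 1 \<mu>)"
proof -
  have "S_op r n \<mu> (Phi H) z = cscale ((-1) ^ 1) (Phi H) z" for z
  proof -
    obtain s a b where z: "z = (s, a, b)" by (cases z) auto
    show ?thesis
    proof (cases "s \<in> Theta n")
      case True then show ?thesis using Phi_hat[OF H True] by (simp add: S_op_eq[OF Phi_TVV[OF H]] z cscale_def)
    next
      case False
      then have "Phi H (s, a, b) = 0" by (cases a; cases b) (simp add: Phi_def)
      then show ?thesis using False by (simp add: S_op_eq[OF Phi_TVV[OF H]] z cscale_def)
    qed
  qed
  then have "S_op r n \<mu> (Phi H) = cscale ((-1) ^ 1) (Phi H)" by (rule ext)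
  then show ?thesis using Phi_TVV[OF H] by (simp add: rho_split_def)
qed

text \<open>\<open>H\<close> is read off from \<Psi> at permutation matrices. The conditions of
  \<open>admissible\<close> are membership of both slices in \<open>V\<close> together with the
  eigenvalue equation.\<close>

theorem Phi_surj:
  assumes Psi: "\<Psi> \<in> rspace (rho_split r n 1 \<mu>)"
  shows "\<exists>H. admissible \<tau> \<mu> H \<and> \<Psi> = Phi H"
proof -
  have T: "\<Psi> \<in> rspace (TVV_rep r n \<mu>)" and S: "S_op r n \<mu> \<Psi> = cscale (-1) \<Psi>"
    using Psi by (auto simp: rho_split_def)
  have V1: "(\<lambda>a. \<Psi> (t, a, b)) \<in> V" and V2: "(\<lambda>b. \<Psi> (t, a, b)) \<in> V" and V0: "t \<notin> Theta n \<Longrightarrow> \<Psi> (t, a, b) = 0" for t a b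
    using T unfolding TVV_iff by blast+
  have hat: "\<Psi> (hat n t, b, a) = - \<Psi> (t, a, b)" if "t \<in> Theta n" for t a b
    using fun_cong[OF S, of "(t, a, b)"] that by (simp add: S_op_eq[OF T] cscale_def)
  \<comment> \<open>A choice of the shuffle factorization; by its uniqueness the choice returns the
    factors from which a permutation is composed.\<close>
  define D where "D w = (SOME (t, u, v). t \<in> Theta n \<and> u permutes {..<N} \<and> v permutes {..<N} \<and> w
    = t \<circ> halves_perm N u v)" for w
  have D: "D (t \<circ> halves_perm N u v) = (t, u, v)" if "t \<in> Theta n" "u permutes {..<N}" "v permutes {..<N}" for t u v
  proof -
    have "case D (t \<circ> halves_perm N u v) of (t', u', v') \<Rightarrow> t' \<in> Theta n \<and> u' permutes {..<N} \<and> v' permutes {..<N}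
      \<and> t \<circ> halves_perm N u v = t' \<circ> halves_perm N u' v'"
      unfolding D_def by (rule someI[of _ "(t, u, v)"]) (use that in simp)
    then obtain t' u' v' where e: "D (t \<circ> halves_perm N u v) = (t', u', v')" "t' \<in> Theta n" "u' permutes {..<N}"
      "v' permutes {..<N}"
      "t \<circ> halves_perm N u v = t' \<circ> halves_perm N u' v'" by (cases "D (t \<circ> halves_perm N u v)") auto
    show ?thesis using theta_unique[OF nN that(1) e(2) that(2,3) e(3,4,5)] e(1) by simp
  qed
  define H where "H w y z = (if y \<in> tabs_list \<mu> \<and> z \<in> tabs_list \<mu> then
     case D w of (t, u, v) \<Rightarrow> \<Psi> (t, (P (inv u), pad y), (P (inv v), pad z)) else 0)" for w y z
  have HD: "H (t \<circ> halves_perm N u v) y z = (if y \<in> tabs_list \<mu>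
    \<and> z \<in> tabs_list \<mu> then \<Psi> (t, (P (inv u), pad y), (P (inv v), pad z)) else 0)"
    if "t \<in> Theta n" "u permutes {..<N}" "v permutes {..<N}" for t u v y z
    using D[OF that] by (simp add: H_def)
  have E1: "\<Psi> (t, (P u, pad y), b) = (\<Sum>x\<in>tabs_list \<mu>. tkernel \<mu> y x * \<Psi> (t, (P u, pad x), b))"
    if "u permutes {..<N}" "y \<in> tabs_list \<mu>" for t u y b
    using V_tkernel[OF V1[of t b] that(1), of "pad y"] that(2) by simp
  have E2: "\<Psi> (t, a, (P u, pad y)) = (\<Sum>x\<in>tabs_list \<mu>. tkernel \<mu> y x * \<Psi> (t, a, (P u, pad x)))"
    if "u permutes {..<N}" "y \<in> tabs_list \<mu>" for t u y a
    using V_tkernel[OF V2[of t a] that(1), of "pad y"] that(2) by simp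
  have "admissible \<tau> \<mu> H"
    unfolding admissible_def n_tau[symmetric] unfolding sum_tau
  proof (intro allI impI conjI ballI)
    fix w assume w: "w permutes {..<n}"
    obtain t u v where t: "t \<in> Theta n" "u permutes {..<N}" "v permutes {..<N}" "w = t \<circ> halves_perm N u v"
      using theta_factor[OF nN w] by blast
    note iu = permutes_inv[OF t(2)] and iv = permutes_inv[OF t(3)]
    show "H w y z = (\<Sum>x\<in>tabs_list \<mu>. tkernel \<mu> y x * H w x z)" for y z
    proof (cases "y \<in> tabs_list \<mu> \<and> z \<in> tabs_list \<mu>")
      case True
      then show ?thesis using E1[OF iu, of y t "(P (inv v), pad z)"] by (simp add: t(4) HD[OF t(1-3)])
    next
      case False then show ?thesis by (auto simp: t(4) HD[OF t(1-3)] tkernel_outside intro!: sum.neutral[symmetric])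
    qed
    show "H w y z = (\<Sum>x\<in>tabs_list \<mu>. tkernel \<mu> z x * H w y x)" for y z
    proof (cases "y \<in> tabs_list \<mu> \<and> z \<in> tabs_list \<mu>")
      case True
      then show ?thesis using E2[OF iv, of z t "(P (inv u), pad y)"] by (simp add: t(4) HD[OF t(1-3)])
    next
      case False then show ?thesis by (auto simp: t(4) HD[OF t(1-3)] tkernel_outside intro!: sum.neutral[symmetric])
    qed
    show "H (w \<circ> halves_perm N (block_perm \<tau> us) (block_perm \<tau> vs)) y z = H w (lact us y) (lact vs z)"
      if us: "us \<in> Young_group \<tau>" and vs: "vs \<in> Young_group \<tau>" and y: "y \<in> tabs_list \<mu>" and z: "z \<in> tabs_list \<mu>"
        for us vs y z
    proof -
      have b: "block_perm \<tau> us permutes {..<N}" "block_perm \<tau> vs permutes {..<N}"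
        using block_perm_permutes[OF us] block_perm_permutes[OF vs] sum_tau by auto
      have ty: "lact us y \<in> tabs_list \<mu>" "lact vs z \<in> tabs_list \<mu>"
        using tabs_list_lact[OF us y] tabs_list_lact[OF vs z] .
      have l: "length y = length \<tau>" "length z = length \<tau>" using length_listset[OF y] length_listset[OF z] by simp_all
      have e: "w \<circ> halves_perm N (block_perm \<tau> us) (block_perm \<tau> vs)
        = t \<circ> halves_perm N (u \<circ> block_perm \<tau> us) (v \<circ> block_perm \<tau> vs)"
        unfolding t(4) comp_assoc halves_perm_comp[OF t(2,3) b] ..
      have "H (w \<circ> halves_perm N (block_perm \<tau> us) (block_perm \<tau> vs)) y z
        = \<Psi> (t, (P (inv (u \<circ> block_perm \<tau> us)), pad y), (P (inv (v \<circ> block_perm \<tau> vs)), pad z))"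
        unfolding e using HD[OF t(1) permutes_compose[OF b(1) t(2)] permutes_compose[OF b(2) t(3)]] y z by simp
      also have "\<dots> = \<Psi> (t, (P (block_perm \<tau> (list_inv us) \<circ> inv u), pad (lact (list_inv us) (lact us y))),
          (P (block_perm \<tau> (list_inv vs) \<circ> inv v), pad (lact (list_inv vs) (lact vs z))))"
        unfolding inv_comp_permutes[OF t(2) b(1)] inv_comp_permutes[OF t(3) b(2)] inv_block_perm[OF us]
          inv_block_perm[OF vs]
          lact_inv(2)[OF us l(1)] lact_inv(2)[OF vs l(2)] ..
      also have "\<dots> = \<Psi> (t, (P (inv u), pad (lact us y)), (P (block_perm \<tau> (list_inv vs) \<circ> inv v), pad
        (lact (list_inv vs) (lact vs z))))"
        by (rule V_block_perm[OF V1 iu Young_group_inv[OF us] ty(1)])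
      also have "\<dots> = \<Psi> (t, (P (inv u), pad (lact us y)), (P (inv v), pad (lact vs z)))"
        by (rule V_block_perm[OF V2 iv Young_group_inv[OF vs] ty(2)])
      also have "\<dots> = H w (lact us y) (lact vs z)" using ty by (simp add: t(4) HD[OF t(1-3)])
      finally show ?thesis .
    qed
    show "H (w \<circ> swap_halves N) y z = - H w z y" for y z
    proof -
      have "w \<circ> swap_halves N = hat n t \<circ> halves_perm N v u"
        unfolding t(4) hat_swap_halves[OF even_n Theta_permutes[OF t(1)]]
          by (simp add: comp_assoc swap_halves_halves_perm[OF t(3,2)])
      then show ?thesis using HD[OF hat_Theta[OF even_n t(1)] t(3,2)] hat[OF t(1)] by (simp add: t(4) HD[OF t(1-3)])
    qed
  qed
  moreover have "\<Psi> z = Phi H z" for z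
  proof -
    obtain t x1 Y1 x2 Y2 where z: "z = (t, (x1, Y1), (x2, Y2))" by (metis surj_pair)
    show ?thesis
    proof (cases "t \<in> Theta n \<and> x1 \<in> carrier (Grn r N) \<and> x2 \<in> carrier (Grn r N)")
      case True
      then have t: "t \<in> Theta n" and x: "x1 \<in> carrier (Grn r N)" "x2 \<in> carrier (Grn r N)" by auto
      note p = Grn_perm[OF x(1)] Grn_perm[OF x(2)]
      have "\<Psi> z = colour_char r \<tau> x1 * (colour_char r \<tau> x2 * \<Psi> (t, (P (perm_of x1), Y1), (P (perm_of x2), Y2)))"
        using V_colour_char[OF V1[of t "(x2, Y2)"], of x1 Y1] V_colour_char[OF V2[of t
          "(P (perm_of x1), Y1)"], of x2 Y2] x by (simp add: z)
      moreover have "\<Psi> (t, (P (perm_of x1), Y1), (P (perm_of x2), Y2)) =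
        (if drop m Y1 = replicate m [] \<and> drop m Y2 = replicate m [] then H (t \<circ> halves_perm N (inv (perm_of x1))
          (inv (perm_of x2))) (take m Y1) (take m Y2) else 0)"
      proof (cases "Y1 \<in> tabs_list L \<and> Y2 \<in> tabs_list L")
        case TT: True
        then obtain y1 y2 where "y1 \<in> tabs_list \<mu>" "Y1 = pad y1" "y2 \<in> tabs_list \<mu>" "Y2 = pad y2"
          unfolding tabs_list_pad by blast
        then show ?thesis using HD[OF t permutes_inv[OF p(1)] permutes_inv[OF p(2)]]
          by (simp add: permutes_inv_inv[OF p(1)] permutes_inv_inv[OF p(2)])
      next
        case FF: False
        have iff: "Y \<in> tabs_list L \<longleftrightarrow> drop m Y = replicate m [] \<and> take m Y \<in> tabs_list \<mu>" for Y
        proof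
          assume "Y \<in> tabs_list L" then show "drop m Y = replicate m [] \<and> take m Y \<in> tabs_list \<mu>"
            unfolding tabs_list_pad by auto
        next
          assume "drop m Y = replicate m [] \<and> take m Y \<in> tabs_list \<mu>"
          then show "Y \<in> tabs_list L" unfolding tabs_list_pad using append_take_drop_id[of m Y] by metis
        qed
        have z1: "\<Psi> (t, (P (perm_of x1), Y1), b) = 0" if "Y1 \<notin> tabs_list L" for b
          using V_tkernel[OF V1[of t b] p(1), of Y1] that unfolding iff by (auto simp: tkernel_outside)
        have z2: "\<Psi> (t, a, (P (perm_of x2), Y2)) = 0" if "Y2 \<notin> tabs_list L" for a
          using V_tkernel[OF V2[of t a] p(2), of Y2] that unfolding iff by (auto simp: tkernel_outside)
        show ?thesis using FF z1 z2 unfolding iff by (auto simp: HD[OF t permutes_inv[OF p(1)] permutes_inv[OF p(2)]])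
      qed
      ultimately show ?thesis using True by (simp add: z Phi_def)
    next
      case False
      have "\<Psi> z = 0" using False V0 V_colour_char[OF V1[of t "(x2, Y2)"], of x1 Y1] V_colour_char[OF V2[of t
        "(x1, Y1)"], of x2 Y2] by (auto simp: z)
      then show ?thesis using False by (auto simp: z Phi_def)
    qed
  qed
  then have "\<Psi> = Phi H" by (rule ext)
  ultimately show ?thesis by blast
qed

text \<open>The exponents of \<open>x\<close> over the first half give the scalar of
  \<open>x1\<close>. Over the second half every block number of \<open>\<tau> @ \<tau>\<close> is
  larger by \<open>m\<close>, and this excess is exactly the twist by \<open>delta\<close>.\<close>

theorem Phi_act:
  assumes H: "admissible \<tau> \<mu> H" and x: "x \<in> carrier (Grn r n)"
    and H': "\<And>w y z. w permutes {..<n} \<Longrightarrow> H' (perm_of x \<circ> w) y z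
      = zeta r ^ (\<Sum>q<n. zexp r x (w q) * block_of (\<tau> @ \<tau>) q) * H w y z"
  shows "ract (TVV_rep r n \<mu>) x (Phi H) = Phi H'"
proof
  fix z :: "(nat \<Rightarrow> nat) \<times> (complex mat \<times> nat set list list) \<times> (complex mat \<times> nat set list list)"
  obtain s b1 Y1 b2 Y2 where z: "z = (s, (b1, Y1), (b2, Y2))" by (metis surj_pair)
  let ?G = "carrier (Grn r N)"
  obtain \<sigma> e where s: "\<sigma> permutes {..<n}" "\<And>j. e j < r" "x = monomial r n \<sigma> e" using Grn_monomial[OF x r] by blast
  have ze: "zexp r x j = e j" if "j < n" for j using that s r by simp
  have fac: "\<exists>t' u v. t' \<in> Theta n \<and> u permutes {..<N} \<and> v permutes {..<N} \<and> \<sigma> \<circ> t = t' \<circ> halves_perm N u v"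
    if "t \<in> Theta n" for t
    using theta_factor[OF nN permutes_compose[OF Theta_permutes[OF that] s(1)]] .
  have A: "ract (TVV_rep r n \<mu>) x (Phi H) z = (\<Sum>t\<in>Theta n. case coset_decomp r n x t of (t', x1, x2) \<Rightarrow>
     (if s = t' \<and> b1 \<in> ?G \<and> b2 \<in> ?G then delta r x2 * Phi H (t, (b1 * x1, Y1), (b2 * x2, Y2)) else 0))"
    unfolding TVV_act_eq[OF Phi_TVV[OF H]] z by simp
  show "ract (TVV_rep r n \<mu>) x (Phi H) z = Phi H' z"
  proof (cases "s \<in> Theta n \<and> b1 \<in> ?G \<and> b2 \<in> ?G")
    case False
    have "(case coset_decomp r n x t of (t', x1, x2) \<Rightarrow>
       (if s = t' \<and> b1 \<in> ?G \<and> b2 \<in> ?G then delta r x2 * Phi H (t, (b1 * x1, Y1), (b2 * x2, Y2)) else 0)) = 0"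
      if t: "t \<in> Theta n" for t
    proof -
      obtain t' u v where "t' \<in> Theta n" "u permutes {..<N}" "v permutes {..<N}" "\<sigma> \<circ> t = t' \<circ> halves_perm N u v"
        using fac[OF t] by blast
      then show ?thesis using coset_decomp_eq[OF nN r s(1) t, of t' u v e] False by (auto simp: s(3))
    qed
    then have "ract (TVV_rep r n \<mu>) x (Phi H) z = 0" unfolding A by simp
    moreover have "Phi H' z = 0" using False by (auto simp: z Phi_def)
    ultimately show ?thesis by simp
  next
    case True
    then have sT: "s \<in> Theta n" and bG: "b1 \<in> ?G" "b2 \<in> ?G" by auto
    \<comment> \<open>The shuffle that contributes at \<open>s\<close> is found by pulling
      \<open>s\<close> back along \<sigma> and factoring the result.\<close>
    have is': "inv \<sigma> \<circ> s permutes {..<n}" using permutes_compose[OF Theta_permutes[OF sT] permutes_inv[OF s(1)]] .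
    obtain t u' v' where t: "t \<in> Theta n" "u' permutes {..<N}" "v' permutes {..<N}" "inv \<sigma> \<circ> s
      = t \<circ> halves_perm N u' v'"
      using theta_factor[OF nN is'] by blast
    define u where "u = inv u'" define v where "v = inv v'"
    have uv: "u permutes {..<N}" "v permutes {..<N}" using t permutes_inv by (auto simp: u_def v_def)
    have st: "\<sigma> \<circ> t = s \<circ> halves_perm N u v"
    proof -
      have d: "halves_perm N u' v' \<circ> halves_perm N u v = id"
        unfolding halves_perm_comp[OF t(2,3) uv] by
          (simp add: u_def v_def permutes_inv_o[OF t(2)] permutes_inv_o[OF t(3)] halves_perm_id)
      have "s \<circ> halves_perm N u v = \<sigma> \<circ> (inv \<sigma> \<circ> s) \<circ> halves_perm N u v"
        by (simp add: permutes_inv_o[OF s(1)] flip: comp_assoc)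
      also have "\<dots> = \<sigma> \<circ> t \<circ> (halves_perm N u' v' \<circ> halves_perm N u v)" unfolding t(4) by (simp only: comp_assoc)
      finally show ?thesis unfolding d by simp
    qed
    define x1 where "x1 = monomial r N u (\<lambda>j. e (t j))"
    define x2 where "x2 = monomial r N v (\<lambda>j. e (t (N + j)))"
    have cd: "coset_decomp r n x t = (s, x1, x2)"
      unfolding s(3) x1_def x2_def by (rule coset_decomp_eq[OF nN r s(1) t(1) sT uv st])
    \<comment> \<open>Two shuffles sent to the coset of the same \<open>s\<close> coincide by
      uniqueness, so all other terms of the sum vanish.\<close>
    have other: "(case coset_decomp r n x t0 of (t', x1, x2) \<Rightarrow>
       (if s = t' \<and> b1 \<in> ?G \<and> b2 \<in> ?G then delta r x2 * Phi H (t0, (b1 * x1, Y1), (b2 * x2, Y2)) else 0)) = 0"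
      if t0: "t0 \<in> Theta n" "t0 \<noteq> t" for t0
    proof -
      obtain t' u1 v1 where f: "t' \<in> Theta n" "u1 permutes {..<N}" "v1 permutes {..<N}" "\<sigma> \<circ> t0
        = t' \<circ> halves_perm N u1 v1" using fac[OF t0(1)] by blast
      have "s \<noteq> t'"
      proof
        assume e': "s = t'"
        have "inv \<sigma> \<circ> s \<circ> halves_perm N u1 v1 = t0" using f(4) e' permutes_inv_o[OF s(1)]
          by (metis comp_assoc id_comp)
        then have "t \<circ> halves_perm N (u' \<circ> u1) (v' \<circ> v1) = t0 \<circ> halves_perm N id id"
          unfolding t(4) comp_assoc halves_perm_comp[OF t(2,3) f(2,3)] by (simp add: halves_perm_id)
        from theta_unique[OF nN t(1) t0(1) permutes_compose[OF f(2) t(2)] permutes_compose[OF f(3) t(3)]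
          permutes_id permutes_id this]
        show False using t0(2) by simp
      qed
      then show ?thesis using coset_decomp_eq[OF nN r s(1) t0(1) f(1-4), of e] by (simp add: s(3))
    qed
    have "ract (TVV_rep r n \<mu>) x (Phi H) z = (\<Sum>t0\<in>Theta n. if t0
      = t then delta r x2 * Phi H (t, (b1 * x1, Y1), (b2 * x2, Y2)) else 0)"
      unfolding A by (intro sum.cong refl) (use other cd bG in auto)
    also have "\<dots> = delta r x2 * Phi H (t, (b1 * x1, Y1), (b2 * x2, Y2))" using t(1) by simp
    finally have B: "ract (TVV_rep r n \<mu>) x (Phi H) z = delta r x2 * Phi H (t, (b1 * x1, Y1), (b2 * x2, Y2))" .
    obtain p1 y1 where p1: "p1 permutes {..<N}" "b1 = monomial r N p1 y1" using Grn_monomial[OF bG(1) r] by blast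
    obtain p2 y2 where p2: "p2 permutes {..<N}" "b2 = monomial r N p2 y2" using Grn_monomial[OF bG(2) r] by blast
    have q1: "p1 \<circ> u permutes {..<N}" and q2: "p2 \<circ> v permutes {..<N}" using permutes_compose uv p1 p2 by auto
    have bx: "b1 * x1 = monomial r N (p1 \<circ> u) (\<lambda>j. e (t j) + y1 (u j))" "b2 * x2
      = monomial r N (p2 \<circ> v) (\<lambda>j. e (t (N + j)) + y2 (v j))"
      unfolding p1 p2 x1_def x2_def monomial_mult[OF uv(1)] monomial_mult[OF uv(2)] by auto
    define w where "w = t \<circ> halves_perm N (inv (p1 \<circ> u)) (inv (p2 \<circ> v))"
    have w: "w permutes {..<n}" unfolding w_def by (intro theta_halves_perm_permutes t(1) permutes_inv q1 q2)
    have sw: "\<sigma> \<circ> w = s \<circ> halves_perm N (inv p1) (inv p2)"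
    proof -
      have "\<sigma> \<circ> w = s \<circ> (halves_perm N u v \<circ> halves_perm N (inv (p1 \<circ> u)) (inv (p2 \<circ> v)))"
        unfolding w_def comp_assoc[symmetric] st ..
      also have "halves_perm N u v \<circ> halves_perm N (inv (p1 \<circ> u)) (inv (p2 \<circ> v)) = halves_perm N (inv p1) (inv p2)"
      proof -
        have "u \<circ> inv (p1 \<circ> u) = inv p1" "v \<circ> inv (p2 \<circ> v) = inv p2"
          unfolding inv_comp_permutes[OF p1(1) uv(1)] inv_comp_permutes[OF p2(1) uv(2)]
          by (simp_all add: permutes_inv_o[OF uv(1)] permutes_inv_o[OF uv(2)] flip: comp_assoc)
        then show ?thesis using halves_perm_comp[OF uv permutes_inv[OF q1] permutes_inv[OF q2]] by simp
      qed
      finally show ?thesis .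
    qed
    have S1: "(\<Sum>j<N. (f j + y (k j)) * block_of \<tau> ((p \<circ> k) j))
      = (\<Sum>q<N. f (inv (p \<circ> k) q) * block_of \<tau> q) + (\<Sum>j<N. y j * block_of \<tau> (p j))"
      if k: "k permutes {..<N}" and p: "p permutes {..<N}" for f y k p :: "nat \<Rightarrow> nat"
    proof -
      have pk: "p \<circ> k permutes {..<N}" using permutes_compose[OF k p] .
      have "(\<Sum>q<N. f (inv (p \<circ> k) q) * block_of \<tau> q) = (\<Sum>j<N. f j * block_of \<tau> ((p \<circ> k) j))"
        using sum.permute[OF pk, of "\<lambda>q. f (inv (p \<circ> k) q) * block_of \<tau> q"] permutes_inverses[OF pk]
          by (simp add: comp_def)
      moreover have "(\<Sum>j<N. y j * block_of \<tau> (p j)) = (\<Sum>j<N. y (k j) * block_of \<tau> ((p \<circ> k) j))"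
        using sum.permute[OF k, of "\<lambda>j. y j * block_of \<tau> (p j)"] by (simp add: comp_def)
      ultimately show ?thesis by (simp add: add_mult_distrib sum.distrib)
    qed
    have c1: "colour_char r \<tau> (b1 * x1) = zeta r ^ (\<Sum>q<N. e (w q) * block_of \<tau> q) * colour_char r \<tau> b1"
    proof -
      have "(\<Sum>q<N. e (t (inv (p1 \<circ> u) q)) * block_of \<tau> q) = (\<Sum>q<N. e (w q) * block_of \<tau> q)"
        by (intro sum.cong refl) (simp add: w_def halves_perm_apply)
      then have "colour_char r \<tau> (b1 * x1)
        = zeta r ^ (\<Sum>q<N. e (w q) * block_of \<tau> q) * zeta r ^ (\<Sum>j<N. y1 j * block_of \<tau> (p1 j))"
        unfolding bx(1) colour_char_monomial[OF q1 r] S1[OF uv(1) p1(1), of "\<lambda>j. e (t j)"] power_add by simp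
      then show ?thesis unfolding p1(2) colour_char_monomial[OF p1(1) r] .
    qed
    have c2: "colour_char r \<tau> (b2 * x2) = zeta r ^ (\<Sum>q<N. e (w (N + q)) * block_of \<tau> q) * colour_char r \<tau> b2"
    proof -
      have "(\<Sum>q<N. e (t (N + inv (p2 \<circ> v) q)) * block_of \<tau> q) = (\<Sum>q<N. e (w (N + q)) * block_of \<tau> q)"
        by (intro sum.cong refl) (simp add: w_def halves_perm_apply)
      then have "colour_char r \<tau> (b2 * x2)
        = zeta r ^ (\<Sum>q<N. e (w (N + q)) * block_of \<tau> q) * zeta r ^ (\<Sum>j<N. y2 j * block_of \<tau> (p2 j))"
        unfolding bx(2) colour_char_monomial[OF q2 r] S1[OF uv(2) p2(1), of "\<lambda>j. e (t (N + j))"] power_add by simp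
      then show ?thesis unfolding p2(2) colour_char_monomial[OF p2(1) r] .
    qed
    \<comment> \<open>\<open>delta\<close> is a power of -1, which is \<open>zeta r ^ m\<close>; the
      sum of exponents is reindexed by the positions of \<open>w\<close> in the second half.\<close>
    have dl: "delta r x2 = zeta r ^ (m * (\<Sum>q<N. e (w (N + q))))"
    proof -
      have "delta r x2 = (zeta r ^ ztotal r x2) ^ m"
        unfolding delta_def using zeta_half[OF even_r r] by (metis mult.commute power_mult)
      also have "\<dots> = (zeta r ^ (\<Sum>j<N. e (t (N + j)))) ^ m" unfolding x2_def ztotal_monomial[OF uv(2) r] ..
      also have "(\<Sum>j<N. e (t (N + j))) = (\<Sum>q<N. e (t (N + inv (p2 \<circ> v) q)))"
        using sum.permute[OF permutes_inv[OF q2], of "\<lambda>j. e (t (N + j))"] by (simp add: comp_def)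
      also have "\<dots> = (\<Sum>q<N. e (w (N + q)))" by (intro sum.cong refl) (simp add: w_def halves_perm_apply)
      finally show ?thesis by (simp add: power_mult[symmetric] mult.commute)
    qed
    \<comment> \<open>The Gelfand exponent splits at the middle; the second half separates into its
      weights by block numbers of \<tau> and the constant weight \<open>m\<close>.\<close>
    have tot: "zeta r ^ (\<Sum>q<n. zexp r x (w q) * block_of (\<tau> @ \<tau>) q) =
      zeta r ^ (\<Sum>q<N. e (w q) * block_of \<tau> q) * (zeta r ^ (\<Sum>q<N. e (w (N + q)) * block_of \<tau> q) * zeta r ^
        (m * (\<Sum>q<N. e (w (N + q)))))"
    proof -
      have "(\<Sum>q<n. zexp r x (w q) * block_of (\<tau> @ \<tau>) q) = (\<Sum>q<n. e (w q) * block_of (\<tau> @ \<tau>) q)"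
        using ze permutes_less[OF w] by simp
      also have "\<dots> = (\<Sum>q<N + N. e (w q) * block_of (\<tau> @ \<tau>) q)" using nN by (simp add: mult_2)
      also have "\<dots> = (\<Sum>q<N. e (w q) * block_of \<tau> q) + (\<Sum>q<N. e (w (N + q)) * (m + block_of \<tau> q))"
        unfolding sum_lessThan_add using sum_tau len_mu by (simp add: block_of_append)
      also have "(\<Sum>q<N. e (w (N + q)) * (m + block_of \<tau> q))
        = m * (\<Sum>q<N. e (w (N + q))) + (\<Sum>q<N. e (w (N + q)) * block_of \<tau> q)"
        by (simp add: distrib_left sum.distrib sum_distrib_left mult.commute)
      finally show ?thesis by (simp add: power_add mult_ac)
    qed
    have bxG: "b1 * x1 \<in> ?G" "b2 * x2 \<in> ?G" unfolding bx by (intro monomial_in_Grn q1 q2 r)+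
    have pb: "perm_of (b1 * x1) = p1 \<circ> u" "perm_of (b2 * x2) = p2 \<circ> v" "perm_of b1 = p1" "perm_of b2 = p2"
      unfolding bx perm_of_monomial[OF q1] perm_of_monomial[OF q2] using p1 p2 by simp_all
    have Hw: "H' (s \<circ> halves_perm N (inv p1) (inv p2)) Z1 Z2
      = zeta r ^ (\<Sum>q<n. zexp r x (w q) * block_of (\<tau> @ \<tau>) q) * H w Z1 Z2" for Z1 Z2
      using H'[OF w] s by (simp add: sw)
    show ?thesis
    proof (cases "drop m Y1 = replicate m [] \<and> drop m Y2 = replicate m []")
      case TT: True
      have "ract (TVV_rep r n \<mu>) x (Phi H) z
        = delta r x2 * (colour_char r \<tau> (b1 * x1) * colour_char r \<tau> (b2 * x2) * H w (take m Y1) (take m Y2))"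
        unfolding B using TT bxG t(1) by (simp add: Phi_def pb w_def)
      also have "\<dots> = colour_char r \<tau> b1 * colour_char r \<tau> b2
        * H' (s \<circ> halves_perm N (inv p1) (inv p2)) (take m Y1) (take m Y2)"
        unfolding Hw tot c1 c2 dl by (simp only: mult_ac)
      also have "\<dots> = Phi H' z" using TT True by (simp add: z Phi_def pb)
      finally show ?thesis .
    next
      case False
      then have "Phi H (t, (b1 * x1, Y1), (b2 * x2, Y2)) = 0" "Phi H' z = 0" by (auto simp: Phi_def z)
      then show ?thesis unfolding B by simp
    qed
  qed
qed

end

section \<open>The intertwining operator\<close>

lemma young_fourier_scale_cong:
  assumes L: "L \<in> parts_list \<tau>" and w: "w permutes {..<2 * sum_list \<tau>}"
    and f: "\<And>w. w permutes {..<2 * sum_list \<tau>} \<Longrightarrow> f' w = c * f w"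
  shows "young_fourier \<tau> L f' w y z = c * young_fourier \<tau> L f w y z"
proof -
  have "f' (w \<circ> halves_perm (sum_list \<tau>) (block_perm \<tau> us) id)
    = c * f (w \<circ> halves_perm (sum_list \<tau>) (block_perm \<tau> us) id)" if "us \<in> Young_group \<tau>" for us
    by (rule f[OF permutes_compose[OF halves_perm_permutes[OF block_perm_permutes[OF that] permutes_id] w]])
  then show ?thesis by (simp add: young_fourier_def sum_distrib_left mult_ac)
qed

lemma young_fourier_sum: "young_fourier \<tau> L (\<lambda>w. \<Sum>X\<in>A. f X w) w y z = (\<Sum>X\<in>A. young_fourier \<tau> L (f X) w y z)"
  unfolding young_fourier_def by (simp add: sum_distrib_right) (rule impI, rule sum.swap)

text \<open>The scalar depends on \<open>w\<close> through exponents weighted with block numbers,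
  which translation by the Young subgroup only reorders. It can therefore be taken out of the
  Fourier sum.\<close>

lemma young_fourier_twist:
  assumes w: "w permutes {..<2 * sum_list \<tau>}"
    and f: "\<And>w. w permutes {..<2 * sum_list \<tau>} \<Longrightarrow>
      f' (\<sigma> \<circ> w) = \<omega> ^ (\<Sum>q<2 * sum_list \<tau>. a (w q) * block_of (\<tau> @ \<tau>) q) * (f w :: complex)"
  shows "young_fourier \<tau> L f' (\<sigma> \<circ> w) y z
    = \<omega> ^ (\<Sum>q<2 * sum_list \<tau>. a (w q) * block_of (\<tau> @ \<tau>) q) * young_fourier \<tau> L f w y z"
proof -
  let ?n = "2 * sum_list \<tau>"
  have "f' (\<sigma> \<circ> w \<circ> halves_perm (sum_list \<tau>) (block_perm \<tau> us) id) =
    \<omega> ^ (\<Sum>q<?n. a (w q) * block_of (\<tau> @ \<tau>) q) * f (w \<circ> halves_perm (sum_list \<tau>) (block_perm \<tau> us) id)"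
    if us: "us \<in> Young_group \<tau>" for us
  proof -
    let ?d = "halves_perm (sum_list \<tau>) (block_perm \<tau> us) id"
    have d: "?d permutes {..<?n}" by (rule halves_perm_permutes[OF block_perm_permutes[OF us] permutes_id])
    have "block_of (\<tau> @ \<tau>) (?d q) = block_of (\<tau> @ \<tau>) q" if "q < ?n" for q
      using block_of_block_perm[OF us] block_perm_less[OF us] that by (simp add: halves_perm_apply block_of_append)
    then have "(\<Sum>q<?n. a (w (?d q)) * block_of (\<tau> @ \<tau>) q) = (\<Sum>q<?n. a (w (?d q)) * block_of (\<tau> @ \<tau>) (?d q))"
      by (intro sum.cong refl) simp
    also have "\<dots> = (\<Sum>q<?n. a (w q) * block_of (\<tau> @ \<tau>) q)"
      using sum.permute[OF d, of "\<lambda>q. a (w q) * block_of (\<tau> @ \<tau>) q"] by (simp add: comp_def)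
    finally show ?thesis using f[OF permutes_compose[OF d w]] by (simp add: comp_assoc)
  qed
  then show ?thesis by (simp add: young_fourier_def sum_distrib_left mult_ac)
qed

context gelfand_setting begin

text \<open>Lifting along a rotation of \<tau> changes the function by a nonzero scalar and a
  translation of its argument, neither of which affects vanishing.\<close>

lemma young_fourier_vanishes_lifted_rotate:
  assumes t: "n = 2 * sum_list \<tau>" "length \<tau> = r div 2" and L: "L \<in> parts_list \<tau>"
  shows "young_fourier_vanishes (rotate (k * (r div p)) \<tau>) (rotate (k * (r div p)) L) (lifted f (rotate (k
    * (r div p)) \<tau>)) \<longleftrightarrow>
    young_fourier_vanishes \<tau> L (lifted f \<tau>)"
proof -
  let ?k = "k * (r div p)"
  have ne: "\<tau> \<noteq> []" using t n by auto
  have "lifted f \<tau> (w \<circ> rotation_perm \<tau> ?k) = zeta p ^ k * lifted f (rotate ?k \<tau>) w" if "w permutes {..<n}" for w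
    using lifted_rotate[OF t that] by simp
  then have "young_fourier (rotate ?k \<tau>) (rotate ?k L) (\<lambda>w. lifted f \<tau> (w \<circ> rotation_perm \<tau> ?k)) w y z =
      zeta p ^ k * young_fourier (rotate ?k \<tau>) (rotate ?k L)
        (lifted f (rotate ?k \<tau>)) w y z" if "w permutes {..<n}" for w y z
    using young_fourier_scale_cong[OF parts_list_rotate[OF L]] that t(1) by simp
  then have "young_fourier_vanishes (rotate ?k \<tau>) (rotate ?k L) (lifted f (rotate ?k \<tau>)) \<longleftrightarrow>
    young_fourier_vanishes (rotate ?k \<tau>) (rotate ?k L) (\<lambda>w. lifted f \<tau> (w \<circ> rotation_perm \<tau> ?k))"
    unfolding young_fourier_vanishes_def using t(1) by simp
  then show ?thesis using young_fourier_vanishes_rotate[OF L lifted_diag_invariant[OF t(1)] ne, of ?k f] by simp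
qed

section \<open>Orbits of multipartitions\<close>

lemma half_factor: "r div 2 = (p div 2) * (r div p)"
  using p even_p p0 by (auto elim!: dvdE)

text \<open>Orbits are defined by rotations by \<open>r div 2 - r div p\<close>, whereas types
  rotate by \<open>r div p\<close>. On lists of length \<open>r div 2\<close> these two rotations
  are inverse to each other, so they generate the same finite cyclic group.\<close>

lemma fer_orbit_iff:
  assumes len: "length \<mu> = r div 2"
  shows "\<nu> \<in> fer_orbit r p \<mu> \<longleftrightarrow> (\<exists>k. \<nu> = rotate (k * (r div p)) \<mu>)"
proof -
  define q and s where "q = p div 2" and "s = r div p"
  have m: "r div 2 = q * s" using half_factor by (simp add: q_def s_def)
  have q: "q > 0" using even_p p0 by (auto simp: q_def elim!: evenE)
  have ms: "r div 2 - r div p = (q - 1) * s" by (simp add: m s_def[symmetric] diff_mult_distrib)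
  \<comment> \<open>Counted in steps of \<open>s\<close> modulo \<open>q\<close>, the generator is
    \<open>q - 1\<close>, that is -1, and its square is 1; hence \<open>k * (q - 1)\<close>
    applications give \<open>k\<close> steps forward.\<close>
  have bk: "rotate (k * s) \<mu> = rotate (k * (q - 1) * ((q - 1) * s)) \<mu>" for k
  proof -
    have "(k * (q - 1) * ((q - 1) * s)) mod (q * s) = (k * s) mod (q * s)"
    proof (cases "q = 1")
      case False
      then have "(q - 1) * (q - 1) = q * (q - 2) + 1" using q
        by (cases q) (auto simp: algebra_simps diff_mult_distrib2)
      then have "k * (q - 1) * ((q - 1) * s) = k * s + (q * s) * (k * (q - 2))"
        by (metis (no_types, opaque_lifting) add.commute distrib_left mult.assoc mult.commute mult.right_neutral)
      then show ?thesis by simp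
    qed simp
    then show ?thesis using rotate_conv_mod len m by metis
  qed
  show ?thesis
  proof
    assume "\<nu> \<in> fer_orbit r p \<mu>"
    then obtain k where "\<nu> = rotate (k * ((q - 1) * s)) \<mu>" unfolding fer_orbit_def funpow_rotate ms by blast
    then have "\<nu> = rotate ((k * (q - 1)) * s) \<mu>" by (simp add: mult.assoc)
    then show "\<exists>k. \<nu> = rotate (k * (r div p)) \<mu>" unfolding s_def by blast
  next
    assume "\<exists>k. \<nu> = rotate (k * (r div p)) \<mu>"
    then obtain k where "\<nu> = rotate (k * s) \<mu>" unfolding s_def by blast
    then show "\<nu> \<in> fer_orbit r p \<mu>" unfolding fer_orbit_def funpow_rotate ms using bk[of k] by auto
  qed
qed

lemma fer_orbit_eq:
  assumes len: "length \<mu> = r div 2" and nu: "\<nu> \<in> fer_orbit r p \<mu>"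
  shows "fer_orbit r p \<nu> = fer_orbit r p \<mu>"
proof -
  obtain k where k: "\<nu> = rotate (k * (r div p)) \<mu>" using nu fer_orbit_iff[OF len] by blast
  have len': "length \<nu> = r div 2" using k len by simp
  \<comment> \<open>The additional steps complete \<open>k\<close> full turns of the list and lead
    back to \<mu>.\<close>
  have "rotate (k * (p div 2 - 1) * (r div p)) \<nu> = rotate ((k * (p div 2 - 1) + k) * (r div p)) \<mu>"
    unfolding k rotate_rotate by (simp add: distrib_right)
  also have "(k * (p div 2 - 1) + k) * (r div p) = k * (r div 2)"
  proof -
    have "p div 2 > 0" using even_p p0 by (auto elim!: evenE)
    then have "k * (p div 2 - 1) + k = k * (p div 2)" by (cases "p div 2") auto
    then show ?thesis unfolding half_factor by (simp add: mult.assoc)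
  qed
  also have "rotate (k * (r div 2)) \<mu> = \<mu>" using rotate_conv_mod[of "k * (r div 2)" \<mu>] len by simp
  finally have bk: "\<mu> = rotate (k * (p div 2 - 1) * (r div p)) \<nu>" by simp
  show ?thesis
  proof (intro subset_antisym subsetI)
    fix x assume "x \<in> fer_orbit r p \<nu>"
    then obtain j where "x = rotate (j * (r div p)) \<nu>" using fer_orbit_iff[OF len'] by blast
    then have "x = rotate ((j + k) * (r div p)) \<mu>" by (simp add: k rotate_rotate distrib_right)
    then show "x \<in> fer_orbit r p \<mu>" using fer_orbit_iff[OF len] by blast
  next
    fix x assume "x \<in> fer_orbit r p \<mu>"
    then obtain j where "x = rotate (j * (r div p)) \<mu>" using fer_orbit_iff[OF len] by blast
    then have "x = rotate ((j + k * (p div 2 - 1)) * (r div p)) \<nu>"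
      by (subst (asm) bk) (simp add: rotate_rotate distrib_right)
    then show "x \<in> fer_orbit r p \<nu>" using fer_orbit_iff[OF len'] by blast
  qed
qed

end

lemma Fer_parts_list:
  "\<mu> \<in> Fer a b \<longleftrightarrow> length \<mu> = a \<and> \<mu> \<in> parts_list (map sum_list \<mu>) \<and> sum_list (map sum_list \<mu>) = b"
  by (auto simp: Fer_def listset_iff parts_def in_set_conv_nth all_set_conv_all_nth)

lemma normalized_sum: "normalized r p (\<lambda>v. \<Sum>X\<in>A. f X v) B = (\<Sum>X\<in>A. normalized r p (f X) B)"
  by (simp add: normalized_def sum_distrib_left)

context gelfand_class begin

abbreviation "\<O> \<equiv> fer_orbits_of_type r p n \<tau>"

lemma sizes_parts_list:
  assumes "\<nu> \<in> parts_list (rotate k \<tau>)" shows "map sum_list \<nu> = rotate k \<tau>" "\<nu> \<in> Fer (r div 2) (n div 2)"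
proof -
  show e: "map sum_list \<nu> = rotate k \<tau>" by (rule parts_list_sum_list[OF assms])
  have "length \<nu> = r div 2" using length_listset[OF assms] tau_type by simp
  then show "\<nu> \<in> Fer (r div 2) (n div 2)" unfolding Fer_parts_list e using assms tau_type by simp
qed

text \<open>Some member of the orbit has the block sizes \<tau>; any other member differs from it by
  a rotation by a multiple of \<open>r div p\<close>, and its block sizes by the same
  rotation.\<close>

lemma orbit_rep:
  assumes X: "X \<in> \<O>" and mu: "\<mu> \<in> X"
  shows "X = fer_orbit r p \<mu>" "length \<mu> = r div 2" "\<exists>k. \<mu> \<in> parts_list (rotate (k * (r div p)) \<tau>)"
    "\<exists>\<nu>\<in>X. \<nu> \<in> parts_list \<tau>"
proof -
  obtain \<mu>0 \<nu> where X0: "X = fer_orbit r p \<mu>0" "\<mu>0 \<in> Fer (r div 2) (n div 2)" and nu: "\<nu> \<in> X"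
    "\<forall>i<r div 2. sum_list (\<nu> ! i) = \<tau> ! i"
    using X by (auto simp: fer_orbits_of_type_def)
  have l0: "length \<mu>0 = r div 2" using X0 by (simp add: Fer_def)
  have parts_list: "\<kappa> \<in> parts_list (map sum_list \<kappa>) \<and> length \<kappa> = r div 2" if kX: "\<kappa> \<in> X" for \<kappa>
  proof -
    obtain k where k: "\<kappa> = rotate (k * (r div p)) \<mu>0" using kX fer_orbit_iff[OF l0, of \<kappa>] unfolding X0(1) by blast
    have "\<mu>0 \<in> parts_list (map sum_list \<mu>0)" using X0(2) Fer_parts_list by blast
    then show ?thesis using parts_list_rotate[of \<mu>0 "map sum_list \<mu>0" "k * (r div p)"] l0 by (simp add: k rotate_map)
  qed
  have Xe: "X = fer_orbit r p \<kappa>" if "\<kappa> \<in> X" for \<kappa> using fer_orbit_eq[OF l0] that X0(1) by blast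
  show "X = fer_orbit r p \<mu>" using Xe[OF mu] .
  show "length \<mu> = r div 2" using parts_list[OF mu] by blast
  have "map sum_list \<nu> = \<tau>" using nu(2) parts_list[OF nu(1)] tau_type by (intro nth_equalityI) auto
  then have nP: "\<nu> \<in> parts_list \<tau>" using parts_list[OF nu(1)] by simp
  then show "\<exists>\<nu>\<in>X. \<nu> \<in> parts_list \<tau>" using nu(1) by blast
  obtain k where "\<mu> = rotate (k * (r div p)) \<nu>" using mu Xe[OF nu(1)] fer_orbit_iff[of \<nu>] parts_list[OF nu(1)]
    by blast
  then show "\<exists>k. \<mu> \<in> parts_list (rotate (k * (r div p)) \<tau>)" using parts_list_rotate[OF nP] by blast
qed

lemma orbit_of_parts_list:
  assumes "\<nu> \<in> parts_list \<tau>" shows "fer_orbit r p \<nu> \<in> \<O>" "\<nu> \<in> fer_orbit r p \<nu>"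
proof -
  have F: "map sum_list \<nu> = \<tau>" "\<nu> \<in> Fer (r div 2) (n div 2)" using sizes_parts_list[of \<nu> 0] assms by auto
  then have l: "length \<nu> = r div 2" by (simp add: Fer_def)
  show s: "\<nu> \<in> fer_orbit r p \<nu>" unfolding fer_orbit_iff[OF l] by (intro exI[of _ 0]) simp
  have "\<forall>i<r div 2. sum_list (\<nu> ! i) = \<tau> ! i" using F(1) l by (metis nth_map)
  then show "fer_orbit r p \<nu> \<in> \<O>" using s F(2) by (auto simp: fer_orbits_of_type_def)
qed

lemma finite_orbits: "finite \<O>"
proof (rule finite_subset)
  show "\<O> \<subseteq> fer_orbit r p ` parts_list \<tau>"
  proof
    fix X assume X: "X \<in> \<O>"
    then obtain \<mu> where "\<mu> \<in> X" by (auto simp: fer_orbits_of_type_def)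
    then obtain \<nu> where "\<nu> \<in> X" "\<nu> \<in> parts_list \<tau>" using orbit_rep(4)[OF X] by blast
    then show "X \<in> fer_orbit r p ` parts_list \<tau>" using orbit_rep(1)[OF X] by blast
  qed
qed simp

text \<open>The component at \<open>X\<close> lifts \<open>f\<close> along the block sizes of
  \<open>repr X\<close> itself, takes the Fourier coefficient there and transports it by
  \<open>Phi\<close>. Injectivity comes from completeness, surjectivity from synthesis one orbit at
  a time.\<close>

theorem gelfand_class_iso:
  assumes repr: "\<forall>X\<in>\<O>. repr X \<in> X"
  shows "rep_iso (Grpn r p n) (gelfand_sub r p n c) (dsum_rep \<O> (\<lambda>X. rho_split r n 1 (repr X)))"
proof -
  define T where "T X = map sum_list (repr X)" for X
  define H where "H f X = young_fourier (T X) (repr X) (lifted f (T X))" for f X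
  define \<phi> where "\<phi> f = (\<lambda>(X, z). if X \<in> \<O> then gelfand_mu.Phi r n (repr X) (H f X) z else 0)" for f
  have T: "repr X \<in> parts_list (T X)" "n = 2 * sum_list (T X)" "length (T X) = r div 2" "gelfand_mu r n p (repr X)"
    "\<exists>k. T X = rotate (k * (r div p)) \<tau>" "X = fer_orbit r p (repr X)" "length (repr X) = r div 2" if X: "X \<in> \<O>" for X
  proof -
    have rX: "repr X \<in> X" using repr X by blast
    obtain k where k: "repr X \<in> parts_list (rotate (k * (r div p)) \<tau>)" using orbit_rep(3)[OF X rX] by blast
    have e: "T X = rotate (k * (r div p)) \<tau>" using sizes_parts_list(1)[OF k] by (simp add: T_def)
    show "repr X \<in> parts_list (T X)" using k e by simp
    show "n = 2 * sum_list (T X)" "length (T X) = r div 2" unfolding e by (rule rot_type)+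
    show "gelfand_mu r n p (repr X)" using sizes_parts_list(2)[OF k] by unfold_locales
    show "\<exists>k. T X = rotate (k * (r div p)) \<tau>" using e by blast
    show "X = fer_orbit r p (repr X)" "length (repr X) = r div 2" using orbit_rep(1,2)[OF X rX] by auto
  qed
  have admissible: "admissible (T X) (repr X) (H f X)" if "X \<in> \<O>" for X f
    unfolding H_def using T[OF that] by (intro young_fourier_admissible lifted_diag_invariant lifted_swap_odd)
  have Phi_lin: "gelfand_mu.Phi r n (repr X) (H (\<lambda>v. f v + g v) X) z =
      gelfand_mu.Phi r n (repr X) (H f X) z + gelfand_mu.Phi r n (repr X) (H g X) z"
    "gelfand_mu.Phi r n (repr X) (H (\<lambda>v. a * f v) X) z = a * gelfand_mu.Phi r n (repr X) (H f X) z"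
    if X: "X \<in> \<O>" for X f g a z
  proof -
    interpret M: gelfand_mu r n p "repr X" using T(4)[OF X] .
    obtain t x1 Y1 x2 Y2 where z: "z = (t, (x1, Y1), (x2, Y2))" by (metis surj_pair)
    have "H (\<lambda>v. f v + g v) X w y1 y2 = H f X w y1 y2 + H g X w y1 y2" "H (\<lambda>v. a * f v) X w y1 y2
      = a * H f X w y1 y2" for w y1 y2
      by (simp_all add: H_def young_fourier_def lifted_def normalized_def sum.distrib[symmetric] sum_distrib_left
        algebra_simps)
    then show "M.Phi (H (\<lambda>v. f v + g v) X) z = M.Phi (H f X) z + M.Phi (H g X) z" "M.Phi (H (\<lambda>v. a * f v) X) z
      = a * M.Phi (H f X) z"
      by (simp_all add: z M.Phi_def algebra_simps)
  qed
  have lin: "clinear \<phi>"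
  proof (rule clinearI)
    fix f g :: "complex mat set \<Rightarrow> complex" and a x
    show "\<phi> (f + g) x = \<phi> f x + \<phi> g x" using Phi_lin(1) by (cases x) (simp add: \<phi>_def plus_fun_def)
    show "\<phi> (cscale a f) x = a * \<phi> f x" using Phi_lin(2) by (cases x) (simp add: \<phi>_def cscale_def)
  qed
  interpret VP: vector_space_pair "cscale :: complex \<Rightarrow> (complex mat set \<Rightarrow> complex) \<Rightarrow> _"
    "cscale :: complex \<Rightarrow> (nat list list set \<times> (nat \<Rightarrow> nat) \<times> (complex mat \<times> nat set list list) \<times>
      (complex mat \<times> nat set list list) \<Rightarrow> complex) \<Rightarrow> _" ..
  have into: "\<phi> f \<in> rspace (dsum_rep \<O> (\<lambda>X. rho_split r n 1 (repr X)))" for f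
  proof -
    have "(\<lambda>z. \<phi> f (X, z)) \<in> rspace (rho_split r n 1 (repr X))" if X: "X \<in> \<O>" for X
    proof -
      interpret M: gelfand_mu r n p "repr X" using T(4)[OF X] .
      show ?thesis using M.Phi_split[OF admissible[OF X, unfolded T_def], of f] X by (simp add: \<phi>_def H_def T_def)
    qed
    then show ?thesis by (simp add: dsum_rep_def \<phi>_def)
  qed
  have inj0: "f = 0" if f: "f \<in> rspace (gelfand_sub r p n c)" and 0: "\<phi> f = 0" for f
  proof -
    \<comment> \<open>The component of the orbit of \<nu> is computed at a representative with
      possibly rotated block sizes; its vanishing is carried back to \<nu> and \<tau>.\<close>
    have van: "young_fourier_vanishes \<tau> \<nu> (lifted f \<tau>)" if nu: "\<nu> \<in> parts_list \<tau>" for \<nu>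
    proof -
      define X where "X = fer_orbit r p \<nu>"
      have X: "X \<in> \<O>" using orbit_of_parts_list[OF nu] by (simp add: X_def)
      interpret M: gelfand_mu r n p "repr X" using T(4)[OF X] .
      have ln: "length \<nu> = r div 2" using length_listset[OF nu] tau_type by simp
      obtain k where k: "repr X = rotate (k * (r div p)) \<nu>" using repr X fer_orbit_iff[OF ln] unfolding X_def by blast
      have TX: "T X = rotate (k * (r div p)) \<tau>" using parts_list_sum_list[OF nu]
        by (simp add: T_def k rotate_map[symmetric])
      have "M.Phi (H f X) = M.Phi (\<lambda>_ _ _. 0)"
      proof
        fix z show "M.Phi (H f X) z = M.Phi (\<lambda>_ _ _. 0) z"
          using fun_cong[OF 0, of "(X, z)"] X by (cases z) (auto simp: \<phi>_def M.Phi_def)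
      qed
      then have "young_fourier_vanishes (T X) (repr X) (lifted f (T X))"
        unfolding young_fourier_vanishes_def using M.Phi_inject[of "H f X" "\<lambda>_ _ _. 0"] T(2)[OF X]
          by (simp add: H_def)
      then show ?thesis using young_fourier_vanishes_lifted_rotate[OF tau_type nu, of k f] by (simp add: TX k)
    qed
    have "lifted f \<tau> w = 0" if w: "w permutes {..<n}" for w
    proof (rule young_fourier_injective[of w \<tau> "lifted f \<tau>"])
      show w': "w permutes {..<2 * sum_list \<tau>}" using w tau_type by simp
      show "young_fourier \<tau> L (lifted f \<tau>) w y y = 0" if "L \<in> parts_list \<tau>" "y \<in> tabs_list L" for L y
        using van[OF that(1)] w' that(2) unfolding young_fourier_vanishes_def by blast
    qed
    then have "f v = 0" if "v \<in> c" for v using that unfolding c_antisym_mat by (auto simp: lifted_def normalized_def)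
    then show ?thesis using f unfolding gelfand_space by (auto simp: fun_eq_iff)
  qed
  have "bij_betw \<phi> (rspace (gelfand_sub r p n c)) (rspace (dsum_rep \<O> (\<lambda>X. rho_split r n 1 (repr X))))"
    unfolding bij_betw_def
  proof (intro conjI subset_antisym subsetI)
    show "inj_on \<phi> (rspace (gelfand_sub r p n c))"
    proof (rule inj_onI)
      fix f g assume fg: "f \<in> rspace (gelfand_sub r p n c)" "g \<in> rspace (gelfand_sub r p n c)" "\<phi> f = \<phi> g"
      have "\<phi> (f - g) = 0" using fg(3) VP.linear_diff[OF lin] by simp
      moreover have "f - g \<in> rspace (gelfand_sub r p n c)" using fg(1,2) unfolding gelfand_space by simp
      ultimately have "f - g = 0" using inj0 by blast
      then show "f = g" by simp
    qed
  next
    fix G assume "G \<in> \<phi> ` rspace (gelfand_sub r p n c)"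
    then show "G \<in> rspace (dsum_rep \<O> (\<lambda>X. rho_split r n 1 (repr X)))" using into by blast
  next
    fix G assume G: "G \<in> rspace (dsum_rep \<O> (\<lambda>X. rho_split r n 1 (repr X)))"
    have "\<exists>K. admissible (T X) (repr X) K \<and> (\<lambda>z. G (X, z)) = gelfand_mu.Phi r n (repr X) K" if X: "X \<in> \<O>" for X
    proof -
      interpret M: gelfand_mu r n p "repr X" using T(4)[OF X] .
      have "(\<lambda>z. G (X, z)) \<in> rspace (rho_split r n 1 (repr X))" using G X by (simp add: dsum_rep_def)
      from M.Phi_surj[OF this] show ?thesis by (simp add: T_def)
    qed
    then obtain K where K: "\<And>X. X \<in> \<O> \<Longrightarrow> admissible (T X) (repr X) (K X)"
      "\<And>X. X \<in> \<O> \<Longrightarrow> (\<lambda>z. G (X, z)) = gelfand_mu.Phi r n (repr X) (K X)" by metis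
    have "\<exists>f. (\<forall>v. v \<notin> c \<longrightarrow> f v = 0) \<and> (\<forall>w. w permutes {..<n} \<longrightarrow> lifted f (T X) w = synthesis (T X) (repr X) (K X) w)"
      if X: "X \<in> \<O>" for X
    proof -
      obtain k where "T X = rotate (k * (r div p)) \<tau>" using T(5)[OF X] by blast
      then show ?thesis
        using lifted_surj[OF T(2,3)[OF X] synthesis_diag_invariant[OF T(1)[OF X] K(1)[OF X]] synthesis_swap_odd[OF
          K(1)[OF X]]] c_antisym_mat_rotate[of k] by simp
    qed
    then obtain F where F: "\<And>X v. X \<in> \<O> \<Longrightarrow> v \<notin> c \<Longrightarrow> F X v = 0"
      "\<And>X w. X \<in> \<O> \<Longrightarrow> w permutes {..<n} \<Longrightarrow> lifted (F X) (T X) w = synthesis (T X) (repr X) (K X) w" by metis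
    \<comment> \<open>Each summand realizes the prescribed coefficient of one orbit;
      \<open>cross\<close> shows that it contributes 0 to the coefficients of the others.\<close>
    define f where "f v = (\<Sum>X\<in>\<O>. F X v)" for v
    have fs: "f \<in> rspace (gelfand_sub r p n c)" unfolding gelfand_space using F(1) by (simp add: f_def)
    have GF: "young_fourier (T X) \<nu> (lifted (F X) (T X)) w y z
      = (if \<nu> = repr X \<and> y \<in> tabs_list (repr X) then K X w y z else 0)"
      if X: "X \<in> \<O>" and nu: "\<nu> \<in> parts_list (T X)" and w: "w permutes {..<n}" for X \<nu> w y z
    proof -
      have w': "w permutes {..<2 * sum_list (T X)}" using w T(2)[OF X] by simp
      have "young_fourier (T X) \<nu> (lifted (F X) (T X)) w y z
        = 1 * young_fourier (T X) \<nu> (synthesis (T X) (repr X) (K X)) w y z"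
        by (rule young_fourier_scale_cong[OF nu w']) (use F(2)[OF X] T(2)[OF X] in simp)
      then show ?thesis using young_fourier_synthesis[OF nu T(1)[OF X] K(1)[OF X] w'] by simp
    qed
    have cross: "young_fourier (T Z) (repr Z) (lifted (F X) (T Z)) w y z = (if X = Z then K Z w y z else 0)"
      if X: "X \<in> \<O>" and Z: "Z \<in> \<O>" and w: "w permutes {..<n}" for X Z w y z
    proof (cases "X = Z")
      case True
      interpret M: gelfand_mu r n p "repr Z" using T(4)[OF Z] .
      show ?thesis
        using GF[OF Z T(1)[OF Z] w, of y z] M.admissibleE(5)[OF K(1)[OF Z, unfolded T_def] w, of y z] True by auto
    next
      case False
      obtain k where k: "T X = rotate (k * (r div p)) \<tau>" using T(5)[OF X] by blast
      obtain \<nu>0 where nu0: "\<nu>0 \<in> Z" "\<nu>0 \<in> parts_list \<tau>" using orbit_rep(4)[OF Z] repr Z by blast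
      \<comment> \<open>The member of \<open>Z\<close> with the block sizes \<open>T X\<close>, for
        which the coefficients of \<open>F X\<close> are known. It differs from
        \<open>repr X\<close> because the orbits are different, so its coefficient vanishes, and
        rotation carries this to \<open>repr Z\<close>.\<close>
      define \<nu> where "\<nu> = rotate (k * (r div p)) \<nu>0"
      have nu: "\<nu> \<in> parts_list (T X)" unfolding \<nu>_def k by (rule parts_list_rotate[OF nu0(2)])
      have "\<nu> \<in> fer_orbit r p \<nu>0" using fer_orbit_iff[OF orbit_rep(2)[OF Z nu0(1)]] unfolding \<nu>_def by blast
      then have nZ: "\<nu> \<in> Z" using orbit_rep(1)[OF Z nu0(1)] by simp
      have "\<nu> \<noteq> repr X" using False orbit_rep(1)[OF Z nZ] T(6)[OF X] by auto
      then have v: "young_fourier_vanishes (T X) \<nu> (lifted (F X) (T X))"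
        unfolding young_fourier_vanishes_def using GF[OF X nu] T(2)[OF X] by simp
      have "repr Z \<in> fer_orbit r p \<nu>" using repr Z orbit_rep(1)[OF Z nZ] by blast
      then obtain j where j: "repr Z = rotate (j * (r div p)) \<nu>" using fer_orbit_iff[OF orbit_rep(2)[OF Z nZ]]
        by blast
      have "T Z = rotate (j * (r div p)) (T X)" using parts_list_sum_list[OF nu]
        by (simp add: T_def[of Z] j rotate_map[symmetric])
      then have "young_fourier_vanishes (T Z) (repr Z) (lifted (F X) (T Z))"
        using young_fourier_vanishes_lifted_rotate[OF T(2,3)[OF X] nu, of j "F X"] v j by simp
      then have "young_fourier (T Z) (repr Z) (lifted (F X) (T Z)) w y z = 0"
        if "y \<in> tabs_list (repr Z)" "z \<in> tabs_list (repr Z)"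
        using that w T(2)[OF Z] unfolding young_fourier_vanishes_def by simp
      moreover have "young_fourier (T Z) (repr Z) (lifted (F X) (T Z)) w y z = 0"
        if "y \<notin> tabs_list (repr Z) \<or> z \<notin> tabs_list (repr Z)"
        using that by (auto simp: young_fourier_def tkernel_outside2)
      ultimately show ?thesis using False by auto
    qed
    have "\<phi> f = G"
    proof
      fix Zz :: "nat list list set \<times> (nat \<Rightarrow> nat) \<times> (complex mat \<times> nat set list list) \<times> (complex mat \<times> nat set list
        list)"
      obtain Z t x1 Y1 x2 Y2 where Zz: "Zz = (Z, t, (x1, Y1), (x2, Y2))" by (metis surj_pair)
      show "\<phi> f Zz = G Zz"
      proof (cases "Z \<in> \<O>")
        case Z: True
        interpret M: gelfand_mu r n p "repr Z" using T(4)[OF Z] .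
        have HK: "H f Z w y z = K Z w y z" if w: "w permutes {..<n}" for w y z
        proof -
          have "lifted f (T Z) = (\<lambda>w. \<Sum>X\<in>\<O>. lifted (F X) (T Z) w)"
            by (rule ext) (simp add: lifted_def f_def[abs_def] normalized_sum)
          then have "H f Z w y z = (\<Sum>X\<in>\<O>. young_fourier (T Z) (repr Z) (lifted (F X) (T Z)) w y z)"
            by (simp add: H_def young_fourier_sum)
          also have "\<dots> = (\<Sum>X\<in>\<O>. if X = Z then K Z w y z else 0)" using cross[OF _ Z w] by (intro sum.cong refl)
          finally show ?thesis using Z finite_orbits by simp
        qed
        have "M.Phi (H f Z) (t, (x1, Y1), (x2, Y2)) = M.Phi (K Z) (t, (x1, Y1), (x2, Y2))"
        proof (cases "t \<in> Theta n \<and> x1 \<in> carrier (Grn r (n div 2)) \<and> x2 \<in> carrier (Grn r (n div 2))")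
          case True
          then have "t \<circ> halves_perm (n div 2) (inv (perm_of x1)) (inv (perm_of x2)) permutes {..<n}"
            by (intro M.theta_halves_perm_permutes permutes_inv M.Grn_perm) auto
          then show ?thesis by (simp add: M.Phi_def HK)
        qed (auto simp: M.Phi_def)
        then show ?thesis using fun_cong[OF K(2)[OF Z]] Z by (simp add: Zz \<phi>_def)
      next
        case False then show ?thesis using G by (simp add: Zz \<phi>_def dsum_rep_def)
      qed
    qed
    then show "G \<in> \<phi> ` rspace (gelfand_sub r p n c)" using fs by blast
  qed
  moreover have "\<phi> (ract (gelfand_sub r p n c) g f) = ract (dsum_rep \<O> (\<lambda>X. rho_split r n 1 (repr X))) g (\<phi> f)"
    if g: "g \<in> Grpn r p n" and f: "f \<in> rspace (gelfand_sub r p n c)" for g f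
  proof
    fix Zz :: "nat list list set \<times> (nat \<Rightarrow> nat) \<times> (complex mat \<times> nat set list list) \<times> (complex mat \<times> nat set list
      list)"
    obtain Z z where Zz: "Zz = (Z, z)" by (cases Zz) auto
    have gG: "g \<in> carrier (Grn r n)" using g by (simp add: Grpn_def)
    show "\<phi> (ract (gelfand_sub r p n c) g f) Zz = ract (dsum_rep \<O> (\<lambda>X. rho_split r n 1 (repr X))) g (\<phi> f) Zz"
    proof (cases "Z \<in> \<O>")
      case Z: True
      interpret M: gelfand_mu r n p "repr Z" using T(4)[OF Z] .
      obtain k where k: "T Z = rotate (k * (r div p)) \<tau>" using T(5)[OF Z] by blast
      have n2: "2 * sum_list (T Z) = n" using T(2)[OF Z] by simp
      have tw: "H (gelfand_act r p n g f) Z (perm_of g \<circ> w) y y' =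
          zeta r ^ (\<Sum>q<n. zexp r g (w q) * block_of
            (T Z @ T Z) q) * H f Z w y y'" if w: "w permutes {..<n}" for w y y'
        unfolding H_def
        using young_fourier_twist[of w "T Z" "lifted (gelfand_act r p n g f) (T Z)" "perm_of g" "zeta r"
          "zexp r g" "lifted f (T Z)" "repr Z" y y']
          lifted_gelfand_act[OF f g _ k] w unfolding n2 by blast
      have "ract (TVV_rep r n (repr Z)) g (M.Phi (H f Z)) = M.Phi (H (gelfand_act r p n g f) Z)"
        by (rule M.Phi_act[OF admissible[OF Z, unfolded T_def] gG]) (use tw in \<open>simp add: T_def\<close>)
      then have "M.Phi (H (gelfand_act r p n g f) Z) z = ract (TVV_rep r n (repr Z)) g (M.Phi (H f Z)) z" by simp
      then show ?thesis using Z by (simp add: Zz \<phi>_def gelfand_sub_def dsum_rep_def rho_split_def)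
    next
      case False then show ?thesis by (simp add: Zz \<phi>_def dsum_rep_def)
    qed
  qed
  ultimately show ?thesis unfolding rep_iso_def using lin by blast
qed

end

theorem theorem8p4:
  fixes r n p :: nat
    and \<tau> :: "nat list"
    and c :: "complex mat set set"
    and repr :: "nat list list set \<Rightarrow> nat list list"
  assumes "r > 0" and "n > 0" and "p > 0" and "p dvd r" and "gcd p n = 2"
    and "\<tau> \<in> antisym_type r ` {A \<in> carrier (Grn r n). transpose_mat A = - A}"
    and "c \<in> Sn_classes r p n"
    and "\<forall>v\<in>c. antisymmetric_elt v \<and> has_type r p v (type_orbit r p \<tau>)"
    and "\<forall>X\<in>fer_orbits_of_type r p n \<tau>. repr X \<in> X"
  shows "rep_iso (Grpn r p n) (gelfand_sub r p n c)
           (dsum_rep (fer_orbits_of_type r p n \<tau>) (\<lambda>X. rho_split r n 1 (repr X)))"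
proof -
  interpret gelfand_class r n p \<tau> c
    by unfold_locales (fact assms)+
  show ?thesis using assms(9) by (rule gelfand_class_iso)
qed

end
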